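(* For a semantics $\sigma\in\{\mathtt{co},\mathtt{st},\mathtt{pr},\mathtt{sst}\}$, let $\mathsf{SF\text{-}EX}^{\sigma}$ be the following decision problem. Input: an argumentation framework $\Lambda=\langle A,R\rangle$, a goal argument $g\in A$, an integer $k\in\mathbb{N}$, and a $\sigma$-labelling $\mathcal{L}\in\sigma(\Lambda)$. Question: does there exist a labelling $\mathcal{L}'\in\sigma(\Lambda)$ such that $\mathcal{L}(g)=\mathcal{L}'(g)$ and $\delta(\mathcal{L},\mathcal{L}')\ge k$? Then $\mathsf{SF\text{-}EX}^{\sigma}$ is: (1) $NP$-complete for $\sigma\in\{\mathtt{co},\mathtt{st}\}$; and (2) $\Sigma_2^p$-complete for $\sigma\in\{\mathtt{pr},\mathtt{sst}\}$.
   Context: An argumentation framework (AF) is a pair $\Lambda=\langle A,R\rangle$ with $A$ a (finite) set of arguments and $R\subseteq A\times A$ a set of attacks. For $S\subseteq A$ let $\mathit{Def}(S)=\{a\in A\mid \exists b\in S,\ (b,a)\in R\}$ and $\mathit{Acc}(S)=\{a\in A\mid \forall (b,a)\in R,\ b\in \mathit{Def}(S)\}$. $S$ is conflict-free iff $S\cap \mathit{Def}(S)=\emptyset$, and admissible iff it is conflict-free and $S\subseteq \mathit{Acc}(S)$. A set $S\subseteq A$ is an extension called: complete ($\mathtt{co}$) iff it is admissible and $S=\mathit{Acc}(S)$; preferred ($\mathtt{pr}$) iff it is a $\subseteq$-maximal complete extension; stable ($\mathtt{st}$) iff it is a preferred extension with $S\cup \mathit{Def}(S)=A$; semi-stable ($\mathtt{sst}$)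 iff it is a preferred extension such that $S\cup \mathit{Def}(S)$ is $\subseteq$-maximal (among preferred extensions). A labelling is a total function $\mathcal{L}:A\to\{\mathbf{in},\mathbf{out},\mathbf{und}\}$. The labelling corresponding to an extension $E$ assigns $\mathbf{in}$ to the elements of $E$, $\mathbf{out}$ to the elements of $\mathit{Def}(E)$, and $\mathbf{und}$ to all other arguments. A $\sigma$-labelling of $\Lambda$ is the labelling corresponding to a $\sigma$-extension of $\Lambda$; $\sigma(\Lambda)$ denotes the set of $\sigma$-labellings of $\Lambda$. The distance between labellings is $\delta(\mathcal{L},\mathcal{L}')=|\{a\in A\mid \mathcal{L}(a)\neq\mathcal{L}'(a)\}|$. Complexity: $\Sigma_2^p=NP^{NP}$. *)

theory Defs
  imports Main "HOL-Library.FuncSet" "HOL-Computational_Algebra.Polynomial"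
begin

section \<open>Argumentation frameworks\<close>

type_synonym 'a framework = "'a set \<times> ('a \<times> 'a) set"

definition framework :: "'a framework \<Rightarrow> bool" where
  "framework \<Lambda> \<longleftrightarrow> (case \<Lambda> of (A, R) \<Rightarrow> finite A \<and> R \<subseteq> A \<times> A)"

definition Def :: "'a framework \<Rightarrow> 'a set \<Rightarrow> 'a set" where
  "Def \<Lambda> S = (case \<Lambda> of (A, R) \<Rightarrow> {a \<in> A. \<exists>b\<in>S. (b, a) \<in> R})"

definition Acc :: "'a framework \<Rightarrow> 'a set \<Rightarrow> 'a set" where
  "Acc \<Lambda> S = (case \<Lambda> of (A, R) \<Rightarrow> {a \<in> A. \<forall>b. (b, a) \<in> R \<longrightarrow> b \<in> Def \<Lambda> S})"

definition conflict_free :: "'a framework \<Rightarrow> 'a set \<Rightarrow> bool" where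
  "conflict_free \<Lambda> S \<longleftrightarrow> S \<inter> Def \<Lambda> S = {}"

definition admissible :: "'a framework \<Rightarrow> 'a set \<Rightarrow> bool" where
  "admissible \<Lambda> S \<longleftrightarrow> S \<subseteq> fst \<Lambda> \<and> conflict_free \<Lambda> S \<and> S \<subseteq> Acc \<Lambda> S"

definition complete_ext :: "'a framework \<Rightarrow> 'a set \<Rightarrow> bool" where
  "complete_ext \<Lambda> S \<longleftrightarrow> admissible \<Lambda> S \<and> S = Acc \<Lambda> S"

definition preferred_ext :: "'a framework \<Rightarrow> 'a set \<Rightarrow> bool" where
  "preferred_ext \<Lambda> S \<longleftrightarrow> complete_ext \<Lambda> S \<and> \<not> (\<exists>T. complete_ext \<Lambda> T \<and> S \<subset> T)"

definition stable_ext :: "'a framework \<Rightarrow> 'a set \<Rightarrow> bool" where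
  "stable_ext \<Lambda> S \<longleftrightarrow> preferred_ext \<Lambda> S \<and> S \<union> Def \<Lambda> S = fst \<Lambda>"

definition semi_stable_ext :: "'a framework \<Rightarrow> 'a set \<Rightarrow> bool" where
  "semi_stable_ext \<Lambda> S \<longleftrightarrow> preferred_ext \<Lambda> S \<and>
     \<not> (\<exists>T. preferred_ext \<Lambda> T \<and> S \<union> Def \<Lambda> S \<subset> T \<union> Def \<Lambda> T)"

datatype sem = CO | ST | PR | SST

fun extension :: "sem \<Rightarrow> 'a framework \<Rightarrow> 'a set \<Rightarrow> bool" where
  "extension CO = complete_ext"
| "extension ST = stable_ext"
| "extension PR = preferred_ext"
| "extension SST = semi_stable_ext"

datatype label = In | Out | Und

text \<open>A labelling of \<open>(A, R)\<close> is a total function on \<open>A\<close>, represented as an extensional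
  function, so that two labellings are equal iff they agree on \<open>A\<close>.\<close>

definition labelling_of :: "'a framework \<Rightarrow> 'a set \<Rightarrow> 'a \<Rightarrow> label" where
  "labelling_of \<Lambda> E =
     (\<lambda>a\<in>fst \<Lambda>. if a \<in> E then In else if a \<in> Def \<Lambda> E then Out else Und)"

definition labellings :: "sem \<Rightarrow> 'a framework \<Rightarrow> ('a \<Rightarrow> label) set" where
  "labellings \<sigma> \<Lambda> = {labelling_of \<Lambda> E | E. extension \<sigma> \<Lambda> E}"

definition distance :: "'a framework \<Rightarrow> ('a \<Rightarrow> label) \<Rightarrow> ('a \<Rightarrow> label) \<Rightarrow> nat" where
  "distance \<Lambda> L L' = card {a \<in> fst \<Lambda>. L a \<noteq> L' a}"


section \<open>The decision problem\<close>

definition sf_ex_instance ::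
    "sem \<Rightarrow> 'a framework \<Rightarrow> 'a \<Rightarrow> nat \<Rightarrow> ('a \<Rightarrow> label) \<Rightarrow> bool" where
  "sf_ex_instance \<sigma> \<Lambda> g k L \<longleftrightarrow> framework \<Lambda> \<and> g \<in> fst \<Lambda> \<and> L \<in> labellings \<sigma> \<Lambda>"

definition sf_ex_question ::
    "sem \<Rightarrow> 'a framework \<Rightarrow> 'a \<Rightarrow> nat \<Rightarrow> ('a \<Rightarrow> label) \<Rightarrow> bool" where
  "sf_ex_question \<sigma> \<Lambda> g k L \<longleftrightarrow> (\<exists>L'\<in>labellings \<sigma> \<Lambda>. L g = L' g \<and> distance \<Lambda> L L' \<ge> k)"

text \<open>Binary notation, least significant digit first, without leading zeros.\<close>

fun binary :: "nat \<Rightarrow> bool list" where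
  "binary 0 = []"
| "binary (Suc n) = odd (Suc n) # binary (Suc n div 2)"

text \<open>A framework is written down with respect to an enumeration \<open>xs\<close> of its arguments: the
  number of arguments in unary, the adjacency matrix of the attack relation, the
  characteristic vector of the goal, two bits per argument for the labelling, and \<open>k\<close> in
  binary.  The names of the arguments do not occur in the code, which depends only on the
  isomorphism type of the enumerated instance; taking the names from \<open>nat\<close> below hence covers
  all finite frameworks.\<close>

definition encode ::
    "'a list \<Rightarrow> ('a \<times> 'a) set \<Rightarrow> 'a \<Rightarrow> nat \<Rightarrow> ('a \<Rightarrow> label) \<Rightarrow> bool list" where
  "encode xs R g k L =
     replicate (length xs) True @ [False]
     @ concat (map (\<lambda>a. map (\<lambda>b. (a, b) \<in> R) xs) xs)
     @ map (\<lambda>a. a = g) xs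
     @ concat (map (\<lambda>a. [L a = In, L a = Out]) xs)
     @ binary k"

lemma binary_inject: "binary m = binary n \<Longrightarrow> m = n"
proof (induction m arbitrary: n rule: binary.induct)
  case 1
  then show ?case by (cases n) auto
next
  case (2 m)
  then obtain n' where n: "n = Suc n'" by (cases n) auto
  from 2(2) n have "Suc m div 2 = Suc n' div 2" "odd (Suc m) = odd (Suc n')"
    using 2(1) by auto
  with n show ?case by presburger
qed

lemma length_concat_const: "(\<And>x. length (f x) = m) \<Longrightarrow> length (concat (map f xs)) = length xs * m"
  by (induction xs) auto

lemma concat_const_inject:
  assumes "concat (map f xs) = concat (map f' ys)" "length xs = length ys"
    and "\<And>x. length (f x) = m" "\<And>y. length (f' y) = m" "i < length xs"
  shows "f (xs ! i) = f' (ys ! i)"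
  using assms(2,1,5)
proof (induction xs ys arbitrary: i rule: list_induct2)
  case (Cons x xs y ys)
  then have "f x = f' y" "concat (map f xs) = concat (map f' ys)"
    using assms(3,4) by auto
  with Cons show ?case by (cases i) auto
qed simp

text \<open>The code determines the instance up to renaming of the arguments.\<close>

lemma encode_inject:
  assumes eq: "encode xs R g k L = encode ys S h l M"
  shows "length xs = length ys"
    and "\<And>i j. i < length xs \<Longrightarrow> j < length xs \<Longrightarrow> (xs ! i, xs ! j) \<in> R \<longleftrightarrow> (ys ! i, ys ! j) \<in> S"
    and "\<And>i. i < length xs \<Longrightarrow> xs ! i = g \<longleftrightarrow> ys ! i = h"
    and "\<And>i. i < length xs \<Longrightarrow> L (xs ! i) = M (ys ! i)"
    and "k = l"
proof -
  have tw: "takeWhile id (replicate n True @ False # zs) = replicate n True" for n zs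
    by (induction n) auto
  have "takeWhile id (encode xs R g k L) = takeWhile id (encode ys S h l M)"
    using eq by simp
  then have "replicate (length xs) True = replicate (length ys) True"
    by (simp add: encode_def tw)
  then show len: "length xs = length ys" by (metis length_replicate)
  define A B where "A = concat (map (\<lambda>a. map (\<lambda>b. (a, b) \<in> R) xs) xs)"
    and "B = concat (map (\<lambda>a. map (\<lambda>b. (a, b) \<in> S) ys) ys)"
  define C D where "C = concat (map (\<lambda>a. [L a = In, L a = Out]) xs)"
    and "D = concat (map (\<lambda>a. [M a = In, M a = Out]) ys)"
  have "length A = length B" "length C = length D"
    unfolding A_def B_def C_def D_def using len
    by (simp_all add: length_concat_const[of _ "length ys"] length_concat_const[of _ 2])
  then have parts: "A = B" "map (\<lambda>a. a = g) xs = map (\<lambda>a. a = h) ys" "C = D"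
      "binary k = binary l"
    using eq len unfolding encode_def A_def[symmetric] B_def[symmetric] C_def[symmetric]
      D_def[symmetric] by auto
  show "k = l" using parts(4) by (rule binary_inject)
  show "xs ! i = g \<longleftrightarrow> ys ! i = h" if "i < length xs" for i
    using arg_cong[OF parts(2), of "\<lambda>zs. zs ! i"] that len by simp
  show "(xs ! i, xs ! j) \<in> R \<longleftrightarrow> (ys ! i, ys ! j) \<in> S"
    if "i < length xs" "j < length xs" for i j
  proof -
    have "map (\<lambda>b. (xs ! i, b) \<in> R) xs = map (\<lambda>b. (ys ! i, b) \<in> S) ys"
      by (rule concat_const_inject[OF parts(1)[unfolded A_def B_def] len, of "length xs"])
        (use len that in auto)
    from arg_cong[OF this, of "\<lambda>zs. zs ! j"] that len show ?thesis by simp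
  qed
  show "L (xs ! i) = M (ys ! i)" if "i < length xs" for i
  proof -
    have "[L (xs ! i) = In, L (xs ! i) = Out] = [M (ys ! i) = In, M (ys ! i) = Out]"
      by (rule concat_const_inject[OF parts(3)[unfolded C_def D_def] len, of 2])
        (use that in auto)
    then show ?thesis by (cases "L (xs ! i)"; cases "M (ys ! i)") auto
  qed
qed

text \<open>The set of codes of yes-instances; words that are not codes of instances are rejected.\<close>

definition SF_EX :: "sem \<Rightarrow> bool list set" where
  "SF_EX \<sigma> = {encode xs R g k L | (xs :: nat list) R g k L.
     distinct xs \<and> sf_ex_instance \<sigma> (set xs, R) g k L \<and> sf_ex_question \<sigma> (set xs, R) g k L}"


section \<open>Turing machines\<close>

text \<open>States and tape symbols are natural numbers; a machine is given by a finite set of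
  transitions and hence uses only finitely many of them.  A transition
  \<open>(q, rs, q', as)\<close> applies in state \<open>q\<close> if \<open>rs\<close> are the symbols under the heads; the machine
  then goes to state \<open>q'\<close> and on every tape writes a symbol and moves the head as prescribed
  by \<open>as\<close>.  Tapes are infinite in both directions.  Symbol 0 is the blank.\<close>

datatype move = Move_Left | Stay | Move_Right

type_synonym action = "nat \<times> move"
type_synonym tape = "(int \<Rightarrow> nat) \<times> int"
type_synonym config = "nat \<times> tape list"

record tm =
  tape_count :: nat
  start :: nat
  accept :: nat
  transitions :: "(nat \<times> nat list \<times> nat \<times> action list) set"

definition wf_tm :: "'z tm_scheme \<Rightarrow> bool" where
  "wf_tm M \<longleftrightarrow> tape_count M \<ge> 2 \<and> finite (transitions M) \<and>
     (\<forall>(q, rs, q', as)\<in>transitions M. length rs = tape_count M \<and> length as = tape_count M)"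

definition deterministic :: "'z tm_scheme \<Rightarrow> bool" where
  "deterministic M \<longleftrightarrow> (\<forall>q rs q' as q'' as'.
     (q, rs, q', as) \<in> transitions M \<longrightarrow> (q, rs, q'', as') \<in> transitions M \<longrightarrow>
     q' = q'' \<and> as = as')"

fun read_tape :: "tape \<Rightarrow> nat" where
  "read_tape (f, i) = f i"

fun act :: "action \<Rightarrow> tape \<Rightarrow> tape" where
  "act (s, m) (f, i) =
     (f(i := s), case m of Move_Left \<Rightarrow> i - 1 | Stay \<Rightarrow> i | Move_Right \<Rightarrow> i + 1)"

definition tm_step :: "'z tm_scheme \<Rightarrow> config \<Rightarrow> config \<Rightarrow> bool" where
  "tm_step M c c' \<longleftrightarrow> (\<exists>q ts q' as. c = (q, ts) \<and>
     (q, map read_tape ts, q', as) \<in> transitions M \<and> c' = (q', map2 act as ts))"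

definition bit_symbol :: "bool \<Rightarrow> nat" where
  "bit_symbol b = (if b then 2 else 1)"

definition word_tape :: "bool list \<Rightarrow> tape" where
  "word_tape w =
     (\<lambda>i. if 0 \<le> i \<and> nat i < length w then bit_symbol (w ! nat i) else 0, 0)"

text \<open>The word on a tape extends from cell 0 to the first blank.\<close>

definition holds_word :: "tape \<Rightarrow> bool list \<Rightarrow> bool" where
  "holds_word t w \<longleftrightarrow>
     (\<forall>i<length w. fst t (int i) = bit_symbol (w ! i)) \<and> fst t (int (length w)) = 0"

text \<open>Tape 0 holds the input initially; tape 1 is the output tape of machines that compute
  functions, and the query tape of oracle machines.\<close>

definition initial :: "'z tm_scheme \<Rightarrow> bool list \<Rightarrow> config" where
  "initial M x = (start M, word_tape x # replicate (tape_count M - 1) (word_tape []))"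

definition halted :: "(config \<Rightarrow> config \<Rightarrow> bool) \<Rightarrow> config \<Rightarrow> bool" where
  "halted step c \<longleftrightarrow> \<not> (\<exists>c'. step c c')"

record oracle_tm = tm +
  query :: nat
  answer_yes :: nat
  answer_no :: nat

definition oracle_step :: "oracle_tm \<Rightarrow> bool list set \<Rightarrow> config \<Rightarrow> config \<Rightarrow> bool" where
  "oracle_step M B c c' \<longleftrightarrow>
     (if fst c = query M
      then c' = (if \<exists>w\<in>B. holds_word (snd c ! 1) w then answer_yes M else answer_no M, snd c)
      else tm_step M c c')"


section \<open>Complexity classes\<close>

text \<open>Nondeterministic polynomial time: all computation paths end after polynomially many
  steps, and a word is accepted iff some path ends in the accepting state.\<close>

definition decides_in_poly_time ::
    "'z tm_scheme \<Rightarrow> (config \<Rightarrow> config \<Rightarrow> bool) \<Rightarrow> bool list set \<Rightarrow> bool" where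
  "decides_in_poly_time M step X \<longleftrightarrow>
     (\<exists>p :: nat poly. \<forall>x n c. (step ^^ n) (initial M x) c \<longrightarrow> n \<le> poly p (length x)) \<and>
     (\<forall>x. x \<in> X \<longleftrightarrow>
        (\<exists>c. step\<^sup>*\<^sup>* (initial M x) c \<and> halted step c \<and> fst c = accept M))"

definition NP :: "bool list set set" where
  "NP = {X. \<exists>M :: tm. wf_tm M \<and> decides_in_poly_time M (tm_step M) X}"

definition NP_oracle :: "bool list set \<Rightarrow> bool list set set" where
  "NP_oracle B =
     {X. \<exists>M :: oracle_tm. wf_tm M \<and> decides_in_poly_time M (oracle_step M B) X}"

definition Sigma2p :: "bool list set set" where
  "Sigma2p = (\<Union>B\<in>NP. NP_oracle B)"

definition poly_time_computable :: "(bool list \<Rightarrow> bool list) \<Rightarrow> bool" where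
  "poly_time_computable f \<longleftrightarrow> (\<exists>(M :: tm) (p :: nat poly). wf_tm M \<and> deterministic M \<and>
     (\<forall>x. \<exists>n c. n \<le> poly p (length x) \<and> (tm_step M ^^ n) (initial M x) c \<and>
        halted (tm_step M) c \<and> holds_word (snd c ! 1) (f x)))"

definition poly_reducible :: "bool list set \<Rightarrow> bool list set \<Rightarrow> bool" where
  "poly_reducible X Y \<longleftrightarrow> (\<exists>f. poly_time_computable f \<and> (\<forall>x. x \<in> X \<longleftrightarrow> f x \<in> Y))"

definition complete_for :: "bool list set set \<Rightarrow> bool list set \<Rightarrow> bool" where
  "complete_for C Y \<longleftrightarrow> Y \<in> C \<and> (\<forall>X\<in>C. poly_reducible X Y)"

end

theory Submission imports Defs "HOL-Library.Countable"
begin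

text \<open>
  Membership: an extension is guessed and checked; maximality of a preferred or semi-stable extension is
  the absence of a complete extension with more arguments or a larger range, which is one call to an NP
  oracle.  (An extension is semi-stable iff its range is maximal among those of all complete extensions.)

  Hardness: the runs of a polynomial time oracle machine are described by clauses over variables for its
  states, head positions and cells.  Positive answers of the oracle are certified by accepting
  runs of a machine for the oracle, and a second clause set over additional, universally quantified
  variables says that some negative answer is refuted by such a run.  Hence the input is accepted iff some
  assignment satisfies the first clause set and cannot be extended to one that satisfies the second; without an
  oracle, iff the first clause set is satisfiable.  The clause sets become a framework with a
  known extension that contains the argument \<open>E\<close>, in which every further extension that agrees with it on the
  goal \<open>G\<close> excludes \<open>E\<close> and therefore encodes such an assignment; the required distance is 1.  The machines that
  decide the problem and compute the reduction are compiled from functions defined by bounded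
  recursion, sums and quantifiers.
\<close>

section \<open>Programs for Turing machines\<close>

text \<open>Two polarities shape the clause sets. The first set is asserted, so facts beyond those
  of the run do little harm in it: they only exclude choices. This is why the first set must force
  the symbols on the query tape to be unique, and why runs that are not activated must leave their
  clauses satisfiable. One wrong negative answer spoils a run, so a single refuting run is enough,
  whereas every positive answer needs its own certificate.

  All numbers in programs are unary, being head positions. Closure under recursion therefore needs a
  polynomial bound on all intermediate values, powers of two are never formed, and the threshold
  \<open>k\<close> can be searched only because no distance exceeds the number of arguments. On the
  other hand a code has at least one bit per argument, so an extension fits into a word as long as
  the input, and machines that guess words of exactly that length suffice.\<close>

inductive hits :: "('c \<Rightarrow> 'c \<Rightarrow> bool) \<Rightarrow> nat \<Rightarrow> 'c \<Rightarrow> 'c set \<Rightarrow> bool" for step where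
  hits_now: "c \<in> S \<Longrightarrow> hits step n c S"
| hits_step: "step c d0 \<Longrightarrow> (\<And>d. step c d \<Longrightarrow> hits step n d S) \<Longrightarrow> hits step (Suc n) c S"

text \<open>\<open>hits\<close> is bounded reachability on all paths; the premise
  \<open>step c d0\<close> of its second rule keeps a stuck configuration from hitting
  \<open>S\<close> vacuously. \<open>runs\<close> adds reachability of each element of
  \<open>S\<close>. The first half yields time bounds, which concern all paths, the second yields
  acceptance, which concerns some path.\<close>

definition runs :: "('c \<Rightarrow> 'c \<Rightarrow> bool) \<Rightarrow> nat \<Rightarrow> 'c \<Rightarrow> 'c set \<Rightarrow> bool" where
  "runs step n c S \<longleftrightarrow> hits step n c S \<and> (\<forall>d\<in>S. step\<^sup>*\<^sup>* c d)"

lemma hits_mono: "hits step n c S \<Longrightarrow> n \<le> m \<Longrightarrow> S \<subseteq> T \<Longrightarrow> hits step m c T"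
proof (induction arbitrary: m rule: hits.induct)
  case (hits_now c S n)
  then show ?case by (auto intro: hits.hits_now)
next
  case (hits_step c d0 n S)
  then obtain m' where "m = Suc m'" "n \<le> m'" by (cases m) auto
  then show ?case using hits_step by (auto intro!: hits.hits_step[of step c d0])
qed

lemma hits_bind: "hits step n c S \<Longrightarrow> (\<And>d. d \<in> S \<Longrightarrow> hits step m d T) \<Longrightarrow> hits step (n + m) c T"
proof (induction rule: hits.induct)
  case (hits_now c S n)
  then show ?case by (meson hits_mono le_add2 order_refl)
next
  case (hits_step c d0 n S)
  then show ?case by (auto intro!: hits.hits_step[of step c d0])
qed

lemma runs_mono: "runs step n c S \<Longrightarrow> n \<le> m \<Longrightarrow> runs step m c S"
  by (auto simp: runs_def intro: hits_mono)

lemma runs_refl: "runs step n c {c}"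
  by (simp add: runs_def hits_now)

text \<open>The intermediate configurations are given as an image, so that the outcomes of the
  second phase are indexed by \<open>S\<close> and not by configurations.\<close>

lemma runs_bind:
  assumes "runs step n c (f ` S)" "\<And>t. t \<in> S \<Longrightarrow> runs step m (f t) (F t)"
  shows "runs step (n + m) c (\<Union>t\<in>S. F t)"
proof -
  have "hits step m (f t) (\<Union>t\<in>S. F t)" if "t \<in> S" for t
    using assms(2)[OF that] that by (auto simp: runs_def intro: hits_mono)
  then have "hits step (n + m) c (\<Union>t\<in>S. F t)"
    using assms(1) by (auto simp: runs_def intro: hits_bind)
  then show ?thesis
    using assms by (fastforce simp: runs_def intro: rtranclp_trans)
qed

lemma runs_steps:
  assumes "\<And>d. step c d \<longleftrightarrow> d \<in> S" "S \<noteq> {}"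
  shows "runs step 1 c S"
proof -
  obtain d where "step c d" using assms by auto
  then have "hits step (Suc 0) c S"
    by (rule hits_step) (simp add: assms hits_now)
  then show ?thesis using assms by (auto simp: runs_def)
qed

lemma runs_Suc:
  assumes "\<And>e. step c e \<longleftrightarrow> e = d" "runs step m d S"
  shows "runs step (Suc m) c S"
  using runs_bind[of step 1 c id "{d}" m "\<lambda>_. S"] runs_steps[of step c "{d}"] assms by simp

lemma hits_path: "hits step n c S \<Longrightarrow> \<exists>d\<in>S. \<exists>m\<le>n. (step ^^ m) c d"
proof (induction rule: hits.induct)
  case (hits_now c S n)
  then show ?case by (auto intro!: bexI[of _ c] exI[of _ 0])
next
  case (hits_step c d0 n S)
  then obtain d m where "d \<in> S" "m \<le> n" "(step ^^ m) d0 d" by blast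
  moreover from this have "(step ^^ Suc m) c d" using hits_step(1) by (metis relpowp_Suc_I2)
  ultimately show ?case by (meson Suc_le_mono)
qed

text \<open>Every path meets \<open>S\<close> within the bound and, \<open>S\<close> being stuck,
  ends there.\<close>

lemma hits_bound:
  "hits step n c S \<Longrightarrow> (\<And>d e. d \<in> S \<Longrightarrow> \<not> step d e) \<Longrightarrow> (step ^^ m) c e \<Longrightarrow> m \<le> n"
proof (induction arbitrary: m rule: hits.induct)
  case (hits_now c S n)
  then show ?case by (cases m) (auto dest: relpowp_Suc_D2 simp del: relpowp.simps)
next
  case (hits_step c d0 n S)
  show ?case
  proof (cases m)
    case (Suc m')
    then obtain d where "step c d" "(step ^^ m') d e"
      using hits_step.prems(2) by (metis relpowp_Suc_D2)
    then show ?thesis using hits_step Suc by blast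
  qed simp
qed

text \<open>A path that ends stuck can neither stop before it meets \<open>S\<close> nor continue
  afterwards.\<close>

lemma hits_halts:
  "hits step n c S \<Longrightarrow> step\<^sup>*\<^sup>* c e \<Longrightarrow> (\<And>d. \<not> step e d) \<Longrightarrow> (\<And>d e. d \<in> S \<Longrightarrow> \<not> step d e) \<Longrightarrow> e \<in> S"
proof (induction rule: hits.induct)
  case (hits_now c S n)
  then show ?case by (auto elim: converse_rtranclpE)
next
  case (hits_step c d0 n S)
  then obtain d where "step c d" "step\<^sup>*\<^sup>* d e"
    by (metis converse_rtranclpE)
  then show ?case using hits_step by blast
qed

section \<open>Structured programs and their compilation into transitions\<close>

definition tstep :: "(nat \<times> nat list \<times> nat \<times> action list) set \<Rightarrow> config \<Rightarrow> config \<Rightarrow> bool" where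
  "tstep \<Delta> c d \<longleftrightarrow> (\<exists>q' as. (fst c, map read_tape (snd c), q', as) \<in> \<Delta> \<and> d = (q', map2 act as (snd c)))"

lemma tm_step_tstep: "tm_step M = tstep (transitions M)"
  by (intro ext) (auto simp: tm_step_def tstep_def)

lemma tstep_cong:
  "(\<And>rs q' as. (fst c, rs, q', as) \<in> \<Delta> \<longleftrightarrow> (fst c, rs, q', as) \<in> \<Delta>') \<Longrightarrow> tstep \<Delta> c d \<longleftrightarrow> tstep \<Delta>' c d"
  by (simp add: tstep_def)

datatype com = Do nat "(nat \<Rightarrow> action) list" | Seq com com (infixr ";;" 55)
  | Cond nat nat com com | While nat nat com

text \<open>The block of a program compiled at \<open>q\<close> occupies the states from
  \<open>q\<close> on and is left at \<open>q + csize c\<close>. The two additional states are the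
  test and a jump: over the second branch for \<open>Cond\<close>, back to the test for
  \<open>While\<close>.\<close>

fun csize :: "com \<Rightarrow> nat" where
  "csize (Do j \<alpha>s) = 1"
| "csize (a ;; b) = csize a + csize b"
| "csize (Cond j x a b) = csize a + csize b + 2"
| "csize (While j x a) = csize a + 2"

text \<open>Transition sets must be finite, so they cover only the symbols that occur on the
  represented tapes: the blank, the two bits and the marker 3.\<close>

definition symbols :: "nat \<Rightarrow> nat list set" where
  "symbols K = {rs. set rs \<subseteq> {0..3} \<and> length rs = K}"

definition keep :: "nat list \<Rightarrow> action list" where
  "keep rs = map (\<lambda>a. (a, Stay)) rs"

definition jump :: "nat \<Rightarrow> nat \<Rightarrow> (nat list \<Rightarrow> nat) \<Rightarrow> (nat \<times> nat list \<times> nat \<times> action list) set" where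
  "jump K p f = {(p, rs, f rs, keep rs) | rs. rs \<in> symbols K}"

text \<open>\<open>While j x a\<close> iterates \<open>a\<close> until the symbol on tape \<open>j\<close> is \<open>x\<close>.\<close>

fun code :: "nat \<Rightarrow> com \<Rightarrow> nat \<Rightarrow> (nat \<times> nat list \<times> nat \<times> action list) set" where
  "code K (Do j \<alpha>s) q = {(q, rs, Suc q, (keep rs)[j := \<alpha> (rs ! j)]) | rs \<alpha>. rs \<in> symbols K \<and> \<alpha> \<in> set \<alpha>s}"
| "code K (a ;; b) q = code K a q \<union> code K b (q + csize a)"
| "code K (Cond j x a b) q =
     jump K q (\<lambda>rs. if rs ! j = x then Suc q else q + csize a + 2) \<union> code K a (Suc q)
     \<union> jump K (Suc q + csize a) (\<lambda>rs. q + csize a + csize b + 2) \<union> code K b (q + csize a + 2)"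
| "code K (While j x a) q =
     jump K q (\<lambda>rs. if rs ! j = x then q + csize a + 2 else Suc q) \<union> code K a (Suc q)
     \<union> jump K (Suc q + csize a) (\<lambda>rs. q)"

lemma finite_symbols: "finite (symbols K)"
  unfolding symbols_def by (rule finite_lists_length_eq) simp

lemma length_keep [simp]: "length (keep rs) = length rs"
  by (simp add: keep_def)

lemma finite_jump: "finite (jump K p f)"
  unfolding jump_def by (rule finite_image_set) (simp add: finite_symbols)

lemma finite_code: "finite (code K c q)"
proof (induction c arbitrary: q)
  case (Do j \<alpha>s)
  have "code K (Do j \<alpha>s) q
      = (\<lambda>(rs, \<alpha>). (q, rs, Suc q, (keep rs)[j := \<alpha> (rs ! j)])) ` (symbols K \<times> set \<alpha>s)"
    by auto
  then show ?case by (simp add: finite_symbols)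
qed (auto simp: finite_jump)

lemma code_length: "(p, rs, p', as) \<in> code K c q \<Longrightarrow> length rs = K \<and> length as = K"
  by (induction c arbitrary: q) (auto simp: jump_def symbols_def)

lemma code_range: "(p, rs, p', as) \<in> code K c q \<Longrightarrow> q \<le> p \<and> p < q + csize c"
  by (induction c arbitrary: q) (force simp: jump_def)+

lemma code_disjoint:
  "(p, rs, p', as) \<in> code K a q \<Longrightarrow> (p, rs', p'', as') \<in> code K b q' \<Longrightarrow> q + csize a \<le> q' \<Longrightarrow> R"
  by (auto dest!: code_range)

lemma code_outside: "(p, rs, p', as) \<in> code K c q \<Longrightarrow> p < q \<or> q + csize c \<le> p \<Longrightarrow> R"
  by (auto dest!: code_range)

fun det :: "com \<Rightarrow> bool" where
  "det (Do j \<alpha>s) \<longleftrightarrow> length \<alpha>s = 1"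
| "det (a ;; b) \<longleftrightarrow> det a \<and> det b"
| "det (Cond j x a b) \<longleftrightarrow> det a \<and> det b"
| "det (While j x a) \<longleftrightarrow> det a"

lemma code_det:
  "det c \<Longrightarrow> (p, rs, p', as) \<in> code K c q \<Longrightarrow> (p, rs, p'', as') \<in> code K c q \<Longrightarrow> p' = p'' \<and> as = as'"
proof (induction c arbitrary: q)
  case (Do j \<alpha>s)
  then show ?case by (auto simp: length_Suc_conv)
next
  case (Seq a b)
  then show ?case by (auto dest: code_disjoint)
next
  case (Cond j x a b)
  from Cond.prems(1) Cond.IH show ?case
    using Cond.prems(2,3) by (auto simp: jump_def dest: code_disjoint code_outside)
next
  case (While j x a)
  from While.prems(1) While.IH show ?case
    using While.prems(2,3) by (auto simp: jump_def dest: code_outside)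
qed

text \<open>The step relation is left abstract so that a block can be run inside any larger machine,
  also inside an oracle machine whose query state lies outside the block.\<close>

definition agrees :: "(config \<Rightarrow> config \<Rightarrow> bool) \<Rightarrow> nat \<Rightarrow> com \<Rightarrow> nat \<Rightarrow> bool" where
  "agrees step K c q \<longleftrightarrow> (\<forall>p ts d. q \<le> p \<longrightarrow> p < q + csize c \<longrightarrow>
     step (p, ts) d = tstep (code K c q) (p, ts) d)"

lemma agreesD:
  "agrees step K c q \<Longrightarrow> q \<le> p \<Longrightarrow> p < q + csize c \<Longrightarrow> step (p, ts) d = tstep (code K c q) (p, ts) d"
  unfolding agrees_def by blast

lemma agreesI:
  "(\<And>p ts d. q \<le> p \<Longrightarrow> p < q + csize c \<Longrightarrow> step (p, ts) d = tstep (code K c q) (p, ts) d) \<Longrightarrow>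
    agrees step K c q"
  unfolding agrees_def by blast

lemma agrees_Seq:
  assumes "agrees step K (a ;; b) q"
  shows "agrees step K a q" "agrees step K b (q + csize a)"
proof -
  have *: "step (p, ts) d = tstep (code K (a ;; b) q) (p, ts) d"
    if "q \<le> p" "p < q + csize a + csize b" for p ts d
    using agreesD[OF assms] that by (simp del: code.simps)
  show "agrees step K a q"
    by (rule agreesI) (auto simp: * simp del: code.simps intro!: tstep_cong,
      auto dest: code_outside)
  show "agrees step K b (q + csize a)"
    by (rule agreesI) (auto simp: * simp del: code.simps intro!: tstep_cong,
      auto dest: code_outside)
qed

lemma agrees_Cond:
  assumes "agrees step K (Cond j x a b) q"
  shows "agrees step K a (Suc q)" "agrees step K b (q + csize a + 2)"
    "step (q, ts) d = tstep (jump K q (\<lambda>rs. if rs ! j = x then Suc q else q + csize a + 2)) (q, ts) d"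
    "step (Suc (q + csize a), ts) d
      = tstep (jump K (Suc (q + csize a)) (\<lambda>rs. q + csize a + csize b + 2)) (Suc (q + csize a), ts) d"
proof -
  have *: "step (p, ts) d = tstep (code K (Cond j x a b) q) (p, ts) d"
    if "q \<le> p" "p < q + csize a + csize b + 2" for p ts d
    using agreesD[OF assms] that by (simp del: code.simps)
  show "agrees step K a (Suc q)"
    by (rule agreesI) (auto simp: * simp del: code.simps intro!: tstep_cong,
      auto simp: jump_def dest: code_outside)
  show "agrees step K b (q + csize a + 2)"
    by (rule agreesI) (auto simp: * simp del: code.simps intro!: tstep_cong,
      auto simp: jump_def dest: code_outside)
  show "step (q, ts) d = tstep (jump K q (\<lambda>rs. if rs ! j = x then Suc q else q + csize a + 2)) (q, ts) d"
    by (auto simp: * simp del: code.simps intro!: tstep_cong) (auto simp: jump_def dest: code_outside)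
  show "step (Suc (q + csize a), ts) d
      = tstep (jump K (Suc (q + csize a)) (\<lambda>rs. q + csize a + csize b + 2)) (Suc (q + csize a), ts) d"
    by (subst *) (auto simp del: code.simps intro!: tstep_cong, auto simp: jump_def dest: code_outside)
qed

lemma agrees_While:
  assumes "agrees step K (While j x a) q"
  shows "agrees step K a (Suc q)"
    "step (q, ts) d = tstep (jump K q (\<lambda>rs. if rs ! j = x then q + csize a + 2 else Suc q)) (q, ts) d"
    "step (Suc (q + csize a), ts) d = tstep (jump K (Suc (q + csize a)) (\<lambda>rs. q)) (Suc (q + csize a), ts) d"
proof -
  have *: "step (p, ts) d = tstep (code K (While j x a) q) (p, ts) d"
    if "q \<le> p" "p < q + csize a + 2" for p ts d
    using agreesD[OF assms] that by (simp del: code.simps)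
  show "agrees step K a (Suc q)"
    by (rule agreesI) (auto simp: * simp del: code.simps intro!: tstep_cong,
      auto simp: jump_def dest: code_outside)
  show "step (q, ts) d = tstep (jump K q (\<lambda>rs. if rs ! j = x then q + csize a + 2 else Suc q)) (q, ts) d"
    by (auto simp: * simp del: code.simps intro!: tstep_cong) (auto simp: jump_def dest: code_outside)
  show "step (Suc (q + csize a), ts) d = tstep (jump K (Suc (q + csize a)) (\<lambda>rs. q)) (Suc (q + csize a), ts) d"
    by (subst *) (auto simp del: code.simps intro!: tstep_cong, auto simp: jump_def dest: code_outside)
qed

text \<open>An abstract view of the tapes: head positions (natural numbers) and contents.  Position 0 of
  every tape carries the marker 3, so that an otherwise blank tape serves as a counter whose value
  is its head position.  On tapes 0 and 1 position \<open>i\<close> is cell \<open>i - 1\<close>, so that the words on them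
  occupy the positions from 1 on.\<close>

type_synonym state = "(nat \<Rightarrow> nat) \<times> (nat \<Rightarrow> nat \<Rightarrow> bool option)"

definition symbol :: "bool option \<Rightarrow> nat" where
  "symbol x = (case x of None \<Rightarrow> 0 | Some b \<Rightarrow> bit_symbol b)"

lemma symbol_simps [simp]:
  "symbol None = 0" "symbol (Some True) = 2" "symbol (Some False) = 1" "symbol x \<noteq> 3" "symbol x \<le> 3"
  "symbol (Some b) \<noteq> 0" "symbol x = 2 \<longleftrightarrow> x = Some True" "symbol x = 0 \<longleftrightarrow> x = None"
  by (auto simp: symbol_def bit_symbol_def split: option.splits)

definition cell :: "(nat \<Rightarrow> bool option) \<Rightarrow> nat \<Rightarrow> nat" where
  "cell g i = (if i = 0 then 3 else symbol (g i))"

definition symb :: "state \<Rightarrow> nat \<Rightarrow> nat" where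
  "symb s j = cell (snd s j) (fst s j)"

lemma symb_simps [simp]:
  "symb (v, G) j = 3 \<longleftrightarrow> v j = 0"
  "0 < v j \<Longrightarrow> symb (v, G) j = symbol (G j (v j))"
  by (simp_all add: symb_def cell_def)

definition offset :: "nat \<Rightarrow> int" where
  "offset j = (if j < 2 then 1 else 0)"

definition tape_of :: "state \<Rightarrow> nat \<Rightarrow> tape" where
  "tape_of s j = (\<lambda>i. if i + offset j < 0 then 0 else cell (snd s j) (nat (i + offset j)),
     int (fst s j) - offset j)"

definition tapes :: "nat \<Rightarrow> state \<Rightarrow> tape list" where
  "tapes K s = map (tape_of s) [0..<K]"

lemma read_tape_of [simp]: "read_tape (tape_of s j) = symb s j"
  by (simp add: tape_of_def symb_def)

lemma read_tapes: "map read_tape (tapes K s) = map (symb s) [0..<K]"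
  by (simp add: tapes_def)

lemma cell_le: "cell g i \<le> 3" by (simp add: cell_def)

lemma symb_symbols: "map (symb s) [0..<K] \<in> symbols K"
  by (auto simp: symbols_def symb_def cell_le)

lemma act_stay: "act (symb s j, Stay) (tape_of s j) = tape_of s j"
  by (auto simp: tape_of_def symb_def)

lemma map2_act_keep: "map2 act (keep (map (symb s) [0..<K])) (tapes K s) = tapes K s"
  by (rule nth_equalityI) (auto simp: tapes_def keep_def act_stay)

lemma tstep_jump:
  "tstep (jump K p f) (p, tapes K s) d \<longleftrightarrow> d = (f (map (symb s) [0..<K]), tapes K s)"
  by (auto simp: tstep_def jump_def read_tapes symb_symbols map2_act_keep)

text \<open>Quantifying over step relations and start states makes the statement independent of the
  place of the block in a machine. What follows is a program logic with running times.\<close>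

definition exec :: "nat \<Rightarrow> com \<Rightarrow> state \<Rightarrow> nat \<Rightarrow> state set \<Rightarrow> bool" where
  "exec K c s n S \<longleftrightarrow> (\<forall>step q. agrees step K c q \<longrightarrow>
     runs step n (q, tapes K s) ((\<lambda>t. (q + csize c, tapes K t)) ` S))"

lemma execD:
  "exec K c s n S \<Longrightarrow> agrees step K c q \<Longrightarrow> q' = q + csize c \<Longrightarrow>
    runs step n (q, tapes K s) ((\<lambda>t. (q', tapes K t)) ` S)"
  by (simp add: exec_def)

lemma exec_mono: "exec K c s n S \<Longrightarrow> n \<le> m \<Longrightarrow> exec K c s m S"
  by (auto simp: exec_def intro: runs_mono)

lemma exec_Seq:
  assumes "exec K a s n (f ` S)" "\<And>t. t \<in> S \<Longrightarrow> exec K b (f t) m (F t)"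
  shows "exec K (a ;; b) s (n + m) (\<Union>t\<in>S. F t)"
  unfolding exec_def
proof (intro allI impI)
  fix step q
  assume "agrees step K (a ;; b) q"
  then have ab: "agrees step K a q" "agrees step K b (q + csize a)"
    by (rule agrees_Seq)+
  have "runs step (n + m) (q, tapes K s)
      (\<Union>t\<in>S. ((\<lambda>t. (q + csize (a ;; b), tapes K t)) ` F t))"
  proof (rule runs_bind)
    show "runs step n (q, tapes K s) ((\<lambda>t. (q + csize a, tapes K (f t))) ` S)"
      using execD[OF assms(1) ab(1)] by (simp add: image_image)
    show "runs step m (q + csize a, tapes K (f t)) ((\<lambda>u. (q + csize (a ;; b), tapes K u)) ` F t)"
      if "t \<in> S" for t
      by (rule execD[OF assms(2)[OF that] ab(2)]) simp
  qed
  then show "runs step (n + m) (q, tapes K s) ((\<lambda>t. (q + csize (a ;; b), tapes K t)) ` (\<Union>t\<in>S. F t))"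
    by (simp add: image_UN)
qed

lemma exec_Seq1:
  assumes "exec K a s n {t}" "exec K b t m S"
  shows "exec K (a ;; b) s (n + m) S"
  using exec_Seq[of K a s n id "{t}" b m "\<lambda>_. S"] assms by simp

lemma exec_Do:
  assumes "j < K" "\<alpha>s \<noteq> []"
    and "\<And>\<alpha>. \<alpha> \<in> set \<alpha>s \<Longrightarrow> act (\<alpha> (symb s j)) (tape_of s j) = tape_of (u \<alpha>) j"
    and "\<And>\<alpha> i. \<alpha> \<in> set \<alpha>s \<Longrightarrow> i \<noteq> j \<Longrightarrow> tape_of (u \<alpha>) i = tape_of s i"
  shows "exec K (Do j \<alpha>s) s 1 (u ` set \<alpha>s)"
  unfolding exec_def
proof (intro allI impI)
  fix step q
  assume ag: "agrees step K (Do j \<alpha>s) q"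
  let ?rs = "map (symb s) [0..<K]"
  have eq: "map2 act ((keep ?rs)[j := \<alpha> (symb s j)]) (tapes K s) = tapes K (u \<alpha>)" if "\<alpha> \<in> set \<alpha>s" for \<alpha>
    using assms that
    by (intro nth_equalityI) (auto simp: tapes_def keep_def act_stay nth_list_update)
  have "step (q, tapes K s) d \<longleftrightarrow> tstep (code K (Do j \<alpha>s) q) (q, tapes K s) d" for d
    by (rule agreesD[OF ag]) simp_all
  also have "\<dots> d \<longleftrightarrow> d \<in> (\<lambda>t. (q + csize (Do j \<alpha>s), tapes K t)) ` u ` set \<alpha>s" for d
    using assms(1) eq by (auto simp: tstep_def read_tapes symb_symbols image_iff)
  finally show "runs step 1 (q, tapes K s) ((\<lambda>t. (q + csize (Do j \<alpha>s), tapes K t)) ` u ` set \<alpha>s)"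
    by (rule runs_steps) (use assms in auto)
qed

lemma exec_Cond:
  assumes "j < K" "exec K (if symb s j = x then a else b) s n S"
  shows "exec K (Cond j x a b) s (n + 2) S"
  unfolding exec_def
proof (intro allI impI)
  fix step q
  let ?f = "\<lambda>t. (q + csize (Cond j x a b), tapes K t)"
  assume "agrees step K (Cond j x a b) q"
  note ag = agrees_Cond[OF this]
  show "runs step (n + 2) (q, tapes K s) (?f ` S)"
  proof (cases "symb s j = x")
    case True
    have "runs step n (Suc q, tapes K s) ((\<lambda>t. (Suc q + csize a, tapes K t)) ` S)"
      using assms True by (intro execD[OF _ ag(1)]) simp_all
    moreover have "runs step 1 (Suc q + csize a, tapes K t) {?f t}" for t
      by (rule runs_steps) (auto simp: ag(4) tstep_jump)
    ultimately have "runs step (n + 1) (Suc q, tapes K s) (\<Union>t\<in>S. {?f t})"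
      by (rule runs_bind)
    then have "runs step (Suc (n + 1)) (q, tapes K s) (\<Union>t\<in>S. {?f t})"
      by (rule runs_Suc[rotated]) (use True assms(1) in \<open>simp add: ag(3) tstep_jump\<close>)
    then show ?thesis by (simp add: UNION_singleton_eq_range)
  next
    case False
    have "runs step n (q + csize a + 2, tapes K s) (?f ` S)"
      using assms False by (intro execD[OF _ ag(2)]) simp_all
    then have "runs step (Suc n) (q, tapes K s) (?f ` S)"
      by (rule runs_Suc[rotated]) (use False assms(1) in \<open>simp add: ag(3) tstep_jump\<close>)
    then show ?thesis by (rule runs_mono) simp
  qed
qed

lemma exec_While_done:
  assumes "j < K" "symb s j = x"
  shows "exec K (While j x a) s 1 {s}"
  unfolding exec_def
proof (intro allI impI)
  fix step q
  assume "agrees step K (While j x a) q"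
  note ag = agrees_While[OF this]
  show "runs step 1 (q, tapes K s) ((\<lambda>t. (q + csize (While j x a), tapes K t)) ` {s})"
    by (rule runs_steps) (use assms in \<open>auto simp: ag(2) tstep_jump\<close>)
qed

lemma exec_While_step:
  assumes "j < K" "symb s j \<noteq> x" "exec K a s n (f ` S)"
    "\<And>t. t \<in> S \<Longrightarrow> exec K (While j x a) (f t) m (F t)"
  shows "exec K (While j x a) s (n + m + 2) (\<Union>t\<in>S. F t)"
  unfolding exec_def
proof (intro allI impI)
  fix step q
  let ?g = "\<lambda>t. (q + csize (While j x a), tapes K t)"
  assume agq: "agrees step K (While j x a) q"
  note ag = agrees_While[OF this]
  have "runs step (Suc m) (Suc q + csize a, tapes K (f t)) (?g ` F t)" if "t \<in> S" for t
    by (rule runs_Suc[of _ _ "(q, tapes K (f t))"])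
      (use execD[OF assms(4)[OF that] agq refl] in \<open>auto simp: tstep_jump ag(3)\<close>)
  moreover have "runs step n (Suc q, tapes K s) ((\<lambda>t. (Suc q + csize a, tapes K (f t))) ` S)"
    using execD[OF assms(3) ag(1) refl] by (simp add: image_image)
  ultimately have "runs step (n + Suc m) (Suc q, tapes K s) (\<Union>t\<in>S. ?g ` F t)"
    by (rule runs_bind[rotated])
  then have "runs step (Suc (n + Suc m)) (q, tapes K s) (\<Union>t\<in>S. ?g ` F t)"
    by (rule runs_Suc[rotated]) (use assms in \<open>simp add: ag(2) tstep_jump\<close>)
  then show "runs step (n + m + 2) (q, tapes K s) (?g ` (\<Union>t\<in>S. F t))"
    by (simp add: image_UN)
qed

text \<open>A round costs the body, the test and the jump back; the failing test at the end costs
  one more step. The induction counts the remaining rounds, because \<open>exec_While_step\<close>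
  prepends a round to the rest of the loop.\<close>

lemma exec_While_count:
  assumes "j < K" "\<And>i. i < N \<Longrightarrow> symb (\<sigma> i) j \<noteq> x \<and> exec K a (\<sigma> i) t {\<sigma> (Suc i)}"
    "symb (\<sigma> N) j = x"
  shows "exec K (While j x a) (\<sigma> 0) (N * (t + 2) + 1) {\<sigma> N}"
proof -
  have "exec K (While j x a) (\<sigma> (N - i)) (i * (t + 2) + 1) {\<sigma> N}" if "i \<le> N" for i
    using that
  proof (induction i)
    case 0
    then show ?case using exec_While_done[OF assms(1,3), of a] by simp
  next
    case (Suc i)
    then have "exec K (While j x a) (\<sigma> (Suc (N - Suc i))) (i * (t + 2) + 1) {\<sigma> N}"
      by (simp add: Suc_diff_Suc)
    with exec_While_step[OF assms(1), of "\<sigma> (N - Suc i)" x a t id "{\<sigma> (Suc (N - Suc i))}"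
        "i * (t + 2) + 1" "\<lambda>_. {\<sigma> N}"] assms(2)[of "N - Suc i"] Suc.prems
    have "exec K (While j x a) (\<sigma> (N - Suc i)) (t + (i * (t + 2) + 1) + 2) {\<sigma> N}" by auto
    then show ?case by (simp add: algebra_simps)
  qed
  from this[of N] show ?thesis by simp
qed

definition Inc :: "nat \<Rightarrow> com" where "Inc j = Do j [\<lambda>a. (a, Move_Right)]"
definition Dec :: "nat \<Rightarrow> com" where "Dec j = Do j [\<lambda>a. (a, Move_Left)]"
definition Put :: "nat \<Rightarrow> bool \<Rightarrow> com" where "Put j b = Do j [\<lambda>a. (bit_symbol b, Stay)]"
definition Guess :: "nat \<Rightarrow> com" where
  "Guess j = Do j [\<lambda>a. (bit_symbol True, Stay), \<lambda>a. (bit_symbol False, Stay)]"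

lemma det_simps [simp]: "det (Inc j)" "det (Dec j)" "det (Put j b)"
  by (simp_all add: Inc_def Dec_def Put_def)

lemma tape_of_cong: "fst s i = fst t i \<Longrightarrow> snd s i = snd t i \<Longrightarrow> tape_of s i = tape_of t i"
  by (simp add: tape_of_def cong: if_cong)

lemma tape_of_Inc: "act (symb s j, Move_Right) (tape_of s j) = tape_of ((fst s)(j := Suc (fst s j)), snd s) j"
  by (auto simp: tape_of_def symb_def)

lemma tape_of_Dec: "fst s j > 0 \<Longrightarrow>
    act (symb s j, Move_Left) (tape_of s j) = tape_of ((fst s)(j := fst s j - 1), snd s) j"
  by (auto simp: tape_of_def symb_def)

text \<open>At position 0 the write would destroy the marker.\<close>

lemma tape_of_Put: "fst s j > 0 \<Longrightarrow>
    act (bit_symbol b, Stay) (tape_of s j) = tape_of (fst s, (snd s)(j := (snd s j)(fst s j := Some b))) j"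
  by (auto simp: tape_of_def symb_def cell_def symbol_def fun_eq_iff)

lemma exec_Do1:
  assumes "j < K" "act (\<alpha> (symb s j)) (tape_of s j) = tape_of u j"
    and "\<And>i. i \<noteq> j \<Longrightarrow> tape_of u i = tape_of s i"
  shows "exec K (Do j [\<alpha>]) s 1 {u}"
  using exec_Do[of j K "[\<alpha>]" s "\<lambda>_. u"] assms by simp

lemma exec_Inc: "j < K \<Longrightarrow> exec K (Inc j) (v, G) 1 {(v(j := Suc (v j)), G)}"
  unfolding Inc_def using tape_of_Inc[of "(v, G)" j]
  by (intro exec_Do1 tape_of_cong) auto

lemma exec_Dec: "j < K \<Longrightarrow> v j > 0 \<Longrightarrow> exec K (Dec j) (v, G) 1 {(v(j := v j - 1), G)}"
  unfolding Dec_def using tape_of_Dec[of "(v, G)" j]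
  by (intro exec_Do1 tape_of_cong) auto

lemma exec_Put: "j < K \<Longrightarrow> v j > 0 \<Longrightarrow> exec K (Put j b) (v, G) 1 {(v, G(j := (G j)(v j := Some b)))}"
  unfolding Put_def using tape_of_Put[of "(v, G)" j b]
  by (intro exec_Do1 tape_of_cong) auto

lemma exec_Guess:
  assumes "j < K" "v j > 0"
  shows "exec K (Guess j) (v, G) 1 ((\<lambda>b. (v, G(j := (G j)(v j := Some b)))) ` UNIV)"
proof -
  \<comment> \<open>The outcome has to be a function of the chosen action; the guessed bit is
    recovered from the symbol that the action writes, 2 being the code of
    \<open>True\<close>.\<close>
  define u where "u \<alpha> = (v, G(j := (G j)(v j := Some (fst ((\<alpha> :: nat \<Rightarrow> action) 0) = 2))))" for \<alpha>
  have "exec K (Guess j) (v, G) 1 (u ` set [\<lambda>a. (bit_symbol True, Stay), \<lambda>a. (bit_symbol False, Stay)])"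
    unfolding Guess_def
  proof (rule exec_Do[OF assms(1)])
    show "act (\<alpha> (symb (v, G) j)) (tape_of (v, G) j) = tape_of (u \<alpha>) j"
      if "\<alpha> \<in> set [\<lambda>a. (bit_symbol True, Stay), \<lambda>a. (bit_symbol False, Stay)]" for \<alpha>
      using that tape_of_Put[of "(v, G)" j True] tape_of_Put[of "(v, G)" j False] assms(2)
      by (auto simp: u_def bit_symbol_def)
    show "tape_of (u \<alpha>) i = tape_of (v, G) i" if "i \<noteq> j" for \<alpha> i
      using that by (auto simp: u_def intro: tape_of_cong)
  qed simp
  then show ?thesis by (simp add: u_def UNIV_bool bit_symbol_def insert_commute)
qed

section \<open>Functions computable in polynomial time by counter programs\<close>

definition Skip :: com where "Skip = Do 0 [\<lambda>a. (a, Stay)]"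
definition Clear :: "nat \<Rightarrow> com" where "Clear j = While j 3 (Dec j)"
definition Move :: "nat \<Rightarrow> nat \<Rightarrow> com" where "Move i j = While i 3 (Dec i ;; Inc j)"

lemma det_simps' [simp]: "det Skip" "det (Clear j)" "det (Move i j)"
  by (simp_all add: Skip_def Clear_def Move_def)

text \<open>The new counters are described pointwise, which avoids proving equations between
  iterated function updates at each use. The same holds for the other primed rules.\<close>

lemma exec_Inc':
  "j < K \<Longrightarrow> 1 \<le> n \<Longrightarrow> (\<And>i. u i = (if i = j then Suc (v j) else v i)) \<Longrightarrow> exec K (Inc j) (v, G) n {(u, G)}"
proof (rule exec_mono[of _ _ _ 1])
  assume "j < K" and u: "\<And>i. u i = (if i = j then Suc (v j) else v i)"
  moreover have "u = v(j := Suc (v j))" using u by (auto simp: fun_eq_iff)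
  ultimately show "exec K (Inc j) (v, G) 1 {(u, G)}"
    using exec_Inc[of j K v G] by simp
qed

lemma exec_Dec':
  "j < K \<Longrightarrow> 0 < v j \<Longrightarrow> 1 \<le> n \<Longrightarrow> (\<And>i. u i = (if i = j then v j - 1 else v i)) \<Longrightarrow>
    exec K (Dec j) (v, G) n {(u, G)}"
proof (rule exec_mono[of _ _ _ 1])
  assume "j < K" "0 < v j" and u: "\<And>i. u i = (if i = j then v j - 1 else v i)"
  moreover have "u = v(j := v j - 1)" using u by (auto simp: fun_eq_iff)
  ultimately show "exec K (Dec j) (v, G) 1 {(u, G)}"
    using exec_Dec[of j K v G] by simp
qed

lemma exec_Skip': "0 < K \<Longrightarrow> 1 \<le> n \<Longrightarrow> (\<And>i. u i = v i) \<Longrightarrow> exec K Skip (v, G) n {(u, G)}"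
proof (rule exec_mono[of _ _ _ 1])
  assume "0 < K" and u: "\<And>i. u i = v i"
  moreover have "u = v" using u by (auto simp: fun_eq_iff)
  ultimately show "exec K Skip (v, G) 1 {(u, G)}"
    unfolding Skip_def by (intro exec_Do1) (auto simp: act_stay)
qed

lemma exec_Clear':
  assumes "j < K" "v j * 3 + 1 \<le> n" "\<And>i. u i = (if i = j then 0 else v i)"
  shows "exec K (Clear j) (v, G) n {(u, G)}"
proof -
  define \<sigma> where "\<sigma> i = (v(j := v j - i), G)" for i
  have "exec K (While j 3 (Dec j)) (\<sigma> 0) (v j * (1 + 2) + 1) {\<sigma> (v j)}"
    using assms(1) by (intro exec_While_count) (auto simp: \<sigma>_def intro!: exec_Dec')
  moreover have "\<sigma> 0 = (v, G)" "\<sigma> (v j) = (u, G)" using assms(3) by (auto simp: \<sigma>_def fun_eq_iff)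
  ultimately show ?thesis
    using exec_mono[of K "While j 3 (Dec j)" "(v, G)" "v j * (1 + 2) + 1" "{(u, G)}" n] assms(2)
    by (auto simp: Clear_def)
qed

lemma exec_Move':
  assumes "i < K" "j < K" "i \<noteq> j" "v i * 4 + 1 \<le> n"
    "\<And>m. u m = (if m = i then 0 else if m = j then v j + v i else v m)"
  shows "exec K (Move i j) (v, G) n {(u, G)}"
proof -
  define \<sigma> where "\<sigma> m = (v(i := v i - m, j := v j + m), G)" for m
  have "exec K (Dec i ;; Inc j) (\<sigma> m) (1 + 1) {\<sigma> (Suc m)}" if "m < v i" for m
    unfolding \<sigma>_def
    by (rule exec_Seq1[where t = "(v(i := v i - Suc m, j := v j + m), G)"]; (rule exec_Dec' exec_Inc')?)
      (use assms that in auto)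
  then have "exec K (While i 3 (Dec i ;; Inc j)) (\<sigma> 0) (v i * (1 + 1 + 2) + 1) {\<sigma> (v i)}"
    using assms by (intro exec_While_count) (auto simp: \<sigma>_def)
  moreover have "\<sigma> 0 = (v, G)" "\<sigma> (v i) = (u, G)" using assms(3,5) by (auto simp: \<sigma>_def fun_eq_iff)
  ultimately show ?thesis
    using exec_mono[of K "While i 3 (Dec i ;; Inc j)" "(v, G)" "v i * (1 + 1 + 2) + 1" "{(u, G)}" n] assms(4)
    by (auto simp: Move_def)
qed

definition word_on :: "(nat \<Rightarrow> bool option) \<Rightarrow> bool list \<Rightarrow> bool" where
  "word_on g w \<longleftrightarrow> (\<forall>i. g (Suc i) = (if i < length w then Some (w ! i) else None))"

definition bit :: "bool list \<Rightarrow> nat \<Rightarrow> bool" where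
  "bit w i \<longleftrightarrow> i < length w \<and> w ! i"

text \<open>Numbers contribute their value and not the length of a numeral, since they are stored in
  unary.\<close>

definition msize :: "('s \<Rightarrow> bool list) list \<Rightarrow> ('s \<Rightarrow> nat) list \<Rightarrow> 's \<Rightarrow> nat" where
  "msize ws vs s = (\<Sum>w\<leftarrow>ws. length (w s)) + (\<Sum>v\<leftarrow>vs. v s)"

definition pb :: "('s \<Rightarrow> bool list) list \<Rightarrow> ('s \<Rightarrow> nat) list \<Rightarrow> ('s \<Rightarrow> nat) \<Rightarrow> bool" where
  "pb ws vs t \<longleftrightarrow> (\<exists>p :: nat poly. \<forall>s. t s \<le> poly p (msize ws vs s))"

definition ready ::
  "('s \<Rightarrow> bool list) list \<Rightarrow> nat list \<Rightarrow> ('s \<Rightarrow> nat) list \<Rightarrow> nat \<Rightarrow> 's \<Rightarrow> state \<Rightarrow> bool" where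
  "ready ws \<rho> vs r s st \<longleftrightarrow>
     (\<forall>j<length ws. fst st j = 0 \<and> word_on (snd st j) ((ws ! j) s)) \<and>
     (\<forall>i<length vs. fst st (\<rho> ! i) = (vs ! i) s) \<and> (\<forall>j\<ge>r. fst st j = 0)"

text \<open>Tape \<open>j\<close> holds the \<open>j\<close>-th word of \<open>ws\<close>, the \<open>i\<close>-th counter of \<open>\<rho>\<close> holds the \<open>i\<close>-th number of \<open>vs\<close>, and the
  counters from \<open>r\<close> on are free.  All of them, like the computed number, depend on a state of type \<open>'s\<close>;
  a bound variable is added by passing to pairs.\<close>

definition PF :: "('s \<Rightarrow> bool list) list \<Rightarrow> ('s \<Rightarrow> nat) list \<Rightarrow> ('s \<Rightarrow> nat) \<Rightarrow> bool" where
  "PF ws vs f \<longleftrightarrow> pb ws vs f \<and>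
     (\<forall>\<rho> r. length \<rho> = length vs \<longrightarrow> set \<rho> \<subseteq> {2..<r} \<longrightarrow> 2 \<le> r \<longrightarrow>
       (\<exists>c k t. pb ws vs t \<and> det c \<and>
         (\<forall>K\<ge>k. \<forall>s v G. ready ws \<rho> vs r s (v, G) \<longrightarrow> exec K c (v, G) (t s) {(v(r := f s), G)})))"

lemma poly_nat_mono: "(m :: nat) \<le> n \<Longrightarrow> poly p m \<le> poly p n"
  by (induction p) (auto intro!: add_mono mult_mono)

lemma pb_le: "pb ws vs t \<Longrightarrow> (\<And>s. t' s \<le> t s) \<Longrightarrow> pb ws vs t'"
  unfolding pb_def by (elim exE, rule exI) (auto intro: order_trans)

lemma pb_const: "pb ws vs (\<lambda>_. n)"
  unfolding pb_def by (intro exI[of _ "[:n:]"]) simp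

lemma pb_add: "pb ws vs t \<Longrightarrow> pb ws vs t' \<Longrightarrow> pb ws vs (\<lambda>s. t s + t' s)"
  unfolding pb_def
proof (elim exE)
  fix p q :: "nat poly"
  assume "\<forall>s. t s \<le> poly p (msize ws vs s)" "\<forall>s. t' s \<le> poly q (msize ws vs s)"
  then show "\<exists>p. \<forall>s. t s + t' s \<le> poly p (msize ws vs s)"
    by (intro exI[of _ "p + q"]) (simp add: add_mono)
qed

lemma pb_mult: "pb ws vs t \<Longrightarrow> pb ws vs t' \<Longrightarrow> pb ws vs (\<lambda>s. t s * t' s)"
  unfolding pb_def
proof (elim exE)
  fix p q :: "nat poly"
  assume "\<forall>s. t s \<le> poly p (msize ws vs s)" "\<forall>s. t' s \<le> poly q (msize ws vs s)"
  then show "\<exists>p. \<forall>s. t s * t' s \<le> poly p (msize ws vs s)"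
    by (intro exI[of _ "p * q"]) (simp add: mult_mono)
qed

lemma pb_msize: "pb ws vs (msize ws vs)"
  unfolding pb_def by (intro exI[of _ "[:0, 1:]"]) simp

lemma pb_poly:
  assumes "pb ws vs t"
  shows "pb ws vs (\<lambda>s. poly q (t s))"
proof -
  obtain p where "t s \<le> poly p (msize ws vs s)" for s using assms by (auto simp: pb_def)
  then have "poly q (t s) \<le> poly (pcompose q p) (msize ws vs s)" for s
    by (simp add: poly_pcompose poly_nat_mono)
  then show ?thesis unfolding pb_def by (intro exI[of _ "pcompose q p"]) simp
qed

lemma pb_var: "v \<in> set vs \<Longrightarrow> pb ws vs v"
  by (rule pb_le[OF pb_msize]) (simp add: msize_def trans_le_add2 member_le_sum_list)

lemma pb_len: "w \<in> set ws \<Longrightarrow> pb ws vs (\<lambda>s. length (w s))"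
  by (rule pb_le[OF pb_msize]) (simp add: msize_def trans_le_add1 member_le_sum_list)

lemmas pb_intros = pb_const pb_add pb_mult pb_poly

lemma PF_pb: "PF ws vs f \<Longrightarrow> pb ws vs f"
  by (simp add: PF_def)

lemma PF_obtain:
  assumes "PF ws vs f" "length \<rho> = length vs" "set \<rho> \<subseteq> {2..<r}" "2 \<le> r"
  obtains c k t where "pb ws vs t" "det c"
    "\<And>K s v G. k \<le> K \<Longrightarrow> ready ws \<rho> vs r s (v, G) \<Longrightarrow> exec K c (v, G) (t s) {(v(r := f s), G)}"
proof -
  obtain c k t where "pb ws vs t" "det c"
    "\<forall>K\<ge>k. \<forall>s v G. ready ws \<rho> vs r s (v, G) \<longrightarrow> exec K c (v, G) (t s) {(v(r := f s), G)}"
    using assms(1)[unfolded PF_def, THEN conjunct2, rule_format, OF assms(2-4)] by (elim exE conjE)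
  then show ?thesis by (intro that[of t c k]) simp_all
qed

lemma PF_I:
  assumes "pb ws vs f"
    and "\<And>\<rho> r. length \<rho> = length vs \<Longrightarrow> set \<rho> \<subseteq> {2..<r} \<Longrightarrow> 2 \<le> r \<Longrightarrow>
       \<exists>c k t. pb ws vs t \<and> det c \<and>
         (\<forall>K\<ge>k. \<forall>s v G. ready ws \<rho> vs r s (v, G) \<longrightarrow> exec K c (v, G) (t s) {(v(r := f s), G)})"
  shows "PF ws vs f"
  using assms by (simp add: PF_def)

lemma ready_D:
  assumes "ready ws \<rho> vs r s (v, G)"
  shows "\<And>j. j < length ws \<Longrightarrow> v j = 0" "\<And>j. j < length ws \<Longrightarrow> word_on (G j) ((ws ! j) s)"
    "\<And>i. i < length vs \<Longrightarrow> v (\<rho> ! i) = (vs ! i) s" "\<And>j. r \<le> j \<Longrightarrow> v j = 0"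
  using assms by (auto simp: ready_def)

text \<open>A value computed into the first free counter leaves the context intact with one free
  counter less; this is how several operands are evaluated in turn.\<close>

lemma ready_upd:
  assumes "ready ws \<rho> vs r s (v, G)" "length ws \<le> 2" "2 \<le> r" "length \<rho> = length vs" "set \<rho> \<subseteq> {2..<r}"
  shows "ready ws \<rho> vs (Suc r) s (v(r := x), G)"
proof -
  have "\<rho> ! i < r" if "i < length vs" for i
    using assms(4,5) that by (metis atLeastLessThan_iff nth_mem subsetD)
  then show ?thesis using assms by (fastforce simp: ready_def)
qed

lemma PF_const: "PF ws vs (\<lambda>_. n)"
proof (rule PF_I)
  fix \<rho> :: "nat list" and r :: nat
  assume "2 \<le> (r :: nat)"
  have "\<exists>c. det c \<and> (\<forall>K>r. \<forall>v G. v r = 0 \<longrightarrow> exec K c (v, G) (n + 1) {(v(r := n), G)})"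
  proof (induction n)
    case 0
    have "exec K Skip (v, G) (0 + 1) {(v(r := 0), G)}" if "K > r" "v r = 0" for K v G
      by (rule exec_Skip') (use that in auto)
    then show ?case by (intro exI[of _ Skip]) (auto simp del: fun_upd_apply)
  next
    case (Suc n)
    then obtain c where c: "det c"
      "\<And>K v G. K > r \<Longrightarrow> v r = 0 \<Longrightarrow> exec K c (v, G) (n + 1) {(v(r := n), G)}" by blast
    have "exec K (c ;; Inc r) (v, G) (n + 1 + 1) {(v(r := Suc n), G)}" if "K > r" "v r = 0" for K v G
      by (rule exec_Seq1[OF c(2)]; (rule exec_Inc')?) (use that in auto)
    with c(1) show ?case by (intro exI[of _ "c ;; Inc r"]) (auto simp del: fun_upd_apply)
  qed
  then obtain c where "det c" "\<And>K v G. K > r \<Longrightarrow> v r = 0 \<Longrightarrow> exec K c (v, G) (n + 1) {(v(r := n), G)}"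
    by blast
  then show "\<exists>c k t. pb ws vs t \<and> det c \<and>
      (\<forall>K\<ge>k. \<forall>s v G. ready ws \<rho> vs r s (v, G) \<longrightarrow> exec K c (v, G) (t s) {(v(r := n), G)})"
    by (intro exI[of _ c] exI[of _ "Suc r"] exI[of _ "\<lambda>_. n + 1"]) (auto simp: pb_const ready_D(4))
qed (rule pb_const)

text \<open>Reading a counter empties it. It is therefore copied into two free counters at once and
  restored from the second.\<close>

lemma PF_var:
  assumes "f \<in> set vs"
  shows "PF ws vs f"
proof (rule PF_I)
  show pbf: "pb ws vs f" by (rule pb_var[OF assms])
  fix \<rho> :: "nat list" and r :: nat
  assume r: "2 \<le> r" "set \<rho> \<subseteq> {2..<r}" "length \<rho> = length vs"
  from assms obtain i where i: "i < length vs" "vs ! i = f" by (auto simp: in_set_conv_nth)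
  define j where "j = \<rho> ! i"
  have j: "j < r" "2 \<le> j" using r i unfolding j_def by (auto simp: subset_iff)
  let ?c = "While j 3 (Dec j ;; Inc r ;; Inc (Suc r)) ;; Move (Suc r) j"
  have "exec K ?c (v, G) (f s * (3 + 2) + 1 + (f s * 4 + 1)) {(v(r := f s), G)}"
    if K: "Suc (Suc r) \<le> K" and R: "ready ws \<rho> vs r s (v, G)" for K s v G
  proof -
    note R = ready_D[OF R]
    define \<sigma> where "\<sigma> m = (v(j := f s - m, r := m, Suc r := m), G)" for m
    have v: "v j = f s" "v r = 0" "v (Suc r) = 0" using R i j by (auto simp: j_def)
    have "exec K (Dec j ;; Inc r ;; Inc (Suc r)) (\<sigma> m) 3 {\<sigma> (Suc m)}" if "m < f s" for m
    proof -
      have "exec K (Dec j ;; Inc r ;; Inc (Suc r)) (\<sigma> m) (1 + (1 + 1)) {\<sigma> (Suc m)}"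
        unfolding \<sigma>_def
        by (rule exec_Seq1[OF exec_Dec'[where u = "v(j := f s - Suc m, r := m, Suc r := m)"]
              exec_Seq1[OF exec_Inc'[where u = "v(j := f s - Suc m, r := Suc m, Suc r := m)"] exec_Inc']])
          (use K j that in auto)
      then show ?thesis by (simp add: numeral_3_eq_3)
    qed
    then have "exec K (While j 3 (Dec j ;; Inc r ;; Inc (Suc r))) (\<sigma> 0) (f s * (3 + 2) + 1) {\<sigma> (f s)}"
      using K j by (intro exec_While_count) (auto simp: \<sigma>_def)
    moreover have "\<sigma> 0 = (v, G)" using v by (auto simp: \<sigma>_def fun_eq_iff)
    moreover have "exec K (Move (Suc r) j) (\<sigma> (f s)) (f s * 4 + 1) {(v(r := f s), G)}"
      unfolding \<sigma>_def by (rule exec_Move') (use K j v in auto)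
    ultimately show ?thesis by (intro exec_Seq1) auto
  qed
  then show "\<exists>c k t. pb ws vs t \<and> det c \<and>
      (\<forall>K\<ge>k. \<forall>s v G. ready ws \<rho> vs r s (v, G) \<longrightarrow> exec K c (v, G) (t s) {(v(r := f s), G)})"
    by (intro exI[of _ ?c] exI[of _ "Suc (Suc r)"] exI[of _ "\<lambda>s. f s * (3 + 2) + 1 + (f s * 4 + 1)"]
        conjI allI impI pb_intros pbf) auto
qed

lemma PF_len:
  assumes "w \<in> set ws" "length ws \<le> 2"
  shows "PF ws vs (\<lambda>s. length (w s))"
proof (rule PF_I)
  show pbf: "pb ws vs (\<lambda>s. length (w s))" by (rule pb_len[OF assms(1)])
  fix \<rho> :: "nat list" and r :: nat
  assume r: "2 \<le> r" "set \<rho> \<subseteq> {2..<r}" "length \<rho> = length vs"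
  from assms(1) obtain j where j: "j < length ws" "ws ! j = w" by (auto simp: in_set_conv_nth)
  \<comment> \<open>The head starts on the marker and position \<open>m + 1\<close> holds bit
    \<open>m\<close>, so after the first \<open>Inc\<close> the blank is met after as many rounds as
    the word has bits.\<close>
  let ?c = "Inc j ;; While j 0 (Inc j ;; Inc r) ;; Clear j"
  let ?t = "\<lambda>s. 1 + (length (w s) * (2 + 2) + 1 + (Suc (length (w s)) * 3 + 1))"
  have "exec K ?c (v, G) (?t s) {(v(r := length (w s)), G)}"
    if K: "Suc r \<le> K" and R: "ready ws \<rho> vs r s (v, G)" for K s v G
  proof -
    note R = ready_D[OF R]
    define \<sigma> where "\<sigma> m = (v(j := Suc m, r := m), G)" for m
    have v: "v j = 0" "word_on (G j) (w s)" "v r = 0" "j < r" using R j r assms(2) by auto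
    have "exec K (Inc j ;; Inc r) (\<sigma> m) 2 {\<sigma> (Suc m)}" for m
    proof -
      have "exec K (Inc j ;; Inc r) (\<sigma> m) (1 + 1) {\<sigma> (Suc m)}"
        unfolding \<sigma>_def
        by (rule exec_Seq1[OF exec_Inc'[where u = "v(j := Suc (Suc m), r := m)"] exec_Inc'])
          (use K v in auto)
      then show ?thesis by (simp add: numeral_2_eq_2)
    qed
    then have "exec K (While j 0 (Inc j ;; Inc r)) (\<sigma> 0) (length (w s) * (2 + 2) + 1) {\<sigma> (length (w s))}"
      using K v by (intro exec_While_count) (auto simp: \<sigma>_def word_on_def)
    moreover have "(v(j := Suc 0), G) = \<sigma> 0" using v by (auto simp: \<sigma>_def fun_eq_iff)
    moreover have "exec K (Clear j) (\<sigma> (length (w s))) (Suc (length (w s)) * 3 + 1) {(v(r := length (w s)), G)}"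
      unfolding \<sigma>_def by (rule exec_Clear') (use K v in auto)
    moreover have "exec K (Inc j) (v, G) 1 {(v(j := Suc 0), G)}"
      by (rule exec_Inc') (use K v in auto)
    ultimately show ?thesis by (intro exec_Seq1) auto
  qed
  then show "\<exists>c k t. pb ws vs t \<and> det c \<and> (\<forall>K\<ge>k. \<forall>s v G. ready ws \<rho> vs r s (v, G) \<longrightarrow>
      exec K c (v, G) (t s) {(v(r := length (w s)), G)})"
    by (intro exI[of _ ?c] exI[of _ "Suc r"] exI[of _ ?t])
      (auto intro!: pb_intros pbf pb_add[OF pb_const, of _ _ _ 1, simplified])
qed

lemma PF_bit:
  assumes "w \<in> set ws" "length ws \<le> 2" "PF ws vs f"
  shows "PF ws vs (\<lambda>s. of_bool (bit (w s) (f s)))"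
proof (rule PF_I)
  show "pb ws vs (\<lambda>s. of_bool (bit (w s) (f s)))" by (rule pb_le[OF pb_const[of _ _ 1]]) simp
  note pbf = PF_pb[OF assms(3)]
  fix \<rho> :: "nat list" and r :: nat
  assume r: "2 \<le> r" "set \<rho> \<subseteq> {2..<r}" "length \<rho> = length vs"
  from assms(1) obtain j where j: "j < length ws" "ws ! j = w" by (auto simp: in_set_conv_nth)
  obtain c k t where c: "pb ws vs t" "det c"
    "\<And>K s v G. k \<le> K \<Longrightarrow> ready ws \<rho> vs r s (v, G) \<Longrightarrow> exec K c (v, G) (t s) {(v(r := f s), G)}"
    using PF_obtain[OF assms(3) r(3,2,1)] by metis
  \<comment> \<open>The index is poured from counter \<open>r\<close> into the head position of the
    word tape; the extra \<open>Inc j\<close> skips the marker. This leaves \<open>r\<close> empty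
    for the answer. Behind the word a blank is read, which gives 0.\<close>
  let ?c = "c ;; Inc j ;; Move r j ;; Cond j 2 (Inc r) Skip ;; Clear j"
  let ?t = "\<lambda>s. t s + (1 + (f s * 4 + 1 + ((1 + 2) + ((1 + f s) * 3 + 1))))"
  have "exec K ?c (v, G) (?t s) {(v(r := of_bool (bit (w s) (f s))), G)}"
    if K: "max k (Suc r) \<le> K" and R: "ready ws \<rho> vs r s (v, G)" for K s v G
  proof -
    note c = c(3)[OF _ R]
    note R = ready_D[OF R]
    have v: "v j = 0" "word_on (G j) (w s)" "v r = 0" "j < r" using R j r assms(2) by auto
    let ?b = "of_bool (bit (w s) (f s)) :: nat"
    have "exec K (Clear j) (v(j := 1 + f s, r := ?b), G) ((1 + f s) * 3 + 1) {(v(r := ?b), G)}"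
      by (rule exec_Clear') (use K v in auto)
    moreover have "exec K (Cond j 2 (Inc r) Skip) (v(j := 1 + f s, r := 0), G) (1 + 2) {(v(j := 1 + f s, r := ?b), G)}"
      using K v by (intro exec_Cond) (auto simp: bit_def word_on_def intro!: exec_Inc' exec_Skip')
    moreover have "exec K (Move r j) (v(r := f s, j := 1), G) (f s * 4 + 1) {(v(j := 1 + f s, r := 0), G)}"
      by (rule exec_Move') (use K v in auto)
    moreover have "exec K (Inc j) (v(r := f s), G) 1 {(v(r := f s, j := 1), G)}"
      by (rule exec_Inc') (use K v in auto)
    moreover have "exec K c (v, G) (t s) {(v(r := f s), G)}" using c K by auto
    ultimately show ?thesis by (intro exec_Seq1)
  qed
  then show "\<exists>c k t. pb ws vs t \<and> det c \<and> (\<forall>K\<ge>k. \<forall>s v G. ready ws \<rho> vs r s (v, G) \<longrightarrow>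
      exec K c (v, G) (t s) {(v(r := of_bool (bit (w s) (f s))), G)})"
    using c(2) by (intro exI[of _ ?c] exI[of _ "max k (Suc r)"] exI[of _ ?t])
      (auto intro!: pb_intros pbf c(1))
qed

text \<open>Scheme for binary operations: the operands lie in counters \<open>r\<close> and
  \<open>r + 1\<close>, and the operation has to leave its result in \<open>r\<close> and to release
  \<open>r + 1\<close>.\<close>

lemma PF_two:
  assumes ws: "length ws \<le> 2" and f: "PF ws vs f" and g: "PF ws vs g" and h: "pb ws vs h"
    and tm: "pb ws vs tm"
    and c: "\<And>r. 2 \<le> r \<Longrightarrow> det (c r) \<and> (\<forall>K>Suc r. \<forall>s v G. v r = f s \<longrightarrow> v (Suc r) = g s \<longrightarrow>
        exec K (c r) (v, G) (tm s) {(v(r := h s, Suc r := 0), G)})"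
  shows "PF ws vs h"
proof (rule PF_I)
  fix \<rho> :: "nat list" and r :: nat
  assume r: "2 \<le> r" "set \<rho> \<subseteq> {2..<r}" "length \<rho> = length vs"
  obtain cf kf tf where cf: "pb ws vs tf" "det cf"
    "\<And>K s v G. kf \<le> K \<Longrightarrow> ready ws \<rho> vs r s (v, G) \<Longrightarrow> exec K cf (v, G) (tf s) {(v(r := f s), G)}"
    using PF_obtain[OF f r(3,2,1)] by metis
  have "set \<rho> \<subseteq> {2..<Suc r}" using r by auto
  then obtain cg kg tg where cg: "pb ws vs tg" "det cg"
    "\<And>K s v G. kg \<le> K \<Longrightarrow> ready ws \<rho> vs (Suc r) s (v, G) \<Longrightarrow> exec K cg (v, G) (tg s) {(v(Suc r := g s), G)}"
    using PF_obtain[OF g r(3)] r(1) by (metis le_SucI)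
  have "exec K (cf ;; cg ;; c r) (v, G) (tf s + (tg s + tm s)) {(v(r := h s), G)}"
    if K: "max (max kf kg) (Suc (Suc r)) \<le> K" and R: "ready ws \<rho> vs r s (v, G)" for K s v G
  proof -
    have v0: "v (Suc r) = 0" using ready_D(4)[OF R] by simp
    have "exec K (c r) (v(r := f s, Suc r := g s), G) (tm s) {((v(r := f s, Suc r := g s))(r := h s, Suc r := 0), G)}"
      by (rule c[OF r(1), THEN conjunct2, rule_format]) (use K in auto)
    moreover have "(v(r := f s, Suc r := g s))(r := h s, Suc r := 0) = v(r := h s)"
      using v0 by (auto simp: fun_eq_iff)
    ultimately have 3: "exec K (c r) (v(r := f s, Suc r := g s), G) (tm s) {(v(r := h s), G)}"
      by simp
    have "ready ws \<rho> vs (Suc r) s (v(r := f s), G)"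
      using ready_upd[OF R ws r(1,3,2)] .
    with K have 2: "exec K cg (v(r := f s), G) (tg s) {(v(r := f s, Suc r := g s), G)}"
      by (intro cg(3)) auto
    have 1: "exec K cf (v, G) (tf s) {(v(r := f s), G)}" using K R by (intro cf(3)) auto
    show ?thesis by (rule exec_Seq1[OF 1 exec_Seq1[OF 2 3]])
  qed
  then show "\<exists>c k t. pb ws vs t \<and> det c \<and>
      (\<forall>K\<ge>k. \<forall>s v G. ready ws \<rho> vs r s (v, G) \<longrightarrow> exec K c (v, G) (t s) {(v(r := h s), G)})"
    using c[OF r(1)] cf(2) cg(2)
    by (intro exI[of _ "cf ;; cg ;; c r"] exI[of _ "max (max kf kg) (Suc (Suc r))"]
        exI[of _ "\<lambda>s. tf s + (tg s + tm s)"])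
      (auto intro!: pb_intros cf(1) cg(1) tm)
qed (rule h)

lemma PF_add:
  assumes "length ws \<le> 2" "PF ws vs f" "PF ws vs g"
  shows "PF ws vs (\<lambda>s. f s + g s)"
proof (rule PF_two[OF assms])
  show "det (Move (Suc r) r) \<and> (\<forall>K>Suc r. \<forall>s v G. v r = f s \<longrightarrow> v (Suc r) = g s \<longrightarrow>
        exec K (Move (Suc r) r) (v, G) (g s * 4 + 1) {(v(r := f s + g s, Suc r := 0), G)})" for r
  proof (intro conjI allI impI)
    fix K s v and G :: "nat \<Rightarrow> nat \<Rightarrow> bool option"
    assume "K > Suc r" "v r = f s" "v (Suc r) = g s"
    then show "exec K (Move (Suc r) r) (v, G) (g s * 4 + 1) {(v(r := f s + g s, Suc r := 0), G)}"
      by (intro exec_Move') auto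
  qed simp
qed (intro pb_intros PF_pb assms)+

lemma PF_diff:
  assumes "length ws \<le> 2" "PF ws vs f" "PF ws vs g"
  shows "PF ws vs (\<lambda>s. f s - g s)"
proof (rule PF_two[OF assms])
  let ?c = "\<lambda>r. While (Suc r) 3 (Dec (Suc r) ;; Cond r 3 Skip (Dec r))"
  show "det (?c r) \<and> (\<forall>K>Suc r. \<forall>s v G. v r = f s \<longrightarrow> v (Suc r) = g s \<longrightarrow>
        exec K (?c r) (v, G) (g s * (4 + 2) + 1) {(v(r := f s - g s, Suc r := 0), G)})" for r
  proof (intro conjI allI impI)
    fix K s v and G :: "nat \<Rightarrow> nat \<Rightarrow> bool option"
    assume v: "K > Suc r" "v r = f s" "v (Suc r) = g s"
    define \<sigma> where "\<sigma> m = (v(r := f s - m, Suc r := g s - m), G)" for m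
    have "exec K (Dec (Suc r) ;; Cond r 3 Skip (Dec r)) (\<sigma> m) 4 {\<sigma> (Suc m)}" if "m < g s" for m
    proof -
      let ?u = "v(r := f s - m, Suc r := g s - Suc m)"
      have "exec K (if symb (?u, G) r = 3 then Skip else Dec r) (?u, G) 1 {\<sigma> (Suc m)}"
        using v unfolding \<sigma>_def by (auto intro!: exec_Skip' exec_Dec')
      then have "exec K (Cond r 3 Skip (Dec r)) (?u, G) (1 + 2) {\<sigma> (Suc m)}"
        using v by (intro exec_Cond) auto
      moreover have "exec K (Dec (Suc r)) (\<sigma> m) 1 {(?u, G)}"
        unfolding \<sigma>_def by (rule exec_Dec') (use v that in auto)
      ultimately have "exec K (Dec (Suc r) ;; Cond r 3 Skip (Dec r)) (\<sigma> m) (1 + (1 + 2)) {\<sigma> (Suc m)}"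
        by (intro exec_Seq1)
      then show ?thesis by (simp add: numeral_eq_Suc)
    qed
    then have "exec K (?c r) (\<sigma> 0) (g s * (4 + 2) + 1) {\<sigma> (g s)}"
      using v by (intro exec_While_count) (auto simp: \<sigma>_def)
    moreover have "\<sigma> 0 = (v, G)" using v by (auto simp: \<sigma>_def fun_eq_iff)
    ultimately show "exec K (?c r) (v, G) (g s * (4 + 2) + 1) {(v(r := f s - g s, Suc r := 0), G)}"
      by (simp add: \<sigma>_def)
  qed simp
  show "pb ws vs (\<lambda>s. f s - g s)" by (rule pb_le[OF PF_pb[OF assms(2)]]) simp
qed (intro pb_intros PF_pb assms)

section \<open>Bounded recursion, sums and quantifiers\<close>

definition lift :: "('s \<Rightarrow> 'b) list \<Rightarrow> ('s \<times> nat \<Rightarrow> 'b) list" where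
  "lift xs = map (\<lambda>x p. x (fst p)) xs"

definition bind :: "('s \<Rightarrow> nat) list \<Rightarrow> ('s \<times> nat \<Rightarrow> nat) list" where
  "bind vs = snd # lift vs"

lemma msize_bind: "msize (lift ws) (bind vs) p = msize ws vs (fst p) + snd p"
  by (simp add: msize_def lift_def bind_def comp_def)

lemma length_lift [simp]: "length (lift xs) = length xs" "length (bind vs) = Suc (length vs)"
  by (simp_all add: lift_def bind_def)

text \<open>The bound \<open>h\<close> is essential, as iterating a polynomially bounded step can
  produce exponential values. Counter \<open>r\<close> is the accumulator, \<open>r + 1\<close> the
  number of remaining rounds, \<open>r + 2\<close> the index, and \<open>r + 3\<close> receives the
  next value before it replaces the accumulator.\<close>

lemma PF_rec:
  assumes ws: "length ws \<le> 2" and a: "PF ws vs a" and b: "PF ws vs b"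
    and F: "PF (lift (lift ws)) (bind (bind vs)) (\<lambda>p. F (fst (fst p)) (snd (fst p)) (snd p))"
    and h: "pb ws vs h" "\<And>s i. i \<le> b s \<Longrightarrow> rec_nat (a s) (F s) i \<le> h s"
  shows "PF ws vs (\<lambda>s. rec_nat (a s) (F s) (b s))"
proof (rule PF_I)
  show "pb ws vs (\<lambda>s. rec_nat (a s) (F s) (b s))" by (rule pb_le[OF h(1)]) (simp add: h(2))
  note pba = PF_pb[OF a] and pbb = PF_pb[OF b]
  fix \<rho> :: "nat list" and r :: nat
  assume r: "2 \<le> r" "set \<rho> \<subseteq> {2..<r}" "length \<rho> = length vs"
  obtain ca ka ta where ca: "pb ws vs ta" "det ca"
    "\<And>K s v G. ka \<le> K \<Longrightarrow> ready ws \<rho> vs r s (v, G) \<Longrightarrow> exec K ca (v, G) (ta s) {(v(r := a s), G)}"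
    using PF_obtain[OF a r(3,2,1)] by metis
  have "set \<rho> \<subseteq> {2..<Suc r}" using r by auto
  then obtain cb kb tb where cb: "pb ws vs tb" "det cb"
    "\<And>K s v G. kb \<le> K \<Longrightarrow> ready ws \<rho> vs (Suc r) s (v, G) \<Longrightarrow> exec K cb (v, G) (tb s) {(v(Suc r := b s), G)}"
    using PF_obtain[OF b r(3)] r(1) by (metis le_SucI)
  \<comment> \<open>\<open>bind\<close> puts the innermost variable first: the accumulator, then the
    index.\<close>
  let ?\<rho> = "r # (r + 2) # \<rho>"
  have "length ?\<rho> = length (bind (bind vs))" "set ?\<rho> \<subseteq> {2..<r + 3}" "2 \<le> r + 3"
    using r by auto
  then obtain cF kF tF where cF: "pb (lift (lift ws)) (bind (bind vs)) tF" "det cF"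
    "\<And>K p v G. kF \<le> K \<Longrightarrow> ready (lift (lift ws)) ?\<rho> (bind (bind vs)) (r + 3) p (v, G) \<Longrightarrow>
      exec K cF (v, G) (tF p) {(v(r + 3 := F (fst (fst p)) (snd (fst p)) (snd p)), G)}"
    using PF_obtain[OF F] by metis
  from cF(1) obtain q :: "nat poly" where q: "\<And>p. tF p \<le> poly q (msize ws vs (fst (fst p)) + snd (fst p) + snd p)"
    unfolding pb_def msize_bind by blast
  let ?c = "cF ;; Clear r ;; Move (r + 3) r ;; Dec (Suc r) ;; Inc (r + 2)"
  \<comment> \<open>One bound for all rounds: the index is at most \<open>b s\<close>, the
    accumulator at most \<open>h s\<close>, and polynomials over \<open>nat\<close> are
    monotone.\<close>
  let ?tc = "\<lambda>s. poly q (msize ws vs s + b s + h s) + (h s * 3 + 1 + (h s * 4 + 1 + (1 + 1)))"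
  let ?cc = "ca ;; cb ;; While (Suc r) 3 ?c ;; Clear (r + 2)"
  let ?t = "\<lambda>s. ta s + (tb s + (b s * (?tc s + 2) + 1 + (b s * 3 + 1)))"
  have "exec K ?cc (v, G) (?t s) {(v(r := rec_nat (a s) (F s) (b s)), G)}"
    if K: "max ka (max kb (max kF (r + 4))) \<le> K" and R: "ready ws \<rho> vs r s (v, G)" for K s v G
  proof -
    define R where "R = rec_nat (a s) (F s)"
    have hR: "R i \<le> h s" if "i \<le> b s" for i using h(2)[OF that] by (simp add: R_def)
    define \<sigma> where "\<sigma> i = (v(r := R i, Suc r := b s - i, r + 2 := i), G)" for i
    have v0: "v r = 0" "v (Suc r) = 0" "v (r + 2) = 0" "v (r + 3) = 0" using ready_D(4)[OF R] by auto
    have body: "exec K ?c (\<sigma> i) (?tc s) {\<sigma> (Suc i)}" if i: "i < b s" for i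
    proof -
      let ?v = "v(r := R i, Suc r := b s - i, r + 2 := i)"
      have rd: "ready (lift (lift ws)) ?\<rho> (bind (bind vs)) (r + 3) ((s, i), R i) (\<sigma> i)"
        unfolding ready_def
      proof (intro conjI allI impI)
        fix j assume "j < length (lift (lift ws))"
        then show "fst (\<sigma> i) j = 0" "word_on (snd (\<sigma> i) j) ((lift (lift ws) ! j) ((s, i), R i))"
          using ready_D(1,2)[OF R, of j] ws r by (simp_all add: \<sigma>_def lift_def)
      next
        fix j assume "j < length (bind (bind vs))"
        then consider "j = 0" | "j = 1" | m where "j = m + 2" "m < length vs"
          by (cases j; cases "j - 1") auto
        then show "fst (\<sigma> i) (?\<rho> ! j) = (bind (bind vs) ! j) ((s, i), R i)"
        proof cases
          case (3 m)
          then have "\<rho> ! m < r" using r by (metis atLeastLessThan_iff nth_mem subsetD)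
          then show ?thesis using 3 ready_D(3)[OF R, of m] by (auto simp: \<sigma>_def bind_def lift_def)
        qed (auto simp: \<sigma>_def bind_def lift_def)
      next
        fix j assume "r + 3 \<le> j"
        then show "fst (\<sigma> i) j = 0" using ready_D(4)[OF R, of j] by (auto simp: \<sigma>_def)
      qed
      have "tF ((s, i), R i) \<le> poly q (msize ws vs s + i + R i)"
        using q[of "((s, i), R i)"] by simp
      also have "\<dots> \<le> poly q (msize ws vs s + b s + h s)"
        by (rule poly_nat_mono) (use hR[of i] i in simp)
      finally have le: "tF ((s, i), R i) \<le> poly q (msize ws vs s + b s + h s)" .
      have "kF \<le> K" using K by simp
      from cF(3)[OF this rd[unfolded \<sigma>_def]]
      have "exec K cF (\<sigma> i) (tF ((s, i), R i)) {(?v(r + 3 := F s i (R i)), G)}"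
        unfolding fst_conv snd_conv \<sigma>_def .
      moreover have "F s i (R i) = R (Suc i)" by (simp add: R_def)
      ultimately have 1: "exec K cF (\<sigma> i) (poly q (msize ws vs s + b s + h s)) {(?v(r + 3 := R (Suc i)), G)}"
        by (metis exec_mono le)
      have 2: "exec K (Clear r) (?v(r + 3 := R (Suc i)), G) (h s * 3 + 1) {(?v(r + 3 := R (Suc i), r := 0), G)}"
        by (rule exec_Clear') (use K hR[of i] i in simp_all)
      have 3: "exec K (Move (r + 3) r) (?v(r + 3 := R (Suc i), r := 0), G) (h s * 4 + 1)
          {(?v(r := R (Suc i)), G)}"
        by (rule exec_Move') (use K v0 hR[of "Suc i"] i in simp_all)
      have 4: "exec K (Dec (Suc r)) (?v(r := R (Suc i)), G) 1 {(?v(r := R (Suc i), Suc r := b s - Suc i), G)}"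
        by (rule exec_Dec') (use K i in auto)
      have 5: "exec K (Inc (r + 2)) (?v(r := R (Suc i), Suc r := b s - Suc i), G) 1 {\<sigma> (Suc i)}"
        unfolding \<sigma>_def by (rule exec_Inc') (use K in auto)
      show ?thesis by (rule exec_Seq1[OF 1 exec_Seq1[OF 2 exec_Seq1[OF 3 exec_Seq1[OF 4 5]]]])
    qed
    have 3: "exec K (While (Suc r) 3 ?c) (\<sigma> 0) (b s * (?tc s + 2) + 1) {\<sigma> (b s)}"
    proof (rule exec_While_count)
      show "symb (\<sigma> i) (Suc r) \<noteq> 3 \<and> exec K ?c (\<sigma> i) (?tc s) {\<sigma> (Suc i)}" if "i < b s" for i
        using body[OF that] that by (intro conjI) (simp add: \<sigma>_def, assumption)
    qed (use K in \<open>auto simp: \<sigma>_def\<close>)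
    have 4: "exec K (Clear (r + 2)) (\<sigma> (b s)) (b s * 3 + 1) {(v(r := R (b s)), G)}"
      unfolding \<sigma>_def by (rule exec_Clear') (use K v0 in auto)
    have 1: "exec K ca (v, G) (ta s) {(v(r := a s), G)}" using ca(3) K R by auto
    have eq: "(v(r := a s, Suc r := b s), G) = \<sigma> 0" using v0 by (auto simp: \<sigma>_def R_def fun_eq_iff)
    have 2: "exec K cb (v(r := a s), G) (tb s) {\<sigma> 0}"
      using cb(3)[OF _ ready_upd[OF R ws r(1,3,2)], of K "a s"] K unfolding eq by simp
    show ?thesis unfolding R_def[symmetric] by (rule exec_Seq1[OF 1 exec_Seq1[OF 2 exec_Seq1[OF 3 4]]])
  qed
  note ex = this
  have "pb ws vs ?t"
    by (intro pb_intros pbb ca(1) cb(1) h(1) pb_msize)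
  moreover have "det ?cc" using ca(2) cb(2) cF(2) by simp
  ultimately show "\<exists>c k t. pb ws vs t \<and> det c \<and> (\<forall>K\<ge>k. \<forall>s v G. ready ws \<rho> vs r s (v, G) \<longrightarrow>
      exec K c (v, G) (t s) {(v(r := rec_nat (a s) (F s) (b s)), G)})"
    by (intro exI[of _ ?cc] exI[of _ ?t] exI[of _ "max ka (max kb (max kF (r + 4)))"] conjI allI impI)
      (assumption | rule ex)+
qed

lemma lift_simps [simp]: "lift [] = []" "lift (x # xs) = (\<lambda>p. x (fst p)) # lift xs"
  by (simp_all add: lift_def)

text \<open>The same program works: the counter of the additional variable is simply dropped from
  the allocation, and the size of the enlarged state is no smaller.\<close>

lemma PF_weaken:
  assumes "PF ws vs f"
  shows "PF (lift ws) (bind vs) (\<lambda>p. f (fst p))"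
proof -
  have pbw: "pb (lift ws) (bind vs) (\<lambda>p. t (fst p))" if t: "pb ws vs t" for t
  proof -
    obtain q where q: "\<And>s. t s \<le> poly q (msize ws vs s)" using t by (auto simp: pb_def)
    have "t (fst p) \<le> poly q (msize (lift ws) (bind vs) p)" for p
      using q[of "fst p"] by (rule order_trans) (simp add: msize_bind poly_nat_mono)
    then show ?thesis unfolding pb_def by (intro exI[of _ q]) simp
  qed
  show ?thesis
  proof (rule PF_I)
    show "pb (lift ws) (bind vs) (\<lambda>p. f (fst p))" by (rule pbw[OF PF_pb[OF assms]])
    fix \<rho>' :: "nat list" and r :: nat
    assume r: "length \<rho>' = length (bind vs)" "set \<rho>' \<subseteq> {2..<r}" "2 \<le> r"
    then obtain r0 \<rho> where \<rho>: "\<rho>' = r0 # \<rho>" "length \<rho> = length vs" "set \<rho> \<subseteq> {2..<r}"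
      by (cases \<rho>') auto
    obtain c k t where c: "pb ws vs t" "det c"
      "\<And>K s v G. k \<le> K \<Longrightarrow> ready ws \<rho> vs r s (v, G) \<Longrightarrow> exec K c (v, G) (t s) {(v(r := f s), G)}"
      using PF_obtain[OF assms \<rho>(2,3) r(3)] by metis
    have rd: "ready ws \<rho> vs r (fst p) st" if "ready (lift ws) \<rho>' (bind vs) r p st" for p st
      using that \<rho>(1) by (fastforce simp: ready_def bind_def lift_def)
    show "\<exists>c k t. pb (lift ws) (bind vs) t \<and> det c \<and> (\<forall>K\<ge>k. \<forall>s v G.
        ready (lift ws) \<rho>' (bind vs) r s (v, G) \<longrightarrow> exec K c (v, G) (t s) {(v(r := f (fst s)), G)})"
      by (intro exI[of _ c] exI[of _ k] exI[of _ "\<lambda>p. t (fst p)"] conjI allI impI)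
        (use c pbw rd in simp_all)
  qed
qed

lemma pb_sum:
  assumes "pb ws vs b" "pb (lift ws) (bind vs) (\<lambda>p. F (fst p) (snd p))"
  shows "pb ws vs (\<lambda>s. \<Sum>i<b s. F s i)"
proof -
  obtain q where q: "\<forall>p. F (fst p) (snd p) \<le> poly q (msize (lift ws) (bind vs) p)"
    using assms(2) unfolding pb_def by (elim exE)
  have "F s i \<le> poly q (msize ws vs s + b s)" if "i < b s" for s i
  proof -
    have "F s i \<le> poly q (msize ws vs s + i)" using q[rule_format, of "(s, i)"] by (simp add: msize_bind)
    also have "\<dots> \<le> poly q (msize ws vs s + b s)" by (rule poly_nat_mono) (use that in simp)
    finally show ?thesis .
  qed
  then have "(\<Sum>i<b s. F s i) \<le> b s * poly q (msize ws vs s + b s)" for s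
    using sum_bounded_above[of "{..<b s}" "F s" "poly q (msize ws vs s + b s)"] by simp
  then show ?thesis
    by (rule pb_le[rotated]) (intro pb_intros pb_msize assms(1))
qed

lemma PF_sum:
  assumes "length ws \<le> 2" "PF ws vs b" "PF (lift ws) (bind vs) (\<lambda>p. F (fst p) (snd p))"
  shows "PF ws vs (\<lambda>s. \<Sum>i<b s. F s i)"
proof -
  have eq: "rec_nat 0 (\<lambda>i acc. acc + F s i) n = (\<Sum>i<n. F s i)" for s n
    by (induction n) auto
  have "PF ws vs (\<lambda>s. rec_nat 0 (\<lambda>i acc. acc + F s i) (b s))"
  proof (rule PF_rec[where h = "\<lambda>s. \<Sum>i<b s. F s i"])
    show "PF (lift (lift ws)) (bind (bind vs)) (\<lambda>p. snd p + F (fst (fst p)) (snd (fst p)))"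
      by (intro PF_add PF_weaken[OF assms(3)]) (auto simp: assms bind_def intro: PF_var)
    show "pb ws vs (\<lambda>s. \<Sum>i<b s. F s i)" by (intro pb_sum PF_pb assms)
    show "rec_nat 0 (\<lambda>i acc. acc + F s i) n \<le> (\<Sum>i<b s. F s i)" if "n \<le> b s" for s n
      unfolding eq by (rule sum_mono2) (use that in auto)
  qed (use assms PF_const in auto)
  then show ?thesis by (simp add: eq)
qed

lemma PF_mult:
  assumes "length ws \<le> 2" "PF ws vs f" "PF ws vs g"
  shows "PF ws vs (\<lambda>s. f s * g s)"
proof -
  have "PF ws vs (\<lambda>s. \<Sum>i<f s. g s)"
    using assms by (intro PF_sum) (auto intro: PF_weaken)
  then show ?thesis by simp
qed

lemma PF_cong: "(\<And>s. f s = g s) \<Longrightarrow> PF ws vs f \<Longrightarrow> PF ws vs g"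
  by presburger

lemma PF_Suc: "length ws \<le> 2 \<Longrightarrow> PF ws vs f \<Longrightarrow> PF ws vs (\<lambda>s. Suc (f s))"
  using PF_add[of ws vs f "\<lambda>_. 1"] PF_const by fastforce

abbreviation PB :: "('s \<Rightarrow> bool list) list \<Rightarrow> ('s \<Rightarrow> nat) list \<Rightarrow> ('s \<Rightarrow> bool) \<Rightarrow> bool" where
  "PB ws vs P \<equiv> PF ws vs (\<lambda>s. of_bool (P s))"

lemma PB_le:
  assumes "length ws \<le> 2" "PF ws vs f" "PF ws vs g"
  shows "PB ws vs (\<lambda>s. f s \<le> g s)"
  by (rule PF_cong[OF _ PF_diff[OF assms(1) PF_const[of ws vs 1] PF_diff[OF assms]]]) auto

lemma PB_less: "length ws \<le> 2 \<Longrightarrow> PF ws vs f \<Longrightarrow> PF ws vs g \<Longrightarrow> PB ws vs (\<lambda>s. f s < g s)"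
  using PB_le[OF _ PF_Suc, of ws vs f g] by (simp add: Suc_le_eq)

lemma PB_not:
  assumes "length ws \<le> 2" "PB ws vs P"
  shows "PB ws vs (\<lambda>s. \<not> P s)"
  by (rule PF_cong[OF _ PF_diff[OF assms(1) PF_const[of ws vs 1] assms(2)]]) auto

lemma PB_conj:
  assumes "length ws \<le> 2" "PB ws vs P" "PB ws vs Q"
  shows "PB ws vs (\<lambda>s. P s \<and> Q s)"
  by (rule PF_cong[OF _ PF_mult[OF assms]]) auto

lemma PB_disj:
  assumes "length ws \<le> 2" "PB ws vs P" "PB ws vs Q"
  shows "PB ws vs (\<lambda>s. P s \<or> Q s)"
  by (rule PF_cong[OF _ PB_not[OF assms(1) PB_conj[OF assms(1) PB_not[OF assms(1,2)] PB_not[OF assms(1,3)]]]]) auto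

lemma PB_imp:
  assumes "length ws \<le> 2" "PB ws vs P" "PB ws vs Q"
  shows "PB ws vs (\<lambda>s. P s \<longrightarrow> Q s)"
  by (rule PF_cong[OF _ PB_disj[OF assms(1) PB_not[OF assms(1,2)] assms(3)]]) auto

lemma PB_eq:
  assumes "length ws \<le> 2" "PF ws vs f" "PF ws vs g"
  shows "PB ws vs (\<lambda>s. f s = g s)"
  by (rule PF_cong[OF _ PB_conj[OF assms(1) PB_le[OF assms] PB_le[OF assms(1,3,2)]]]) auto

lemma PB_iff:
  assumes "length ws \<le> 2" "PB ws vs P" "PB ws vs Q"
  shows "PB ws vs (\<lambda>s. P s \<longleftrightarrow> Q s)"
  by (rule PF_cong[OF _ PB_eq[OF assms]]) auto

lemma PB_const: "PB ws vs (\<lambda>_. P)"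
  by (rule PF_const)

lemma PB_ex:
  assumes "length ws \<le> 2" "PF ws vs b" "PB (lift ws) (bind vs) (\<lambda>p. P (fst p) (snd p))"
  shows "PB ws vs (\<lambda>s. \<exists>i<b s. P s i)"
proof -
  have "(0 < (\<Sum>i<b s. of_bool (P s i) :: nat)) \<longleftrightarrow> (\<exists>i<b s. P s i)" for s
    by (subst zero_less_iff_neq_zero, subst sum_eq_0_iff) auto
  then show ?thesis
    using PB_less[OF assms(1) PF_const[of ws vs 0] PF_sum[OF assms]] by simp
qed

lemma PB_all:
  assumes "length ws \<le> 2" "PF ws vs b" "PB (lift ws) (bind vs) (\<lambda>p. P (fst p) (snd p))"
  shows "PB ws vs (\<lambda>s. \<forall>i<b s. P s i)"
  by (rule PF_cong[OF _ PB_not[OF assms(1) PB_ex[OF assms(1,2) PB_not[OF _ assms(3)]]]]) (use assms(1) in auto)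

lemma PF_if:
  assumes "length ws \<le> 2" "PB ws vs P" "PF ws vs f" "PF ws vs g"
  shows "PF ws vs (\<lambda>s. if P s then f s else g s)"
  by (rule PF_cong[OF _ PF_add[OF assms(1) PF_mult[OF assms(1,2,3)]
      PF_mult[OF assms(1) PB_not[OF assms(1,2)] assms(4)]]]) auto

text \<open>The quotient is obtained by counting the \<open>q\<close> with
  \<open>Suc q * n \<le> m\<close>; the guard \<open>0 < n\<close> gives 0 for the divisor 0, in
  accordance with \<open>div\<close>.\<close>

lemma PF_div:
  assumes "length ws \<le> 2" "PF ws vs f" "PF ws vs g"
  shows "PF ws vs (\<lambda>s. f s div g s)"
proof -
  have "(\<Sum>q<m. of_bool (0 < n \<and> Suc q * n \<le> m)) = m div n" for m n :: nat
  proof (cases "n = 0")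
    case False
    have "q < m \<and> 0 < n \<and> Suc q * n \<le> m \<longleftrightarrow> q < m div n" for q
    proof -
      have "Suc q * n \<le> m \<longleftrightarrow> q < m div n"
        using less_eq_div_iff_mult_less_eq[of n "Suc q" m] False by (simp only: Suc_le_eq)
      moreover have "q < m div n \<Longrightarrow> q < m" using div_le_dividend[of m n] by linarith
      ultimately show ?thesis using False by blast
    qed
    then have "{..<m} \<inter> {q. 0 < n \<and> Suc q * n \<le> m} = {..<m div n}" by auto
    then show ?thesis by (subst sum_of_bool_eq) auto
  qed auto
  moreover have "PF ws vs (\<lambda>s. \<Sum>q<f s. of_bool (0 < g s \<and> Suc q * g s \<le> f s))"
    using assms by (intro PF_sum PB_conj PB_less PB_le PF_mult PF_Suc PF_const PF_weaken)
      (auto simp: bind_def intro: PF_var)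
  ultimately show ?thesis by simp
qed

lemma PF_mod:
  assumes "length ws \<le> 2" "PF ws vs f" "PF ws vs g"
  shows "PF ws vs (\<lambda>s. f s mod g s)"
  using PF_diff[OF assms(1,2) PF_mult[OF assms(1) PF_div[OF assms] assms(3)]]
  by (simp add: minus_div_mult_eq_mod)

lemma PF_poly: "length ws \<le> 2 \<Longrightarrow> PF ws vs f \<Longrightarrow> PF ws vs (\<lambda>s. poly p (f s))"
  by (induction p) (auto intro!: PF_const PF_add PF_mult)

text \<open>The list is a constant, so the quantifier becomes a disjunction spelled out in the
  program, and the \<open>P x\<close> may be different programs.\<close>

lemma PB_bex_list:
  assumes "length ws \<le> 2" "\<And>x. x \<in> set xs \<Longrightarrow> PB ws vs (P x)"
  shows "PB ws vs (\<lambda>s. \<exists>x\<in>set xs. P x s)"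
  using assms(2)
proof (induction xs)
  case (Cons x xs)
  then have "PB ws vs (\<lambda>s. P x s \<or> (\<exists>x\<in>set xs. P x s))"
    by (intro PB_disj assms(1)) auto
  then show ?case by simp
qed (simp add: PF_const)

lemma PB_bit: "w \<in> set ws \<Longrightarrow> length ws \<le> 2 \<Longrightarrow> PF ws vs f \<Longrightarrow> PB ws vs (\<lambda>s. bit (w s) (f s))"
  by (rule PF_bit)

section \<open>Machines\<close>

definition cont :: "bool list \<Rightarrow> nat \<Rightarrow> bool option" where
  "cont w i = (if 1 \<le> i \<and> i \<le> length w then Some (w ! (i - 1)) else None)"

lemma word_on_cont: "word_on (cont w) w"
  by (simp add: word_on_def cont_def Suc_le_eq)

lemma cont_snoc: "(cont w)(Suc (length w) := Some b) = cont (w @ [b])"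
  by (auto simp: cont_def fun_eq_iff nth_append)

definition init_state :: "bool list \<Rightarrow> state" where
  "init_state x = (\<lambda>_. 0, (\<lambda>_. cont [])(0 := cont x))"

text \<open>Sets the markers. Words start at cell 0, so on tapes 0 and 1 the heads first step to
  cell -1, which explains \<open>offset\<close>; on the other tapes the marker goes to cell
  0.\<close>

definition pre :: "nat \<Rightarrow> (nat \<times> nat list \<times> nat \<times> action list) set" where
  "pre K = {(0, rs, 1, map (\<lambda>j. if j < 2 then (rs ! j, Move_Left) else (3, Stay)) [0..<K]) | rs. rs \<in> symbols K}
     \<union> {(1, rs, 2, replicate K (3, Stay)) | rs. rs \<in> symbols K}"

lemma finite_pre: "finite (pre K)"
  unfolding pre_def by (intro finite_UnI finite_image_set) (simp_all add: finite_symbols)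

lemma word_tape_act:
  "act (3, Stay) (act (read_tape (word_tape x), Move_Left) (word_tape x))
     = tape_of (\<lambda>_. 0, (\<lambda>_. cont [])(j := cont x)) j" if "j < 2"
proof -
  have "(\<lambda>i. if 0 \<le> i \<and> nat i < length x then bit_symbol (x ! nat i) else 0)(-1 := 3)
      = (\<lambda>i. if i + 1 < 0 then 0 else cell (cont x) (nat (i + 1)))" (is "?l = ?r")
  proof
    fix i :: int
    have "i < -1 \<or> i = -1 \<or> 0 \<le> i" by linarith
    then consider "i < -1" | "i = -1" | m where "i = int m" using zero_le_imp_eq_int[of i] by blast
    then show "?l i = ?r i"
    proof cases
      case 3
      then have "nat (i + 1) = Suc m" by simp
      then show ?thesis using 3 by (simp add: cell_def cont_def symbol_def)
    qed (auto simp: cell_def)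
  qed
  moreover have "act (read_tape (word_tape x), Move_Left) (word_tape x) = (fst (word_tape x), -1)"
    by (auto simp: word_tape_def)
  ultimately show ?thesis using that
    by (simp add: word_tape_def tape_of_def offset_def cong: if_cong)
qed

lemma runs_pre:
  assumes K: "K \<ge> 2" and step: "\<And>p ts d. p < 2 \<Longrightarrow> step (p, ts) d = tstep (pre K) (p, ts) d"
  shows "runs step 2 (0, word_tape x # replicate (K - 1) (word_tape [])) {(2, tapes K (init_state x))}"
proof -
  define ts where "ts = word_tape x # replicate (K - 1) (word_tape [])"
  have nth: "ts ! j = (if j = 0 then word_tape x else word_tape [])" "length ts = K" if "j < K" for j
    using that by (auto simp: ts_def nth_Cons split: nat.splits)
  have len: "length ts = K" using K by (simp add: ts_def)
  define ts' where "ts' = map (\<lambda>j. if j < 2 then act (read_tape (ts ! j), Move_Left) (ts ! j)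
      else act (3, Stay) (ts ! j)) [0..<K]"
  have rs: "map read_tape ts \<in> symbols K"
    using K unfolding ts_def symbols_def by (auto simp: word_tape_def bit_symbol_def)
  have rs': "map read_tape ts' \<in> symbols K"
  proof -
    have "read_tape (ts' ! j) \<le> 3" if "j < K" for j
      using that nth[OF that] by (auto simp: ts'_def word_tape_def bit_symbol_def)
    then show ?thesis by (fastforce simp: symbols_def in_set_conv_nth ts'_def)
  qed
  have "map2 act (map (\<lambda>j. if j < 2 then (map read_tape ts ! j, Move_Left) else (3, Stay)) [0..<K]) ts = ts'"
    by (rule nth_equalityI) (auto simp: ts'_def len)
  then have 1: "step (0, ts) d \<longleftrightarrow> d = (1, ts')" for d
    using rs by (auto simp: step tstep_def pre_def)
  have "map2 act (replicate K (3, Stay)) ts' = tapes K (init_state x)"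
  proof (rule nth_equalityI)
    fix j assume "j < length (map2 act (replicate K (3, Stay)) ts')"
    then have j: "j < K" by (simp add: ts'_def)
    show "map2 act (replicate K (3, Stay)) ts' ! j = tapes K (init_state x) ! j"
    proof (cases "j < 2")
      case True
      then consider "j = 0" | "j = 1" by linarith
      then show ?thesis
      proof cases
        case 1
        then show ?thesis using j nth[OF j] word_tape_act[of 0 x]
          by (simp add: ts'_def tapes_def init_state_def)
      next
        case 2
        have "tape_of (init_state x) 1 = tape_of (\<lambda>_. 0, (\<lambda>_. cont [])(1 := cont [])) 1"
          by (rule tape_of_cong) (simp_all add: init_state_def)
        then show ?thesis using 2 j nth[OF j] word_tape_act[of 1 "[]"]
          by (simp add: ts'_def tapes_def)
      qed
    next
      case False
      then show ?thesis using j nth[OF j]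
        by (auto simp: ts'_def tapes_def init_state_def word_tape_def tape_of_def offset_def cell_def cont_def)
    qed
  qed (simp add: ts'_def tapes_def)
  then have 2: "step (1, ts') d \<longleftrightarrow> d = (2, tapes K (init_state x))" for d
    using rs' by (auto simp: step tstep_def pre_def)
  have "runs step (Suc 1) (0, ts) {(2, tapes K (init_state x))}"
    by (rule runs_Suc[OF _ runs_steps]) (use 1 2 in auto)
  then show ?thesis by (simp add: ts_def numeral_2_eq_2)
qed

definition machine :: "nat \<Rightarrow> com \<Rightarrow> (nat \<times> nat list \<times> nat \<times> action list) set" where
  "machine K c = pre K \<union> code K c 2"

lemma runs_machine:
  assumes "K \<ge> 2" "exec K c (init_state x) n S"
    and "\<And>p ts d. p < 2 + csize c \<Longrightarrow> step (p, ts) d = tstep (machine K c) (p, ts) d"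
  shows "runs step (2 + n) (0, word_tape x # replicate (K - 1) (word_tape []))
    ((\<lambda>t. (2 + csize c, tapes K t)) ` S)"
proof -
  have "runs step 2 (0, word_tape x # replicate (K - 1) (word_tape [])) {(2, tapes K (init_state x))}"
    by (rule runs_pre[OF assms(1)])
      (subst assms(3), auto simp: machine_def intro!: tstep_cong dest: code_outside)
  moreover have "agrees step K c 2"
    by (rule agreesI) (subst assms(3), auto simp: machine_def pre_def intro!: tstep_cong)
  then have "runs step n (2, tapes K (init_state x)) ((\<lambda>t. (2 + csize c, tapes K t)) ` S)"
    by (rule execD[OF assms(2)]) simp
  ultimately show ?thesis
    using runs_bind[of step 2 _ id "{(2, tapes K (init_state x))}" n "\<lambda>_. (\<lambda>t. (2 + csize c, tapes K t)) ` S"]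
    by simp
qed

lemma finite_machine: "finite (machine K c)"
  by (simp add: machine_def finite_pre finite_code)

lemma machine_length: "(p, rs, p', as) \<in> machine K c \<Longrightarrow> length rs = K \<and> length as = K"
  by (auto simp: machine_def pre_def symbols_def dest: code_length)

lemma machine_range: "(p, rs, p', as) \<in> machine K c \<Longrightarrow> p < 2 + csize c"
  by (auto simp: machine_def pre_def dest: code_range)

section \<open>Guessing words, and criteria for membership in the classes\<close>

definition guess :: com where
  "guess = Inc 0 ;; Inc 1 ;; While 0 0 (Guess 1 ;; Inc 1 ;; Inc 0) ;; Clear 0"

text \<open>The head of tape 1 remains behind the word, ready to append. The same state therefore
  also describes a machine with input \<open>x\<close> that has written \<open>y\<close> as its
  output so far.\<close>

definition guessed :: "bool list \<Rightarrow> bool list \<Rightarrow> state" where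
  "guessed x y = ((\<lambda>_. 0)(1 := Suc (length y)), (\<lambda>_. cont [])(0 := cont x, 1 := cont y))"

lemma exec_guess_loop:
  fixes x :: "bool list"
  defines "\<sigma> \<equiv> \<lambda>y :: bool list. ((\<lambda>_. 0)(0 := Suc (length y), 1 := Suc (length y)), (\<lambda>_. cont [])(0 := cont x, 1 := cont y)) :: state"
  assumes K: "2 \<le> K"
  shows "length y + d = length x \<Longrightarrow>
    exec K (While 0 0 (Guess 1 ;; Inc 1 ;; Inc 0)) (\<sigma> y) (d * 5 + 1) ((\<lambda>z. \<sigma> (y @ z)) ` {z. length z = d})"
proof (induction d arbitrary: y)
  case 0
  then show ?case
    using exec_While_done[of 0 K "\<sigma> y" 0] K by (simp add: \<sigma>_def cont_def)
next
  case (Suc d)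
  let ?v = "(\<lambda>_ :: nat. 0 :: nat)(0 := Suc (length y), 1 := Suc (length y))"
  let ?G = "(\<lambda>_ :: nat. cont [])(0 := cont x, 1 := cont y)"
  let ?w = "\<lambda>b. (?v, ?G(1 := (?G 1)(?v 1 := Some b)))"
  have w: "?w b = (?v, (\<lambda>_. cont [])(0 := cont x, 1 := cont (y @ [b])))" for b
    using cont_snoc[of y b] by simp
  have "exec K (Inc 1 ;; Inc 0) (?w b) (1 + 1) {\<sigma> (y @ [b])}" for b
    unfolding w \<sigma>_def
    by (rule exec_Seq1[OF exec_Inc'[where u = "?v(1 := Suc (Suc (length y)))"] exec_Inc']) (use K in auto)
  then have "exec K (Guess 1 ;; Inc 1 ;; Inc 0) (\<sigma> y) (1 + (1 + 1)) (\<Union>b\<in>UNIV. {\<sigma> (y @ [b])})"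
    by (intro exec_Seq[where f = ?w]) (use K exec_Guess[of 1 K ?v ?G] in \<open>simp_all add: \<sigma>_def\<close>)
  then have "exec K (Guess 1 ;; Inc 1 ;; Inc 0) (\<sigma> y) (1 + (1 + 1)) (range (\<lambda>b. \<sigma> (y @ [b])))"
    by (simp add: UNION_singleton_eq_range)
  moreover have "symb (\<sigma> y) 0 \<noteq> 0"
    using Suc.prems by (simp add: \<sigma>_def cont_def)
  moreover have "exec K (While 0 0 (Guess 1 ;; Inc 1 ;; Inc 0)) (\<sigma> (y @ [b])) (d * 5 + 1)
      ((\<lambda>z. \<sigma> ((y @ [b]) @ z)) ` {z. length z = d})" for b
    by (rule Suc.IH) (use Suc.prems in simp)
  ultimately have "exec K (While 0 0 (Guess 1 ;; Inc 1 ;; Inc 0)) (\<sigma> y) (1 + (1 + 1) + (d * 5 + 1) + 2)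
      (\<Union>b\<in>UNIV. (\<lambda>z. \<sigma> ((y @ [b]) @ z)) ` {z. length z = d})"
    using K by (intro exec_While_step) simp_all
  moreover have "(\<Union>b\<in>UNIV. (\<lambda>z. \<sigma> ((y @ [b]) @ z)) ` {z. length z = d})
      = (\<lambda>z. \<sigma> (y @ z)) ` {z. length z = Suc d}"
    by (fastforce simp: length_Suc_conv image_iff)
  ultimately show ?case by (simp add: numeral_eq_Suc)
qed

lemma exec_guess:
  assumes K: "2 \<le> K"
  shows "exec K guess (init_state x) (8 * length x + 7) (guessed x ` {y. length y = length x})"
proof -
  define \<sigma> where "\<sigma> y = (((\<lambda>_. 0)(0 := Suc (length y), 1 := Suc (length y)),
    (\<lambda>_. cont [])(0 := cont x, 1 := cont y)) :: state)" for y
  have cl: "exec K (Clear 0) (\<sigma> y) (Suc (length x) * 3 + 1) {guessed x y}" if "length y = length x" for y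
    unfolding \<sigma>_def guessed_def by (rule exec_Clear') (use K that in auto)
  have "exec K (While 0 0 (Guess 1 ;; Inc 1 ;; Inc 0)) (\<sigma> []) (length x * 5 + 1)
      (\<sigma> ` {y. length y = length x})"
    using exec_guess_loop[OF K, of "[]" "length x" x] by (simp add: \<sigma>_def)
  then have 3: "exec K (While 0 0 (Guess 1 ;; Inc 1 ;; Inc 0) ;; Clear 0) (\<sigma> [])
      (length x * 5 + 1 + (Suc (length x) * 3 + 1)) (\<Union>y\<in>{y. length y = length x}. {guessed x y})"
    by (rule exec_Seq) (use cl in simp)
  have 2: "exec K (Inc 1) ((\<lambda>_. 0)(0 := Suc 0), snd (init_state x)) 1 {\<sigma> []}"
    using exec_Inc'[of 1 K 1 "(\<lambda>_. 0)(0 := Suc 0, 1 := Suc 0)" "(\<lambda>_. 0)(0 := Suc 0)" "snd (init_state x)"] K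
    by (simp add: \<sigma>_def init_state_def fun_upd_idem)
  have 1: "exec K (Inc 0) (init_state x) 1 {((\<lambda>_. 0)(0 := Suc 0), snd (init_state x))}"
    unfolding init_state_def snd_conv by (rule exec_Inc') (use K in auto)
  have "exec K guess (init_state x) (1 + (1 + (length x * 5 + 1 + (Suc (length x) * 3 + 1))))
      (\<Union>y\<in>{y. length y = length x}. {guessed x y})"
    unfolding guess_def by (rule exec_Seq1[OF 1 exec_Seq1[OF 2 3]])
  then have "exec K guess (init_state x) (8 * length x + 7) (\<Union>y\<in>{y. length y = length x}. {guessed x y})"
    by (rule exec_mono) simp
  moreover have "(\<Union>y\<in>{y. length y = length x}. {guessed x y}) = guessed x ` {y. length y = length x}" by auto
  ultimately show ?thesis by simp
qed

text \<open>\<open>Y x\<close> collects the possible guesses, and \<open>F x y\<close> is the final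
  configuration of the path that guesses \<open>y\<close>.\<close>

lemma decidesI:
  assumes "\<And>x. runs step (poly p (length x)) (initial M x) (F x ` Y x)"
    and "\<And>x y d. y \<in> Y x \<Longrightarrow> \<not> step (F x y) d"
    and "\<And>x. x \<in> X \<longleftrightarrow> (\<exists>y\<in>Y x. fst (F x y) = accept M)"
  shows "decides_in_poly_time M step X"
  unfolding decides_in_poly_time_def
proof (intro conjI exI[of _ p] allI impI)
  fix x n c
  assume "(step ^^ n) (initial M x) c"
  then show "n \<le> poly p (length x)"
    using assms(1)[of x] assms(2) unfolding runs_def by (elim conjE) (erule hits_bound, auto)
next
  fix x
  have "(\<exists>y\<in>Y x. fst (F x y) = accept M)" if "step\<^sup>*\<^sup>* (initial M x) c" "halted step c" "fst c = accept M" for c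
  proof -
    have "c \<in> F x ` Y x"
      by (rule hits_halts[of step "poly p (length x)" "initial M x"])
        (use assms(1)[of x] assms(2) that in \<open>auto simp: runs_def halted_def\<close>)
    then show ?thesis using that by auto
  qed
  moreover have "\<exists>c. step\<^sup>*\<^sup>* (initial M x) c \<and> halted step c \<and> fst c = accept M"
    if "y \<in> Y x" "fst (F x y) = accept M" for y
    using assms(1)[of x] assms(2) that unfolding runs_def halted_def by blast
  ultimately show "x \<in> X \<longleftrightarrow> (\<exists>c. step\<^sup>*\<^sup>* (initial M x) c \<and> halted step c \<and> fst c = accept M)"
    unfolding assms(3) by blast
qed

text \<open>The length of the certificate comes from \<open>guess\<close>, which writes one bit for
  each input cell that it passes. Afterwards the checker for \<open>V\<close> runs on the two
  words.\<close>

theorem NP_I: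
  assumes "PB [fst, snd] [] V"
  shows "{x. \<exists>y. length y = length x \<and> V (x, y)} \<in> NP"
proof -
  have *: "length ([] :: nat list) = length ([] :: (bool list \<times> bool list \<Rightarrow> nat) list)"
    "set ([] :: nat list) \<subseteq> {2..<r}" for r by simp_all
  obtain c k t where c: "pb [fst, snd] [] t" "det c"
    "\<And>K s v G. k \<le> K \<Longrightarrow> ready [fst, snd] [] [] 2 s (v, G) \<Longrightarrow>
      exec K c (v, G) (t s) {(v(2 := of_bool (V s)), G)}"
    using PF_obtain[OF assms *, of 2] by (metis order_refl)
  from c(1) obtain p where p: "\<forall>s. t s \<le> poly p (msize [fst, snd] [] s)"
    unfolding pb_def by (elim exE)
  define K where "K = max k 3"
  define P where "P = guess ;; Clear 1 ;; c"
  define q where "q = 2 + csize P"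
  \<comment> \<open>The truth value is the head position on tape 2, which reads the marker 3 just in
    the case of the value 0. So the transition to the accepting state is possible only if
    \<open>V\<close> holds, and otherwise the machine halts in \<open>q\<close>.\<close>
  define fin where "fin = {(q, rs, Suc q, keep rs) | rs. rs \<in> symbols K \<and> rs ! 2 \<noteq> 3}"
  define M :: tm where "M = \<lparr>tape_count = K, start = 0, accept = Suc q, transitions = machine K P \<union> fin\<rparr>"
  define F where "F x y = (((\<lambda>_. 0)(2 := of_bool (V (x, y))), (\<lambda>_. cont [])(0 := cont x, 1 := cont y)) :: state)" for x y
  \<comment> \<open>Apart from the checker there are at most \<open>11 * n + 14\<close> steps: 2 for
    the markers, \<open>8 * n + 7\<close> for guessing, \<open>3 * n + 4\<close> for returning the
    head and 1 for accepting. The checker sees two words of total length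
    \<open>2 * n\<close>.\<close>
  define pp where "pp = [:20, 11:] + pcompose p [:0, 2:]"
  have K: "3 \<le> K" "k \<le> K" by (simp_all add: K_def)
  have "finite fin"
    unfolding fin_def by (rule finite_image_set) (simp add: finite_symbols)
  moreover have "length rs = K \<and> length as = K" if "(s, rs, s', as) \<in> machine K P \<union> fin" for s rs s' as
    using that machine_length by (auto simp: fin_def symbols_def)
  ultimately have "wf_tm M"
    using K by (auto simp: wf_tm_def M_def finite_machine)
  moreover have "decides_in_poly_time M (tm_step M) {x. \<exists>y. length y = length x \<and> V (x, y)}"
  proof (rule decidesI[where p = pp and Y = "\<lambda>x. {y. length y = length x}"
        and F = "\<lambda>x y. (if V (x, y) then Suc q else q, tapes K (F x y))"])
    fix x y d
    show "\<not> tm_step M (if V (x, y) then Suc q else q, tapes K (F x y)) d"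
      using K
      by (auto simp: tm_step_tstep tstep_def M_def fin_def q_def read_tapes F_def dest!: machine_range)
  next
    fix x
    have 2: "exec K (Clear 1 ;; c) (guessed x y) (Suc (length x) * 3 + 1 + poly p (2 * length x)) {F x y}"
      if y: "length y = length x" for y
    proof (rule exec_Seq1)
      show "exec K (Clear 1) (guessed x y) (Suc (length x) * 3 + 1)
          {(\<lambda>_. 0, (\<lambda>_. cont [])(0 := cont x, 1 := cont y))}"
        unfolding guessed_def by (rule exec_Clear') (use K y in auto)
      have "ready [fst, snd] [] [] 2 (x, y) (\<lambda>_. 0, (\<lambda>_. cont [])(0 := cont x, 1 := cont y))"
        by (auto simp: ready_def word_on_cont less_Suc_eq)
      from c(3)[OF K(2) this] have "exec K c (\<lambda>_. 0, (\<lambda>_. cont [])(0 := cont x, 1 := cont y)) (t (x, y)) {F x y}"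
        by (simp add: F_def)
      moreover have "t (x, y) \<le> poly p (2 * length x)"
        using p[rule_format, of "(x, y)"] y by (simp add: msize_def mult_2)
      ultimately show "exec K c (\<lambda>_. 0, (\<lambda>_. cont [])(0 := cont x, 1 := cont y)) (poly p (2 * length x)) {F x y}"
        by (rule exec_mono)
    qed
    have 1: "exec K guess (init_state x) (8 * length x + 7) (guessed x ` {y. length y = length x})"
      by (rule exec_guess) (use K in simp)
    have "exec K P (init_state x) (8 * length x + 7 + (Suc (length x) * 3 + 1 + poly p (2 * length x)))
      (\<Union>y\<in>{y. length y = length x}. {F x y})"
      unfolding P_def by (rule exec_Seq[OF 1]) (use 2 in simp)
    then have "runs (tm_step M) (2 + (8 * length x + 7 + (Suc (length x) * 3 + 1 + poly p (2 * length x))))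
        (initial M x) ((\<lambda>t. (2 + csize P, tapes K t)) ` (\<Union>y\<in>{y. length y = length x}. {F x y}))"
      unfolding initial_def M_def tm.simps
      by (rule runs_machine[rotated])
        (use K in \<open>auto simp: tm_step_tstep fin_def q_def intro!: tstep_cong\<close>)
    then have "runs (tm_step M) (2 + (8 * length x + 7 + (Suc (length x) * 3 + 1 + poly p (2 * length x))))
        (initial M x) ((\<lambda>y. (q, tapes K (F x y))) ` {y. length y = length x})"
      by (simp add: q_def image_UN UNION_singleton_eq_range image_image)
    moreover have "runs (tm_step M) 1 (q, tapes K (F x y)) {(if V (x, y) then Suc q else q, tapes K (F x y))}" for y
    proof (cases "V (x, y)")
      case True
      have "tm_step M (q, tapes K (F x y)) d \<longleftrightarrow> tstep fin (q, tapes K (F x y)) d" for d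
        unfolding tm_step_tstep
        by (rule tstep_cong) (auto simp: M_def q_def dest: machine_range)
      moreover have "tstep fin (q, tapes K (F x y)) d \<longleftrightarrow> d = (Suc q, tapes K (F x y))" for d
        using True K by (auto simp: tstep_def fin_def read_tapes symb_symbols map2_act_keep F_def)
      ultimately show ?thesis using True by (intro runs_steps) auto
    qed (simp add: runs_refl)
    ultimately have "runs (tm_step M) (2 + (8 * length x + 7 + (Suc (length x) * 3 + 1 + poly p (2 * length x))) + 1)
        (initial M x) (\<Union>y\<in>{y. length y = length x}. {(if V (x, y) then Suc q else q, tapes K (F x y))})"
      by (rule runs_bind)
    then have "runs (tm_step M) (poly pp (length x))
        (initial M x) (\<Union>y\<in>{y. length y = length x}. {(if V (x, y) then Suc q else q, tapes K (F x y))})"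
      by (rule runs_mono) (simp add: pp_def poly_pcompose mult.commute)
    then show "runs (tm_step M) (poly pp (length x)) (initial M x)
        ((\<lambda>y. (if V (x, y) then Suc q else q, tapes K (F x y))) ` {y. length y = length x})"
      by (simp add: UNION_singleton_eq_range)
  qed (auto simp: M_def)
  ultimately show ?thesis by (auto simp: NP_def)
qed

lemma holds_word_unique:
  assumes "holds_word t w" "holds_word t w'"
  shows "w = w'"
proof -
  have *: "length u \<le> length u'" if "holds_word t u" "holds_word t u'" for u u'
  proof (rule ccontr)
    assume "\<not> length u \<le> length u'"
    then have "bit_symbol (u ! length u') = 0" using that by (auto simp: holds_word_def)
    then show False by (simp add: bit_symbol_def split: if_splits)
  qed
  have len: "length w = length w'" using *[OF assms] *[OF assms(2,1)] by simp
  then show ?thesis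
  proof (rule nth_equalityI)
    fix i assume "i < length w"
    then have "bit_symbol (w ! i) = bit_symbol (w' ! i)" using assms len by (auto simp: holds_word_def)
    then show "w ! i = w' ! i" by (simp add: bit_symbol_def split: if_splits)
  qed
qed

lemma holds_word_cont:
  assumes "1 < K" "snd s 1 = cont w"
  shows "holds_word (tapes K s ! 1) w"
proof -
  have "nat (int i + 1) = Suc i" for i by simp
  then show ?thesis
    using assms by (auto simp: holds_word_def tapes_def tape_of_def offset_def cell_def cont_def symbol_def)
qed

text \<open>The guess precedes the input in the query because \<open>guess\<close> leaves the head
  of tape 1 behind \<open>y\<close>, where a copy of \<open>x\<close> is then appended.\<close>

theorem Sigma2p_I:
  assumes "B \<in> NP"
  shows "{x. \<exists>y. length y = length x \<and> y @ x \<notin> B} \<in> Sigma2p"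
proof -
  let ?body = "Cond 0 2 (Put 1 True) (Put 1 False) ;; Inc 1 ;; Inc 0"
  define P where "P = guess ;; Inc 0 ;; While 0 0 ?body"
  define q where "q = 2 + csize P"
  \<comment> \<open>The exit of the program is the query state, and the negative answer leads
    directly to the accepting state. Both answer states are stuck.\<close>
  define M :: oracle_tm where "M = \<lparr>tape_count = 2, start = 0, accept = q + 2, transitions = machine 2 P,
    query = q, answer_yes = q + 1, answer_no = q + 2\<rparr>"
  define F where "F x y = (((\<lambda>_. 0)(0 := Suc (length x), 1 := Suc (length y + length x)),
    (\<lambda>_. cont [])(0 := cont x, 1 := cont (y @ x))) :: state)" for x y
  define ans where "ans x y = (if y @ x \<in> B then q + 1 else q + 2)" for x y
  have "wf_tm M"
    using machine_length by (fastforce simp: wf_tm_def M_def finite_machine)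
  moreover have "decides_in_poly_time M (oracle_step M B) {x. \<exists>y. length y = length x \<and> y @ x \<notin> B}"
  proof (rule decidesI[where p = "[:20, 15:]" and Y = "\<lambda>x. {y. length y = length x}"
        and F = "\<lambda>x y. (ans x y, tapes 2 (F x y))"])
    fix x y d
    show "\<not> oracle_step M B (ans x y, tapes 2 (F x y)) d"
      by (auto simp: oracle_step_def tm_step_tstep tstep_def M_def q_def ans_def dest!: machine_range)
  next
    fix x
    have 2: "exec 2 (Inc 0 ;; While 0 0 ?body) (guessed x y) (1 + (length x * (5 + 2) + 1)) {F x y}"
      if y: "length y = length x" for y
    proof -
      define \<sigma> where "\<sigma> i = (((\<lambda>_. 0)(0 := Suc i, 1 := Suc (length y + i)),
        (\<lambda>_. cont [])(0 := cont x, 1 := cont (y @ take i x))) :: state)" for i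
      have "exec 2 (Inc 0) (guessed x y) 1 {\<sigma> 0}"
        unfolding guessed_def \<sigma>_def by (simp, rule exec_Inc') auto
      moreover have "exec 2 (While 0 0 ?body) (\<sigma> 0) (length x * (5 + 2) + 1) {\<sigma> (length x)}"
      proof (rule exec_While_count)
        fix i assume i: "i < length x"
        let ?v = "(\<lambda>_ :: nat. 0 :: nat)(0 := Suc i, 1 := Suc (length y + i))"
        let ?G = "\<lambda>i. (\<lambda>_ :: nat. cont [])(0 := cont x, 1 := cont (y @ take i x))"
        have "(?G i)(1 := ((?G i) 1)(?v 1 := Some (x ! i))) = ?G (Suc i)"
          using cont_snoc[of "y @ take i x" "x ! i"] i by (simp add: take_Suc_conv_app_nth)
        then have "exec 2 (Put 1 (x ! i)) (\<sigma> i) 1 {(?v, ?G (Suc i))}"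
          using exec_Put[of 1 2 ?v "x ! i" "?G i"] by (simp add: \<sigma>_def)
        moreover have "symb (\<sigma> i) 0 = bit_symbol (x ! i)"
          using i by (simp add: \<sigma>_def cont_def symbol_def)
        ultimately have "exec 2 (Cond 0 2 (Put 1 True) (Put 1 False)) (\<sigma> i) (1 + 2) {(?v, ?G (Suc i))}"
          by (intro exec_Cond) (auto simp: bit_symbol_def split: if_splits)
        moreover have "exec 2 (Inc 1) (?v, ?G (Suc i)) 1 {(?v(1 := Suc (length y + Suc i)), ?G (Suc i))}"
          by (rule exec_Inc') auto
        moreover have "exec 2 (Inc 0) (?v(1 := Suc (length y + Suc i)), ?G (Suc i)) 1 {\<sigma> (Suc i)}"
          unfolding \<sigma>_def by (rule exec_Inc') auto
        ultimately have "exec 2 ?body (\<sigma> i) (1 + 2 + (1 + 1)) {\<sigma> (Suc i)}"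
          by (intro exec_Seq1)
        then show "symb (\<sigma> i) 0 \<noteq> 0 \<and> exec 2 ?body (\<sigma> i) 5 {\<sigma> (Suc i)}"
          using i by (auto simp: \<sigma>_def cont_def numeral_eq_Suc)
      qed (auto simp: \<sigma>_def cont_def)
      moreover have "\<sigma> (length x) = F x y" by (simp add: \<sigma>_def F_def)
      ultimately show ?thesis by (intro exec_Seq1) auto
    qed
    have 1: "exec 2 guess (init_state x) (8 * length x + 7) (guessed x ` {y. length y = length x})"
      by (rule exec_guess) simp
    have "exec 2 P (init_state x) (8 * length x + 7 + (1 + (length x * (5 + 2) + 1)))
      (\<Union>y\<in>{y. length y = length x}. {F x y})"
      unfolding P_def by (rule exec_Seq[OF 1]) (use 2 in simp)
    then have "runs (oracle_step M B) (2 + (8 * length x + 7 + (1 + (length x * (5 + 2) + 1))))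
        (initial M x) ((\<lambda>t. (2 + csize P, tapes 2 t)) ` (\<Union>y\<in>{y. length y = length x}. {F x y}))"
      unfolding initial_def M_def tm.simps
      by (rule runs_machine[rotated])
        (auto simp: oracle_step_def tm_step_tstep q_def)
    then have "runs (oracle_step M B) (2 + (8 * length x + 7 + (1 + (length x * (5 + 2) + 1))))
        (initial M x) ((\<lambda>y. (q, tapes 2 (F x y))) ` {y. length y = length x})"
      by (simp add: q_def image_UN UNION_singleton_eq_range image_image)
    moreover have "runs (oracle_step M B) 1 (q, tapes 2 (F x y)) {(ans x y, tapes 2 (F x y))}" for y
    proof (rule runs_steps)
      have "holds_word (tapes 2 (F x y) ! 1) (y @ x)"
        by (rule holds_word_cont) (simp_all add: F_def)
      then have "(\<exists>w\<in>B. holds_word (tapes 2 (F x y) ! 1) w) \<longleftrightarrow> y @ x \<in> B"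
        using holds_word_unique by blast
      then show "oracle_step M B (q, tapes 2 (F x y)) d \<longleftrightarrow> d \<in> {(ans x y, tapes 2 (F x y))}" for d
        by (simp add: oracle_step_def M_def ans_def)
    qed simp
    ultimately have "runs (oracle_step M B) (2 + (8 * length x + 7 + (1 + (length x * (5 + 2) + 1))) + 1)
        (initial M x) (\<Union>y\<in>{y. length y = length x}. {(ans x y, tapes 2 (F x y))})"
      by (rule runs_bind)
    then have "runs (oracle_step M B) (poly [:20, 15:] (length x))
        (initial M x) (\<Union>y\<in>{y. length y = length x}. {(ans x y, tapes 2 (F x y))})"
      by (rule runs_mono) simp
    then show "runs (oracle_step M B) (poly [:20, 15:] (length x)) (initial M x)
        ((\<lambda>y. (ans x y, tapes 2 (F x y))) ` {y. length y = length x})"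
      by (simp add: UNION_singleton_eq_range)
  qed (auto simp: M_def ans_def)
  ultimately show ?thesis using assms by (auto simp: Sigma2p_def NP_oracle_def)
qed

section \<open>Computing a function bit by bit\<close>

type_synonym segment = "(bool list \<Rightarrow> nat) \<times> (bool list \<times> nat \<Rightarrow> bool)"

definition emit :: "segment \<Rightarrow> bool list \<Rightarrow> bool list" where
  "emit g x = map (\<lambda>i. snd g (x, i)) [0..<fst g x]"

text \<open>A loop over the positions of the segment: counter 2 is the current position, 3 the
  number of missing bits and 4 the bit to be appended on tape 1.\<close>

lemma exec_segment:
  assumes b: "PF [\<lambda>x. x] [] (fst g)" and e: "PB [fst] [snd] (snd g)"
  shows "\<exists>c k t. pb [\<lambda>x. x] [] t \<and> det c \<and>
    (\<forall>K\<ge>k. \<forall>x w. exec K c (guessed x w) (t x) {guessed x (w @ emit g x)})"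
proof -
  have *: "length ([] :: nat list) = length ([] :: (bool list \<Rightarrow> nat) list)"
    "set ([] :: nat list) \<subseteq> {2..<3}" "2 \<le> (3 :: nat)"
    "length [2 :: nat] = length [snd :: bool list \<times> nat \<Rightarrow> nat]" "set [2 :: nat] \<subseteq> {2..<4}" "2 \<le> (4 :: nat)"
    by simp_all
  obtain cb kb tb where cb: "pb [\<lambda>x. x] [] tb" "det cb"
    "\<And>K s v G. kb \<le> K \<Longrightarrow> ready [\<lambda>x. x] [] [] 3 s (v, G) \<Longrightarrow>
      exec K cb (v, G) (tb s) {(v(3 := fst g s), G)}"
    using PF_obtain[OF b *(1-3)] by metis
  obtain ce ke te where ce: "pb [fst] [snd] te" "det ce"
    "\<And>K s v G. ke \<le> K \<Longrightarrow> ready [fst] [2] [snd] 4 s (v, G) \<Longrightarrow>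
      exec K ce (v, G) (te s) {(v(4 := of_bool (snd g s)), G)}"
    using PF_obtain[OF e *(4-6)] by metis
  from ce(1) obtain p where p: "\<forall>s. te s \<le> poly p (msize [fst] [snd] s)"
    unfolding pb_def by (elim exE)
  let ?body = "ce ;; Cond 4 3 (Put 1 False) (Put 1 True) ;; Inc 1 ;; Clear 4 ;; Dec 3 ;; Inc 2"
  let ?c = "cb ;; While 3 3 ?body ;; Clear 2"
  let ?tb = "\<lambda>x. poly p (length x + fst g x) + (1 + 2 + (1 + (4 + (1 + 1))))"
  let ?t = "\<lambda>x. tb x + (fst g x * (?tb x + 2) + 1 + (fst g x * 3 + 1))"
  have "exec K ?c (guessed x w) (?t x) {guessed x (w @ emit g x)}" if K: "max (max kb ke) 5 \<le> K" for K x w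
  proof -
    let ?G = "\<lambda>w. (\<lambda>_ :: nat. cont [])(0 := cont x, 1 := cont w)"
    define W where "W i = w @ map (\<lambda>i. snd g (x, i)) [0..<i]" for i
    define \<sigma> where "\<sigma> i = (((\<lambda>_. 0)(1 := Suc (length w + i), 3 := fst g x - i, 2 := i), ?G (W i)) :: state)" for i
    have lenW: "length (W i) = length w + i" for i by (simp add: W_def)
    have "ready [\<lambda>x. x] [] [] 3 x (guessed x w)"
      by (auto simp: ready_def guessed_def word_on_cont)
    then have 1: "exec K cb (guessed x w) (tb x) {\<sigma> 0}"
      using cb(3)[of K x "fst (guessed x w)" "snd (guessed x w)"] K
      by (simp add: guessed_def \<sigma>_def W_def fun_upd_idem)
    have 2: "exec K (While 3 3 ?body) (\<sigma> 0) (fst g x * (?tb x + 2) + 1) {\<sigma> (fst g x)}"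
    proof (rule exec_While_count)
      fix i assume i: "i < fst g x"
      let ?v = "(\<lambda>_ :: nat. 0 :: nat)(1 := Suc (length w + i), 3 := fst g x - i, 2 := i)"
      let ?v4 = "?v(4 := of_bool (snd g (x, i)))"
      have "ready [fst] [2] [snd] 4 (x, i) (?v, ?G (W i))"
        by (auto simp: ready_def word_on_cont)
      then have "exec K ce (?v, ?G (W i)) (te (x, i)) {(?v4, ?G (W i))}"
        using ce(3)[of K "(x, i)" ?v "?G (W i)"] K by simp
      moreover have "te (x, i) \<le> poly p (length x + fst g x)"
      proof -
        have "te (x, i) \<le> poly p (length x + i)" using p[rule_format, of "(x, i)"] by (simp add: msize_def)
        also have "\<dots> \<le> poly p (length x + fst g x)" by (rule poly_nat_mono) (use i in simp)
        finally show ?thesis .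
      qed
      ultimately have 1: "exec K ce (\<sigma> i) (poly p (length x + fst g x)) {(?v4, ?G (W i))}"
        unfolding \<sigma>_def by (rule exec_mono)
      have "(?G (W i))(1 := ((?G (W i)) 1)(?v4 1 := Some (snd g (x, i)))) = ?G (W (Suc i))"
        using cont_snoc[of "W i" "snd g (x, i)"] lenW[of i] by (simp add: W_def)
      then have "exec K (Put 1 (snd g (x, i))) (?v4, ?G (W i)) 1 {(?v4, ?G (W (Suc i)))}"
        using exec_Put[of 1 K ?v4 "snd g (x, i)" "?G (W i)"] K by simp
      then have 2: "exec K (Cond 4 3 (Put 1 False) (Put 1 True)) (?v4, ?G (W i)) (1 + 2) {(?v4, ?G (W (Suc i)))}"
        using K by (intro exec_Cond) (auto split: if_splits)
      have 3: "exec K (Inc 1) (?v4, ?G (W (Suc i))) 1 {(?v4(1 := Suc (length w + Suc i)), ?G (W (Suc i)))}"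
        by (rule exec_Inc') (use K in auto)
      have 4: "exec K (Clear 4) (?v4(1 := Suc (length w + Suc i)), ?G (W (Suc i))) 4
          {(?v(1 := Suc (length w + Suc i)), ?G (W (Suc i)))}"
        by (rule exec_Clear') (use K in auto)
      have 5: "exec K (Dec 3) (?v(1 := Suc (length w + Suc i)), ?G (W (Suc i))) 1
          {(?v(1 := Suc (length w + Suc i), 3 := fst g x - Suc i), ?G (W (Suc i)))}"
        by (rule exec_Dec') (use K i in auto)
      have 6: "exec K (Inc 2) (?v(1 := Suc (length w + Suc i), 3 := fst g x - Suc i), ?G (W (Suc i))) 1 {\<sigma> (Suc i)}"
        unfolding \<sigma>_def by (rule exec_Inc') (use K in auto)
      have "exec K ?body (\<sigma> i) (?tb x) {\<sigma> (Suc i)}"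
        by (rule exec_Seq1[OF 1 exec_Seq1[OF 2 exec_Seq1[OF 3 exec_Seq1[OF 4 exec_Seq1[OF 5 6]]]]])
      moreover have "symb (\<sigma> i) 3 \<noteq> 3" using i by (simp add: \<sigma>_def)
      ultimately show "symb (\<sigma> i) 3 \<noteq> 3 \<and> exec K ?body (\<sigma> i) (?tb x) {\<sigma> (Suc i)}" by (intro conjI)
    qed (use K in \<open>auto simp: \<sigma>_def\<close>)
    have 3: "exec K (Clear 2) (\<sigma> (fst g x)) (fst g x * 3 + 1) {guessed x (w @ emit g x)}"
      unfolding \<sigma>_def guessed_def W_def emit_def
      by (rule exec_Clear') (use K in auto)
    show ?thesis by (rule exec_Seq1[OF 1 exec_Seq1[OF 2 3]])
  qed
  note ex = this
  have "pb [\<lambda>x. x] [] (\<lambda>x. poly p (length x + fst g x))"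
    by (intro pb_poly pb_add pb_len PF_pb[OF b]) simp
  then have "pb [\<lambda>x. x] [] ?t"
    by (intro pb_add pb_mult pb_const cb(1) PF_pb[OF b])
  moreover have "det ?c" using cb(2) ce(2) by simp
  ultimately show ?thesis
    by (intro exI[of _ ?c] exI[of _ ?t] exI[of _ "max (max kb ke) 5"] conjI allI impI)
      (assumption | rule ex)+
qed

lemma exec_segments:
  assumes "\<And>g. g \<in> set gs \<Longrightarrow> PF [\<lambda>x. x] [] (fst g) \<and> PB [fst] [snd] (snd g)"
  shows "\<exists>c k t. pb [\<lambda>x. x] [] t \<and> det c \<and>
    (\<forall>K\<ge>k. \<forall>x w. exec K c (guessed x w) (t x) {guessed x (w @ concat (map (\<lambda>g. emit g x) gs))})"
  using assms
proof (induction gs)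
  case Nil
  have "exec K Skip (guessed x w) 1 {guessed x w}" if "1 \<le> K" for K x w
    unfolding guessed_def by (rule exec_Skip') (use that in auto)
  then show ?case
    by (intro exI[of _ Skip] exI[of _ 1] exI[of _ "\<lambda>_. 1"]) (auto simp: pb_const)
next
  case (Cons g gs)
  obtain c k t where c: "pb [\<lambda>x. x] [] t" "det c"
    "\<forall>K\<ge>k. \<forall>x w. exec K c (guessed x w) (t x) {guessed x (w @ emit g x)}"
    using exec_segment[OF Cons.prems[OF list.set_intros(1), THEN conjunct1]
      Cons.prems[OF list.set_intros(1), THEN conjunct2]] by (elim exE conjE)
  have IH: "\<exists>c k t. pb [\<lambda>x. x] [] t \<and> det c \<and>
    (\<forall>K\<ge>k. \<forall>x w. exec K c (guessed x w) (t x) {guessed x (w @ concat (map (\<lambda>g. emit g x) gs))})"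
    by (rule Cons.IH) (simp add: Cons.prems)
  obtain c' k' t' where c': "pb [\<lambda>x. x] [] t'" "det c'"
    "\<forall>K\<ge>k'. \<forall>x w. exec K c' (guessed x w) (t' x) {guessed x (w @ concat (map (\<lambda>g. emit g x) gs))}"
    using IH by (elim exE conjE)
  have ex: "exec K (c ;; c') (guessed x w) (t x + t' x) {guessed x (w @ concat (map (\<lambda>g. emit g x) (g # gs)))}"
    if "max k k' \<le> K" for K x w
    using exec_Seq1[OF c(3)[rule_format, of K x w] c'(3)[rule_format, of K x "w @ emit g x"]] that by simp
  show ?case
    by (intro exI[of _ "c ;; c'"] exI[of _ "max k k'"] exI[of _ "\<lambda>x. t x + t' x"] conjI allI impI pb_add c(1) c'(1) ex)
      (simp_all add: c(2) c'(2))
qed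

theorem poly_time_computableI:
  assumes "\<And>g. g \<in> set gs \<Longrightarrow> PF [\<lambda>x. x] [] (fst g) \<and> PB [fst] [snd] (snd g)"
  shows "poly_time_computable (\<lambda>x. concat (map (\<lambda>g. emit g x) gs))"
proof -
  have ex: "\<exists>c k t. pb [\<lambda>x. x] [] t \<and> det c \<and>
    (\<forall>K\<ge>k. \<forall>x w. exec K c (guessed x w) (t x) {guessed x (w @ concat (map (\<lambda>g. emit g x) gs))})"
    by (rule exec_segments) (rule assms)
  obtain c k t where c: "pb [\<lambda>x. x] [] t" "det c"
    "\<forall>K\<ge>k. \<forall>x w. exec K c (guessed x w) (t x) {guessed x (w @ concat (map (\<lambda>g. emit g x) gs))}"
    using ex by (elim exE conjE)
  from c(1) obtain p where p: "\<forall>s. t s \<le> poly p (msize [\<lambda>x. x] [] s)"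
    unfolding pb_def by (elim exE)
  define K where "K = max k 2"
  define P where "P = Inc 1 ;; c"
  define M :: tm where "M = \<lparr>tape_count = K, start = 0, accept = 0, transitions = machine K P\<rparr>"
  have K: "2 \<le> K" "k \<le> K" by (simp_all add: K_def)
  have wf: "wf_tm M"
    using machine_length K by (fastforce simp: wf_tm_def M_def finite_machine)
  have "det P" using c(2) by (simp add: P_def)
  then have "deterministic M"
    unfolding deterministic_def M_def machine_def
    by (auto simp: pre_def dest: code_det code_outside)
  moreover have "\<exists>n d. n \<le> poly ([:3:] + p) (length x) \<and> (tm_step M ^^ n) (initial M x) d \<and>
      halted (tm_step M) d \<and> holds_word (snd d ! 1) (concat (map (\<lambda>g. emit g x) gs))" for x
  proof -
    let ?w = "concat (map (\<lambda>g. emit g x) gs)"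
    have "exec K (Inc 1) (init_state x) 1 {guessed x []}"
      using exec_Inc'[of 1 K 1 "(\<lambda>_. 0)(1 := Suc 0)" "\<lambda>_. 0" "snd (init_state x)"] K
      by (simp add: guessed_def init_state_def fun_upd_idem)
    moreover have "exec K c (guessed x []) (t x) {guessed x ?w}"
      using c(3)[rule_format, OF K(2), of x "[]"] by simp
    ultimately have "exec K P (init_state x) (1 + t x) {guessed x ?w}"
      unfolding P_def by (rule exec_Seq1)
    then have "runs (tm_step M) (2 + (1 + t x)) (initial M x) ((\<lambda>t. (2 + csize P, tapes K t)) ` {guessed x ?w})"
      unfolding initial_def M_def tm.simps
      by (rule runs_machine[rotated]) (use K in \<open>auto simp: tm_step_tstep\<close>)
    then obtain n where n: "n \<le> 2 + (1 + t x)"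
      "(tm_step M ^^ n) (initial M x) (2 + csize P, tapes K (guessed x ?w))"
      unfolding runs_def using hits_path by fastforce
    have "n \<le> poly ([:3:] + p) (length x)"
      using n(1) p[rule_format, of x] by (simp add: msize_def)
    moreover have "halted (tm_step M) (2 + csize P, tapes K (guessed x ?w))"
      using machine_range[of _ _ _ _ K P]
      by (fastforce simp: halted_def tm_step_tstep tstep_def M_def)
    moreover have "holds_word (tapes K (guessed x ?w) ! 1) ?w"
      by (rule holds_word_cont) (use K in \<open>auto simp: guessed_def\<close>)
    ultimately show ?thesis using n(2) by (intro exI conjI) auto
  qed
  ultimately show ?thesis
    unfolding poly_time_computable_def using wf by blast
qed

section \<open>Tableaux of computations\<close>

type_synonym rule = "nat \<times> nat \<times> nat list \<times> nat \<times> action list"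

abbreviation flag :: "rule \<Rightarrow> nat" where "flag r \<equiv> fst r"
abbreviation source :: "rule \<Rightarrow> nat" where "source r \<equiv> fst (snd r)"
abbreviation reads :: "rule \<Rightarrow> nat list" where "reads r \<equiv> fst (snd (snd r))"
abbreviation target :: "rule \<Rightarrow> nat" where "target r \<equiv> fst (snd (snd (snd r)))"
abbreviation acts :: "rule \<Rightarrow> action list" where "acts r \<equiv> snd (snd (snd (snd r)))"

definition rstep :: "rule \<Rightarrow> config \<Rightarrow> config \<Rightarrow> bool" where
  "rstep r c d \<longleftrightarrow> fst c = source r \<and> map read_tape (snd c) = reads r \<and>
     d = (target r, map2 act (acts r) (snd c))"

fun mv :: "move \<Rightarrow> nat \<Rightarrow> nat" where
  "mv Move_Left p = p - 1"
| "mv Stay p = p"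
| "mv Move_Right p = Suc p"

text \<open>Position \<open>p\<close> stands for cell \<open>p - T\<close>.  Apart from the first line, these are Horn clauses: they
  force the facts of a run to hold, and the last two lines forbid the choice of a rule that is not
  applicable.  Spurious additional facts can only forbid more rules.\<close>

definition tableau :: "rule list \<Rightarrow> nat \<Rightarrow> nat list \<Rightarrow> nat list \<Rightarrow> nat \<Rightarrow> bool \<Rightarrow> (nat \<Rightarrow> nat \<Rightarrow> bool) \<Rightarrow>
    (nat \<Rightarrow> nat \<Rightarrow> nat \<Rightarrow> bool) \<Rightarrow> (nat \<Rightarrow> nat \<Rightarrow> nat \<Rightarrow> nat \<Rightarrow> bool) \<Rightarrow> (nat \<Rightarrow> nat \<Rightarrow> nat \<Rightarrow> bool) \<Rightarrow>
    (nat \<Rightarrow> nat \<Rightarrow> bool) \<Rightarrow> bool" where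
  "tableau \<Delta> k Q A T active st he ce rd tr \<longleftrightarrow>
     (\<forall>t<T. active \<longrightarrow> (\<exists>j<length \<Delta>. tr t j)) \<and>
     (\<forall>j<length \<Delta>. \<forall>t<T. tr t j \<longrightarrow> st (Suc t) (target (\<Delta> ! j))) \<and>
     (\<forall>j<length \<Delta>. \<forall>\<tau><k. \<forall>t<T. \<forall>p\<le>2*T. tr t j \<longrightarrow> he t \<tau> p \<longrightarrow> he (Suc t) \<tau> (mv (snd (acts (\<Delta> ! j) ! \<tau>)) p)) \<and>
     (\<forall>j<length \<Delta>. \<forall>\<tau><k. \<forall>t<T. \<forall>p\<le>2*T. tr t j \<longrightarrow> he t \<tau> p \<longrightarrow> ce (Suc t) \<tau> p (fst (acts (\<Delta> ! j) ! \<tau>))) \<and>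
     (\<forall>\<tau><k. \<forall>s\<in>set A. \<forall>t<T. \<forall>p\<le>2*T. \<forall>p'\<le>2*T. p \<noteq> p' \<longrightarrow> ce t \<tau> p s \<longrightarrow> he t \<tau> p' \<longrightarrow> ce (Suc t) \<tau> p s) \<and>
     (\<forall>\<tau><k. \<forall>s\<in>set A. \<forall>t<T. \<forall>p\<le>2*T. he t \<tau> p \<longrightarrow> ce t \<tau> p s \<longrightarrow> rd t \<tau> s) \<and>
     (\<forall>j<length \<Delta>. \<forall>q\<in>set Q. q \<noteq> source (\<Delta> ! j) \<longrightarrow> (\<forall>t<T. tr t j \<longrightarrow> \<not> st t q)) \<and>
     (\<forall>j<length \<Delta>. \<forall>\<tau><k. \<forall>s\<in>set A. s \<noteq> reads (\<Delta> ! j) ! \<tau> \<longrightarrow> (\<forall>t<T. tr t j \<longrightarrow> \<not> rd t \<tau> s))"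

lemma tableauD:
  assumes "tableau \<Delta> k Q A T active st he ce rd tr" "t < T"
  shows "active \<Longrightarrow> \<exists>j<length \<Delta>. tr t j"
    "j < length \<Delta> \<Longrightarrow> tr t j \<Longrightarrow> st (Suc t) (target (\<Delta> ! j))"
    "j < length \<Delta> \<Longrightarrow> \<tau> < k \<Longrightarrow> p \<le> 2*T \<Longrightarrow> tr t j \<Longrightarrow> he t \<tau> p \<Longrightarrow>
      he (Suc t) \<tau> (mv (snd (acts (\<Delta> ! j) ! \<tau>)) p)"
    "j < length \<Delta> \<Longrightarrow> \<tau> < k \<Longrightarrow> p \<le> 2*T \<Longrightarrow> tr t j \<Longrightarrow> he t \<tau> p \<Longrightarrow>
      ce (Suc t) \<tau> p (fst (acts (\<Delta> ! j) ! \<tau>))"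
    "\<tau> < k \<Longrightarrow> s \<in> set A \<Longrightarrow> p \<le> 2*T \<Longrightarrow> p' \<le> 2*T \<Longrightarrow> p \<noteq> p' \<Longrightarrow> ce t \<tau> p s \<Longrightarrow> he t \<tau> p' \<Longrightarrow>
      ce (Suc t) \<tau> p s"
    "\<tau> < k \<Longrightarrow> s \<in> set A \<Longrightarrow> p \<le> 2*T \<Longrightarrow> he t \<tau> p \<Longrightarrow> ce t \<tau> p s \<Longrightarrow> rd t \<tau> s"
    "j < length \<Delta> \<Longrightarrow> q \<in> set Q \<Longrightarrow> tr t j \<Longrightarrow> st t q \<Longrightarrow> q = source (\<Delta> ! j)"
    "j < length \<Delta> \<Longrightarrow> \<tau> < k \<Longrightarrow> s \<in> set A \<Longrightarrow> tr t j \<Longrightarrow> rd t \<tau> s \<Longrightarrow> s = reads (\<Delta> ! j) ! \<tau>"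
  using assms unfolding tableau_def by (elim conjE; simp; fail | elim conjE, metis)+

text \<open>Only one direction: the true facts are present, but others may be present too, since
  Horn clauses cannot exclude them. Positions up to \<open>2 * T\<close> represent the cells from
  \<open>-T\<close> to \<open>T\<close>.\<close>

definition facts :: "nat \<Rightarrow> nat \<Rightarrow> (nat \<Rightarrow> bool) \<Rightarrow> (nat \<Rightarrow> nat \<Rightarrow> bool) \<Rightarrow> (nat \<Rightarrow> nat \<Rightarrow> nat \<Rightarrow> bool) \<Rightarrow> config \<Rightarrow> bool" where
  "facts k T st he ce c \<longleftrightarrow> st (fst c) \<and>
     (\<forall>\<tau><k. he \<tau> (nat (snd (snd c ! \<tau>) + int T)) \<and>
        (\<forall>p\<le>2*T. ce \<tau> p (fst (snd c ! \<tau>) (int p - int T))))"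

definition conf_ok :: "nat \<Rightarrow> nat list \<Rightarrow> nat list \<Rightarrow> config \<Rightarrow> bool" where
  "conf_ok k Q A c \<longleftrightarrow> fst c \<in> set Q \<and> length (snd c) = k \<and> (\<forall>\<tau><k. \<forall>i. fst (snd c ! \<tau>) i \<in> set A)"

text \<open>Heads start at cell 0 and move by at most one cell per step, hence stay in the
  represented window during \<open>T\<close> steps.\<close>

definition near :: "nat \<Rightarrow> nat \<Rightarrow> config \<Rightarrow> bool" where
  "near k t c \<longleftrightarrow> (\<forall>\<tau><k. \<bar>snd (snd c ! \<tau>)\<bar> \<le> int t)"

definition rules_ok :: "rule list \<Rightarrow> nat \<Rightarrow> nat list \<Rightarrow> nat list \<Rightarrow> bool" where
  "rules_ok \<Delta> k Q A \<longleftrightarrow> (\<forall>r\<in>set \<Delta>. length (reads r) = k \<and> length (acts r) = k \<and> target r \<in> set Q \<and>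
     fst ` set (acts r) \<subseteq> set A)"

lemma act_simps:
  "fst (act a tp) = (fst tp)(snd tp := fst a)"
  "snd (act a tp) = snd tp + (case snd a of Move_Left \<Rightarrow> -1 | Stay \<Rightarrow> 0 | Move_Right \<Rightarrow> 1)"
  by (cases a; cases tp; auto split: move.splits)+

lemma rstep_ok:
  assumes ok: "rules_ok \<Delta> k Q A" and r: "r \<in> set \<Delta>" and c: "conf_ok k Q A c" and st: "rstep r c d"
  shows "conf_ok k Q A d" "near k t c \<Longrightarrow> near k (Suc t) d"
proof -
  have r: "length (acts r) = k" "target r \<in> set Q" "\<And>\<tau>. \<tau> < k \<Longrightarrow> fst (acts r ! \<tau>) \<in> set A"
    using ok r by (auto simp: rules_ok_def subset_iff image_iff) (metis nth_mem prod.collapse)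
  have d: "snd d ! \<tau> = act (acts r ! \<tau>) (snd c ! \<tau>)" if "\<tau> < k" for \<tau>
    using that st r c by (simp add: rstep_def conf_ok_def)
  show "conf_ok k Q A d"
    using r c st d by (auto simp: conf_ok_def act_simps rstep_def)
  show "near k (Suc t) d" if "near k t c"
    unfolding near_def
  proof (intro allI impI)
    fix \<tau> assume "\<tau> < k"
    then have "\<bar>snd (snd c ! \<tau>)\<bar> \<le> int t" using that by (simp add: near_def)
    then show "\<bar>snd (snd d ! \<tau>)\<bar> \<le> int (Suc t)"
      using d[OF \<open>\<tau> < k\<close>] by (auto simp: act_simps split: move.splits)
  qed
qed

text \<open>Before time \<open>T\<close> a head stands at a positive position, so the truncated
  subtraction in \<open>mv\<close> is exact.\<close>

lemma nat_mv:
  assumes "\<bar>i\<bar> \<le> int t" "t < T"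
  shows "nat (i + (case m of Move_Left \<Rightarrow> -1 | Stay \<Rightarrow> 0 | Move_Right \<Rightarrow> 1) + int T) = mv m (nat (i + int T))"
  using assms by (cases m) (auto simp: nat_diff_distrib nat_add_distrib)

text \<open>The true state and the symbols under the heads are among the facts, and the last two
  conjuncts of \<open>tableau\<close> forbid rules that contradict any fact. Hence the chosen rule
  is applicable, and the other conjuncts carry the facts to the next time.\<close>

lemma tableau_step:
  assumes tab: "tableau \<Delta> k Q A T True st he ce rd tr" and ok: "rules_ok \<Delta> k Q A"
    and t: "t < T" and c: "conf_ok k Q A c" "near k t c" "facts k T (st t) (he t) (ce t) c"
  shows "\<exists>j<length \<Delta>. tr t j \<and> (\<exists>d. rstep (\<Delta> ! j) c d \<and> conf_ok k Q A d \<and> near k (Suc t) d \<and>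
    facts k T (st (Suc t)) (he (Suc t)) (ce (Suc t)) d)"
proof -
  note tabD = tableauD[OF tab t]
  obtain j where j: "j < length \<Delta>" "tr t j" using tabD(1) by auto
  define r where "r = \<Delta> ! j"
  have r: "r \<in> set \<Delta>" using j by (simp add: r_def)
  then have len: "length (reads r) = k" "length (acts r) = k" using ok by (auto simp: rules_ok_def)
  have pos: "nat (snd (snd c ! \<tau>) + int T) \<le> 2 * T" "int (nat (snd (snd c ! \<tau>) + int T)) - int T = snd (snd c ! \<tau>)"
    if "\<tau> < k" for \<tau>
  proof -
    have "\<bar>snd (snd c ! \<tau>)\<bar> \<le> int t" using c(2) that by (simp add: near_def)
    then show "nat (snd (snd c ! \<tau>) + int T) \<le> 2 * T"
      "int (nat (snd (snd c ! \<tau>) + int T)) - int T = snd (snd c ! \<tau>)" using t by auto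
  qed
  have src: "fst c = source r"
    unfolding r_def using c by (intro tabD(7)[OF j(1) _ j(2)]) (auto simp: conf_ok_def facts_def)
  have rd: "map read_tape (snd c) = reads r"
  proof (rule nth_equalityI)
    show "length (map read_tape (snd c)) = length (reads r)" using len c by (simp add: conf_ok_def)
    fix \<tau> assume "\<tau> < length (map read_tape (snd c))"
    then have \<tau>: "\<tau> < k" "\<tau> < length (snd c)" using c by (simp_all add: conf_ok_def)
    let ?p = "nat (snd (snd c ! \<tau>) + int T)" and ?s = "read_tape (snd c ! \<tau>)"
    have s: "?s = fst (snd c ! \<tau>) (int ?p - int T)"
      unfolding pos(2)[OF \<tau>(1)] by (cases "snd c ! \<tau>") simp
    then have sA: "?s \<in> set A" using c(1) \<tau> by (auto simp: conf_ok_def)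
    have "he t \<tau> ?p" "ce t \<tau> ?p ?s"
      using c(3) \<tau>(1) pos(1)[OF \<tau>(1)] unfolding s facts_def by blast+
    then have "rd t \<tau> ?s"
      using tabD(6)[OF \<tau>(1) sA pos(1)[OF \<tau>(1)]] by blast
    then have "?s = reads r ! \<tau>"
      unfolding r_def by (rule tabD(8)[OF j(1) \<tau>(1) sA j(2)])
    then show "map read_tape (snd c) ! \<tau> = reads r ! \<tau>" using \<tau> by simp
  qed
  define d where "d = (target r, map2 act (acts r) (snd c))"
  have rs: "rstep r c d" using src rd by (simp add: rstep_def d_def)
  note dok = rstep_ok[OF ok r c(1) rs]
  have "facts k T (st (Suc t)) (he (Suc t)) (ce (Suc t)) d"
    unfolding facts_def
  proof (intro conjI allI impI)
    show "st (Suc t) (fst d)" using tabD(2)[OF j] by (simp add: d_def r_def)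
  next
    fix \<tau> assume \<tau>: "\<tau> < k"
    let ?p = "nat (snd (snd c ! \<tau>) + int T)"
    have d: "snd d ! \<tau> = act (acts r ! \<tau>) (snd c ! \<tau>)"
      using \<tau> len c by (simp add: d_def conf_ok_def)
    have he: "he t \<tau> ?p" using c(3) \<tau> unfolding facts_def by blast
    have "he (Suc t) \<tau> (mv (snd (acts r ! \<tau>)) ?p)"
      unfolding r_def by (rule tabD(3)[OF j(1) \<tau> pos(1)[OF \<tau>] j(2) he])
    moreover have "nat (snd (snd d ! \<tau>) + int T) = mv (snd (acts r ! \<tau>)) ?p"
      unfolding d act_simps(2) by (rule nat_mv[OF _ t]) (use c(2) \<tau> in \<open>simp add: near_def\<close>)
    ultimately show "he (Suc t) \<tau> (nat (snd (snd d ! \<tau>) + int T))" by simp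
    fix p assume p: "p \<le> 2 * T"
    show "ce (Suc t) \<tau> p (fst (snd d ! \<tau>) (int p - int T))"
    proof (cases "p = ?p")
      case True
      have "fst (snd d ! \<tau>) (int p - int T) = fst (acts r ! \<tau>)"
        unfolding d act_simps(1) True pos(2)[OF \<tau>] by simp
      then show ?thesis
        using tabD(4)[OF j(1) \<tau> pos(1)[OF \<tau>] j(2) he] by (simp add: r_def True)
    next
      case False
      then have "int p - int T \<noteq> snd (snd c ! \<tau>)" using pos(2)[OF \<tau>] by linarith
      then have eq: "fst (snd d ! \<tau>) (int p - int T) = fst (snd c ! \<tau>) (int p - int T)"
        unfolding d act_simps(1) by simp
      have "ce t \<tau> p (fst (snd c ! \<tau>) (int p - int T))" using c(3) \<tau> p unfolding facts_def by blast
      moreover have "fst (snd c ! \<tau>) (int p - int T) \<in> set A" using c(1) \<tau> by (simp add: conf_ok_def)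
      ultimately show ?thesis
        unfolding eq by (intro tabD(5)[OF \<tau> _ p pos(1)[OF \<tau>] False _ he])
    qed
  qed
  then show ?thesis
    using j rs dok(1) dok(2)[OF c(2)] unfolding r_def by (intro exI[of _ j] exI[of _ d] conjI)
qed

definition rrun :: "rule list \<Rightarrow> nat \<Rightarrow> (nat \<Rightarrow> config) \<Rightarrow> (nat \<Rightarrow> nat) \<Rightarrow> bool" where
  "rrun \<Delta> T c j \<longleftrightarrow> (\<forall>t<T. j t < length \<Delta> \<and> rstep (\<Delta> ! j t) (c t) (c (Suc t)))"

lemma rrun_ok:
  assumes "rrun \<Delta> T c j" "rules_ok \<Delta> k Q A" "conf_ok k Q A (c 0)" "near k 0 (c 0)" "t \<le> T"
  shows "conf_ok k Q A (c t) \<and> near k t (c t)"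
  using \<open>t \<le> T\<close>
proof (induction t)
  case (Suc t)
  then show ?case
    using rstep_ok[OF assms(2) nth_mem, of "j t" "c t" "c (Suc t)"] assms(1) by (auto simp: rrun_def)
qed (use assms in simp)

lemma tableau_run:
  assumes tab: "tableau \<Delta> k Q A T True st he ce rd tr" and ok: "rules_ok \<Delta> k Q A"
    and c0: "conf_ok k Q A c0" "near k 0 c0" "facts k T (st 0) (he 0) (ce 0) c0"
  shows "\<exists>c j. c 0 = c0 \<and> rrun \<Delta> T c j \<and> (\<forall>t<T. tr t (j t)) \<and>
    (\<forall>t\<le>T. facts k T (st t) (he t) (ce t) (c t))"
proof -
  define P where "P t c \<longleftrightarrow> (t \<le> T \<longrightarrow> conf_ok k Q A c \<and> near k t c \<and> facts k T (st t) (he t) (ce t) c) \<and>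
    (t = 0 \<longrightarrow> c = c0)" for t c
  define R where "R t c d \<longleftrightarrow> (t < T \<longrightarrow> (\<exists>j<length \<Delta>. tr t j \<and> rstep (\<Delta> ! j) c d))" for t c d
  have "\<exists>c. \<forall>t. P t (c t) \<and> R t (c t) (c (Suc t))"
  proof (rule dependent_nat_choice)
    show "\<exists>c. P 0 c" using c0 by (intro exI[of _ c0]) (simp add: P_def)
    fix c t assume P: "P t c"
    show "\<exists>d. P (Suc t) d \<and> R t c d"
    proof (cases "t < T")
      case True
      then show ?thesis
        using tableau_step[OF tab ok True, of c] P by (auto simp: P_def R_def)
    qed (auto simp: P_def R_def)
  qed
  then obtain c where c: "\<And>t. P t (c t)" "\<And>t. R t (c t) (c (Suc t))" by blast
  then obtain j where "\<forall>t<T. j t < length \<Delta> \<and> tr t (j t) \<and> rstep (\<Delta> ! j t) (c t) (c (Suc t))"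
    unfolding R_def by metis
  then show ?thesis
    using c(1) by (intro exI[of _ c] exI[of _ j]) (auto simp: P_def rrun_def)
qed

lemma run_tableau:
  assumes run: "rrun \<Delta> T c j" and ok: "rules_ok \<Delta> k Q A"
    and c0: "conf_ok k Q A (c 0)" "near k 0 (c 0)"
  shows "tableau \<Delta> k Q A T active (\<lambda>t q. q = fst (c t)) (\<lambda>t \<tau> p. int p - int T = snd (snd (c t) ! \<tau>))
    (\<lambda>t \<tau> p s. s = fst (snd (c t) ! \<tau>) (int p - int T)) (\<lambda>t \<tau> s. s = read_tape (snd (c t) ! \<tau>))
    (\<lambda>t i. i = j t)"
proof -
  have R: "j t < length \<Delta>" "rstep (\<Delta> ! j t) (c t) (c (Suc t))" if "t < T" for t
    using run that by (auto simp: rrun_def)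
  have okt: "conf_ok k Q A (c t)" "near k t (c t)" if "t < T" for t
    using rrun_ok[OF run ok c0, of t] that by auto
  have d: "snd (c (Suc t)) ! \<tau> = act (acts (\<Delta> ! j t) ! \<tau>) (snd (c t) ! \<tau>)" if "\<tau> < k" "t < T" for t \<tau>
  proof -
    have "length (acts (\<Delta> ! j t)) = k" using ok R[OF that(2)] by (simp add: rules_ok_def)
    then show ?thesis using R[OF that(2)] okt[OF that(2)] that by (simp add: rstep_def conf_ok_def)
  qed
  have he: "int (mv (snd (acts (\<Delta> ! j t) ! \<tau>)) p) - int T = snd (snd (c (Suc t)) ! \<tau>)"
    if "\<tau> < k" "t < T" "int p - int T = snd (snd (c t) ! \<tau>)" for t \<tau> p
  proof -
    have "\<bar>int p - int T\<bar> \<le> int t" using okt[OF that(2)] that by (auto simp: near_def)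
    then have "0 < p" using that(2) by auto
    then show ?thesis
      unfolding d[OF that(1,2)] act_simps(2) that(3)[symmetric]
      by (cases "snd (acts (\<Delta> ! j t) ! \<tau>)") auto
  qed
  show ?thesis
    unfolding tableau_def
  proof (intro conjI allI impI ballI)
    fix t assume "t < T" then show "\<exists>i<length \<Delta>. i = j t" using R by auto
  next
    fix i t assume "t < T" "i = j t"
    then show "target (\<Delta> ! i) = fst (c (Suc t))" using R[of t] by (simp add: rstep_def)
  next
    fix i \<tau> t p assume "\<tau> < k" "t < T" "i = j t" "int p - int T = snd (snd (c t) ! \<tau>)"
    then show "int (mv (snd (acts (\<Delta> ! i) ! \<tau>)) p) - int T = snd (snd (c (Suc t)) ! \<tau>)" using he by simp
  next
    fix i \<tau> t p assume "\<tau> < k" "t < T" "i = j t" "int p - int T = snd (snd (c t) ! \<tau>)"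
    then show "fst (acts (\<Delta> ! i) ! \<tau>) = fst (snd (c (Suc t)) ! \<tau>) (int p - int T)"
      using d by (simp add: act_simps)
  next
    fix \<tau> s t p p' assume "\<tau> < k" "t < T" "p \<noteq> p'" "s = fst (snd (c t) ! \<tau>) (int p - int T)"
      "int p' - int T = snd (snd (c t) ! \<tau>)"
    then show "s = fst (snd (c (Suc t)) ! \<tau>) (int p - int T)"
      using d by (auto simp: act_simps)
  next
    fix \<tau> s t p assume "int p - int T = snd (snd (c t) ! \<tau>)" "s = fst (snd (c t) ! \<tau>) (int p - int T)"
    then show "s = read_tape (snd (c t) ! \<tau>)" by (cases "snd (c t) ! \<tau>") simp
  next
    fix i q t assume "q \<noteq> source (\<Delta> ! i)" "t < T" "i = j t"
    then show "q \<noteq> fst (c t)" using R[of t] by (auto simp: rstep_def)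
  next
    fix i \<tau> s t assume "\<tau> < k" "s \<noteq> reads (\<Delta> ! i) ! \<tau>" "t < T" "i = j t"
    moreover from this have "reads (\<Delta> ! j t) ! \<tau> = read_tape (snd (c t) ! \<tau>)"
      using R[of t] okt[of t] by (metis (no_types, lifting) conf_ok_def nth_map rstep_def)
    ultimately show "s \<noteq> read_tape (snd (c t) ! \<tau>)" by simp
  qed
qed

lemma trivial_tableau:
  "tableau \<Delta> k Q A T False (\<lambda>_ _. True) (\<lambda>_ _ _. True) (\<lambda>_ _ _ _. True) (\<lambda>_ _ _. True) (\<lambda>_ _. False)"
  by (simp add: tableau_def)

text \<open>Accepting halted configurations get idle rules and other halted configurations get none.
  Thus accepting computations, and no others, can be stretched to the fixed length of a tableau.
  \<open>good\<close> is the part of applicability that a tableau cannot see locally, namely the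
  correctness of oracle answers.\<close>

definition simulates :: "rule list \<Rightarrow> nat \<Rightarrow> nat list \<Rightarrow> nat list \<Rightarrow> (rule \<Rightarrow> config \<Rightarrow> bool) \<Rightarrow>
    (config \<Rightarrow> config \<Rightarrow> bool) \<Rightarrow> nat \<Rightarrow> bool" where
  "simulates \<Delta> k Q A good step acc \<longleftrightarrow> rules_ok \<Delta> k Q A \<and>
     (\<forall>c d. conf_ok k Q A c \<longrightarrow> step c d \<longrightarrow> (\<exists>r\<in>set \<Delta>. rstep r c d \<and> good r c)) \<and>
     (\<forall>c d. \<forall>r\<in>set \<Delta>. conf_ok k Q A c \<longrightarrow> rstep r c d \<longrightarrow> good r c \<longrightarrow>
        step c d \<or> halted step c \<and> fst c = acc) \<and>
     (\<forall>c. conf_ok k Q A c \<longrightarrow> halted step c \<longrightarrow> fst c = acc \<longrightarrow>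
        (\<exists>r\<in>set \<Delta>. flag r = 0 \<and> rstep r c c \<and> good r c))"

lemma rstep_relpowp:
  assumes sim: "simulates \<Delta> k Q A good step acc" and c0: "conf_ok k Q A (c 0)"
    and steps: "\<And>t. t < n \<Longrightarrow> step (c t) (c (Suc t))"
  shows "t \<le> n \<Longrightarrow> conf_ok k Q A (c t)"
proof (induction t)
  case (Suc t)
  then have "conf_ok k Q A (c t)" "step (c t) (c (Suc t))" using steps by auto
  then obtain r where r: "r \<in> set \<Delta>" "rstep r (c t) (c (Suc t))"
    using sim unfolding simulates_def by blast
  moreover have "rules_ok \<Delta> k Q A" using sim by (simp add: simulates_def)
  ultimately show ?case using rstep_ok(1) \<open>conf_ok k Q A (c t)\<close> by blast
qed (use c0 in simp)

text \<open>After the \<open>n\<close> steps of the computation the run idles. Idle rules have flag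
  0, so rules for oracle answers occur only at times before \<open>n\<close>; this later bounds the
  length of query words.\<close>

lemma accepting_run:
  assumes sim: "simulates \<Delta> k Q A good step acc" and c0: "conf_ok k Q A c0"
    and e: "(step ^^ n) c0 e" "halted step e" "fst e = acc"
  shows "\<exists>c j. c 0 = c0 \<and> rrun \<Delta> T c j \<and> (\<forall>t<T. good (\<Delta> ! j t) (c t) \<and> (flag (\<Delta> ! j t) \<noteq> 0 \<longrightarrow> t < n))"
proof -
  obtain f where f: "f 0 = c0" "f n = e" "\<And>i. i < n \<Longrightarrow> step (f i) (f (Suc i))"
    using e(1) by (auto simp: relpowp_fun_conv)
  have ok: "conf_ok k Q A (f t)" if "t \<le> n" for t
    using rstep_relpowp[of \<Delta> k Q A good step acc f n t] sim f c0 that by simp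
  define c where "c t = f (min t n)" for t
  have "\<exists>i. i < length \<Delta> \<and> rstep (\<Delta> ! i) (c t) (c (Suc t)) \<and> good (\<Delta> ! i) (c t) \<and>
      (flag (\<Delta> ! i) \<noteq> 0 \<longrightarrow> t < n)" for t
  proof (cases "t < n")
    case True
    then have "step (c t) (c (Suc t))" "conf_ok k Q A (c t)" using f(3)[of t] ok[of t] by (auto simp: c_def)
    then obtain r where "r \<in> set \<Delta>" "rstep r (c t) (c (Suc t))" "good r (c t)"
      using sim unfolding simulates_def by blast
    then show ?thesis using True by (auto simp: in_set_conv_nth)
  next
    case False
    then have "c t = e" "c (Suc t) = e" using f(2) by (auto simp: c_def)
    moreover obtain r where "r \<in> set \<Delta>" "flag r = 0" "rstep r e e" "good r e"
      using sim ok[of n] f(2) e(2,3) unfolding simulates_def by blast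
    ultimately show ?thesis by (auto simp: in_set_conv_nth)
  qed
  then obtain j where "\<And>t. j t < length \<Delta> \<and> rstep (\<Delta> ! j t) (c t) (c (Suc t)) \<and> good (\<Delta> ! j t) (c t) \<and>
      (flag (\<Delta> ! j t) \<noteq> 0 \<longrightarrow> t < n)" by metis
  then show ?thesis
    using f(1) by (intro exI[of _ c] exI[of _ j]) (auto simp: rrun_def c_def)
qed

text \<open>If nothing accepting were reachable, no rule of the run could be idle, and the run would
  be a computation of \<open>T\<close> steps, contrary to the time bound. \<open>good\<close> is
  demanded only at times reached by genuine steps, because the correctness of answers is shown by
  means of the time bound.\<close>

lemma run_accepts:
  assumes sim: "simulates \<Delta> k Q A good step acc" and c0: "conf_ok k Q A (c 0)"
    and run: "rrun \<Delta> T c j" and bound: "\<And>n d. (step ^^ n) (c 0) d \<Longrightarrow> n < T"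
    and good: "\<And>t. t < T \<Longrightarrow> (step ^^ t) (c 0) (c t) \<Longrightarrow> good (\<Delta> ! j t) (c t)"
  shows "\<exists>e. step\<^sup>*\<^sup>* (c 0) e \<and> halted step e \<and> fst e = acc"
proof (rule ccontr)
  assume no: "\<not> ?thesis"
  have "t \<le> T \<Longrightarrow> (step ^^ t) (c 0) (c t) \<and> conf_ok k Q A (c t)" for t
  proof (induction t)
    case (Suc t)
    then have t: "(step ^^ t) (c 0) (c t)" "conf_ok k Q A (c t)" "t < T" by auto
    then have r: "\<Delta> ! j t \<in> set \<Delta>" "rstep (\<Delta> ! j t) (c t) (c (Suc t))" "good (\<Delta> ! j t) (c t)"
      using run good by (auto simp: rrun_def)
    then have "step (c t) (c (Suc t)) \<or> halted step (c t) \<and> fst (c t) = acc"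
      using sim t(2) unfolding simulates_def by blast
    moreover have "step\<^sup>*\<^sup>* (c 0) (c t)" using t(1) by (rule relpowp_imp_rtranclp)
    ultimately have "step (c t) (c (Suc t))" using no by blast
    then have "(step ^^ Suc t) (c 0) (c (Suc t))" using t(1) by auto
    moreover have "conf_ok k Q A (c (Suc t))"
      using rstep_ok(1)[OF _ r(1) t(2) r(2)] sim by (simp add: simulates_def)
    ultimately show ?case by blast
  qed (use c0 in simp)
  then have "(step ^^ T) (c 0) (c T)" by blast
  then show False using bound[of T "c T"] by simp
qed

text \<open>The second part consists of the idle rules: one for each reading in the accepting state
  for which there is no transition.\<close>

definition rules_of :: "(nat \<times> nat list \<times> nat \<times> action list) list \<Rightarrow> nat \<Rightarrow> nat list \<Rightarrow> nat \<Rightarrow> rule list" where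
  "rules_of trs k A acc = map (Pair 0) trs @
     map (\<lambda>rs. (0, acc, rs, acc, keep rs)) (filter (\<lambda>rs. \<forall>q' as. (acc, rs, q', as) \<notin> set trs) (List.n_lists k A))"

definition syms :: "(nat \<times> nat list \<times> nat \<times> action list) list \<Rightarrow> nat list" where
  "syms trs = [0, 1, 2] @ concat (map (\<lambda>tr. map fst (snd (snd (snd tr)))) trs)"

lemma map2_act_reads: "map2 act (keep (map read_tape ts)) ts = ts"
proof (rule nth_equalityI)
  fix i assume "i < length (map2 act (keep (map read_tape ts)) ts)"
  then show "map2 act (keep (map read_tape ts)) ts ! i = ts ! i"
    by (cases "ts ! i") (auto simp: keep_def)
qed simp

lemma reads_n_lists: "conf_ok k Q A c \<Longrightarrow> map read_tape (snd c) \<in> set (List.n_lists k A)"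
proof -
  assume c: "conf_ok k Q A c"
  have "read_tape (snd c ! \<tau>) \<in> set A" if "\<tau> < k" for \<tau>
    using c that by (cases "snd c ! \<tau>") (auto simp: conf_ok_def)
  then have "set (map read_tape (snd c)) \<subseteq> set A"
    using c by (force simp: conf_ok_def in_set_conv_nth)
  then show ?thesis using c by (simp add: set_n_lists conf_ok_def)
qed

lemma rules_ok_rules_of:
  assumes "\<And>q rs q' as. (q, rs, q', as) \<in> set trs \<Longrightarrow> length rs = k \<and> length as = k"
    and "acc \<in> set Q" "\<And>q rs q' as. (q, rs, q', as) \<in> set trs \<Longrightarrow> q' \<in> set Q"
  shows "rules_ok (rules_of trs k (syms trs) acc) k Q (syms trs)"
proof -
  have tr: "fst ` set as \<subseteq> set (syms trs)" if "(q, rs, q', as) \<in> set trs" for q rs q' as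
    using that by (force simp: syms_def)
  have kp: "fst ` set (keep rs) \<subseteq> set (syms trs)" if "set rs \<subseteq> set (syms trs)" for rs
    using that by (auto simp: keep_def)
  show ?thesis
    unfolding rules_ok_def
  proof
    fix r assume "r \<in> set (rules_of trs k (syms trs) acc)"
    then consider q rs q' as where "r = (0, q, rs, q', as)" "(q, rs, q', as) \<in> set trs"
      | rs where "r = (0, acc, rs, acc, keep rs)" "rs \<in> set (List.n_lists k (syms trs))"
      unfolding rules_of_def by auto
    then show "length (reads r) = k \<and> length (acts r) = k \<and> target r \<in> set Q \<and>
        fst ` set (acts r) \<subseteq> set (syms trs)"
    proof cases
      case 1
      then show ?thesis using assms(1,3) tr by simp
    next
      case 2
      then show ?thesis using assms(2) kp[of rs] by (simp add: set_n_lists)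
    qed
  qed
qed

lemma tm_simulates:
  fixes M :: tm
  assumes wf: "wf_tm M"
  shows "\<exists>\<Delta> Q A. simulates \<Delta> (tape_count M) Q A (\<lambda>_ _. True) (tm_step M) (accept M) \<and>
    (\<forall>r\<in>set \<Delta>. flag r = 0) \<and> {0, 1, 2} \<subseteq> set A \<and> start M \<in> set Q"
proof -
  obtain trs where trs: "set trs = transitions M" using wf by (auto simp: wf_tm_def dest: finite_list)
  define k where "k = tape_count M"
  define A where "A = syms trs"
  define Q where "Q = start M # accept M # map (\<lambda>tr. fst (snd (snd tr))) trs"
  define \<Delta> where "\<Delta> = rules_of trs k A (accept M)"
  have tr: "length rs = k \<and> length as = k" "q' \<in> set Q" if "(q, rs, q', as) \<in> set trs" for q rs q' as
    using wf trs that rev_image_eqI[OF that, of q' "\<lambda>tr. fst (snd (snd tr))"]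
    by (auto simp: wf_tm_def k_def Q_def)
  have acc: "accept M \<in> set Q" by (simp add: Q_def)
  have "rules_ok \<Delta> k Q A"
    unfolding \<Delta>_def A_def by (rule rules_ok_rules_of[OF tr(1) acc tr(2)])
  moreover have "\<exists>r\<in>set \<Delta>. rstep r c d" if "tm_step M c d" for c d
    using that trs by (force simp: tm_step_def rstep_def \<Delta>_def rules_of_def)
  moreover have "tm_step M c d \<or> halted (tm_step M) c \<and> fst c = accept M"
    if "r \<in> set \<Delta>" "rstep r c d" for r c d
    using that trs by (cases c) (auto simp: tm_step_def rstep_def \<Delta>_def rules_of_def halted_def)
  moreover have "\<exists>r\<in>set \<Delta>. flag r = 0 \<and> rstep r c c"
    if "conf_ok k Q A c" "halted (tm_step M) c" "fst c = accept M" for c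
  proof -
    let ?r = "(0, accept M, map read_tape (snd c), accept M, keep (map read_tape (snd c))) :: rule"
    have "\<forall>q' as. (accept M, map read_tape (snd c), q', as) \<notin> set trs"
      using that(2,3) trs by (cases c) (auto simp: halted_def tm_step_def)
    then have "?r \<in> set \<Delta>" using reads_n_lists[OF that(1)] by (auto simp: \<Delta>_def rules_of_def)
    moreover have "rstep ?r c c" using that(3) by (cases c) (simp add: rstep_def map2_act_reads)
    ultimately show ?thesis by force
  qed
  ultimately have "simulates \<Delta> k Q A (\<lambda>_ _. True) (tm_step M) (accept M)"
    unfolding simulates_def by simp
  moreover have "\<forall>r\<in>set \<Delta>. flag r = 0" by (auto simp: \<Delta>_def rules_of_def)
  moreover have "{0, 1, 2} \<subseteq> set A" "start M \<in> set Q" by (simp_all add: A_def Q_def syms_def)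
  ultimately show ?thesis unfolding k_def by (intro exI[of _ \<Delta>] exI[of _ Q] exI[of _ A]) simp
qed

text \<open>Rules with flag 1 and 2 are the steps after a positive and a negative answer of the oracle.\<close>

definition answered :: "bool list set \<Rightarrow> rule \<Rightarrow> config \<Rightarrow> bool" where
  "answered B r c \<longleftrightarrow> (flag r = 1 \<longrightarrow> (\<exists>w\<in>B. holds_word (snd c ! 1) w)) \<and>
     (flag r = 2 \<longrightarrow> \<not> (\<exists>w\<in>B. holds_word (snd c ! 1) w))"

lemma oracle_tm_simulates:
  fixes M :: oracle_tm
  assumes wf: "wf_tm M"
  shows "\<exists>\<Delta> Q A. simulates \<Delta> (tape_count M) Q A (answered B) (oracle_step M B) (accept M) \<and>
    (\<forall>r\<in>set \<Delta>. flag r \<le> 2) \<and> {0, 1, 2} \<subseteq> set A \<and> start M \<in> set Q"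
proof -
  have "finite {tr \<in> transitions M. fst tr \<noteq> query M}" using wf by (simp add: wf_tm_def)
  then obtain trs where trs: "set trs = {tr \<in> transitions M. fst tr \<noteq> query M}" by (auto dest: finite_list)
  define k where "k = tape_count M"
  define A where "A = syms trs"
  define Q where "Q = [start M, accept M, answer_yes M, answer_no M] @ map (\<lambda>tr. fst (snd (snd tr))) trs"
  \<comment> \<open>In the query state \<open>oracle_step\<close> ignores the transitions of the
    machine, which is why \<open>trs\<close> omits them. It also always has a successor there, so
    idle rules would be wrong if the accepting state were the query state.\<close>
  define \<Delta>0 where "\<Delta>0 = (if accept M = query M then map (Pair 0) trs else rules_of trs k A (accept M))"
  define \<Delta> where "\<Delta> = \<Delta>0 @
    map (\<lambda>rs. (1, query M, rs, answer_yes M, keep rs)) (List.n_lists k A) @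
    map (\<lambda>rs. (2, query M, rs, answer_no M, keep rs)) (List.n_lists k A)"
  have tr: "length rs = k \<and> length as = k" "q' \<in> set Q" if "(q, rs, q', as) \<in> set trs" for q rs q' as
    using wf trs that rev_image_eqI[OF that, of q' "\<lambda>tr. fst (snd (snd tr))"]
    by (auto simp: wf_tm_def k_def Q_def)
  have acc: "accept M \<in> set Q" by (simp add: Q_def)
  have ok0: "rules_ok (rules_of trs k A (accept M)) k Q A"
    unfolding A_def by (rule rules_ok_rules_of[OF tr(1) acc tr(2)])
  have "rules_ok (map (Pair 0) trs) k Q A"
    using ok0 unfolding rules_ok_def rules_of_def set_append ball_Un by (rule conjunct1)
  moreover have "rules_ok (map (\<lambda>rs. (n, query M, rs, q', keep rs)) (List.n_lists k A)) k Q A"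
    if "q' \<in> set Q" for n q'
    using that by (auto simp: rules_ok_def set_n_lists keep_def)
  moreover have "answer_yes M \<in> set Q" "answer_no M \<in> set Q" by (simp_all add: Q_def)
  ultimately have ok: "rules_ok \<Delta> k Q A"
    using ok0 unfolding \<Delta>_def \<Delta>0_def by (simp add: rules_ok_def ball_Un del: image_subset_iff)
  have 1: "\<exists>r\<in>set \<Delta>. rstep r c d \<and> answered B r c" if c: "conf_ok k Q A c" and st: "oracle_step M B c d" for c d
  proof (cases "fst c = query M")
    case True
    let ?rs = "map read_tape (snd c)"
    let ?yes = "\<exists>w\<in>B. holds_word (snd c ! 1) w"
    let ?r = "(if ?yes then 1 else 2, query M, ?rs, if ?yes then answer_yes M else answer_no M, keep ?rs) :: rule"
    have "?r \<in> set \<Delta>" using reads_n_lists[OF c] by (auto simp: \<Delta>_def)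
    moreover have "rstep ?r c d" using True st by (simp add: rstep_def oracle_step_def map2_act_reads)
    moreover have "answered B ?r c" by (simp add: answered_def)
    ultimately show ?thesis by blast
  next
    case False
    then obtain q' as where tr: "(fst c, map read_tape (snd c), q', as) \<in> transitions M"
      "d = (q', map2 act as (snd c))"
      using st by (auto simp: oracle_step_def tm_step_def)
    let ?r = "(0, fst c, map read_tape (snd c), q', as) :: rule"
    have "?r \<in> set \<Delta>" using tr trs False by (auto simp: \<Delta>_def \<Delta>0_def rules_of_def)
    moreover have "rstep ?r c d" using tr by (simp add: rstep_def)
    moreover have "answered B ?r c" by (simp add: answered_def)
    ultimately show ?thesis by blast
  qed
  have 2: "oracle_step M B c d \<or> halted (oracle_step M B) c \<and> fst c = accept M"
    if r: "r \<in> set \<Delta>" "rstep r c d" "answered B r c" for r c d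
  proof -
    have "r \<in> set \<Delta>0 \<or> r \<in> (\<lambda>rs. (1, query M, rs, answer_yes M, keep rs)) ` set (List.n_lists k A) \<or>
      r \<in> (\<lambda>rs. (2, query M, rs, answer_no M, keep rs)) ` set (List.n_lists k A)"
      using r(1) unfolding \<Delta>_def set_append set_map Un_iff .
    then show ?thesis
    proof (elim disjE imageE)
      assume "r \<in> set \<Delta>0"
      then have "r \<in> Pair 0 ` set trs \<or> accept M \<noteq> query M \<and> r \<in> (\<lambda>rs. (0, accept M, rs, accept M, keep rs)) `
          {rs \<in> set (List.n_lists k A). \<forall>q' as. (accept M, rs, q', as) \<notin> set trs}"
        unfolding rules_of_def \<Delta>0_def by (simp split: if_splits)
      then show ?thesis
      proof (elim disjE conjE)
        assume "r \<in> Pair 0 ` set trs"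
        then obtain tr where tr: "r = (0, tr)" "tr \<in> transitions M" "fst tr \<noteq> query M"
          unfolding trs by (elim imageE) simp
        have "fst c = fst tr" "(fst c, map read_tape (snd c), fst (snd (snd tr)), snd (snd (snd tr))) = tr"
          "d = (fst (snd (snd tr)), map2 act (snd (snd (snd tr))) (snd c))"
          using r(2) tr(1) by (simp_all add: rstep_def)
        then have "tm_step M c d" using tr(2) unfolding tm_step_def by (metis prod.collapse)
        then show ?thesis using \<open>fst c = fst tr\<close> tr(3) by (simp add: oracle_step_def)
      next
        assume nq: "accept M \<noteq> query M" and "r \<in> (\<lambda>rs. (0, accept M, rs, accept M, keep rs)) `
          {rs \<in> set (List.n_lists k A). \<forall>q' as. (accept M, rs, q', as) \<notin> set trs}"
        then obtain rs where rs: "r = (0, accept M, rs, accept M, keep rs)"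
          "\<And>q' as. (accept M, rs, q', as) \<notin> set trs" by (elim imageE) simp
        then have "fst c = accept M" "map read_tape (snd c) = rs" using r(2) by (simp_all add: rstep_def)
        moreover from this rs(2) have "\<not> oracle_step M B c e" for e
          using nq trs by (cases c) (simp add: oracle_step_def tm_step_def)
        ultimately show ?thesis by (simp add: halted_def)
      qed
    next
      fix rs assume "r = (1, query M, rs, answer_yes M, keep rs)"
      then show ?thesis
        using r(2,3) map2_act_reads[of "snd c"] by (simp add: oracle_step_def rstep_def answered_def)
    next
      fix rs assume "r = (2, query M, rs, answer_no M, keep rs)"
      then show ?thesis
        using r(2,3) map2_act_reads[of "snd c"] by (simp add: oracle_step_def rstep_def answered_def)
    qed
  qed
  have 3: "\<exists>r\<in>set \<Delta>. flag r = 0 \<and> rstep r c c \<and> answered B r c"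
    if c: "conf_ok k Q A c" "halted (oracle_step M B) c" "fst c = accept M" for c
  proof -
    let ?r = "(0, accept M, map read_tape (snd c), accept M, keep (map read_tape (snd c))) :: rule"
    have nq: "accept M \<noteq> query M" using c(2,3) by (auto simp: halted_def oracle_step_def)
    moreover have "\<forall>q' as. (accept M, map read_tape (snd c), q', as) \<notin> set trs"
      using c(2,3) trs nq by (cases c) (auto simp: halted_def oracle_step_def tm_step_def)
    ultimately have "?r \<in> set \<Delta>" using reads_n_lists[OF c(1)] by (auto simp: \<Delta>_def \<Delta>0_def rules_of_def)
    moreover have "rstep ?r c c" using c(3) by (cases c) (simp add: rstep_def map2_act_reads)
    moreover have "answered B ?r c" by (simp add: answered_def)
    ultimately show ?thesis by (intro bexI[of _ ?r]) simp_all
  qed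
  have "simulates \<Delta> k Q A (answered B) (oracle_step M B) (accept M)"
    unfolding simulates_def by (intro conjI allI impI ballI ok 1 2 3)
  moreover have "\<forall>r\<in>set \<Delta>. flag r \<le> 2" by (auto simp: \<Delta>_def \<Delta>0_def rules_of_def)
  moreover have "{0, 1, 2} \<subseteq> set A" "start M \<in> set Q" by (simp_all add: A_def Q_def syms_def)
  ultimately show ?thesis unfolding k_def by (intro exI[of _ \<Delta>] exI[of _ Q] exI[of _ A]) simp
qed

text \<open>In \<open>t\<close> steps a head writes only on cells before \<open>t\<close>. With
  \<open>holds_word_length\<close> this bounds a query word by the time of the query.\<close>

lemma blank_outside:
  assumes run: "rrun \<Delta> T c j" and ok: "rules_ok \<Delta> k Q A" "conf_ok k Q A (c 0)" "near k 0 (c 0)"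
    and \<tau>: "\<tau> < k" and c0: "\<And>i. fst (snd (c 0) ! \<tau>) i = 0"
  shows "t \<le> T \<Longrightarrow> int t \<le> i \<Longrightarrow> fst (snd (c t) ! \<tau>) i = 0"
proof (induction t arbitrary: i)
  case (Suc t)
  then have t: "t < T" "int t < i" by auto
  then have r: "\<Delta> ! j t \<in> set \<Delta>" "rstep (\<Delta> ! j t) (c t) (c (Suc t))" using run by (auto simp: rrun_def)
  have c: "conf_ok k Q A (c t)" "near k t (c t)" using rrun_ok[OF run ok, of t] t by auto
  have "length (acts (\<Delta> ! j t)) = k" using ok(1) r(1) by (simp add: rules_ok_def)
  then have "snd (c (Suc t)) ! \<tau> = act (acts (\<Delta> ! j t) ! \<tau>) (snd (c t) ! \<tau>)"
    using r(2) c(1) \<tau> by (simp add: rstep_def conf_ok_def)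
  moreover have "snd (snd (c t) ! \<tau>) \<noteq> i" using c(2) \<tau> t(2) by (fastforce simp: near_def)
  ultimately show ?case using Suc.IH[of i] t by (simp add: act_simps)
qed (use c0 in simp)

lemma holds_word_length:
  assumes "holds_word tp w" "\<And>i. int n \<le> i \<Longrightarrow> fst tp i = 0"
  shows "length w \<le> n"
proof (rule ccontr)
  assume "\<not> length w \<le> n"
  then have "fst tp (int n) = bit_symbol (w ! n)" using assms(1) by (simp add: holds_word_def)
  then show False using assms(2)[of "int n"] by (simp add: bit_symbol_def split: if_splits)
qed

section \<open>The tableaux as clause sets\<close>

text \<open>The first argument of most constructors is a tag: 0 for the run of the oracle machine, 1 for the
  runs of the machine for the oracle that certify positive answers, 2 for the run that refutes a
  negative answer.  A variable is a kind together with three numbers: the time of the query (0 for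
  tag 0), the time and the position.  \<open>Live\<close> and \<open>Dead\<close> mark the positions of a query word and the
  positions behind it, and \<open>Ch\<close> selects the query that is refuted.\<close>

datatype kind = St nat nat | He nat nat | Ce nat nat nat | Rd nat nat nat | Tr nat nat | Act nat
  | Live nat | Dead nat | Ch

instance kind :: countable
  by countable_datatype

fun universal :: "kind \<Rightarrow> bool" where
  "universal (St g q) \<longleftrightarrow> g = 2"
| "universal (He g \<tau>) \<longleftrightarrow> g = 2"
| "universal (Ce g \<tau> s) \<longleftrightarrow> g = 2"
| "universal (Rd g \<tau> s) \<longleftrightarrow> g = 2"
| "universal (Tr g j) \<longleftrightarrow> g = 2"
| "universal (Act g) \<longleftrightarrow> g = 2"
| "universal (Live g) \<longleftrightarrow> g = 2"
| "universal (Dead g) \<longleftrightarrow> g = 2"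
| "universal Ch \<longleftrightarrow> True"

type_synonym fn = "bool list \<Rightarrow> nat \<Rightarrow> nat \<Rightarrow> nat \<Rightarrow> nat \<Rightarrow> nat"
type_synonym literal = "bool \<times> kind \<times> fn \<times> fn \<times> fn"
text \<open>A clause scheme: a guard and a literal list of fixed length, with four parameters.
  Finitely many families yield polynomially many clauses in a form whose literals can be computed
  from the number of the clause.\<close>

type_synonym family = "(bool list \<Rightarrow> nat \<Rightarrow> nat \<Rightarrow> nat \<Rightarrow> nat \<Rightarrow> bool) \<times> literal list"
type_synonym valuation = "kind \<Rightarrow> nat \<Rightarrow> nat \<Rightarrow> nat \<Rightarrow> bool"

definition fam_sat :: "nat \<Rightarrow> valuation \<Rightarrow> bool list \<Rightarrow> family \<Rightarrow> bool" where
  "fam_sat N val x F \<longleftrightarrow> (\<forall>a<N. \<forall>b<N. \<forall>c<N. \<forall>d<N. fst F x a b c d \<longrightarrow>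
     (\<exists>(sg, \<kappa>, f, g, h)\<in>set (snd F). val \<kappa> (f x a b c d) (g x a b c d) (h x a b c d) = sg))"

definition hold :: "nat \<Rightarrow> valuation \<Rightarrow> bool list \<Rightarrow> family list \<Rightarrow> bool" where
  "hold N val x Fs \<longleftrightarrow> (\<forall>F\<in>set Fs. fam_sat N val x F)"

lemma hold_append: "hold N val x (Fs @ Gs) \<longleftrightarrow> hold N val x Fs \<and> hold N val x Gs"
  by (auto simp: hold_def)

abbreviation v0 :: fn where "v0 \<equiv> \<lambda>x a b c d. 0"
abbreviation vA :: fn where "vA \<equiv> \<lambda>x a b c d. a"
abbreviation vB :: fn where "vB \<equiv> \<lambda>x a b c d. b"
abbreviation vSB :: fn where "vSB \<equiv> \<lambda>x a b c d. Suc b"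
abbreviation vC :: fn where "vC \<equiv> \<lambda>x a b c d. c"
abbreviation vSC :: fn where "vSC \<equiv> \<lambda>x a b c d. Suc c"
abbreviation vD :: fn where "vD \<equiv> \<lambda>x a b c d. d"

text \<open>\<open>tab1\<close> to \<open>tab8\<close> are the conjuncts of \<open>tableau\<close>
  in their order. Parameter \<open>a\<close> is the time of the query, \<open>b\<close> the time
  within the run, \<open>c\<close> and \<open>d\<close> are positions.\<close>

definition tab1 :: "nat \<Rightarrow> rule list \<Rightarrow> (bool list \<Rightarrow> nat) \<Rightarrow> family list" where
  "tab1 g \<Delta> T = [(\<lambda>x a b c d. b < T x,
     (False, Act g, vA, v0, v0) # map (\<lambda>j. (True, Tr g j, vA, vB, v0)) [0..<length \<Delta>])]"

definition tab2 :: "nat \<Rightarrow> rule list \<Rightarrow> (bool list \<Rightarrow> nat) \<Rightarrow> family list" where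
  "tab2 g \<Delta> T = map (\<lambda>j. (\<lambda>x a b c d. b < T x,
     [(False, Tr g j, vA, vB, v0), (True, St g (target (\<Delta> ! j)), vA, vSB, v0)])) [0..<length \<Delta>]"

definition tab3 :: "nat \<Rightarrow> rule list \<Rightarrow> nat \<Rightarrow> (bool list \<Rightarrow> nat) \<Rightarrow> family list" where
  "tab3 g \<Delta> k T = concat (map (\<lambda>j. map (\<lambda>\<tau>. (\<lambda>x a b c d. b < T x \<and> c \<le> 2 * T x,
     [(False, Tr g j, vA, vB, v0), (False, He g \<tau>, vA, vB, vC),
      (True, He g \<tau>, vA, vSB, \<lambda>x a b c d. mv (snd (acts (\<Delta> ! j) ! \<tau>)) c)])) [0..<k]) [0..<length \<Delta>])"

definition tab4 :: "nat \<Rightarrow> rule list \<Rightarrow> nat \<Rightarrow> (bool list \<Rightarrow> nat) \<Rightarrow> family list" where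
  "tab4 g \<Delta> k T = concat (map (\<lambda>j. map (\<lambda>\<tau>. (\<lambda>x a b c d. b < T x \<and> c \<le> 2 * T x,
     [(False, Tr g j, vA, vB, v0), (False, He g \<tau>, vA, vB, vC),
      (True, Ce g \<tau> (fst (acts (\<Delta> ! j) ! \<tau>)), vA, vSB, vC)])) [0..<k]) [0..<length \<Delta>])"

definition tab5 :: "nat \<Rightarrow> nat \<Rightarrow> nat list \<Rightarrow> (bool list \<Rightarrow> nat) \<Rightarrow> family list" where
  "tab5 g k A T = concat (map (\<lambda>\<tau>. map (\<lambda>s. (\<lambda>x a b c d. b < T x \<and> c \<le> 2 * T x \<and> d \<le> 2 * T x \<and> c \<noteq> d,
     [(False, Ce g \<tau> s, vA, vB, vC), (False, He g \<tau>, vA, vB, vD), (True, Ce g \<tau> s, vA, vSB, vC)])) A) [0..<k])"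

definition tab6 :: "nat \<Rightarrow> nat \<Rightarrow> nat list \<Rightarrow> (bool list \<Rightarrow> nat) \<Rightarrow> family list" where
  "tab6 g k A T = concat (map (\<lambda>\<tau>. map (\<lambda>s. (\<lambda>x a b c d. b < T x \<and> c \<le> 2 * T x,
     [(False, He g \<tau>, vA, vB, vC), (False, Ce g \<tau> s, vA, vB, vC), (True, Rd g \<tau> s, vA, vB, v0)])) A) [0..<k])"

definition tab7 :: "nat \<Rightarrow> rule list \<Rightarrow> nat list \<Rightarrow> (bool list \<Rightarrow> nat) \<Rightarrow> family list" where
  "tab7 g \<Delta> Q T = concat (map (\<lambda>j. map (\<lambda>q. (\<lambda>x a b c d. q \<noteq> source (\<Delta> ! j) \<and> b < T x,
     [(False, Tr g j, vA, vB, v0), (False, St g q, vA, vB, v0)])) Q) [0..<length \<Delta>])"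

definition tab8 :: "nat \<Rightarrow> rule list \<Rightarrow> nat \<Rightarrow> nat list \<Rightarrow> (bool list \<Rightarrow> nat) \<Rightarrow> family list" where
  "tab8 g \<Delta> k A T = concat (map (\<lambda>j. concat (map (\<lambda>\<tau>. map (\<lambda>s. (\<lambda>x a b c d. s \<noteq> reads (\<Delta> ! j) ! \<tau> \<and> b < T x,
     [(False, Tr g j, vA, vB, v0), (False, Rd g \<tau> s, vA, vB, v0)])) A) [0..<k])) [0..<length \<Delta>])"

definition tab where
  "tab g \<Delta> k Q A T = tab1 g \<Delta> T @ tab2 g \<Delta> T @ tab3 g \<Delta> k T @ tab4 g \<Delta> k T @ tab5 g k A T @ tab6 g k A T @
     tab7 g \<Delta> Q T @ tab8 g \<Delta> k A T"

abbreviation tableau_at :: "nat \<Rightarrow> rule list \<Rightarrow> nat \<Rightarrow> nat list \<Rightarrow> nat list \<Rightarrow> nat \<Rightarrow> valuation \<Rightarrow> nat \<Rightarrow> bool" where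
  "tableau_at g \<Delta> k Q A T val a \<equiv> tableau \<Delta> k Q A T (val (Act g) a 0 0) (\<lambda>t q. val (St g q) a t 0)
     (\<lambda>t \<tau> p. val (He g \<tau>) a t p) (\<lambda>t \<tau> p s. val (Ce g \<tau> s) a t p) (\<lambda>t \<tau> s. val (Rd g \<tau> s) a t 0)
     (\<lambda>t j. val (Tr g j) a t 0)"

lemma ex_less_nat: "(\<exists>c::nat. c < N) \<longleftrightarrow> 0 < N"
  by auto

text \<open>\<open>N\<close> must exceed all times and positions so that they occur among the
  parameter values; parameters that a family ignores disappear because \<open>N\<close> is
  positive.\<close>

lemma hold_tab:
  assumes N: "2 * T x < N"
  shows "hold N val x (tab g \<Delta> k Q A T) \<longleftrightarrow> (\<forall>a<N. tableau_at g \<Delta> k Q A (T x) val a)"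
proof -
  have N': "0 < N" "\<And>t. t < T x \<Longrightarrow> t < N" "\<And>p. p \<le> 2 * T x \<Longrightarrow> p < N" using N by auto
  have 1: "hold N val x (tab1 g \<Delta> T) \<longleftrightarrow>
      (\<forall>a<N. \<forall>t<T x. val (Act g) a 0 0 \<longrightarrow> (\<exists>j<length \<Delta>. val (Tr g j) a t 0))"
  proof -
    have ex: "(\<exists>j\<in>{0..<length \<Delta>}. P j) \<longleftrightarrow> (\<exists>j<length \<Delta>. P j)" for P by auto
    show ?thesis
      using N' by (auto simp: hold_def tab1_def fam_sat_def ex_less_nat ex)
  qed
  have 2: "hold N val x (tab2 g \<Delta> T) \<longleftrightarrow>
      (\<forall>a<N. \<forall>j<length \<Delta>. \<forall>t<T x. val (Tr g j) a t 0 \<longrightarrow> val (St g (target (\<Delta> ! j))) a (Suc t) 0)"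
    using N' by (auto simp: hold_def tab2_def fam_sat_def ex_less_nat)
  have 3: "hold N val x (tab3 g \<Delta> k T) \<longleftrightarrow>
      (\<forall>a<N. \<forall>j<length \<Delta>. \<forall>\<tau><k. \<forall>t<T x. \<forall>p\<le>2*T x. val (Tr g j) a t 0 \<longrightarrow> val (He g \<tau>) a t p \<longrightarrow>
        val (He g \<tau>) a (Suc t) (mv (snd (acts (\<Delta> ! j) ! \<tau>)) p))"
    using N' by (auto simp: hold_def tab3_def fam_sat_def ex_less_nat)
  have 4: "hold N val x (tab4 g \<Delta> k T) \<longleftrightarrow>
      (\<forall>a<N. \<forall>j<length \<Delta>. \<forall>\<tau><k. \<forall>t<T x. \<forall>p\<le>2*T x. val (Tr g j) a t 0 \<longrightarrow> val (He g \<tau>) a t p \<longrightarrow>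
        val (Ce g \<tau> (fst (acts (\<Delta> ! j) ! \<tau>))) a (Suc t) p)"
    using N' by (auto simp: hold_def tab4_def fam_sat_def ex_less_nat)
  have 5: "hold N val x (tab5 g k A T) \<longleftrightarrow>
      (\<forall>a<N. \<forall>\<tau><k. \<forall>s\<in>set A. \<forall>t<T x. \<forall>p\<le>2*T x. \<forall>p'\<le>2*T x. p \<noteq> p' \<longrightarrow> val (Ce g \<tau> s) a t p \<longrightarrow>
        val (He g \<tau>) a t p' \<longrightarrow> val (Ce g \<tau> s) a (Suc t) p)"
    using N' by (auto simp: hold_def tab5_def fam_sat_def ex_less_nat)
      (meson N' atLeastLessThan_iff le0)
  have 6: "hold N val x (tab6 g k A T) \<longleftrightarrow>
      (\<forall>a<N. \<forall>\<tau><k. \<forall>s\<in>set A. \<forall>t<T x. \<forall>p\<le>2*T x. val (He g \<tau>) a t p \<longrightarrow> val (Ce g \<tau> s) a t p \<longrightarrow>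
        val (Rd g \<tau> s) a t 0)"
    using N' by (auto simp: hold_def tab6_def fam_sat_def ex_less_nat)
      (meson N' atLeastLessThan_iff le0)
  have 7: "hold N val x (tab7 g \<Delta> Q T) \<longleftrightarrow>
      (\<forall>a<N. \<forall>j<length \<Delta>. \<forall>q\<in>set Q. q \<noteq> source (\<Delta> ! j) \<longrightarrow> (\<forall>t<T x. val (Tr g j) a t 0 \<longrightarrow> \<not> val (St g q) a t 0))"
    using N' by (auto simp: hold_def tab7_def fam_sat_def ex_less_nat)
  have 8: "hold N val x (tab8 g \<Delta> k A T) \<longleftrightarrow>
      (\<forall>a<N. \<forall>j<length \<Delta>. \<forall>\<tau><k. \<forall>s\<in>set A. s \<noteq> reads (\<Delta> ! j) ! \<tau> \<longrightarrow>
        (\<forall>t<T x. val (Tr g j) a t 0 \<longrightarrow> \<not> val (Rd g \<tau> s) a t 0))"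
    using N' by (auto simp: hold_def tab8_def fam_sat_def ex_less_nat)
  show ?thesis
    unfolding tab_def hold_append 1 2 3 4 5 6 7 8 tableau_def by (simp only: all_conj_distrib imp_conjR)
qed

section \<open>Initial configurations, query words and the choice of a refuted query\<close>

definition ini :: "nat \<Rightarrow> nat \<Rightarrow> bool list \<Rightarrow> config" where
  "ini k q x = (q, word_tape x # replicate (k - 1) (word_tape []))"

text \<open>Tape 0 is left open: its contents are the input for tag 0 and a query word for the other
  tags, and are fixed by \<open>main_fams\<close> and \<open>link_fams\<close>.\<close>

definition start_fams :: "nat \<Rightarrow> nat \<Rightarrow> nat \<Rightarrow> (bool list \<Rightarrow> nat) \<Rightarrow> family list" where
  "start_fams g k q T = [(\<lambda>x a b c d. True, [(True, St g q, vA, v0, v0)])] @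
     map (\<lambda>\<tau>. (\<lambda>x a b c d. True, [(True, He g \<tau>, vA, v0, \<lambda>x a b c d. T x)])) [0..<k] @
     map (\<lambda>\<tau>. (\<lambda>x a b c d. c \<le> 2 * T x, [(True, Ce g \<tau> 0, vA, v0, vC)])) [1..<k]"

lemma hold_start_fams:
  assumes N: "2 * T x < N"
  shows "hold N val x (start_fams g k q T) \<longleftrightarrow> (\<forall>a<N. val (St g q) a 0 0 \<and> (\<forall>\<tau><k. val (He g \<tau>) a 0 (T x)) \<and>
    (\<forall>\<tau>\<in>{1..<k}. \<forall>p\<le>2*T x. val (Ce g \<tau> 0) a 0 p))"
proof -
  have N': "0 < N" "\<And>p. p \<le> 2 * T x \<Longrightarrow> p < N" using N by auto
  show ?thesis
    unfolding start_fams_def hold_append all_conj_distrib imp_conjR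
    using N' by (intro arg_cong2[where f = "(\<and>)"]) (auto simp: hold_def fam_sat_def ex_less_nat)
qed

text \<open>The word on tape 1 of the main run at the time of the query is the input of the run with tag \<open>g\<close>.\<close>

definition link_fams :: "nat \<Rightarrow> nat list \<Rightarrow> (bool list \<Rightarrow> nat) \<Rightarrow> family list" where
  "link_fams g A T =
     [(\<lambda>x a b c d. a < T x, [(True, Live g, vA, v0, v0)])] @
     map (\<lambda>s. (\<lambda>x a b c d. a < T x \<and> c < T x, [(False, Live g, vA, v0, vC),
       (False, Ce 0 1 s, v0, vA, \<lambda>x a b c d. T x + c), (True, Live g, vA, v0, vSC)])) [1, 2] @
     map (\<lambda>s. (\<lambda>x a b c d. a < T x \<and> c \<le> T x, [(False, Live g, vA, v0, vC),
       (False, Ce 0 1 s, v0, vA, \<lambda>x a b c d. T x + c), (True, Ce g 0 s, vA, v0, \<lambda>x a b c d. T x + c)])) [0, 1, 2] @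
     [(\<lambda>x a b c d. a < T x \<and> c < T x, [(False, Live g, vA, v0, vC),
       (False, Ce 0 1 0, v0, vA, \<lambda>x a b c d. T x + c), (True, Dead g, vA, v0, vSC)])] @
     [(\<lambda>x a b c d. a < T x \<and> c < T x, [(False, Dead g, vA, v0, vC), (True, Dead g, vA, v0, vSC)])] @
     [(\<lambda>x a b c d. a < T x \<and> c \<le> T x, [(False, Dead g, vA, v0, vC), (True, Ce g 0 0, vA, v0, \<lambda>x a b c d. T x + c)])] @
     [(\<lambda>x a b c d. a < T x \<and> c < T x, [(True, Ce g 0 0, vA, v0, vC)])] @
     map (\<lambda>s. (\<lambda>x a b c d. a < T x \<and> c \<le> T x, [(False, Act g, vA, v0, v0), (False, Live g, vA, v0, vC),
       (False, Ce 0 1 s, v0, vA, \<lambda>x a b c d. T x + c)])) (filter (\<lambda>s. s \<notin> {0, 1, 2}) A)"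

text \<open>\<open>live\<close> advances over bits and copies them, together with the first blank;
  \<open>dead\<close> takes over behind this blank and demands blanks, as do the cells to the left.
  The last conjunct rules out a tape that holds no word, because another symbol precedes the first
  blank; the oracle answers such a query negatively.\<close>

definition link :: "nat list \<Rightarrow> nat \<Rightarrow> bool \<Rightarrow> (nat \<Rightarrow> nat \<Rightarrow> bool) \<Rightarrow> (nat \<Rightarrow> bool) \<Rightarrow> (nat \<Rightarrow> bool) \<Rightarrow>
    (nat \<Rightarrow> nat \<Rightarrow> bool) \<Rightarrow> bool" where
  "link A T active cel live dead inp \<longleftrightarrow> live 0 \<and>
     (\<forall>s\<in>{1, 2}. \<forall>c<T. live c \<longrightarrow> cel s (T + c) \<longrightarrow> live (Suc c)) \<and>
     (\<forall>s\<in>{0, 1, 2}. \<forall>c\<le>T. live c \<longrightarrow> cel s (T + c) \<longrightarrow> inp s (T + c)) \<and>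
     (\<forall>c<T. live c \<longrightarrow> cel 0 (T + c) \<longrightarrow> dead (Suc c)) \<and>
     (\<forall>c<T. dead c \<longrightarrow> dead (Suc c)) \<and>
     (\<forall>c\<le>T. dead c \<longrightarrow> inp 0 (T + c)) \<and>
     (\<forall>c<T. inp 0 c) \<and>
     (\<forall>s\<in>set A. s \<notin> {0, 1, 2} \<longrightarrow> (\<forall>c\<le>T. active \<longrightarrow> live c \<longrightarrow> \<not> cel s (T + c)))"

abbreviation link_at :: "nat \<Rightarrow> nat list \<Rightarrow> nat \<Rightarrow> valuation \<Rightarrow> nat \<Rightarrow> bool" where
  "link_at g A T val a \<equiv> link A T (val (Act g) a 0 0) (\<lambda>s p. val (Ce 0 1 s) 0 a p) (\<lambda>p. val (Live g) a 0 p)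
     (\<lambda>p. val (Dead g) a 0 p) (\<lambda>s p. val (Ce g 0 s) a 0 p)"

lemma hold_link_fams:
  assumes N: "2 * T x < N"
  shows "hold N val x (link_fams g A T) \<longleftrightarrow> (\<forall>a<T x. link_at g A (T x) val a)"
proof -
  have N': "0 < N" "\<And>p. p \<le> T x \<Longrightarrow> p < N" "\<And>p. p < T x \<Longrightarrow> p < N" using N by auto
  show ?thesis
    unfolding link_fams_def hold_append link_def all_conj_distrib imp_conjR
    using N' by (intro arg_cong2[where f = "(\<and>)"]) (auto simp: hold_def fam_sat_def ex_less_nat)
qed

text \<open>The word ends at the first cell \<open>n\<close> without a bit symbol. It exists and
  lies inside the window because the tape is blank from \<open>n0 \<le> T\<close> on, and its symbol
  must be the blank by the last conjunct of \<open>link\<close>.\<close>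

lemma linkD:
  assumes link: "link A T True cel live dead inp"
    and tp: "\<And>p. p \<le> 2 * T \<Longrightarrow> cel (fst tp (int p - int T)) p" "\<And>i. fst tp i \<in> set A"
    and blank: "\<And>i. int n0 \<le> i \<Longrightarrow> fst tp i = 0" "n0 \<le> T"
  shows "\<exists>w. holds_word tp w \<and> length w \<le> n0 \<and> (\<forall>p\<le>2*T. inp (fst (word_tape w) (int p - int T)) p)"
proof -
  note L = link[unfolded link_def]
  note L3 = L[THEN conjunct2, THEN conjunct2, THEN conjunct1, rule_format]
  note L6 = L[THEN conjunct2, THEN conjunct2, THEN conjunct2, THEN conjunct2, THEN conjunct2, THEN conjunct1, rule_format]
  define n where "n = (LEAST n. fst tp (int n) \<notin> {1, 2})"
  have ex: "fst tp (int n0) \<notin> {1, 2}" using blank(1)[of "int n0"] by simp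
  have n: "fst tp (int n) \<notin> {1, 2}" "n \<le> n0"
    unfolding n_def by (rule LeastI[of "\<lambda>n. fst tp (int n) \<notin> {1, 2}", OF ex],
      rule Least_le[of "\<lambda>n. fst tp (int n) \<notin> {1, 2}", OF ex])
  have lt: "fst tp (int i) \<in> {1, 2}" if "i < n" for i
    using not_less_Least[of i "\<lambda>n. fst tp (int n) \<notin> {1, 2}"] that by (auto simp: n_def)
  have cel: "cel (fst tp (int i)) (T + i)" if "i \<le> T" for i using tp(1)[of "T + i"] that by simp
  have live: "i \<le> n \<Longrightarrow> live i" for i
  proof (induction i)
    case (Suc i)
    then show ?case using L cel[of i] lt[of i] n(2) blank(2) by auto
  qed (use L in simp)
  have n0: "fst tp (int n) = 0"
    using n L live[of n] cel[of n] blank(2) tp(2)[of "int n"] by (meson insertE insertI1 le_trans order_refl empty_iff)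
  have dead: "n < i \<Longrightarrow> i \<le> T \<Longrightarrow> dead i" for i
  proof (induction i)
    case (Suc i)
    show ?case
    proof (cases "i = n")
      case True
      then show ?thesis using L Suc.prems live[of n] cel[of n] n0 by auto
    next
      case False
      then show ?thesis using Suc L by auto
    qed
  qed simp
  define w where "w = map (\<lambda>i. fst tp (int i) = 2) [0..<n]"
  have bit: "bit_symbol (w ! i) = fst tp (int i)" if "i < n" for i
    using lt[OF that] that by (auto simp: w_def bit_symbol_def)
  have lw: "length w = n" by (simp add: w_def)
  have "holds_word tp w" unfolding holds_word_def using bit n0 lw by simp
  moreover have "inp (fst (word_tape w) (int p - int T)) p" if p: "p \<le> 2 * T" for p
  proof (cases "p < T")
    case True
    then show ?thesis using L by (simp add: word_tape_def)
  next
    case False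
    define i where "i = p - T"
    have i: "p = T + i" "i \<le> T" using False p by (auto simp: i_def)
    have eq: "fst (word_tape w) (int p - int T) = (if i < n then fst tp (int i) else 0)"
      using i bit lw by (simp add: word_tape_def)
    consider "i < n" | "i = n" | "n < i" by linarith
    then show ?thesis
    proof cases
      case 1
      then have "inp (fst tp (int i)) (T + i)" using live[of i] cel[of i] lt[of i] i by (intro L3) auto
      then show ?thesis using 1 eq i by simp
    next
      case 2
      then have "inp 0 (T + i)" using live[of i] cel[of i] n0 i by (intro L3) auto
      then show ?thesis using 2 eq i by simp
    next
      case 3
      then have "inp 0 (T + i)" using dead[of i] i by (intro L6) auto
      then show ?thesis using 3 eq i by simp
    qed
  qed
  ultimately show ?thesis using n(2) lw by auto
qed

text \<open>Here \<open>cel\<close> has to be exact. A spurious symbol in the live part would demand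
  a second symbol in the same cell of the linked run.\<close>

lemma linkI:
  assumes w: "holds_word tp w"
    and cel: "\<And>s c. s \<in> set A \<Longrightarrow> c \<le> T \<Longrightarrow> cel s (T + c) \<Longrightarrow> s = fst tp (int c)" "{0, 1, 2} \<subseteq> set A"
  shows "link A T True cel (\<lambda>p. p \<le> length w) (\<lambda>p. length w < p)
    (\<lambda>s p. s = fst (word_tape w) (int p - int T))"
proof -
  have w1: "fst tp (int i) = bit_symbol (w ! i)" if "i < length w" for i using w that by (simp add: holds_word_def)
  have w2: "fst tp (int (length w)) = 0" using w by (simp add: holds_word_def)
  have b: "bit_symbol (w ! i) \<in> {1, 2}" for i by (simp add: bit_symbol_def)
  show ?thesis
    unfolding link_def
  proof (intro conjI ballI allI impI)
    fix s :: nat and c assume s: "s \<in> {1, 2}" and c: "c < T" "c \<le> length w" "cel s (T + c)"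
    then have "s = fst tp (int c)" using cel by auto
    then have "c \<noteq> length w" using w2 s by auto
    then show "Suc c \<le> length w" using c by simp
  next
    fix s :: nat and c assume s: "s \<in> {0, 1, 2}" and c: "c \<le> T" "c \<le> length w" "cel s (T + c)"
    then have "s = fst tp (int c)" using cel by auto
    then show "s = fst (word_tape w) (int (T + c) - int T)"
      using w1[of c] w2 c by (cases "c = length w") (auto simp: word_tape_def)
  next
    fix c assume c: "c < T" "c \<le> length w" "cel 0 (T + c)"
    then have "0 = fst tp (int c)" using cel by auto
    then have "\<not> c < length w" using w1[of c] b[of c] by auto
    then show "length w < Suc c" by simp
  next
    fix s c assume s: "s \<in> set A" "s \<notin> {0, 1, 2}" and c: "c \<le> T" "c \<le> length w"
    show "\<not> cel s (T + c)"
    proof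
      assume "cel s (T + c)"
      then have "s = fst tp (int c)" using cel s c by auto
      then show False using w1[of c] w2 b[of c] s c by (cases "c = length w") auto
    qed
  qed (auto simp: word_tape_def)
qed

lemma trivial_link: "link A T False cel (\<lambda>_. True) (\<lambda>_. True) (\<lambda>_ _. True)"
  by (simp add: link_def)

text \<open>Besides the input and the activation of certificates, the symbols on tape 1 are required
  to be unique, which the Horn clauses do not enforce. Spurious symbols in a query word would
  tighten the second clause set through \<open>link\<close> and could keep a wrong negative answer
  from being refuted.\<close>

definition main_fams :: "nat list \<Rightarrow> nat list \<Rightarrow> (bool list \<Rightarrow> nat) \<Rightarrow> family list" where
  "main_fams A yes T =
     [(\<lambda>x a b c d. True, [(True, Act 0, v0, v0, v0)])] @
     [(\<lambda>x a b c d. c \<le> 2 * T x \<and> T x \<le> c \<and> bit x (c - T x), [(True, Ce 0 0 2, v0, v0, vC)])] @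
     [(\<lambda>x a b c d. c \<le> 2 * T x \<and> T x \<le> c \<and> c - T x < length x \<and> \<not> bit x (c - T x), [(True, Ce 0 0 1, v0, v0, vC)])] @
     [(\<lambda>x a b c d. c \<le> 2 * T x \<and> \<not> (T x \<le> c \<and> c - T x < length x), [(True, Ce 0 0 0, v0, v0, vC)])] @
     concat (map (\<lambda>s. map (\<lambda>s'. (\<lambda>x a b c d. s \<noteq> s' \<and> b < T x \<and> c \<le> 2 * T x,
       [(False, Ce 0 1 s, v0, vB, vC), (False, Ce 0 1 s', v0, vB, vC)])) A) A) @
     map (\<lambda>j. (\<lambda>x a b c d. a < T x, [(False, Tr 0 j, v0, vA, v0), (True, Act 1, vA, v0, v0)])) yes"

lemma hold_main_fams:
  assumes N: "2 * T x < N"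
  shows "hold N val x (main_fams A yes T) \<longleftrightarrow> val (Act 0) 0 0 0 \<and>
    (\<forall>p\<le>2*T x. val (Ce 0 0 (fst (word_tape x) (int p - int (T x)))) 0 0 p) \<and>
    (\<forall>s\<in>set A. \<forall>s'\<in>set A. s \<noteq> s' \<longrightarrow> (\<forall>t<T x. \<forall>p\<le>2*T x. val (Ce 0 1 s) 0 t p \<longrightarrow> \<not> val (Ce 0 1 s') 0 t p)) \<and>
    (\<forall>j\<in>set yes. \<forall>t<T x. val (Tr 0 j) 0 t 0 \<longrightarrow> val (Act 1) t 0 0)"
proof -
  have N': "0 < N" "\<And>p. p \<le> 2 * T x \<Longrightarrow> p < N" "\<And>p. p < T x \<Longrightarrow> p < N" using N by auto
  let ?sym = "\<lambda>p. fst (word_tape x) (int p - int (T x))"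
  have sym: "T x \<le> p \<Longrightarrow> bit x (p - T x) \<Longrightarrow> ?sym p = 2"
      "T x \<le> p \<Longrightarrow> p - T x < length x \<Longrightarrow> \<not> bit x (p - T x) \<Longrightarrow> ?sym p = 1"
      "\<not> (T x \<le> p \<and> p - T x < length x) \<Longrightarrow> ?sym p = 0" for p
  proof -
    have i: "nat (int p - int (T x)) = p - T x" by linarith
    show "T x \<le> p \<Longrightarrow> bit x (p - T x) \<Longrightarrow> ?sym p = 2"
      "T x \<le> p \<Longrightarrow> p - T x < length x \<Longrightarrow> \<not> bit x (p - T x) \<Longrightarrow> ?sym p = 1"
      by (simp_all add: word_tape_def bit_def bit_symbol_def i)
    show "?sym p = 0" if "\<not> (T x \<le> p \<and> p - T x < length x)"
      using that by (auto simp: word_tape_def i)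
  qed
  have inp: "(\<forall>p\<le>2*T x. val (Ce 0 0 (?sym p)) 0 0 p) \<longleftrightarrow>
      (\<forall>p\<le>2*T x. T x \<le> p \<longrightarrow> bit x (p - T x) \<longrightarrow> val (Ce 0 0 2) 0 0 p) \<and>
      (\<forall>p\<le>2*T x. T x \<le> p \<longrightarrow> p - T x < length x \<longrightarrow> \<not> bit x (p - T x) \<longrightarrow> val (Ce 0 0 1) 0 0 p) \<and>
      (\<forall>p\<le>2*T x. \<not> (T x \<le> p \<and> p - T x < length x) \<longrightarrow> val (Ce 0 0 0) 0 0 p)" (is "?L \<longleftrightarrow> ?R")
  proof
    assume L: ?L
    show ?R
    proof (intro conjI allI impI)
      fix p assume "p \<le> 2 * T x" "T x \<le> p" "bit x (p - T x)"
      then show "val (Ce 0 0 2) 0 0 p" using L[rule_format, of p] sym(1)[of p] by simp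
    next
      fix p assume "p \<le> 2 * T x" "T x \<le> p" "p - T x < length x" "\<not> bit x (p - T x)"
      then show "val (Ce 0 0 1) 0 0 p" using L[rule_format, of p] sym(2)[of p] by simp
    next
      fix p assume "p \<le> 2 * T x" "\<not> (T x \<le> p \<and> p - T x < length x)"
      then show "val (Ce 0 0 0) 0 0 p" using L[rule_format, of p] sym(3)[of p] by simp
    qed
  next
    assume R: ?R
    show ?L
    proof (intro allI impI)
      fix p assume "p \<le> 2 * T x"
      note R = R[THEN conjunct1, rule_format, OF this] R[THEN conjunct2, THEN conjunct1, rule_format, OF this]
        R[THEN conjunct2, THEN conjunct2, rule_format, OF this]
      show "val (Ce 0 0 (?sym p)) 0 0 p"
      proof (cases "T x \<le> p \<and> p - T x < length x")
        case True
        note le = conjunct1[OF True] and lt = conjunct2[OF True]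
        show ?thesis
        proof (cases "bit x (p - T x)")
          case True
          show ?thesis using R(1)[OF le True] unfolding sym(1)[OF le True] .
        next
          case False
          show ?thesis using R(2)[OF le lt False] unfolding sym(2)[OF le lt False] .
        qed
      next
        case False
        show ?thesis using R(3)[OF False] unfolding sym(3)[OF False] .
      qed
    qed
  qed
  have 1: "hold N val x [(\<lambda>x a b c d. True, [(True, Act 0, v0, v0, v0)])] \<longleftrightarrow> val (Act 0) 0 0 0"
    using N' by (auto simp: hold_def fam_sat_def ex_less_nat)
  have 2: "hold N val x [(\<lambda>x a b c d. c \<le> 2 * T x \<and> G x c, [(True, Ce 0 0 s, v0, v0, vC)])] \<longleftrightarrow>
      (\<forall>p\<le>2*T x. G x p \<longrightarrow> val (Ce 0 0 s) 0 0 p)" for G s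
    using N' by (auto simp: hold_def fam_sat_def ex_less_nat)
  have "fam_sat N val x (\<lambda>x a b c d. s \<noteq> s' \<and> b < T x \<and> c \<le> 2 * T x,
       [(False, Ce 0 1 s, v0, vB, vC), (False, Ce 0 1 s', v0, vB, vC)]) \<longleftrightarrow>
    (s \<noteq> s' \<longrightarrow> (\<forall>t<T x. \<forall>p\<le>2*T x. val (Ce 0 1 s) 0 t p \<longrightarrow> \<not> val (Ce 0 1 s') 0 t p))" for s s'
    using N' by (cases "s = s'") (auto simp: fam_sat_def ex_less_nat)
  then have 3: "hold N val x (concat (map (\<lambda>s. map (\<lambda>s'. (\<lambda>x a b c d. s \<noteq> s' \<and> b < T x \<and> c \<le> 2 * T x,
       [(False, Ce 0 1 s, v0, vB, vC), (False, Ce 0 1 s', v0, vB, vC)])) A) A)) \<longleftrightarrow>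
    (\<forall>s\<in>set A. \<forall>s'\<in>set A. s \<noteq> s' \<longrightarrow> (\<forall>t<T x. \<forall>p\<le>2*T x. val (Ce 0 1 s) 0 t p \<longrightarrow> \<not> val (Ce 0 1 s') 0 t p))"
    unfolding hold_def by simp
  have 4: "hold N val x (map (\<lambda>j. (\<lambda>x a b c d. a < T x, [(False, Tr 0 j, v0, vA, v0), (True, Act 1, vA, v0, v0)])) yes)
      \<longleftrightarrow> (\<forall>j\<in>set yes. \<forall>t<T x. val (Tr 0 j) 0 t 0 \<longrightarrow> val (Act 1) t 0 0)"
    using N' by (auto simp: hold_def fam_sat_def ex_less_nat)
  show ?thesis
    unfolding main_fams_def hold_append inp conj_assoc 1 2 3 4 imp_conjL ..
qed

text \<open>\<open>Ch\<close> holds at 0 and not at \<open>T\<close>, so it ends somewhere in between, at an activated query.\<close>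

definition chain_fams :: "nat list \<Rightarrow> (bool list \<Rightarrow> nat) \<Rightarrow> family list" where
  "chain_fams no T =
     [(\<lambda>x a b c d. True, [(True, Ch, v0, v0, v0)])] @
     [(\<lambda>x a b c d. a < T x, [(False, Ch, vA, v0, v0), (True, Act 2, vA, v0, v0), (True, Ch, \<lambda>x a b c d. Suc a, v0, v0)])] @
     [(\<lambda>x a b c d. True, [(False, Ch, \<lambda>x a b c d. T x, v0, v0)])] @
     [(\<lambda>x a b c d. a < T x, (False, Act 2, vA, v0, v0) # map (\<lambda>j. (True, Tr 0 j, v0, vA, v0)) no)]"

lemma hold_chain_fams:
  assumes N: "2 * T x < N"
  shows "hold N val x (chain_fams no T) \<longleftrightarrow> val Ch 0 0 0 \<and>
    (\<forall>t<T x. val Ch t 0 0 \<longrightarrow> val (Act 2) t 0 0 \<or> val Ch (Suc t) 0 0) \<and> \<not> val Ch (T x) 0 0 \<and>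
    (\<forall>t<T x. val (Act 2) t 0 0 \<longrightarrow> (\<exists>j\<in>set no. val (Tr 0 j) 0 t 0))"
proof -
  have N': "0 < N" "\<And>p. p < T x \<Longrightarrow> p < N" using N by auto
  show ?thesis
    unfolding chain_fams_def hold_append
    using N' by (intro arg_cong2[where f = "(\<and>)"]) (auto simp: hold_def fam_sat_def ex_less_nat)
qed

text \<open>A disjunction over all times would be a clause whose length depends on the input,
  whereas a family has a fixed literal list. The chain replaces it by clauses of bounded
  length.\<close>

lemma chain_ends:
  fixes P :: "nat \<Rightarrow> bool"
  assumes "P 0" "\<not> P n" "\<And>t. t < n \<Longrightarrow> P t \<Longrightarrow> Q t \<or> P (Suc t)"
  shows "\<exists>t<n. Q t"
proof (rule ccontr)
  assume no: "\<not> ?thesis"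
  have "t \<le> n \<Longrightarrow> P t" for t
    by (induction t) (use assms no in auto)
  then show False using assms(2) by simp
qed

lemma facts_ini:
  assumes "val (St g q) a 0 0" "\<And>\<tau>. \<tau> < k \<Longrightarrow> val (He g \<tau>) a 0 T"
    "\<And>\<tau> p. 1 \<le> \<tau> \<Longrightarrow> \<tau> < k \<Longrightarrow> p \<le> 2 * T \<Longrightarrow> val (Ce g \<tau> 0) a 0 p"
    "\<And>p. p \<le> 2 * T \<Longrightarrow> val (Ce g 0 (fst (word_tape w) (int p - int T))) a 0 p"
  shows "facts k T (\<lambda>q. val (St g q) a 0 0) (\<lambda>\<tau> p. val (He g \<tau>) a 0 p) (\<lambda>\<tau> p s. val (Ce g \<tau> s) a 0 p) (ini k q w)"
  unfolding facts_def
proof (intro conjI allI impI)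
  fix \<tau> assume \<tau>: "\<tau> < k"
  have nth: "snd (ini k q w) ! \<tau> = (if \<tau> = 0 then word_tape w else word_tape [])"
    using \<tau> by (auto simp: ini_def nth_Cons split: nat.splits)
  show "val (He g \<tau>) a 0 (nat (snd (snd (ini k q w) ! \<tau>) + int T))"
    unfolding nth using assms(2)[OF \<tau>] by (cases "\<tau> = 0") (simp_all add: word_tape_def)
  fix p assume "p \<le> 2 * T"
  then show "val (Ce g \<tau> (fst (snd (ini k q w) ! \<tau>) (int p - int T))) a 0 p"
    unfolding nth using assms(3,4) \<tau> by (cases \<tau>) (auto simp: word_tape_def)
qed (use assms(1) in \<open>simp add: ini_def\<close>)

text \<open>The valuation that describes the runs \<open>C\<close> with tag \<open>g\<close> for the queries \<open>t0\<close> with \<open>sel g t0\<close>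
  exactly.  All other facts hold, which satisfies the Horn clauses.\<close>

fun gval :: "(nat \<Rightarrow> nat \<Rightarrow> bool) \<Rightarrow> (nat \<Rightarrow> nat \<Rightarrow> nat \<Rightarrow> config) \<Rightarrow> (nat \<Rightarrow> nat \<Rightarrow> nat \<Rightarrow> nat) \<Rightarrow>
    (nat \<Rightarrow> nat \<Rightarrow> bool list) \<Rightarrow> nat \<Rightarrow> nat \<Rightarrow> valuation" where
  "gval sel C J W m T (St g q) = (\<lambda>t0 t p. sel g t0 \<longrightarrow> q = fst (C g t0 t))"
| "gval sel C J W m T (He g \<tau>) = (\<lambda>t0 t p. sel g t0 \<longrightarrow> int p - int T = snd (snd (C g t0 t) ! \<tau>))"
| "gval sel C J W m T (Ce g \<tau> s) = (\<lambda>t0 t p. sel g t0 \<longrightarrow> s = fst (snd (C g t0 t) ! \<tau>) (int p - int T))"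
| "gval sel C J W m T (Rd g \<tau> s) = (\<lambda>t0 t p. sel g t0 \<longrightarrow> s = read_tape (snd (C g t0 t) ! \<tau>))"
| "gval sel C J W m T (Tr g j) = (\<lambda>t0 t p. sel g t0 \<and> j = J g t0 t)"
| "gval sel C J W m T (Act g) = (\<lambda>t0 t p. sel g t0)"
| "gval sel C J W m T (Live g) = (\<lambda>t0 t p. sel g t0 \<longrightarrow> p \<le> length (W g t0))"
| "gval sel C J W m T (Dead g) = (\<lambda>t0 t p. sel g t0 \<longrightarrow> length (W g t0) < p)"
| "gval sel C J W m T Ch = (\<lambda>t0 t p. t0 \<le> m)"

lemma gval_tableau:
  assumes "rules_ok \<Delta> k Q A"
    and "sel g a \<Longrightarrow> rrun \<Delta> T (C g a) (J g a) \<and> conf_ok k Q A (C g a 0) \<and> near k 0 (C g a 0)"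
  shows "tableau_at g \<Delta> k Q A T (gval sel C J W m T) a"
proof (cases "sel g a")
  case True
  then show ?thesis using run_tableau[OF _ assms(1)] assms(2) by simp
next
  case False
  then show ?thesis by (simp add: trivial_tableau)
qed

lemma gval_start:
  assumes "sel g a \<Longrightarrow> C g a 0 = ini k q w"
  shows "gval sel C J W m T (St g q) a 0 0" "\<tau> < k \<Longrightarrow> gval sel C J W m T (He g \<tau>) a 0 T"
    "1 \<le> \<tau> \<Longrightarrow> \<tau> < k \<Longrightarrow> gval sel C J W m T (Ce g \<tau> 0) a 0 p"
  using assms by (auto simp: ini_def word_tape_def nth_Cons split: nat.splits)

section \<open>The tableau of a computation with an oracle\<close>

locale oracle_tableau =
  fixes X B :: "bool list set"
    and \<Delta> :: "rule list" and k :: nat and Q A :: "nat list" and step acc q0 p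
    and \<Delta>' :: "rule list" and k' :: nat and Q' A' :: "nat list" and step' acc' q0' p'
  assumes sim: "simulates \<Delta> k Q A (answered B) step acc" "2 \<le> k" "{0, 1, 2} \<subseteq> set A" "q0 \<in> set Q"
    and flags: "\<And>r. r \<in> set \<Delta> \<Longrightarrow> flag r \<le> 2"
    and dec: "\<And>x. x \<in> X \<longleftrightarrow> (\<exists>c. step\<^sup>*\<^sup>* (ini k q0 x) c \<and> halted step c \<and> fst c = acc)"
    and time: "\<And>x n c. (step ^^ n) (ini k q0 x) c \<Longrightarrow> n \<le> poly p (length x)"
    and sim': "simulates \<Delta>' k' Q' A' (\<lambda>_ _. True) step' acc'" "2 \<le> k'" "{0, 1, 2} \<subseteq> set A'" "q0' \<in> set Q'"
    and dec': "\<And>x. x \<in> B \<longleftrightarrow> (\<exists>c. step'\<^sup>*\<^sup>* (ini k' q0' x) c \<and> halted step' c \<and> fst c = acc')"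
    and time': "\<And>x n c. (step' ^^ n) (ini k' q0' x) c \<Longrightarrow> n \<le> poly p' (length x)"
begin

text \<open>\<open>p\<close> bounds the main run and hence the length of its queries, and
  \<open>pcompose p' p\<close> bounds the runs on these queries. The constant 1 makes both
  inequalities strict, as \<open>run_accepts\<close> requires.\<close>

definition PT :: "nat poly" where
  "PT = p + pcompose p' p + [:1, 1:]"

definition T :: "bool list \<Rightarrow> nat" where
  "T x = poly PT (length x)"

definition yes :: "nat list" where "yes = filter (\<lambda>j. flag (\<Delta> ! j) = 1) [0..<length \<Delta>]"
definition no :: "nat list" where "no = filter (\<lambda>j. flag (\<Delta> ! j) = 2) [0..<length \<Delta>]"

definition fams1 :: "family list" where
  "fams1 = tab 0 \<Delta> k Q A T @ start_fams 0 k q0 T @ main_fams A yes T @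
     tab 1 \<Delta>' k' Q' A' T @ start_fams 1 k' q0' T @ link_fams 1 A T"

definition fams2 :: "family list" where
  "fams2 = tab 2 \<Delta>' k' Q' A' T @ start_fams 2 k' q0' T @ link_fams 2 A T @ chain_fams no T"

text \<open>All indices of variables must stay below \<open>N x\<close>, also the position
  \<open>2 * T x + 1\<close>, which arises when a head at the last position moves to the
  right.\<close>

definition N :: "bool list \<Rightarrow> nat" where "N x = 2 * T x + 3"

lemma T_bounds: "poly p (length x) < T x" "m \<le> poly p (length x) \<Longrightarrow> poly p' m < T x" "2 * T x < N x"
proof -
  show "poly p (length x) < T x" by (simp add: T_def PT_def)
  have "poly p' m \<le> poly p' (poly p (length x))" if "m \<le> poly p (length x)" using that by (rule poly_nat_mono)
  then show "m \<le> poly p (length x) \<Longrightarrow> poly p' m < T x" by (simp add: T_def PT_def poly_pcompose)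
  show "2 * T x < N x" by (simp add: N_def)
qed

lemmas hold_rules =
  hold_tab[where T = T and x = x and N = "N x" for x, OF T_bounds(3)]
  hold_start_fams[where T = T and x = x and N = "N x" for x, OF T_bounds(3)]
  hold_link_fams[where T = T and x = x and N = "N x" for x, OF T_bounds(3)]
  hold_main_fams[where T = T and x = x and N = "N x" for x, OF T_bounds(3)]
  hold_chain_fams[where T = T and x = x and N = "N x" for x, OF T_bounds(3)]

lemma ok: "rules_ok \<Delta> k Q A" "rules_ok \<Delta>' k' Q' A'"
  using sim sim' by (simp_all add: simulates_def)

lemma ini_ok: "conf_ok k Q A (ini k q0 x)" "near k 0 (ini k q0 x)"
    "conf_ok k' Q' A' (ini k' q0' x)" "near k' 0 (ini k' q0' x)"
proof -
  have *: "conf_ok k Q A (ini k q x) \<and> near k 0 (ini k q x)" if "2 \<le> k" "{0, 1, 2} \<subseteq> set A" "q \<in> set Q" for k Q A q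
    using that by (auto simp: conf_ok_def near_def ini_def word_tape_def bit_symbol_def nth_Cons split: nat.splits)
  show "conf_ok k Q A (ini k q0 x)" "near k 0 (ini k q0 x)" using *[of k A q0 Q] sim by auto
  show "conf_ok k' Q' A' (ini k' q0' x)" "near k' 0 (ini k' q0' x)" using *[of k' A' q0' Q'] sim' by auto
qed

lemma oracle_run:
  assumes "w \<in> B"
  shows "\<exists>c j. c 0 = ini k' q0' w \<and> rrun \<Delta>' T' c j"
proof -
  obtain e where e: "step'\<^sup>*\<^sup>* (ini k' q0' w) e" "halted step' e" "fst e = acc'" using assms dec' by blast
  then obtain n where "(step' ^^ n) (ini k' q0' w) e" by (meson rtranclp_imp_relpowp)
  from accepting_run[OF sim'(1) ini_ok(3) this e(2,3)] show ?thesis by blast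
qed

lemma word_of_query:
  assumes run: "rrun \<Delta> (T x) c j" "c 0 = ini k q0 x" and t: "t < T x"
  shows "\<And>i. int t \<le> i \<Longrightarrow> fst (snd (c t) ! 1) i = 0"
    "\<And>i. fst (snd (c t) ! 1) i \<in> set A" "holds_word (snd (c t) ! 1) w \<Longrightarrow> length w \<le> t"
proof -
  show bl: "fst (snd (c t) ! 1) i = 0" if "int t \<le> i" for i
    by (rule blank_outside[OF run(1) ok(1), of 1 t i])
      (use run ini_ok sim(2) t that in \<open>auto simp: ini_def word_tape_def\<close>)
  have "conf_ok k Q A (c t)" using rrun_ok[OF run(1) ok(1), of t] run(2) ini_ok t by simp
  then show "fst (snd (c t) ! 1) i \<in> set A" for i using sim(2) by (simp add: conf_ok_def)
  show "holds_word (snd (c t) ! 1) w \<Longrightarrow> length w \<le> t" using holds_word_length bl by blast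
qed

text \<open>Used for certificates (tag 1) and for refutations (tag 2). The time of the query bounds
  the length of its word, so \<open>T x\<close> exceeds every computation on that word and the
  tableau describes an accepting one.\<close>

lemma oracle_tableau_sound:
  assumes link: "link_at g A (T x) val t" and tab: "tableau_at g \<Delta>' k' Q' A' (T x) val t"
    and start: "val (St g q0') t 0 0" "\<And>\<tau>. \<tau> < k' \<Longrightarrow> val (He g \<tau>) t 0 (T x)"
      "\<And>\<tau> p. 1 \<le> \<tau> \<Longrightarrow> \<tau> < k' \<Longrightarrow> p \<le> 2 * T x \<Longrightarrow> val (Ce g \<tau> 0) t 0 p"
    and sel: "val (Act g) t 0 0"
    and run: "rrun \<Delta> (T x) c j" "c 0 = ini k q0 x" and t: "t < T x" "t \<le> poly p (length x)"
    and cells: "\<And>p. p \<le> 2 * T x \<Longrightarrow> val (Ce 0 1 (fst (snd (c t) ! 1) (int p - int (T x)))) 0 t p"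
  shows "\<exists>w\<in>B. holds_word (snd (c t) ! 1) w"
proof -
  note wq = word_of_query[OF run t(1)]
  have l: "link A (T x) True (\<lambda>s p. val (Ce 0 1 s) 0 t p) (\<lambda>p. val (Live g) t 0 p)
     (\<lambda>p. val (Dead g) t 0 p) (\<lambda>s p. val (Ce g 0 s) t 0 p)"
    using link sel by simp
  obtain w where w: "holds_word (snd (c t) ! 1) w" "length w \<le> t"
    "\<And>p. p \<le> 2 * T x \<Longrightarrow> val (Ce g 0 (fst (word_tape w) (int p - int (T x)))) t 0 p"
    using linkD[OF l cells wq(2,1) less_imp_le[OF t(1)]] by blast
  have f: "facts k' (T x) (\<lambda>q. val (St g q) t 0 0) (\<lambda>\<tau> p. val (He g \<tau>) t 0 p)
      (\<lambda>\<tau> p s. val (Ce g \<tau> s) t 0 p) (ini k' q0' w)"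
    by (rule facts_ini) (rule start w(3); assumption)+
  have tab': "tableau \<Delta>' k' Q' A' (T x) True (\<lambda>u q. val (St g q) t u 0) (\<lambda>u \<tau> p. val (He g \<tau>) t u p)
      (\<lambda>u \<tau> p s. val (Ce g \<tau> s) t u p) (\<lambda>u \<tau> s. val (Rd g \<tau> s) t u 0) (\<lambda>u j. val (Tr g j) t u 0)"
    using tab sel by simp
  obtain d i where d: "d 0 = ini k' q0' w" "rrun \<Delta>' (T x) d i"
    using tableau_run[OF tab' ok(2) ini_ok(3,4) f] by blast
  have "n < T x" if "(step' ^^ n) (d 0) e" for n e
    using time'[of n w e] that d(1) T_bounds(2)[of "length w" x] w(2) t(2) by simp
  then have "\<exists>e. step'\<^sup>*\<^sup>* (d 0) e \<and> halted step' e \<and> fst e = acc'"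
    by (intro run_accepts[OF sim'(1) _ d(2)]) (use d(1) ini_ok(3) in auto)
  then have "w \<in> B" unfolding dec' d(1) .
  then show ?thesis using w(1) by blast
qed

text \<open>The exact description of an accepting run, with runs for its positive answers, satisfies
  the first set. An extension to the second set would contain an accepting run on a word that was
  correctly answered negatively.\<close>

lemma accepts_sat:
  assumes "x \<in> X"
  shows "\<exists>val. hold (N x) val x fams1 \<and>
    (\<forall>val'. (\<forall>\<kappa>. \<not> universal \<kappa> \<longrightarrow> val' \<kappa> = val \<kappa>) \<longrightarrow> \<not> hold (N x) val' x fams2)"
proof -
  obtain e where e: "step\<^sup>*\<^sup>* (ini k q0 x) e" "halted step e" "fst e = acc" using assms dec by blast
  then obtain n where n: "(step ^^ n) (ini k q0 x) e" by (meson rtranclp_imp_relpowp)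
  have np: "n \<le> poly p (length x)" using time[OF n] .
  obtain c j where c: "c 0 = ini k q0 x" "rrun \<Delta> (T x) c j"
    "\<And>t. t < T x \<Longrightarrow> answered B (\<Delta> ! j t) (c t)" "\<And>t. t < T x \<Longrightarrow> flag (\<Delta> ! j t) \<noteq> 0 \<Longrightarrow> t < n"
    using accepting_run[OF sim(1) ini_ok(1) n e(2,3), of "T x"] by blast
  have jl: "j t < length \<Delta>" if "t < T x" for t using c(2) that by (simp add: rrun_def)
  define yesat where "yesat t \<longleftrightarrow> t < T x \<and> flag (\<Delta> ! j t) = 1" for t
  have "\<exists>w. yesat t \<longrightarrow> w \<in> B \<and> holds_word (snd (c t) ! 1) w" for t
    using c(3)[of t] by (auto simp: yesat_def answered_def)
  then obtain W where W: "\<And>t. yesat t \<Longrightarrow> W t \<in> B \<and> holds_word (snd (c t) ! 1) (W t)" by metis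
  have "\<exists>d i. yesat t \<longrightarrow> d 0 = ini k' q0' (W t) \<and> rrun \<Delta>' (T x) d i" for t
    using oracle_run[of "W t" "T x"] W[of t] by blast
  then obtain D I where D: "\<And>t. yesat t \<Longrightarrow> D t 0 = ini k' q0' (W t) \<and> rrun \<Delta>' (T x) (D t) (I t)" by metis
  \<comment> \<open>The main run is filed under query time 0; runs with tag 1 exist at the times of
    positive answers.\<close>
  define sel where "sel g t0 \<longleftrightarrow> (if g = 0 then t0 = 0 else yesat t0)" for g t0 :: nat
  define C where "C g t0 = (if g = 0 then c else D t0)" for g t0 :: nat
  define J where "J g t0 = (if g = 0 then j else I t0)" for g t0 :: nat
  define val where "val = gval sel C J (\<lambda>g. W) 0 (T x)"
  have 1: "hold (N x) val x (tab 0 \<Delta> k Q A T)"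
    unfolding hold_rules val_def
    by (intro allI impI gval_tableau ok) (use c ini_ok in \<open>simp add: C_def J_def\<close>)
  have 2: "hold (N x) val x (start_fams 0 k q0 T)"
    unfolding hold_rules val_def
    by (intro allI impI conjI ballI gval_start[where w = x]) (use c in \<open>auto simp: C_def\<close>)
  have 3: "hold (N x) val x (main_fams A yes T)"
    unfolding hold_rules
  proof (intro conjI allI impI ballI)
    show "val (Act 0) 0 0 0" by (simp add: val_def sel_def)
    show "val (Ce 0 0 (fst (word_tape x) (int p - int (T x)))) 0 0 p" for p
      using c(1) by (simp add: val_def sel_def C_def ini_def)
    show "\<not> val (Ce 0 1 s') 0 t p" if "s \<noteq> s'" "val (Ce 0 1 s) 0 t p" for s s' t p
      using that by (simp add: val_def sel_def)
    show "val (Act 1) t 0 0" if "i \<in> set yes" "t < T x" "val (Tr 0 i) 0 t 0" for i t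
      using that by (simp add: val_def sel_def J_def yes_def yesat_def)
  qed
  have 4: "hold (N x) val x (tab 1 \<Delta>' k' Q' A' T)"
    unfolding hold_rules val_def
    by (intro allI impI gval_tableau ok) (use D ini_ok in \<open>simp add: C_def J_def sel_def\<close>)
  have 5: "hold (N x) val x (start_fams 1 k' q0' T)"
    unfolding hold_rules
  proof (intro allI impI)
    fix a
    have "sel 1 a \<Longrightarrow> C 1 a 0 = ini k' q0' (W a)" using D by (simp add: sel_def C_def)
    from gval_start[where g = 1 and sel = sel and C = C and a = a, OF this]
    show "val (St 1 q0') a 0 0 \<and> (\<forall>\<tau><k'. val (He 1 \<tau>) a 0 (T x)) \<and>
      (\<forall>\<tau>\<in>{1..<k'}. \<forall>p\<le>2 * T x. val (Ce 1 \<tau> 0) a 0 p)"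
      unfolding val_def by auto
  qed
  have 6: "hold (N x) val x (link_fams 1 A T)"
    unfolding hold_rules
  proof (intro allI impI)
    fix t assume t: "t < T x"
    show "link_at 1 A (T x) val t"
    proof (cases "yesat t")
      case True
      have "link A (T x) True (\<lambda>s p. val (Ce 0 1 s) 0 t p) (\<lambda>p. p \<le> length (W t)) (\<lambda>p. length (W t) < p)
          (\<lambda>s p. s = fst (word_tape (W t)) (int p - int (T x)))"
        by (rule linkI[of "snd (c t) ! 1"]) (use W[OF True] sim(3) in \<open>auto simp: val_def sel_def C_def\<close>)
      then show ?thesis using True D[OF True] by (simp add: val_def sel_def C_def ini_def)
    next
      case False
      then show ?thesis using trivial_link by (simp add: val_def sel_def)
    qed
  qed
  have "\<not> hold (N x) val' x fams2" if agree: "\<forall>\<kappa>. \<not> universal \<kappa> \<longrightarrow> val' \<kappa> = val \<kappa>" for val'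
  proof
    assume h: "hold (N x) val' x fams2"
    note h = h[unfolded fams2_def hold_append hold_rules]
    obtain t where t: "t < T x" "val' (Act 2) t 0 0"
      using chain_ends[of "\<lambda>t. val' Ch t 0 0" "T x" "\<lambda>t. val' (Act 2) t 0 0"] h by blast
    then obtain i where i: "i \<in> set no" "val' (Tr 0 i) 0 t 0" using h by blast
    then have "i = j t" using agree by (simp add: val_def sel_def J_def)
    then have fl: "flag (\<Delta> ! j t) = 2" using i by (simp add: no_def)
    \<comment> \<open>A rule with flag 2 is not idle, so this query belongs to the genuine
      computation and obeys its time bound.\<close>
    then have "t \<le> poly p (length x)" using c(4)[OF t(1)] np by simp
    moreover have "t < N x" using t(1) T_bounds(3)[of x] by simp
    moreover have "val' (Ce 0 1 (fst (snd (c t) ! 1) (int p - int (T x)))) 0 t p" for p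
      using agree by (simp add: val_def sel_def C_def)
    ultimately have "\<exists>w\<in>B. holds_word (snd (c t) ! 1) w"
      by (intro oracle_tableau_sound[where g = 2 and x = x and val = val' and t = t and c = c and j = j]) (use h t c in auto)
    then show False using c(3)[OF t(1)] fl by (simp add: answered_def)
  qed
  then show ?thesis
    unfolding fams1_def hold_append using 1 2 3 4 5 6 by blast
qed

text \<open>A satisfying valuation yields a run, and it remains to show that its answers are
  correct: positive ones by their certificates, negative ones because a wrong one would allow the
  second set to be satisfied. For an empty oracle no negative answer is wrong, which explains the
  disjunction.\<close>

lemma sat_accepts:
  assumes val: "hold (N x) val x fams1"
    and ref: "B = {} \<or> (\<forall>val'. (\<forall>\<kappa>. \<not> universal \<kappa> \<longrightarrow> val' \<kappa> = val \<kappa>) \<longrightarrow> \<not> hold (N x) val' x fams2)"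
  shows "x \<in> X"
proof -
  note h = val[unfolded fams1_def hold_append hold_rules]
  have N0: "0 < N x" by (simp add: N_def)
  have "facts k (T x) (\<lambda>q. val (St 0 q) 0 0 0) (\<lambda>\<tau> p. val (He 0 \<tau>) 0 0 p) (\<lambda>\<tau> p s. val (Ce 0 \<tau> s) 0 0 p) (ini k q0 x)"
    by (rule facts_ini) (use h N0 in auto)
  moreover have "tableau \<Delta> k Q A (T x) True (\<lambda>u q. val (St 0 q) 0 u 0) (\<lambda>u \<tau> p. val (He 0 \<tau>) 0 u p)
      (\<lambda>u \<tau> p s. val (Ce 0 \<tau> s) 0 u p) (\<lambda>u \<tau> s. val (Rd 0 \<tau> s) 0 u 0) (\<lambda>u j. val (Tr 0 j) 0 u 0)"
    using h N0 by auto
  ultimately obtain c j where c: "c 0 = ini k q0 x" "rrun \<Delta> (T x) c j" "\<And>t. t < T x \<Longrightarrow> val (Tr 0 (j t)) 0 t 0"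
    "\<And>t. t \<le> T x \<Longrightarrow> facts k (T x) (\<lambda>q. val (St 0 q) 0 t 0) (\<lambda>\<tau> p. val (He 0 \<tau>) 0 t p) (\<lambda>\<tau> p s. val (Ce 0 \<tau> s) 0 t p) (c t)"
    using tableau_run[OF _ ok(1) ini_ok(1,2)] by blast
  have cells: "val (Ce 0 1 (fst (snd (c t) ! 1) (int p - int (T x)))) 0 t p" if "t < T x" "p \<le> 2 * T x" for t p
    using c(4)[of t] that sim(2) by (simp add: facts_def)
  have "answered B (\<Delta> ! j t) (c t)" if t: "t < T x" and reach: "(step ^^ t) (c 0) (c t)" for t
  proof -
    have tp: "t \<le> poly p (length x)" using time[of t x "c t"] reach c(1) by simp
    have tN: "t < N x" using t T_bounds(3)[of x] by simp
    have jl: "j t < length \<Delta>" using c(2) t by (simp add: rrun_def)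
    have "\<exists>w\<in>B. holds_word (snd (c t) ! 1) w" if "flag (\<Delta> ! j t) = 1"
    proof -
      have "j t \<in> set yes" using that jl by (simp add: yes_def)
      then have "val (Act 1) t 0 0" using h c(3)[OF t] t by blast
      then show ?thesis
        by (intro oracle_tableau_sound[where g = 1 and x = x and val = val and t = t and c = c and j = j]) (use h t tp tN c cells[OF t] in auto)
    qed
    moreover have False if fl: "flag (\<Delta> ! j t) = 2" and w: "w \<in> B" "holds_word (snd (c t) ! 1) w" for w
    proof -
      obtain d i where d: "d 0 = ini k' q0' w" "rrun \<Delta>' (T x) d i" using oracle_run[OF w(1)] by blast
      \<comment> \<open>The run on \<open>w\<close> is placed at the wrongly answered query
        \<open>t\<close>, and all other query times are inactive. The argument \<open>t\<close> of
        \<open>gval\<close> makes \<open>Ch\<close> end there.\<close>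
      define sel where "sel g t0 \<longleftrightarrow> t0 = t" for g t0 :: nat
      define gv where "gv = gval sel (\<lambda>g t0. d) (\<lambda>g t0. i) (\<lambda>g t0. w) t (T x)"
      define val' where "val' \<kappa> = (if universal \<kappa> then gv \<kappa> else val \<kappa>)" for \<kappa>
      have 1: "hold (N x) val' x (tab 2 \<Delta>' k' Q' A' T)"
      proof -
        have "tableau_at 2 \<Delta>' k' Q' A' (T x) gv a" for a
          unfolding gv_def by (rule gval_tableau[OF ok(2)]) (use d ini_ok in auto)
        then show ?thesis unfolding hold_rules by (simp add: val'_def)
      qed
      have 2: "hold (N x) val' x (start_fams 2 k' q0' T)"
      proof -
        have "sel 2 a \<Longrightarrow> d 0 = ini k' q0' w" for a using d by simp
        from gval_start[where g = 2 and sel = sel and C = "\<lambda>g t0. d", OF this]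
        show ?thesis unfolding hold_rules val'_def gv_def by auto
      qed
      have 3: "hold (N x) val' x (link_fams 2 A T)"
        unfolding hold_rules
      proof (intro allI impI)
        fix a assume a: "a < T x"
        show "link_at 2 A (T x) val' a"
        proof (cases "a = t")
          case True
          have "link A (T x) True (\<lambda>s p. val (Ce 0 1 s) 0 t p) (\<lambda>p. p \<le> length w) (\<lambda>p. length w < p)
              (\<lambda>s p. s = fst (word_tape w) (int p - int (T x)))"
          proof (rule linkI[OF w(2)])
            fix s b assume s: "s \<in> set A" "b \<le> T x" "val (Ce 0 1 s) 0 t (T x + b)"
            have "val (Ce 0 1 (fst (snd (c t) ! 1) (int b))) 0 t (T x + b)"
              using cells[OF t, of "T x + b"] s(2) by simp
            moreover have "fst (snd (c t) ! 1) (int b) \<in> set A" using word_of_query(2)[OF c(2,1) t] .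
            moreover have "T x + b \<le> 2 * T x" using s(2) by simp
            \<comment> \<open>Both symbols are facts about the same cell of tape 1, so the
              uniqueness clauses of \<open>main_fams\<close> identify them.\<close>
            ultimately show "s = fst (snd (c t) ! 1) (int b)" using h s t by blast
          qed (use sim(3) in simp)
          then show ?thesis using True d by (simp add: val'_def gv_def sel_def ini_def)
        next
          case False
          then show ?thesis using trivial_link by (simp add: val'_def gv_def sel_def)
        qed
      qed
      have 4: "hold (N x) val' x (chain_fams no T)"
      proof -
        have "j t \<in> set no" using fl jl by (simp add: no_def)
        then show ?thesis
          unfolding hold_rules using t c(3)[OF t] by (auto simp: val'_def gv_def sel_def)
      qed
      have "hold (N x) val' x fams2" unfolding fams2_def hold_append using 1 2 3 4 by blast
      moreover have "\<forall>\<kappa>. \<not> universal \<kappa> \<longrightarrow> val' \<kappa> = val \<kappa>" by (simp add: val'_def)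
      ultimately show False using ref w(1) by blast
    qed
    ultimately show ?thesis unfolding answered_def by blast
  qed
  moreover have "n < T x" if "(step ^^ n) (c 0) d" for n d
    using time[of n x d] that c(1) T_bounds(1)[of x] by simp
  ultimately have "\<exists>e. step\<^sup>*\<^sup>* (c 0) e \<and> halted step e \<and> fst e = acc"
    by (intro run_accepts[OF sim(1) _ c(2)]) (use c(1) ini_ok(1) in auto)
  then show ?thesis unfolding dec c(1) .
qed

end

section \<open>Argumentation frameworks\<close>

lemma in_Def: "a \<in> Def (A, R) S \<longleftrightarrow> a \<in> A \<and> (\<exists>b\<in>S. (b, a) \<in> R)"
  by (simp add: Def_def)

lemma in_Acc: "a \<in> Acc (A, R) S \<longleftrightarrow> a \<in> A \<and> (\<forall>b. (b, a) \<in> R \<longrightarrow> b \<in> Def (A, R) S)"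
  by (simp add: Acc_def)

lemma DefI: "b \<in> S \<Longrightarrow> (b, a) \<in> R \<Longrightarrow> a \<in> A \<Longrightarrow> a \<in> Def (A, R) S"
  by (auto simp: in_Def)

lemma Def_mono: "S \<subseteq> T \<Longrightarrow> Def \<Lambda> S \<subseteq> Def \<Lambda> T"
  by (cases \<Lambda>) (fastforce simp: Def_def)

lemma Acc_mono: "S \<subseteq> T \<Longrightarrow> Acc \<Lambda> S \<subseteq> Acc \<Lambda> T"
proof
  fix x assume "S \<subseteq> T" "x \<in> Acc \<Lambda> S"
  moreover obtain A R where "\<Lambda> = (A, R)" by fastforce
  ultimately show "x \<in> Acc \<Lambda> T" using Def_mono[of S T \<Lambda>] by (simp add: in_Acc) blast
qed

lemma Acc_subset: "Acc \<Lambda> S \<subseteq> fst \<Lambda>"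
  by (cases \<Lambda>) (auto simp: in_Acc)

lemma complete_extD:
  assumes "complete_ext (A, R) S"
  shows "S \<subseteq> A" "a \<in> S \<Longrightarrow> b \<in> S \<Longrightarrow> (b, a) \<notin> R" "Acc (A, R) S = S"
    "a \<in> S \<Longrightarrow> (b, a) \<in> R \<Longrightarrow> b \<in> Def (A, R) S"
proof -
  show "S \<subseteq> A" "Acc (A, R) S = S" using assms by (auto simp: complete_ext_def admissible_def)
  show "(b, a) \<notin> R" if "a \<in> S" "b \<in> S"
  proof
    assume "(b, a) \<in> R"
    then have "a \<in> Def (A, R) S" using that \<open>S \<subseteq> A\<close> by (auto simp: in_Def)
    then show False using that assms by (auto simp: complete_ext_def admissible_def conflict_free_def)
  qed
  show "b \<in> Def (A, R) S" if "a \<in> S" "(b, a) \<in> R"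
    using that \<open>Acc (A, R) S = S\<close> in_Acc[of a A R S] by blast
qed

lemma complete_extI:
  assumes "S \<subseteq> A" "\<And>a b. a \<in> S \<Longrightarrow> b \<in> S \<Longrightarrow> (b, a) \<notin> R"
    "\<And>a b. a \<in> S \<Longrightarrow> (b, a) \<in> R \<Longrightarrow> b \<in> Def (A, R) S" "\<And>a. a \<in> Acc (A, R) S \<Longrightarrow> a \<in> S"
  shows "complete_ext (A, R) S"
proof -
  have "S \<subseteq> Acc (A, R) S" using assms(1,3) by (auto simp: in_Acc)
  then show ?thesis
    using assms by (auto simp: complete_ext_def admissible_def conflict_free_def in_Def)
qed

text \<open>Dung's fundamental lemma. An attack inside \<open>insert a S\<close> would be answered
  by an attack of \<open>S\<close> on the attacker; as the attacker is itself defended,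
  \<open>S\<close> would have to attack one of its own members.\<close>

lemma fundamental_lemma:
  assumes "admissible \<Lambda> S" "a \<in> Acc \<Lambda> S"
  shows "admissible \<Lambda> (insert a S)"
proof -
  obtain A R where \<Lambda>: "\<Lambda> = (A, R)" by fastforce
  have cf: "b \<in> S \<Longrightarrow> b \<in> Def \<Lambda> S \<Longrightarrow> False" for b
    using assms(1) by (auto simp: admissible_def conflict_free_def)
  have acc: "b \<in> Def \<Lambda> S" if "(b, x) \<in> R" "x \<in> insert a S" for b x
    using that assms unfolding \<Lambda> admissible_def by (auto simp: in_Acc subset_iff)
  have sub: "insert a S \<subseteq> A" using assms Acc_subset[of \<Lambda> S] by (auto simp: admissible_def \<Lambda>)
  have no: "(y, x) \<notin> R" if x: "x \<in> insert a S" and y: "y \<in> insert a S" for x y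
  proof
    assume "(y, x) \<in> R"
    then have "y \<in> Def \<Lambda> S" using acc x by blast
    then obtain b where "b \<in> S" "(b, y) \<in> R" by (auto simp: \<Lambda> in_Def)
    then show False using acc[OF _ y] cf by blast
  qed
  have "insert a S \<subseteq> Acc \<Lambda> (insert a S)"
    using assms Acc_mono[of S "insert a S" \<Lambda>] by (auto simp: admissible_def)
  then show ?thesis using sub no by (auto simp: admissible_def conflict_free_def \<Lambda> in_Def)
qed

text \<open>A maximal admissible superset exists by finiteness, and by the fundamental lemma it is
  complete.\<close>

lemma admissible_preferred:
  assumes "framework \<Lambda>" "admissible \<Lambda> S"
  shows "\<exists>T. preferred_ext \<Lambda> T \<and> S \<subseteq> T"
proof -
  let ?F = "{T. admissible \<Lambda> T}"
  have "?F \<subseteq> Pow (fst \<Lambda>)" by (auto simp: admissible_def)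
  then have "finite ?F"
    using assms(1) by (auto simp: framework_def intro: finite_subset)
  then obtain T where T: "admissible \<Lambda> T" "S \<subseteq> T" "\<And>U. admissible \<Lambda> U \<Longrightarrow> T \<subseteq> U \<Longrightarrow> T = U"
    using finite_has_maximal2[of ?F S] assms(2) by auto
  have "Acc \<Lambda> T \<subseteq> T" using fundamental_lemma[OF T(1)] T(3) by blast
  then have "complete_ext \<Lambda> T" using T(1) by (auto simp: complete_ext_def admissible_def)
  moreover have "\<not> T \<subset> U" if "complete_ext \<Lambda> U" for U
    using T(3)[of U] that by (auto simp: complete_ext_def)
  ultimately show ?thesis using T(2) by (auto simp: preferred_ext_def)
qed

lemma range_subset: "S \<subseteq> T \<Longrightarrow> S \<union> Def \<Lambda> S \<subseteq> T \<union> Def \<Lambda> T"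
  using Def_mono[of S T \<Lambda>] by blast

text \<open>The criterion excludes every other complete extension with at least the same range. It
  covers preferredness as well, because ranges grow with the sets.\<close>

lemma semi_stableI:
  assumes "complete_ext \<Lambda> S" "\<And>T. complete_ext \<Lambda> T \<Longrightarrow> S \<union> Def \<Lambda> S \<subseteq> T \<union> Def \<Lambda> T \<Longrightarrow> T = S"
  shows "semi_stable_ext \<Lambda> S"
  using assms range_subset[of S _ \<Lambda>]
  unfolding semi_stable_ext_def preferred_ext_def by blast

lemma stableI:
  assumes "complete_ext \<Lambda> S" "S \<union> Def \<Lambda> S = fst \<Lambda>"
  shows "stable_ext \<Lambda> S"
proof -
  have "T \<subseteq> S" if T: "complete_ext \<Lambda> T" "S \<subseteq> T" for T
  proof
    fix x assume x: "x \<in> T"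
    then have "x \<in> fst \<Lambda>" using T(1) by (auto simp: complete_ext_def admissible_def)
    moreover have "x \<notin> Def \<Lambda> S"
      using T x Def_mono[OF T(2), of \<Lambda>] by (auto simp: complete_ext_def admissible_def conflict_free_def)
    ultimately show "x \<in> S" using assms(2) by blast
  qed
  then show ?thesis using assms by (auto simp: stable_ext_def preferred_ext_def)
qed

lemma extension_subset: "extension \<sigma> \<Lambda> S \<Longrightarrow> S \<subseteq> fst \<Lambda>"
  by (cases \<sigma>) (auto simp: stable_ext_def semi_stable_ext_def preferred_ext_def complete_ext_def admissible_def)

lemma extension_complete: "extension \<sigma> \<Lambda> S \<Longrightarrow> complete_ext \<Lambda> S"
  by (cases \<sigma>) (auto simp: stable_ext_def semi_stable_ext_def preferred_ext_def)

lemma labelling_of_In: "S \<subseteq> fst \<Lambda> \<Longrightarrow> labelling_of \<Lambda> S a = In \<longleftrightarrow> a \<in> S" if "a \<in> fst \<Lambda>"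
  using that by (auto simp: labelling_of_def)

subsection \<open>The framework of a clause set\<close>

text \<open>Both frameworks use the same arguments, so that one numbering and one computation of the
  code serve for both.\<close>

datatype arg = E | Est | G | S | Lit bool nat | Star bool nat | Cl nat

definition args :: "nat \<Rightarrow> arg set" where
  "args n = {E, Est, G, S} \<union> (\<lambda>(b, v). Lit b v) ` (UNIV \<times> {..<n}) \<union> (\<lambda>(b, v). Star b v) ` (UNIV \<times> {..<n})
     \<union> Cl ` {..<n}"

lemma in_args [simp]: "E \<in> args n" "Est \<in> args n" "G \<in> args n" "S \<in> args n"
  "Lit b v \<in> args n \<longleftrightarrow> v < n" "Star b v \<in> args n \<longleftrightarrow> v < n" "Cl c \<in> args n \<longleftrightarrow> c < n"
  by (auto simp: args_def)

lemma finite_args: "finite (args n)"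
  by (simp add: args_def)

text \<open>Variables and clauses share the bound \<open>n\<close> because they are numbered by the
  same scheme; \<open>has c b v\<close> says that clause \<open>c\<close> contains variable
  \<open>v\<close> with sign \<open>b\<close>.\<close>

locale clause_framework =
  fixes n :: nat and univ second :: "nat \<Rightarrow> bool" and has :: "nat \<Rightarrow> bool \<Rightarrow> nat \<Rightarrow> bool"
begin

definition sat1 :: "(nat \<Rightarrow> bool) \<Rightarrow> bool" where
  "sat1 \<alpha> \<longleftrightarrow> (\<forall>c<n. \<not> second c \<longrightarrow> (\<exists>v<n. has c (\<alpha> v) v))"

definition sat2 :: "(nat \<Rightarrow> bool) \<Rightarrow> bool" where
  "sat2 \<alpha> \<longleftrightarrow> (\<forall>c<n. second c \<longrightarrow> (\<exists>v<n. has c (\<alpha> v) v))"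

text \<open>\<open>E\<close> represents the given labelling; the literals switch it off.\<close>

fun att1 :: "arg \<Rightarrow> arg \<Rightarrow> bool" where
  "att1 E (Lit b v) \<longleftrightarrow> True"
| "att1 E (Cl c) \<longleftrightarrow> True"
| "att1 (Lit b v) E \<longleftrightarrow> True"
| "att1 (Lit b v) (Lit b' v') \<longleftrightarrow> v = v' \<and> b \<noteq> b'"
| "att1 (Lit b v) (Cl c) \<longleftrightarrow> has c b v"
| "att1 (Cl c) G \<longleftrightarrow> \<not> second c"
| "att1 _ _ \<longleftrightarrow> False"

text \<open>\<open>G\<close> keeps the universal literals undecided unless \<open>S\<close> defeats it, which requires a satisfying
  assignment of the second clause set.  The self-attacking arguments \<open>Est\<close> and \<open>Star\<close> make
  the ranges of different choices incomparable.\<close>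

fun att2 :: "arg \<Rightarrow> arg \<Rightarrow> bool" where
  "att2 E (Lit b v) \<longleftrightarrow> True"
| "att2 E (Cl c) \<longleftrightarrow> True"
| "att2 E S \<longleftrightarrow> True"
| "att2 E Est \<longleftrightarrow> True"
| "att2 Est Est \<longleftrightarrow> True"
| "att2 G G \<longleftrightarrow> True"
| "att2 G (Lit b v) \<longleftrightarrow> univ v"
| "att2 S G \<longleftrightarrow> True"
| "att2 (Lit b v) E \<longleftrightarrow> \<not> univ v"
| "att2 (Lit b v) (Lit b' v') \<longleftrightarrow> v = v' \<and> b \<noteq> b'"
| "att2 (Lit b v) (Star b' v') \<longleftrightarrow> v = v' \<and> b = b'"
| "att2 (Lit b v) (Cl c) \<longleftrightarrow> has c b v"
| "att2 (Star b v) (Star b' v') \<longleftrightarrow> v = v' \<and> b = b'"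
| "att2 (Cl c) (Cl c') \<longleftrightarrow> c = c' \<and> second c"
| "att2 (Cl c) G \<longleftrightarrow> \<not> second c"
| "att2 (Cl c) S \<longleftrightarrow> second c"
| "att2 _ _ \<longleftrightarrow> False"

definition R1 where "R1 = {(a, b). a \<in> args n \<and> b \<in> args n \<and> att1 a b}"
definition R2 where "R2 = {(a, b). a \<in> args n \<and> b \<in> args n \<and> att2 a b}"

text \<open>\<open>E\<close> defeats all literals and clauses. In \<open>att1\<close> the only
  attackers of \<open>G\<close> are clauses, and the other arguments besides \<open>E\<close> have
  no attackers at all.\<close>

definition L1 :: "arg set" where "L1 = {E, Est, G, S} \<union> {Star b v | b v. v < n}"

lemma framework: "framework (args n, R1)" "framework (args n, R2)"
  by (auto simp: framework_def R1_def R2_def finite_args)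

lemma R1_simps: "(a, b) \<in> R1 \<longleftrightarrow> a \<in> args n \<and> b \<in> args n \<and> att1 a b"
  by (simp add: R1_def)

lemma R2_simps: "(a, b) \<in> R2 \<longleftrightarrow> a \<in> args n \<and> b \<in> args n \<and> att2 a b"
  by (simp add: R2_def)

lemma L1_stable: "stable_ext (args n, R1) L1"
proof (rule stableI)
  have D: "Lit b v \<in> Def (args n, R1) L1" if "v < n" for b v
    using that by (intro DefI[of E]) (auto simp: R1_simps L1_def)
  have D': "Cl c \<in> Def (args n, R1) L1" if "c < n" for c
    using that by (intro DefI[of E]) (auto simp: R1_simps L1_def)
  show "complete_ext (args n, R1) L1"
  proof (rule complete_extI)
    show "(b, a) \<notin> R1" if "a \<in> L1" "b \<in> L1" for a b
      using that by (auto simp: L1_def R1_simps)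
    show "b \<in> Def (args n, R1) L1" if "a \<in> L1" "(b, a) \<in> R1" for a b
      using that D D' by (cases b; auto simp: L1_def R1_simps)
    show "a \<in> L1" if "a \<in> Acc (args n, R1) L1" for a
    proof (rule ccontr)
      assume "a \<notin> L1"
      then have "(E, a) \<in> R1" using that by (cases a) (auto simp: in_Acc L1_def R1_simps)
      then have "E \<in> Def (args n, R1) L1" using that by (auto simp: in_Acc)
      then show False by (auto simp: in_Def R1_simps L1_def)
    qed
  qed (auto simp: L1_def)
  show "L1 \<union> Def (args n, R1) L1 = fst (args n, R1)"
  proof
    show "fst (args n, R1) \<subseteq> L1 \<union> Def (args n, R1) L1"
    proof
      fix a assume "a \<in> fst (args n, R1)"
      then show "a \<in> L1 \<union> Def (args n, R1) L1" using D D' by (cases a) (auto simp: L1_def)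
    qed
  qed (auto simp: L1_def in_Def)
qed

lemma sat1_stable:
  assumes "sat1 \<alpha>" "0 < n"
  shows "\<exists>T. stable_ext (args n, R1) T \<and> G \<in> T \<and> E \<notin> T"
proof -
  \<comment> \<open>Clauses without a true literal must be members to make the set stable. They
    belong to the second set and hence do not attack \<open>G\<close>.\<close>
  define T where "T = {Est, G, S} \<union> {Star b v | b v. v < n} \<union> {Lit (\<alpha> v) v | v. v < n} \<union>
    {Cl c | c. c < n \<and> \<not> (\<exists>v<n. has c (\<alpha> v) v)}"
  have T: "Lit b v \<in> T \<longleftrightarrow> v < n \<and> b = \<alpha> v" "E \<notin> T" "Cl c \<in> T \<longleftrightarrow> c < n \<and> \<not> (\<exists>v<n. has c (\<alpha> v) v)"
    "Star b v \<in> T \<longleftrightarrow> v < n" "{Est, G, S} \<subseteq> T" for b v c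
    by (auto simp: T_def)
  have DE: "E \<in> Def (args n, R1) T"
    using assms(2) T(1)[of "\<alpha> 0" 0] by (intro DefI[of "Lit (\<alpha> 0) 0"]) (auto simp: R1_simps)
  have DL: "Lit b v \<in> Def (args n, R1) T" if "v < n" "b \<noteq> \<alpha> v" for b v
    using that T(1) by (intro DefI[of "Lit (\<alpha> v) v"]) (auto simp: R1_simps)
  have DC: "Cl c \<in> Def (args n, R1) T" if "c < n" "v < n" "has c (\<alpha> v) v" for c v
    using that T(1) by (intro DefI[of "Lit (\<alpha> v) v"]) (auto simp: R1_simps)
  have out: "a \<in> Def (args n, R1) T" if a: "a \<in> args n" "a \<notin> T" for a
  proof (cases a)
    case (Cl c)
    then obtain v where "v < n" "has c (\<alpha> v) v" using a T(3)[of c] by auto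
    then show ?thesis using a DC Cl by simp
  qed (use a DE DL T in auto)
  have no: "(b, a) \<notin> R1" if ab: "a \<in> T" "b \<in> T" for a b
  proof
    assume "(b, a) \<in> R1"
    then have at: "att1 b a" by (simp add: R1_simps)
    show False
    proof (cases b)
      case (Lit s v)
      then have v: "v < n" "s = \<alpha> v" using ab T(1) by simp_all
      show False
      proof (cases a)
        case (Lit s' v')
        then show ?thesis using at \<open>b = Lit s v\<close> ab(1) T(1) v by auto
      next
        case (Cl c)
        then have "has c (\<alpha> v) v" using at Lit v by simp
        then show ?thesis using Cl ab(1) T(3) v(1) by blast
      qed (use at Lit ab T(2) in simp_all)
    next
      case (Cl c)
      then have c: "\<not> second c" using at by (cases a) auto
      have "c < n" "\<not> (\<exists>v<n. has c (\<alpha> v) v)" using Cl ab(2) T(3) by simp_all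
      then show ?thesis using assms(1) c unfolding sat1_def by blast
    qed (use at ab T(2) in auto)
  qed
  have "complete_ext (args n, R1) T"
  proof (rule complete_extI)
    show "T \<subseteq> args n" by (auto simp: T_def)
    show "b \<in> Def (args n, R1) T" if "a \<in> T" "(b, a) \<in> R1" for a b
      using out[of b] no[of a b] that by (auto simp: R1_simps)
    show "a \<in> T" if a: "a \<in> Acc (args n, R1) T" for a
    proof (rule ccontr)
      assume "a \<notin> T"
      then obtain b where "b \<in> T" "(b, a) \<in> R1" using out[of a] a by (auto simp: in_Acc in_Def)
      then obtain d where "d \<in> T" "(d, b) \<in> R1" using a by (auto simp: in_Acc in_Def)
      then show False using no \<open>b \<in> T\<close> by blast
    qed
  qed (rule no)
  moreover have "T \<subseteq> args n" by (auto simp: T_def)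
  then have "T \<union> Def (args n, R1) T = args n"
    using out by (fastforce simp: Def_def)
  ultimately show ?thesis using T by (intro exI[of _ T]) (auto intro!: stableI)
qed

text \<open>A complete extension with \<open>E\<close> is \<open>L1\<close>, so here
  \<open>E\<close> is missing. Then only literals can defend \<open>G\<close> against the clauses of
  the first set.\<close>

lemma complete_sat1:
  assumes T: "complete_ext (args n, R1) T" "G \<in> T" "T \<noteq> L1"
  shows "\<exists>\<alpha>. sat1 \<alpha>"
proof -
  note c = complete_extD[OF T(1)]
  have "E \<notin> T"
  proof
    assume E: "E \<in> T"
    have no: "Lit b v \<notin> T" "Cl d \<notin> T" for b v d
      using c(1,2) E by (force simp: R1_simps)+
    have "T \<subseteq> L1"
    proof
      fix a assume "a \<in> T"
      then show "a \<in> L1" using no c(1) by (cases a) (auto simp: L1_def)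
    qed
    moreover have "L1 \<subseteq> T"
    proof
      fix a assume "a \<in> L1"
      then consider "a = E" | "a = G" | "a \<in> args n" "\<And>b. \<not> att1 b a" by (fastforce simp: L1_def)
      then show "a \<in> T"
      proof cases
        case 3
        then have "a \<in> Acc (args n, R1) T" by (simp add: in_Acc R1_simps)
        then show ?thesis using c(3) by simp
      qed (use E T in auto)
    qed
    ultimately show False using T(3) by blast
  qed
  \<comment> \<open>A variable without a literal in \<open>T\<close> becomes false. The literals
    that defeat the clauses lie in \<open>T\<close> and are true because \<open>T\<close> is free of
    conflicts.\<close>
  have "sat1 (\<lambda>v. Lit True v \<in> T)"
    unfolding sat1_def
  proof (intro allI impI)
    fix d assume d: "d < n" "\<not> second d"
    then have "(Cl d, G) \<in> R1" by (simp add: R1_simps)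
    then obtain b where b: "b \<in> T" "(b, Cl d) \<in> R1" using c(4)[OF T(2)] by (auto simp: in_Def)
    then obtain s v where v: "b = Lit s v" "v < n" "has d s v"
      using \<open>E \<notin> T\<close> by (cases b) (auto simp: R1_simps)
    have "(Lit True v \<in> T) = s"
    proof (cases s)
      case False
      then have "(Lit True v, b) \<in> R1" using v by (simp add: R1_simps)
      then show ?thesis using c(2)[OF b(1)] False by blast
    qed (use b v in simp)
    then show "\<exists>v<n. has d (Lit True v \<in> T) v" using v by auto
  qed
  then show ?thesis by blast
qed

end

text \<open>Universal literals stay undecided in the intended extensions, so the first clauses must
  be defeated by existential literals; at least one such literal is needed to defeat
  \<open>E\<close>.\<close>

locale clause_framework2 = clause_framework +
  assumes first: "c < n \<Longrightarrow> \<not> second c \<Longrightarrow> v < n \<Longrightarrow> has c b v \<Longrightarrow> \<not> univ v"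
    and exist: "\<exists>v<n. \<not> univ v"
begin

lemma no_self: "complete_ext (args n, R2) T \<Longrightarrow> Est \<notin> T \<and> G \<notin> T \<and> Star b v \<notin> T \<and> (second c \<longrightarrow> Cl c \<notin> T)"
  using complete_extD(1,2)[of "args n" R2 T] by (force simp: R2_simps)

text \<open>Only \<open>E\<close> can bring \<open>Est\<close> into the range, since
  \<open>Est\<close> attacks itself. Together with \<open>E\<close> nothing else can be accepted:
  every other argument is attacked by \<open>E\<close> or by itself.\<close>

lemma E_semi_stable: "semi_stable_ext (args n, R2) {E}"
proof (rule semi_stableI)
  have D: "a \<in> Def (args n, R2) {E} \<longleftrightarrow> a \<in> args n \<and> att2 E a" for a
    by (auto simp: in_Def R2_simps)
  show "complete_ext (args n, R2) {E}"
  proof (rule complete_extI)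
    show "b \<in> Def (args n, R2) {E}" if "a \<in> {E}" "(b, a) \<in> R2" for a b
      using that unfolding D by (cases b) (auto simp: R2_simps)
    show "a \<in> {E}" if a: "a \<in> Acc (args n, R2) {E}" for a
    proof (rule ccontr)
      assume "a \<notin> {E}"
      have "a \<in> args n" using a by (simp add: in_Acc)
      then have "(E, a) \<in> R2 \<or> (a, a) \<in> R2 \<and> \<not> att2 E a"
        using \<open>a \<notin> {E}\<close> by (cases a) (auto simp: R2_simps)
      moreover have "E \<notin> Def (args n, R2) {E}" by (simp add: D)
      ultimately show False using a by (auto simp: in_Acc D)
    qed
  qed (auto simp: R2_simps)
  fix T assume T: "complete_ext (args n, R2) T" and range: "{E} \<union> Def (args n, R2) {E} \<subseteq> T \<union> Def (args n, R2) T"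
  have "Est \<in> Def (args n, R2) {E}" by (simp add: D)
  then have "Est \<in> Def (args n, R2) T" using range no_self[OF T] by blast
  then obtain b where "b \<in> T" "att2 b Est" by (auto simp: in_Def R2_simps)
  then have E: "E \<in> T" using no_self[OF T] by (cases b) auto
  have "a = E" if a: "a \<in> T" for a
  proof (rule ccontr)
    assume "a \<noteq> E"
    moreover have "a \<in> args n" using complete_extD(1)[OF T] a by blast
    ultimately have "(E, a) \<in> R2 \<or> (a, a) \<in> R2" by (cases a) (auto simp: R2_simps)
    then show False using complete_extD(2)[OF T] E a by blast
  qed
  then show "T = {E}" using E by blast
qed

text \<open>The witness consists of the true existential literals. Each has its \<open>Star\<close>
  in the range, so a competitor contains the same literals. It cannot contain more: universal
  literals need \<open>S\<close> as a defender against \<open>G\<close>, and \<open>S\<close> needs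
  all clauses of the second set to be defeated, which would satisfy \<open>sat2\<close>.\<close>

lemma sat_semi_stable:
  assumes \<alpha>: "sat1 \<alpha>" "\<And>\<beta>. (\<And>v. v < n \<Longrightarrow> \<not> univ v \<Longrightarrow> \<beta> v = \<alpha> v) \<Longrightarrow> \<not> sat2 \<beta>"
  shows "\<exists>T. semi_stable_ext (args n, R2) T \<and> G \<notin> Def (args n, R2) T \<and> E \<notin> T"
proof -
  define Z where "Z = {Lit (\<alpha> v) v | v. v < n \<and> \<not> univ v}"
  let ?D = "Def (args n, R2)"
  obtain v0 where v0: "v0 < n" "\<not> univ v0" using exist by blast
  have Z: "Lit b v \<in> Z \<longleftrightarrow> v < n \<and> \<not> univ v \<and> b = \<alpha> v" "E \<notin> Z" "G \<notin> Z" "Est \<notin> Z" "S \<notin> Z" "Star b v \<notin> Z" "Cl c \<notin> Z" for b v c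
    by (auto simp: Z_def)
  have DZ: "a \<in> ?D Z \<longleftrightarrow> a \<in> args n \<and> (\<exists>v<n. \<not> univ v \<and> att2 (Lit (\<alpha> v) v) a)" for a
    by (auto simp: in_Def R2_simps Z_def)
  have comp: "complete_ext (args n, R2) Z"
  proof (rule complete_extI)
    show "Z \<subseteq> args n" by (auto simp: Z_def)
    show "(b, a) \<notin> R2" if "a \<in> Z" "b \<in> Z" for a b using that by (auto simp: Z_def R2_simps)
    show "b \<in> ?D Z" if "a \<in> Z" "(b, a) \<in> R2" for a b
    proof -
      obtain v where v: "a = Lit (\<alpha> v) v" "v < n" "\<not> univ v" using \<open>a \<in> Z\<close> by (auto simp: Z_def)
      then show ?thesis using that(2) by (cases b) (auto simp: DZ R2_simps)
    qed
    show "a \<in> Z" if a: "a \<in> Acc (args n, R2) Z" for a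
    proof (rule ccontr)
      assume aZ: "a \<notin> Z"
      have an: "a \<in> args n" and att: "\<And>b. (b, a) \<in> R2 \<Longrightarrow> b \<in> ?D Z" using a by (auto simp: in_Acc)
      have ZD: "b \<notin> Z" if "(b, a) \<in> R2" for b
        using att[OF that] Z by (cases b) (auto simp: DZ)
      show False
      proof (cases a)
        case E
        then show False using ZD[of "Lit (\<alpha> v0) v0"] v0 Z(1) by (auto simp: R2_simps)
      next
        case Est
        then show False using att[of Est] by (auto simp: R2_simps DZ)
      next
        case G
        then show False using att[of G] by (auto simp: R2_simps DZ)
      next
        case S
        have "\<exists>v<n. has c (\<alpha> v) v" if "c < n" "second c" for c
        proof -
          have "Cl c \<in> ?D Z" using att[of "Cl c"] that S by (auto simp: R2_simps)
          then show ?thesis by (auto simp: DZ)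
        qed
        then have "sat2 \<alpha>" by (simp add: sat2_def)
        then show False using \<alpha>(2) by blast
      next
        case (Lit b v)
        then show False using att[of G] ZD[of "Lit (\<alpha> v) v"] aZ an Z(1) by (auto simp: R2_simps DZ)
      next
        case (Star b v)
        then have "Star b v \<in> ?D Z" using att[of a] an by (auto simp: R2_simps)
        then have "Lit b v \<in> Z" by (auto simp: DZ Z)
        then show False using ZD[of "Lit b v"] Star an by (auto simp: R2_simps)
      next
        case (Cl c)
        have "\<exists>v<n. \<not> univ v \<and> has c (\<alpha> v) v"
        proof (cases "second c")
          case True
          then have "Cl c \<in> ?D Z" using att[of a] an Cl by (auto simp: R2_simps)
          then show ?thesis by (auto simp: DZ)
        next
          case False
          then show ?thesis using \<alpha>(1) an Cl first unfolding sat1_def by (metis in_args(7))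
        qed
        then obtain v where "v < n" "\<not> univ v" "has c (\<alpha> v) v" by blast
        then show False using ZD[of "Lit (\<alpha> v) v"] Z(1) Cl an by (auto simp: R2_simps)
      qed
    qed
  qed
  have "T = Z" if T: "complete_ext (args n, R2) T" and range: "Z \<union> ?D Z \<subseteq> T \<union> ?D T" for T
  proof -
    note c = complete_extD[OF T] and ns = no_self[OF T]
    have ZT: "Lit (\<alpha> v) v \<in> T" if v: "v < n" "\<not> univ v" for v
    proof -
      \<comment> \<open>A self-attacking argument enters a range only by being attacked, and the
        only other attacker of \<open>Star\<close> is the literal with the same sign and
        variable.\<close>
      have "Star (\<alpha> v) v \<in> ?D Z" using v by (auto simp: DZ)
      then have "Star (\<alpha> v) v \<in> ?D T" using range ns by blast
      then obtain b where b: "b \<in> T" "att2 b (Star (\<alpha> v) v)" by (auto simp: in_Def R2_simps)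
      then show ?thesis using ns by (cases b) auto
    qed
    have nE: "E \<notin> T" using c(2)[OF _ ZT[OF v0], of E] v0 by (auto simp: R2_simps)
    have nL: "b = \<alpha> v" if "Lit b v \<in> T" "\<not> univ v" for b v
    proof -
      have "v < n" using c(1) that by force
      then show ?thesis using c(2)[OF that(1) ZT[of v]] that(2) by (auto simp: R2_simps)
    qed
    have nC: "Cl d \<notin> T" for d
    proof
      assume d: "Cl d \<in> T"
      then have dn: "d < n" "\<not> second d" using c(1) ns by force+
      then obtain v where v: "v < n" "has d (\<alpha> v) v" using \<alpha>(1) by (auto simp: sat1_def)
      then have "\<not> univ v" using first dn by blast
      then show False using c(2)[OF d ZT[OF v(1)]] v dn by (auto simp: R2_simps)
    qed
    have nS: "S \<notin> T"
    proof
      assume S: "S \<in> T"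
      \<comment> \<open>The existential part is fixed by \<open>Z\<close>; the universal part is
        read off from the competitor \<open>T\<close>.\<close>
      define \<beta> where "\<beta> v = (if univ v then Lit True v \<in> T else \<alpha> v)" for v
      have "\<exists>v<n. has d (\<beta> v) v" if d: "d < n" "second d" for d
      proof -
        have "(Cl d, S) \<in> R2" using d by (simp add: R2_simps)
        then obtain b where b: "b \<in> T" "(b, Cl d) \<in> R2" using c(4)[OF S] by (auto simp: in_Def)
        then obtain s v where v: "b = Lit s v" "v < n" "has d s v"
          using nE nC by (cases b) (auto simp: R2_simps)
        have "\<beta> v = s"
        proof (cases "univ v")
          case True
          have "s \<or> (Lit True v, b) \<in> R2" using v by (auto simp: R2_simps)
          then show ?thesis using True c(2)[OF b(1)] b(1) v by (cases s) (auto simp: \<beta>_def)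
        next
          case False
          then show ?thesis using nL[of s v] b v by (simp add: \<beta>_def)
        qed
        then show ?thesis using v by auto
      qed
      then have "sat2 \<beta>" by (simp add: sat2_def)
      moreover have "\<beta> v = \<alpha> v" if "\<not> univ v" for v using that by (simp add: \<beta>_def)
      ultimately show False using \<alpha>(2) by blast
    qed
    have nU: "\<not> univ v" if "Lit b v \<in> T" for b v
    proof
      assume u: "univ v"
      have "(G, Lit b v) \<in> R2" using u c(1) that by (force simp: R2_simps)
      then have "G \<in> ?D T" using c(4)[OF that] by blast
      then obtain d where "d \<in> T" "att2 d G" by (auto simp: in_Def R2_simps)
      then show False using nS nC ns by (cases d) auto
    qed
    show "T = Z"
    proof
      show "T \<subseteq> Z"
      proof
        fix a assume "a \<in> T"
        then show "a \<in> Z" using nE nC nS ns nU nL c(1) by (cases a) (auto simp: Z)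
      qed
      show "Z \<subseteq> T" using ZT by (auto simp: Z_def)
    qed
  qed
  then have "semi_stable_ext (args n, R2) Z" by (rule semi_stableI[OF comp])
  moreover have "G \<notin> ?D Z" by (auto simp: DZ)
  ultimately show ?thesis using Z(2) by blast
qed

text \<open>Maximality is used twice: \<open>T\<close> decides every existential variable, since
  otherwise a literal could be added, and no extension of the assignment satisfies the second set,
  since otherwise \<open>S\<close> with all literals of that extension would be a larger admissible
  set.\<close>

lemma preferred_sat:
  assumes T: "preferred_ext (args n, R2) T" "G \<notin> Def (args n, R2) T" "E \<notin> T"
  shows "\<exists>\<alpha>. sat1 \<alpha> \<and> (\<forall>\<beta>. (\<forall>v<n. \<not> univ v \<longrightarrow> \<beta> v = \<alpha> v) \<longrightarrow> \<not> sat2 \<beta>)"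
proof -
  let ?D = "Def (args n, R2)"
  have comp: "complete_ext (args n, R2) T" using T(1) by (simp add: preferred_ext_def)
  note c = complete_extD[OF comp] and ns = no_self[OF comp]
  have max: "U = T" if "admissible (args n, R2) U" "T \<subseteq> U" for U
    using admissible_preferred[OF framework(2) that(1)] T(1) that(2)
    unfolding preferred_ext_def by blast
  have total: "Lit True v \<in> T \<or> Lit False v \<in> T" if v: "v < n" "\<not> univ v" for v
  proof (rule ccontr)
    assume none: "\<not> ?thesis"
    then have noL: "Lit s v \<notin> T" for s by (cases s) auto
    let ?U = "insert (Lit True v) T"
    have D: "E \<in> ?D ?U" "Lit False v \<in> ?D ?U" using v by (auto simp: in_Def R2_simps)
    have 1: "(b, Lit True v) \<notin> R2" if "b \<in> ?U" for b
      using that noL T(3) v by (cases b) (auto simp: R2_simps)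
    have 2: "(Lit True v, a) \<notin> R2" if a: "a \<in> T" for a
    proof
      assume R: "(Lit True v, a) \<in> R2"
      then have "Lit True v \<in> ?D T" using c(4)[OF a] by blast
      then obtain b where "b \<in> T" "(b, Lit True v) \<in> R2" by (auto simp: in_Def)
      then show False using 1 by blast
    qed
    have "?U \<subseteq> Acc (args n, R2) ?U"
    proof -
      have "b \<in> ?D ?U" if "(b, Lit True v) \<in> R2" for b
        using that D v by (cases b) (auto simp: R2_simps)
      moreover have "T \<subseteq> Acc (args n, R2) ?U" using c(3) Acc_mono[of T ?U] by blast
      ultimately show ?thesis using v by (auto simp: in_Acc)
    qed
    moreover have "?U \<inter> ?D ?U = {}"
      using 1 2 c(2) by (auto simp: in_Def)
    ultimately have "admissible (args n, R2) ?U"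
      using c(1) v by (auto simp: admissible_def conflict_free_def)
    then show False using max[of ?U] none by blast
  qed
  define \<alpha> where "\<alpha> v \<longleftrightarrow> Lit True v \<in> T" for v
  have lit: "Lit (\<alpha> v) v \<in> T" if "v < n" "\<not> univ v" for v
    using total[OF that] by (cases "\<alpha> v") (auto simp: \<alpha>_def)
  obtain v0 where v0: "v0 < n" "\<not> univ v0" using exist by blast
  have dE: "E \<in> ?D T" using lit[OF v0] v0 by (intro DefI[of "Lit (\<alpha> v0) v0"]) (auto simp: R2_simps)
  have nS: "S \<notin> T" using T(2) by (force simp: in_Def R2_simps)
  have nC: "Cl d \<notin> T" for d
  proof
    assume d: "Cl d \<in> T"
    then have "d < n" "\<not> second d" using c(1) ns by force+
    then have "(Cl d, G) \<in> R2" by (simp add: R2_simps)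
    then show False using T(2) d by (force simp: in_Def)
  qed
  have "sat1 \<alpha>"
    unfolding sat1_def
  proof (intro allI impI, rule ccontr)
    fix d assume d: "d < n" "\<not> second d" "\<not> (\<exists>v<n. has d (\<alpha> v) v)"
    have "b \<in> ?D T" if "(b, Cl d) \<in> R2" for b
    proof (cases b)
      case (Lit s v)
      then have v: "v < n" "has d s v" using that by (auto simp: R2_simps)
      then have "\<not> univ v" using first d by blast
      moreover have "s \<noteq> \<alpha> v" using d v by blast
      ultimately show ?thesis using Lit v lit[of v]
        by (intro DefI[of "Lit (\<alpha> v) v"]) (auto simp: R2_simps)
    qed (use that d dE in \<open>auto simp: R2_simps\<close>)
    \<comment> \<open>All attackers of an unsatisfied first clause are defeated, so completeness
      would accept it, although it attacks \<open>G\<close>.\<close>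
    then have "Cl d \<in> Acc (args n, R2) T" using d by (simp add: in_Acc)
    then show False using c(3) nC by blast
  qed
  moreover have "\<not> sat2 \<beta>" if \<beta>: "\<And>v. v < n \<Longrightarrow> \<not> univ v \<Longrightarrow> \<beta> v = \<alpha> v" for \<beta>
  proof
    assume sat: "sat2 \<beta>"
    \<comment> \<open>\<open>S\<close> defeats \<open>G\<close> and so defends the universal
      literals; the satisfied second clauses, the only attackers of \<open>S\<close> besides
      \<open>E\<close>, are defeated by the literals.\<close>
    define U where "U = insert S {Lit (\<beta> v) v | v. v < n}"
    have "a \<in> U" if a: "a \<in> T" for a
    proof (cases a)
      case (Lit s v)
      have v: "v < n" using Lit a c(1) by force
      have nu: "\<not> univ v"
      proof
        assume "univ v"
        then have "(G, a) \<in> R2" using v Lit by (simp add: R2_simps)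
        then show False using c(4)[OF a] T(2) by blast
      qed
      have "s = \<alpha> v"
        using c(2)[OF a lit[OF v nu]] Lit v by (auto simp: R2_simps)
      then show ?thesis using Lit v \<beta>[OF v nu] by (simp add: U_def)
    qed (use a T(3) ns nS nC in auto)
    then have TU: "T \<subseteq> U" by blast
    have SU: "S \<in> U" and LU: "Lit b v \<in> U \<longleftrightarrow> v < n \<and> b = \<beta> v" for b v by (auto simp: U_def)
    have "E \<in> ?D U" using dE Def_mono[OF TU, of "(args n, R2)"] by blast
    moreover have "G \<in> ?D U" using SU by (intro DefI[of S]) (auto simp: R2_simps)
    moreover have "Lit b v \<in> ?D U" if "v < n" "b \<noteq> \<beta> v" for b v
      using that LU by (intro DefI[of "Lit (\<beta> v) v"]) (auto simp: R2_simps)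
    moreover have "Cl d \<in> ?D U" if d: "d < n" "second d" for d
    proof -
      obtain v where "v < n" "has d (\<beta> v) v" using sat d by (auto simp: sat2_def)
      then show ?thesis using d LU by (intro DefI[of "Lit (\<beta> v) v"]) (auto simp: R2_simps)
    qed
    ultimately have def: "b \<in> ?D U" if "a \<in> U" "(b, a) \<in> R2" for a b
      using that by (cases b) (auto simp: U_def R2_simps)
    have "admissible (args n, R2) U"
      unfolding admissible_def conflict_free_def
    proof (intro conjI)
      show "U \<subseteq> fst (args n, R2)" by (auto simp: U_def)
      show "U \<inter> ?D U = {}" by (auto simp: U_def in_Def R2_simps)
      show "U \<subseteq> Acc (args n, R2) U"
      proof
        fix a assume "a \<in> U"
        then show "a \<in> Acc (args n, R2) U" using def by (auto simp: in_Acc U_def)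
      qed
    qed
    then show False using max[OF _ TU] nS SU by blast
  qed
  ultimately show ?thesis by blast
qed

end

subsection \<open>Renaming arguments\<close>

context
  fixes A :: "'a set" and R :: "('a \<times> 'a) set" and f :: "'a \<Rightarrow> 'b"
  assumes f: "inj_on f A" and R: "R \<subseteq> A \<times> A"
begin

lemma attack_image:
  assumes "b \<in> A" "a \<in> A"
  shows "(f b, f a) \<in> map_prod f f ` R \<longleftrightarrow> (b, a) \<in> R"
proof
  assume "(f b, f a) \<in> map_prod f f ` R"
  then obtain d c where dc: "f b = f d" "f a = f c" "(d, c) \<in> R" by auto
  then have "d \<in> A" "c \<in> A" using R by auto
  then have "b = d" "a = c" using f assms dc by (auto dest: inj_onD)
  then show "(b, a) \<in> R" using dc by simp
qed (rule rev_image_eqI, auto)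

lemma Def_image:
  assumes "T \<subseteq> A"
  shows "Def (f ` A, map_prod f f ` R) (f ` T) = f ` Def (A, R) T"
proof -
  have "f a \<in> Def (f ` A, map_prod f f ` R) (f ` T) \<longleftrightarrow> a \<in> Def (A, R) T" if "a \<in> A" for a
    using that assms by (auto simp: in_Def attack_image subset_iff)
  moreover have "Def (f ` A, map_prod f f ` R) (f ` T) \<subseteq> f ` A" "Def (A, R) T \<subseteq> A" by (auto simp: in_Def)
  ultimately show ?thesis by blast
qed

lemma mem_image: "T \<subseteq> A \<Longrightarrow> a \<in> A \<Longrightarrow> f a \<in> f ` T \<longleftrightarrow> a \<in> T"
  using f by (meson inj_on_image_mem_iff)

lemma subset_image: "U \<subseteq> A \<Longrightarrow> T \<subseteq> A \<Longrightarrow> f ` U \<subseteq> f ` T \<longleftrightarrow> U \<subseteq> T"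
  unfolding image_subset_iff using mem_image[of T] by blast

lemma Acc_image:
  assumes "T \<subseteq> A"
  shows "Acc (f ` A, map_prod f f ` R) (f ` T) = f ` Acc (A, R) T"
proof -
  have D: "Def (A, R) T \<subseteq> A" by (auto simp: in_Def)
  have "f a \<in> Acc (f ` A, map_prod f f ` R) (f ` T) \<longleftrightarrow> a \<in> Acc (A, R) T" if a: "a \<in> A" for a
  proof
    assume acc: "f a \<in> Acc (f ` A, map_prod f f ` R) (f ` T)"
    have "b \<in> Def (A, R) T" if "(b, a) \<in> R" for b
    proof -
      have "b \<in> A" using that R by auto
      then have "f b \<in> Def (f ` A, map_prod f f ` R) (f ` T)" using acc that a by (auto simp: in_Acc attack_image)
      then show ?thesis using \<open>b \<in> A\<close> D by (simp add: Def_image[OF assms] mem_image)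
    qed
    then show "a \<in> Acc (A, R) T" using a by (simp add: in_Acc)
  next
    assume acc: "a \<in> Acc (A, R) T"
    have "b' \<in> Def (f ` A, map_prod f f ` R) (f ` T)" if "(b', f a) \<in> map_prod f f ` R" for b'
    proof -
      obtain b c where b: "b' = f b" "f a = f c" "(b, c) \<in> R" using \<open>(b', f a) \<in> map_prod f f ` R\<close> by auto
      then have "b \<in> A" "c = a" using R a f by (auto dest: inj_onD)
      then have "b \<in> Def (A, R) T" using acc b by (simp add: in_Acc)
      then show ?thesis using b by (simp add: Def_image[OF assms])
    qed
    then show "f a \<in> Acc (f ` A, map_prod f f ` R) (f ` T)" using a by (simp add: in_Acc)
  qed
  moreover have "Acc (f ` A, map_prod f f ` R) (f ` T) \<subseteq> f ` A" "Acc (A, R) T \<subseteq> A" by (auto simp: in_Acc)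
  ultimately show ?thesis by blast
qed

lemma complete_ext_image:
  assumes "T \<subseteq> A"
  shows "complete_ext (f ` A, map_prod f f ` R) (f ` T) \<longleftrightarrow> complete_ext (A, R) T"
proof -
  have D: "Def (A, R) T \<subseteq> A" "Acc (A, R) T \<subseteq> A" by (auto simp: in_Def in_Acc)
  have "f ` T \<inter> f ` Def (A, R) T = {} \<longleftrightarrow> T \<inter> Def (A, R) T = {}"
    unfolding inj_on_image_Int[OF f assms D(1), symmetric] by simp
  moreover have "f ` T = f ` Acc (A, R) T \<longleftrightarrow> T = Acc (A, R) T"
    by (rule inj_on_image_eq_iff[OF f assms D(2)])
  moreover have "f ` T \<subseteq> f ` Acc (A, R) T \<longleftrightarrow> T \<subseteq> Acc (A, R) T"
    by (rule subset_image[OF assms D(2)])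
  moreover have "f ` T \<subseteq> f ` A" using assms by (rule image_mono)
  ultimately show ?thesis
    unfolding complete_ext_def admissible_def conflict_free_def Def_image[OF assms] Acc_image[OF assms] fst_conv
    using assms by argo
qed

lemma psubset_image: "U \<subseteq> A \<Longrightarrow> T \<subseteq> A \<Longrightarrow> f ` U \<subset> f ` T \<longleftrightarrow> U \<subset> T"
  using f by (simp add: psubset_eq subset_image inj_on_image_eq_iff)

lemma all_image: "(\<And>T. P T \<Longrightarrow> T \<subseteq> f ` A) \<Longrightarrow> (\<exists>T. P T \<and> Q T) \<longleftrightarrow> (\<exists>T\<subseteq>A. P (f ` T) \<and> Q (f ` T))"
  by (metis subset_image_iff)

lemma preferred_ext_image:
  assumes T: "T \<subseteq> A"
  shows "preferred_ext (f ` A, map_prod f f ` R) (f ` T) \<longleftrightarrow> preferred_ext (A, R) T"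
proof -
  have "(\<exists>U. complete_ext (f ` A, map_prod f f ` R) U \<and> f ` T \<subset> U) \<longleftrightarrow> (\<exists>U\<subseteq>A. complete_ext (f ` A, map_prod f f ` R) (f ` U) \<and> f ` T \<subset> f ` U)"
    by (rule all_image) (auto simp: complete_ext_def admissible_def)
  also have "\<dots> \<longleftrightarrow> (\<exists>U\<subseteq>A. complete_ext (A, R) U \<and> T \<subset> U)"
    using complete_ext_image psubset_image T by (intro ex_cong1 conj_cong refl) simp_all
  also have "\<dots> \<longleftrightarrow> (\<exists>U. complete_ext (A, R) U \<and> T \<subset> U)"
    by (auto simp: complete_ext_def admissible_def)
  finally show ?thesis unfolding preferred_ext_def complete_ext_image[OF T] by simp
qed

lemma range_image: "T \<subseteq> A \<Longrightarrow> f ` T \<union> Def (f ` A, map_prod f f ` R) (f ` T) = f ` (T \<union> Def (A, R) T)"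
  by (simp add: Def_image image_Un)

lemma range_A: "T \<subseteq> A \<Longrightarrow> T \<union> Def (A, R) T \<subseteq> A"
  by (auto simp: in_Def)

lemma semi_stable_ext_image:
  assumes T: "T \<subseteq> A"
  shows "semi_stable_ext (f ` A, map_prod f f ` R) (f ` T) \<longleftrightarrow> semi_stable_ext (A, R) T"
proof -
  have "(\<exists>U. preferred_ext (f ` A, map_prod f f ` R) U \<and> f ` T \<union> Def (f ` A, map_prod f f ` R) (f ` T) \<subset> U \<union> Def (f ` A, map_prod f f ` R) U) \<longleftrightarrow>
      (\<exists>U\<subseteq>A. preferred_ext (f ` A, map_prod f f ` R) (f ` U) \<and> f ` T \<union> Def (f ` A, map_prod f f ` R) (f ` T) \<subset> f ` U \<union> Def (f ` A, map_prod f f ` R) (f ` U))"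
    by (rule all_image) (auto simp: preferred_ext_def complete_ext_def admissible_def)
  also have "\<dots> \<longleftrightarrow> (\<exists>U\<subseteq>A. preferred_ext (A, R) U \<and> T \<union> Def (A, R) T \<subset> U \<union> Def (A, R) U)"
    using preferred_ext_image range_image psubset_image range_A T by (intro ex_cong1 conj_cong refl) simp_all
  also have "\<dots> \<longleftrightarrow> (\<exists>U. preferred_ext (A, R) U \<and> T \<union> Def (A, R) T \<subset> U \<union> Def (A, R) U)"
    by (auto simp: preferred_ext_def complete_ext_def admissible_def)
  finally show ?thesis unfolding semi_stable_ext_def preferred_ext_image[OF T] by simp
qed

lemma extension_image:
  assumes T: "T \<subseteq> A"
  shows "extension \<sigma> (f ` A, map_prod f f ` R) (f ` T) \<longleftrightarrow> extension \<sigma> (A, R) T"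
proof (cases \<sigma>)
  case ST
  then show ?thesis
    using inj_on_image_eq_iff[OF f range_A[OF T], of A]
    by (simp add: stable_ext_def preferred_ext_image[OF T] range_image[OF T])
qed (simp_all add: complete_ext_image preferred_ext_image semi_stable_ext_image T)

lemma labelling_of_image:
  assumes "T \<subseteq> A" "a \<in> A"
  shows "labelling_of (f ` A, map_prod f f ` R) (f ` T) (f a) = labelling_of (A, R) T a"
proof -
  have "Def (A, R) T \<subseteq> A" by (auto simp: in_Def)
  then show ?thesis
    using assms by (simp add: labelling_of_def Def_image mem_image)
qed

text \<open>One direction is enough: \<open>encode_SF_EX\<close> uses it for an enumeration of the
  arguments and for a renaming back to an initial segment of the numbers.\<close>

lemma sf_ex_image:
  assumes inst: "sf_ex_instance \<sigma> (A, R) g k L" and quest: "sf_ex_question \<sigma> (A, R) g k L"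
    and M: "M \<in> extensional (f ` A)" "\<And>a. a \<in> A \<Longrightarrow> M (f a) = L a"
  shows "sf_ex_instance \<sigma> (f ` A, map_prod f f ` R) (f g) k M \<and> sf_ex_question \<sigma> (f ` A, map_prod f f ` R) (f g) k M"
proof -
  obtain T where T: "extension \<sigma> (A, R) T" "L = labelling_of (A, R) T" using inst by (auto simp: sf_ex_instance_def labellings_def)
  obtain U where U: "extension \<sigma> (A, R) U" "L g = labelling_of (A, R) U g" "k \<le> distance (A, R) L (labelling_of (A, R) U)"
    using quest by (auto simp: sf_ex_question_def labellings_def)
  have TA: "T \<subseteq> A" and UA: "U \<subseteq> A" using extension_subset[OF T(1)] extension_subset[OF U(1)] by auto
  have g: "g \<in> A" "finite A" using inst by (auto simp: sf_ex_instance_def framework_def)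
  have "M = labelling_of (f ` A, map_prod f f ` R) (f ` T)"
  proof (rule extensionalityI[OF M(1)])
    show "labelling_of (f ` A, map_prod f f ` R) (f ` T) \<in> extensional (f ` A)" by (auto simp: labelling_of_def)
    show "M a = labelling_of (f ` A, map_prod f f ` R) (f ` T) a" if "a \<in> f ` A" for a
      using that M(2) labelling_of_image[OF TA] T(2) by auto
  qed
  then have "M \<in> labellings \<sigma> (f ` A, map_prod f f ` R)" using T(1) extension_image[OF TA] by (auto simp: labellings_def)
  moreover have "framework (f ` A, map_prod f f ` R)" using g R by (auto simp: framework_def)
  ultimately have 1: "sf_ex_instance \<sigma> (f ` A, map_prod f f ` R) (f g) k M" using g by (simp add: sf_ex_instance_def)
  have "{b \<in> f ` A. M b \<noteq> labelling_of (f ` A, map_prod f f ` R) (f ` U) b} = f ` {a \<in> A. L a \<noteq> labelling_of (A, R) U a}"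
    using M(2) labelling_of_image[OF UA] by auto
  moreover have "inj_on f {a \<in> A. L a \<noteq> labelling_of (A, R) U a}" using f by (rule inj_on_subset) auto
  ultimately have "distance (f ` A, map_prod f f ` R) M (labelling_of (f ` A, map_prod f f ` R) (f ` U)) = distance (A, R) L (labelling_of (A, R) U)"
    by (simp add: distance_def card_image)
  then have "sf_ex_question \<sigma> (f ` A, map_prod f f ` R) (f g) k M"
    unfolding sf_ex_question_def labellings_def
    using U extension_image[OF UA] M(2)[OF g(1)] labelling_of_image[OF UA g(1)]
    by (intro bexI[of _ "labelling_of (f ` A, map_prod f f ` R) (f ` U)"]) auto
  with 1 show ?thesis by blast
qed

lemma encode_image:
  assumes "set xs = A" "g \<in> A" "\<And>a. a \<in> A \<Longrightarrow> M (f a) = L a"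
  shows "encode (map f xs) (map_prod f f ` R) (f g) k M = encode xs R g k L"
proof -
  have 1: "map (\<lambda>a. map (\<lambda>b. (f a, f b) \<in> map_prod f f ` R) xs) xs = map (\<lambda>a. map (\<lambda>b. (a, b) \<in> R) xs) xs"
    by (intro map_cong refl) (simp add: attack_image assms)
  have 2: "map (\<lambda>a. f a = f g) xs = map (\<lambda>a. a = g) xs"
    using f assms by (intro map_cong refl) (auto dest: inj_onD)
  have 3: "map (\<lambda>a. [M (f a) = In, M (f a) = Out]) xs = map (\<lambda>a. [L a = In, L a = Out]) xs"
    using assms by (intro map_cong refl) simp
  show ?thesis by (simp add: encode_def comp_def 1 2 3)
qed

end

lemma index_map:
  assumes "distinct xs"
  shows "\<exists>f. inj_on f (set xs) \<and> map f xs = [0..<length xs]"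
proof -
  let ?f = "the_inv_into {..<length xs} ((!) xs)"
  have bij: "bij_betw ((!) xs) {..<length xs} (set xs)" using assms by (intro bij_betw_nth) auto
  have "map ?f xs = [0..<length xs]"
    using bij by (intro nth_equalityI) (auto simp: bij_betw_def the_inv_into_f_f)
  moreover have "inj_on ?f (set xs)"
    using bij inj_on_the_inv_into[of "(!) xs" "{..<length xs}"] by (auto simp: bij_betw_def)
  ultimately show ?thesis by blast
qed

lemma SF_EX_upt:
  "w \<in> SF_EX \<sigma> \<longleftrightarrow> (\<exists>n R g k L. w = encode [0..<n] R g k L \<and>
     sf_ex_instance \<sigma> ({0..<n}, R) g k L \<and> sf_ex_question \<sigma> ({0..<n}, R) g k L)"
proof
  assume "w \<in> SF_EX \<sigma>"
  then obtain xs :: "nat list" and R g k L where w: "w = encode xs R g k L" "distinct xs"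
    "sf_ex_instance \<sigma> (set xs, R) g k L" "sf_ex_question \<sigma> (set xs, R) g k L"
    by (auto simp: SF_EX_def)
  obtain f where f: "inj_on f (set xs)" "map f xs = [0..<length xs]" using index_map[OF w(2)] by blast
  have R: "R \<subseteq> set xs \<times> set xs" and g: "g \<in> set xs" using w(3) by (auto simp: sf_ex_instance_def framework_def)
  have img: "f ` set xs = {0..<length xs}" by (metis f(2) set_map set_upt)
  define M where "M = (\<lambda>b\<in>f ` set xs. L (inv_into (set xs) f b))"
  have M: "M \<in> extensional (f ` set xs)" "\<And>a. a \<in> set xs \<Longrightarrow> M (f a) = L a"
    using f(1) by (auto simp: M_def)
  show "\<exists>n R g k L. w = encode [0..<n] R g k L \<and>
     sf_ex_instance \<sigma> ({0..<n}, R) g k L \<and> sf_ex_question \<sigma> ({0..<n}, R) g k L"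
    using sf_ex_image[where M = M, OF f(1) R w(3,4) M] encode_image[where M = M and L = L, OF f(1) R refl g M(2), of k] w(1)
    unfolding img f(2) by metis
next
  assume "\<exists>n R g k L. w = encode [0..<n] R g k L \<and>
     sf_ex_instance \<sigma> ({0..<n}, R) g k L \<and> sf_ex_question \<sigma> ({0..<n}, R) g k L"
  then show "w \<in> SF_EX \<sigma>"
    unfolding SF_EX_def by (metis (mono_tags, lifting) CollectI distinct_upt set_upt)
qed

text \<open>\<open>SF_EX\<close> names arguments by numbers, while the reduction builds frameworks
  over \<open>arg\<close>. Since a code determines its instance up to renaming, such a framework can
  be judged without being renamed.\<close>

lemma encode_SF_EX:
  assumes xs: "distinct xs" and R: "R \<subseteq> set xs \<times> set xs" and g: "g \<in> set xs" and L: "L \<in> extensional (set xs)"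
  shows "encode xs R g k L \<in> SF_EX \<sigma> \<longleftrightarrow>
    sf_ex_instance \<sigma> (set xs, R) g k L \<and> sf_ex_question \<sigma> (set xs, R) g k L"
proof
  assume "encode xs R g k L \<in> SF_EX \<sigma>"
  then obtain n S h l M where e: "encode [0..<n] S h l M = encode xs R g k L"
    "sf_ex_instance \<sigma> ({0..<n}, S) h l M" "sf_ex_question \<sigma> ({0..<n}, S) h l M"
    unfolding SF_EX_upt by metis
  note enc = encode_inject[OF e(1)]
  have n: "n = length xs" using enc(1) by simp
  have S: "S \<subseteq> {0..<n} \<times> {0..<n}" and h: "h < n" using e(2) by (auto simp: sf_ex_instance_def framework_def)
  have img: "(!) xs ` {0..<n} = set xs" using n by (auto simp: set_conv_nth)
  have inj: "inj_on ((!) xs) {0..<n}" using xs n by (simp add: inj_on_nth)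
  have SR: "(i, j) \<in> S \<longleftrightarrow> (xs ! i, xs ! j) \<in> R" if "i < n" "j < n" for i j
    using enc(2)[of i j] that by simp
  have "map_prod ((!) xs) ((!) xs) ` S = R"
  proof
    show "map_prod ((!) xs) ((!) xs) ` S \<subseteq> R" using S SR by auto
    show "R \<subseteq> map_prod ((!) xs) ((!) xs) ` S"
    proof
      fix p assume p: "p \<in> R"
      obtain a b where ab: "p = (a, b)" by (rule prod.exhaust)
      then have "a \<in> set xs" "b \<in> set xs" using p R by auto
      then obtain i j where ij: "i < n" "xs ! i = a" "j < n" "xs ! j = b"
        using n by (metis in_set_conv_nth)
      then have "(i, j) \<in> S" using SR p ab by simp
      then have "map_prod ((!) xs) ((!) xs) (i, j) \<in> map_prod ((!) xs) ((!) xs) ` S" by (rule imageI)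
      then show "p \<in> map_prod ((!) xs) ((!) xs) ` S" using ij ab by simp
    qed
  qed
  moreover have "xs ! h = g" using enc(3)[of h] h by simp
  moreover have "k = l" using enc(5) by simp
  moreover have "L (xs ! i) = M i" if "i \<in> {0..<n}" for i using enc(4)[of i] that by simp
  ultimately show "sf_ex_instance \<sigma> (set xs, R) g k L \<and> sf_ex_question \<sigma> (set xs, R) g k L"
    using sf_ex_image[where M = L, OF inj S e(2,3)] L img by simp
next
  assume yes: "sf_ex_instance \<sigma> (set xs, R) g k L \<and> sf_ex_question \<sigma> (set xs, R) g k L"
  obtain f where f: "inj_on f (set xs)" "map f xs = [0..<length xs]" using index_map[OF xs] by blast
  have img: "f ` set xs = {0..<length xs}" by (metis f(2) set_map set_upt)
  define M where "M = (\<lambda>b\<in>f ` set xs. L (inv_into (set xs) f b))"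
  have M: "M \<in> extensional (f ` set xs)" "\<And>a. a \<in> set xs \<Longrightarrow> M (f a) = L a"
    using f(1) by (auto simp: M_def)
  show "encode xs R g k L \<in> SF_EX \<sigma>"
    unfolding SF_EX_upt
    using sf_ex_image[where M = M, OF f(1) R conjunct1[OF yes] conjunct2[OF yes] M] encode_image[where M = M and L = L, OF f(1) R refl g M(2), of k]
    unfolding img f(2) by metis
qed

section \<open>Hardness\<close>

abbreviation PFx :: "(bool list \<times> nat \<Rightarrow> nat) \<Rightarrow> bool" where "PFx \<equiv> PF [fst] [snd]"
abbreviation PBx :: "(bool list \<times> nat \<Rightarrow> bool) \<Rightarrow> bool" where "PBx \<equiv> PB [fst] [snd]"

text \<open>Closure under substitution is built in because the parameters will be digits extracted
  from the number of a clause.\<close>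

definition fn_ok :: "fn \<Rightarrow> bool" where
  "fn_ok f \<longleftrightarrow> (\<forall>A B C D. PFx A \<longrightarrow> PFx B \<longrightarrow> PFx C \<longrightarrow> PFx D \<longrightarrow> PFx (\<lambda>s. f (fst s) (A s) (B s) (C s) (D s)))"

definition fam_ok :: "family \<Rightarrow> bool" where
  "fam_ok F \<longleftrightarrow> fn_ok (\<lambda>x a b c d. of_bool (fst F x a b c d)) \<and>
     (\<forall>(sg, \<kappa>, f, g, h)\<in>set (snd F). fn_ok f \<and> fn_ok g \<and> fn_ok h)"

definition fam_bounded :: "(bool list \<Rightarrow> nat) \<Rightarrow> family \<Rightarrow> bool" where
  "fam_bounded N F \<longleftrightarrow> (\<forall>x a b c d. a < N x \<longrightarrow> b < N x \<longrightarrow> c < N x \<longrightarrow> d < N x \<longrightarrow> fst F x a b c d \<longrightarrow>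
     (\<forall>(sg, \<kappa>, f, g, h)\<in>set (snd F). f x a b c d < N x \<and> g x a b c d < N x \<and> h x a b c d < N x))"

definition existential :: "family \<Rightarrow> bool" where
  "existential F \<longleftrightarrow> (\<forall>(sg, \<kappa>, f, g, h)\<in>set (snd F). \<not> universal \<kappa>)"

lemma digits:
  fixes N j a b c d :: nat
  assumes "a < N" "b < N" "c < N" "d < N"
  defines "e \<equiv> (((j * N + a) * N + b) * N + c) * N + d"
  shows "e div N ^ 4 = j" "e div N ^ 3 mod N = a" "e div N ^ 2 mod N = b" "e div N mod N = c" "e mod N = d"
proof -
  have m: "e div N ^ 4 = e div N div N div N div N" "e div N ^ 3 = e div N div N div N" "e div N ^ 2 = e div N div N"
    by (simp_all add: div_mult2_eq[symmetric] power_numeral_reduce mult.assoc)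
  have s: "(y * N + d) div N = y" "(y * N + d) mod N = d" if "d < N" for y d
    using that by auto
  show "e div N ^ 4 = j" "e div N ^ 3 mod N = a" "e div N ^ 2 mod N = b" "e div N mod N = c" "e mod N = d"
    unfolding m unfolding e_def using assms by (simp_all only: s)
qed

lemma digits_less:
  fixes N :: nat
  assumes "a < N" "b < N" "c < N" "d < N" "j < F"
  shows "(((j * N + a) * N + b) * N + c) * N + d < F * N ^ 4"
proof -
  have s: "x * N + y < (z :: nat) * N" if "x < z" "y < N" for x y z
  proof -
    have "x * N + y < Suc x * N" using that by simp
    also have "\<dots> \<le> z * N" using that by (intro mult_le_mono1) simp
    finally show ?thesis .
  qed
  have "(((j * N + a) * N + b) * N + c) * N + d < (((F * N) * N) * N) * N"
    by (intro s assms)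
  then show ?thesis by (simp add: power_numeral_reduce mult.assoc)
qed

locale clause_families =
  fixes Fs Gs :: "family list" and N :: "bool list \<Rightarrow> nat"
  assumes fams: "F \<in> set (Fs @ Gs) \<Longrightarrow> fam_ok F \<and> fam_bounded N F"
    and existential: "F \<in> set Fs \<Longrightarrow> existential F"
    and N: "0 < N x" "PF [\<lambda>x. x] [] N" "PFx (\<lambda>s. N (fst s))"
begin

definition code :: "kind \<Rightarrow> nat" where "code = to_nat"

text \<open>\<open>St 0 0\<close> is included to provide an existential variable in any case, both
  for the tautologies in \<open>has\<close> and for the assumption \<open>exist\<close>.\<close>

definition kinds :: "kind set" where
  "kinds = insert (St 0 0) ((\<lambda>l. fst (snd l)) ` (\<Union>F\<in>set (Fs @ Gs). set (snd F)))"

text \<open>A common bound for the leading digits of variables and clauses, so that both are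
  numbered below the same \<open>size\<close>.\<close>

definition H :: nat where "H = Suc (Max (insert (length (Fs @ Gs)) (code ` kinds)))"

lemma finite_kinds: "finite kinds"
  by (simp add: kinds_def)

lemma code_H: "\<kappa> \<in> kinds \<Longrightarrow> code \<kappa> < H" and length_H: "length (Fs @ Gs) < H"
  unfolding H_def using finite_kinds by (auto simp: less_Suc_eq_le simp del: Max_insert)

lemma code_inject: "code \<kappa> = code \<kappa>' \<longleftrightarrow> \<kappa> = \<kappa>'"
  by (simp add: code_def)

text \<open>The clause of the \<open>j\<close>-th family for the parameters \<open>a b c d\<close> has the number with leading digit
  \<open>j\<close> and digits \<open>a b c d\<close> to the base \<open>N x\<close>; variables are numbered in the same way, with last
  digit 0.\<close>

definition size :: "bool list \<Rightarrow> nat" where "size x = H * N x ^ 4"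

definition var :: "bool list \<Rightarrow> kind \<Rightarrow> nat \<Rightarrow> nat \<Rightarrow> nat \<Rightarrow> nat" where
  "var x \<kappa> a b c = (((code \<kappa> * N x + a) * N x + b) * N x + c) * N x"

text \<open>The codes of universal kinds are collected in a constant list, the form that
  \<open>PB_bex_list\<close> can handle.\<close>

definition univ :: "bool list \<Rightarrow> nat \<Rightarrow> bool" where
  "univ x v \<longleftrightarrow> (\<exists>i\<in>set (filter (\<lambda>i. \<exists>\<kappa>\<in>kinds. universal \<kappa> \<and> code \<kappa> = i) [0..<H]). v div N x ^ 4 = i)"

definition second :: "bool list \<Rightarrow> nat \<Rightarrow> bool" where
  "second x c \<longleftrightarrow> length Fs \<le> c div N x ^ 4"

definition applies :: "bool list \<Rightarrow> nat \<Rightarrow> nat \<times> family \<Rightarrow> bool" where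
  "applies x c J \<longleftrightarrow> c div N x ^ 4 = fst J \<and>
     fst (snd J) x (c div N x ^ 3 mod N x) (c div N x ^ 2 mod N x) (c div N x mod N x) (c mod N x)"

definition member :: "bool list \<Rightarrow> nat \<Rightarrow> bool \<Rightarrow> nat \<Rightarrow> literal \<Rightarrow> bool" where
  "member x c b v l \<longleftrightarrow> (case l of (sg, \<kappa>, f, g, h) \<Rightarrow> b = sg \<and>
     v = var x \<kappa> (f x (c div N x ^ 3 mod N x) (c div N x ^ 2 mod N x) (c div N x mod N x) (c mod N x))
       (g x (c div N x ^ 3 mod N x) (c div N x ^ 2 mod N x) (c div N x mod N x) (c mod N x))
       (h x (c div N x ^ 3 mod N x) (c div N x ^ 2 mod N x) (c div N x mod N x) (c mod N x)))"

text \<open>The numbers that do not stand for a clause become tautologies.\<close>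

definition has :: "bool list \<Rightarrow> nat \<Rightarrow> bool \<Rightarrow> nat \<Rightarrow> bool" where
  "has x c b v \<longleftrightarrow>
     (\<exists>J\<in>set (List.enumerate 0 (Fs @ Gs)). applies x c J \<and> (\<exists>l\<in>set (snd (snd J)). member x c b v l)) \<or>
     \<not> (\<exists>J\<in>set (List.enumerate 0 (Fs @ Gs)). applies x c J) \<and> v = var x (St 0 0) 0 0 0"

lemma var_div: "a < N x \<Longrightarrow> b < N x \<Longrightarrow> c < N x \<Longrightarrow> var x \<kappa> a b c div N x ^ 4 = code \<kappa>"
    "a < N x \<Longrightarrow> b < N x \<Longrightarrow> c < N x \<Longrightarrow> var x \<kappa> a b c div N x ^ 3 mod N x = a"
    "a < N x \<Longrightarrow> b < N x \<Longrightarrow> c < N x \<Longrightarrow> var x \<kappa> a b c div N x ^ 2 mod N x = b"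
    "a < N x \<Longrightarrow> b < N x \<Longrightarrow> c < N x \<Longrightarrow> var x \<kappa> a b c div N x mod N x = c"
  using digits[where j = "code \<kappa>" and N = "N x" and a = a and b = b and c = c and d = 0] N(1)[of x] by (simp_all add: var_def)

lemma var_less: "a < N x \<Longrightarrow> b < N x \<Longrightarrow> c < N x \<Longrightarrow> \<kappa> \<in> kinds \<Longrightarrow> var x \<kappa> a b c < size x"
  using digits_less[of a "N x" b c 0 "code \<kappa>" H] N(1)[of x] code_H[of \<kappa>] by (simp add: var_def size_def)

lemma univ_var: "a < N x \<Longrightarrow> b < N x \<Longrightarrow> c < N x \<Longrightarrow> \<kappa> \<in> kinds \<Longrightarrow> univ x (var x \<kappa> a b c) \<longleftrightarrow> universal \<kappa>"
  by (auto simp: univ_def var_div code_inject code_H)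

lemma kindsI: "F \<in> set (Fs @ Gs) \<Longrightarrow> (sg, \<kappa>, f, g, h) \<in> set (snd F) \<Longrightarrow> \<kappa> \<in> kinds"
  unfolding kinds_def by force

lemma digit_less: "m mod N x < N x"
  using N(1)[of x] by simp

lemma enumerate_iff: "J \<in> set (List.enumerate 0 (Fs @ Gs)) \<longleftrightarrow> fst J < length (Fs @ Gs) \<and> snd J = (Fs @ Gs) ! fst J"
  by (cases J) (auto simp: in_set_enumerate_eq)

lemma member_less:
  assumes "J \<in> set (List.enumerate 0 (Fs @ Gs))" "applies x c J" "(sg, \<kappa>, f, g, h) \<in> set (snd (snd J))"
    and "\<phi> \<in> {f, g, h}"
  shows "\<phi> x (c div N x ^ 3 mod N x) (c div N x ^ 2 mod N x) (c div N x mod N x) (c mod N x) < N x"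
proof -
  have "snd J \<in> set (Fs @ Gs)" using assms(1) unfolding enumerate_iff using nth_mem by metis
  then have "fam_bounded N (snd J)" using fams by blast
  note b = this[unfolded fam_bounded_def, rule_format, OF digit_less digit_less digit_less digit_less, of x]
  have "fst (snd J) x (c div N x ^ 3 mod N x) (c div N x ^ 2 mod N x) (c div N x mod N x) (c mod N x)"
    using assms(2) by (simp add: applies_def)
  from b[OF this assms(3)] show ?thesis using assms(4) by auto
qed

text \<open>The digits of a clause number recover its family and parameters, so clauses and
  instances of families correspond, and the remaining numbers are tautologies. \<open>I\<close>
  selects either the first or the second clause set by the leading digit.\<close>

lemma clause_hold:
  assumes \<alpha>: "\<And>\<kappa> a b c. \<kappa> \<in> kinds \<Longrightarrow> a < N x \<Longrightarrow> b < N x \<Longrightarrow> c < N x \<Longrightarrow> \<alpha> (var x \<kappa> a b c) = val \<kappa> a b c"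
  shows "(\<forall>c<size x. I (c div N x ^ 4) \<longrightarrow> (\<exists>v<size x. has x c (\<alpha> v) v)) \<longleftrightarrow>
    (\<forall>j<length (Fs @ Gs). I j \<longrightarrow> fam_sat (N x) val x ((Fs @ Gs) ! j))"
proof (intro iffI allI impI)
  fix j assume sat: "\<forall>c<size x. I (c div N x ^ 4) \<longrightarrow> (\<exists>v<size x. has x c (\<alpha> v) v)"
    and j: "j < length (Fs @ Gs)" "I j"
  show "fam_sat (N x) val x ((Fs @ Gs) ! j)"
    unfolding fam_sat_def
  proof (intro allI impI)
    fix a b c d assume abcd: "a < N x" "b < N x" "c < N x" "d < N x" and guard: "fst ((Fs @ Gs) ! j) x a b c d"
    define e where "e = (((j * N x + a) * N x + b) * N x + c) * N x + d"
    note dig = digits[OF abcd, of j, folded e_def]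
    have "e < size x" unfolding e_def size_def using length_H j(1) by (intro digits_less abcd) simp
    then obtain v where v: "has x e (\<alpha> v) v" using sat dig j by metis
    define J where "J = (j, (Fs @ Gs) ! j)"
    have J: "J \<in> set (List.enumerate 0 (Fs @ Gs))" using j by (simp add: J_def in_set_enumerate_eq)
    have app: "applies x e J" using guard by (simp add: applies_def dig J_def)
    have uniq: "K = J" if "applies x e K" "K \<in> set (List.enumerate 0 (Fs @ Gs))" for K
      using that app unfolding enumerate_iff applies_def J_def by (cases K) auto
    have "\<exists>l\<in>set (snd ((Fs @ Gs) ! j)). member x e (\<alpha> v) v l"
    proof -
      obtain K l where "K \<in> set (List.enumerate 0 (Fs @ Gs))" "applies x e K" "l \<in> set (snd (snd K))" "member x e (\<alpha> v) v l"
        using v J app unfolding has_def by blast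
      moreover from this have "snd K = (Fs @ Gs) ! j" using uniq[of K] by (simp add: J_def)
      ultimately show ?thesis by metis
    qed
    then obtain l where l: "l \<in> set (snd ((Fs @ Gs) ! j))" "member x e (\<alpha> v) v l" by blast
    obtain sg \<kappa> f g h where lit: "l = (sg, \<kappa>, f, g, h)" by (metis prod.exhaust)
    have \<kappa>: "\<kappa> \<in> kinds" using kindsI[of "(Fs @ Gs) ! j"] l(1) lit j(1) nth_mem by metis
    have less: "\<phi> x a b c d < N x" if "\<phi> \<in> {f, g, h}" for \<phi>
      using member_less[OF J app, of sg \<kappa> f g h \<phi>] that l lit by (simp add: J_def dig)
    have "\<alpha> v = sg" "v = var x \<kappa> (f x a b c d) (g x a b c d) (h x a b c d)"
      using l(2) by (auto simp: member_def lit dig)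
    then have "val \<kappa> (f x a b c d) (g x a b c d) (h x a b c d) = sg"
      using \<alpha>[OF \<kappa> less[of f] less[of g] less[of h]] by simp
    then show "\<exists>(sg, \<kappa>, f, g, h)\<in>set (snd ((Fs @ Gs) ! j)). val \<kappa> (f x a b c d) (g x a b c d) (h x a b c d) = sg"
      using l(1) unfolding lit by (intro bexI[of _ "(sg, \<kappa>, f, g, h)"]) simp_all
  qed
next
  fix c assume sat: "\<forall>j<length (Fs @ Gs). I j \<longrightarrow> fam_sat (N x) val x ((Fs @ Gs) ! j)"
    and c: "c < size x" "I (c div N x ^ 4)"
  show "\<exists>v<size x. has x c (\<alpha> v) v"
  proof (cases "\<exists>J\<in>set (List.enumerate 0 (Fs @ Gs)). applies x c J")
    case False
    then have "has x c (\<alpha> (var x (St 0 0) 0 0 0)) (var x (St 0 0) 0 0 0)" by (simp add: has_def)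
    moreover have "var x (St 0 0) 0 0 0 < size x" using N(1)[of x] by (intro var_less) (auto simp: kinds_def)
    ultimately show ?thesis by blast
  next
    case True
    then obtain J where J: "J \<in> set (List.enumerate 0 (Fs @ Gs))" and app: "applies x c J" by blast
    define j where "j = fst J"
    have j: "j < length (Fs @ Gs)" "snd J = (Fs @ Gs) ! j" using J unfolding enumerate_iff j_def by auto
    have "c div N x ^ 4 = j" using app by (simp add: applies_def j_def)
    then have "fam_sat (N x) val x ((Fs @ Gs) ! j)" using sat c j by simp
    note sat0 = this[unfolded fam_sat_def, rule_format, OF digit_less[of "c div N x ^ 3"] digit_less[of "c div N x ^ 2"]
        digit_less[of "c div N x"] digit_less[of c]]
    have guard: "fst ((Fs @ Gs) ! j) x (c div N x ^ 3 mod N x) (c div N x ^ 2 mod N x) (c div N x mod N x) (c mod N x)"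
      using app j by (simp add: applies_def)
    obtain l where lF: "l \<in> set (snd ((Fs @ Gs) ! j))" and sat': "case l of (sg, \<kappa>, f, g, h) \<Rightarrow>
      val \<kappa> (f x (c div N x ^ 3 mod N x) (c div N x ^ 2 mod N x) (c div N x mod N x) (c mod N x))
       (g x (c div N x ^ 3 mod N x) (c div N x ^ 2 mod N x) (c div N x mod N x) (c mod N x))
       (h x (c div N x ^ 3 mod N x) (c div N x ^ 2 mod N x) (c div N x mod N x) (c mod N x)) = sg" by (rule bexE[OF sat0[OF guard]])
    obtain sg \<kappa> f g h where lit: "l = (sg, \<kappa>, f, g, h)" by (metis prod.exhaust)
    have l: "(sg, \<kappa>, f, g, h) \<in> set (snd (snd J))" using lF lit j by simp
    have \<kappa>: "\<kappa> \<in> kinds" using kindsI[of "(Fs @ Gs) ! j"] l j nth_mem by metis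
    note less = member_less[OF J app l]
    define v where "v = var x \<kappa> (f x (c div N x ^ 3 mod N x) (c div N x ^ 2 mod N x) (c div N x mod N x) (c mod N x))
       (g x (c div N x ^ 3 mod N x) (c div N x ^ 2 mod N x) (c div N x mod N x) (c mod N x))
       (h x (c div N x ^ 3 mod N x) (c div N x ^ 2 mod N x) (c div N x mod N x) (c mod N x))"
    have "\<alpha> v = sg" unfolding v_def using \<alpha>[OF \<kappa> less[of f] less[of g] less[of h]] sat' lit by simp
    then have "member x c (\<alpha> v) v (sg, \<kappa>, f, g, h)" by (simp add: member_def v_def)
    then have "has x c (\<alpha> v) v" unfolding has_def using J app l by blast
    moreover have "v < size x" unfolding v_def by (intro var_less less \<kappa>) simp_all
    ultimately show ?thesis by blast
  qed
qed

lemma has_existential: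
  assumes "\<not> second x c" "has x c b v"
  shows "\<not> univ x v"
proof (cases "\<exists>J\<in>set (List.enumerate 0 (Fs @ Gs)). applies x c J")
  case False
  then have "v = var x (St 0 0) 0 0 0" using assms(2) by (simp add: has_def)
  moreover have "univ x (var x (St 0 0) 0 0 0) \<longleftrightarrow> universal (St 0 0)"
    using N(1)[of x] by (intro univ_var) (auto simp: kinds_def)
  ultimately show ?thesis by simp
next
  case True
  then obtain J l where J: "J \<in> set (List.enumerate 0 (Fs @ Gs))" "applies x c J"
    and l: "l \<in> set (snd (snd J))" "member x c b v l"
    using assms(2) unfolding has_def by blast
  obtain sg \<kappa> f g h where lit: "l = (sg, \<kappa>, f, g, h)" by (metis prod.exhaust)
  have "fst J < length Fs" using assms(1) J(2) by (simp add: second_def applies_def)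
  then have "snd J \<in> set Fs" using J(1) unfolding enumerate_iff by (simp add: nth_append)
  then have nu: "\<not> universal \<kappa>" using existential[of "snd J"] l(1) lit by (auto simp: existential_def)
  note less = member_less[OF J l(1)[unfolded lit]]
  have "\<kappa> \<in> kinds"
    using kindsI[of "snd J"] l(1) lit \<open>snd J \<in> set Fs\<close> by simp
  then show ?thesis
    using nu l(2) univ_var[OF less[of f] less[of g] less[of h]] unfolding lit member_def by simp
qed

sublocale af: clause_framework2 "size x" "univ x" "second x" "has x" for x
proof
  show "\<not> univ x v" if "c < size x" "\<not> second x c" "v < size x" "has x c b v" for c v b
    using has_existential that(2,4) .
  have "\<not> univ x (var x (St 0 0) 0 0 0)" "var x (St 0 0) 0 0 0 < size x"
    using N(1)[of x] univ_var[of 0 x 0 0 "St 0 0"] var_less[of 0 x 0 0 "St 0 0"] by (auto simp: kinds_def)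
  then show "\<exists>v<size x. \<not> univ x v" by blast
qed

lemma sat_hold:
  assumes \<alpha>: "\<And>\<kappa> a b c. \<kappa> \<in> kinds \<Longrightarrow> a < N x \<Longrightarrow> b < N x \<Longrightarrow> c < N x \<Longrightarrow> \<alpha> (var x \<kappa> a b c) = val \<kappa> a b c"
  shows "af.sat1 x \<alpha> \<longleftrightarrow> hold (N x) val x Fs" "af.sat2 x \<alpha> \<longleftrightarrow> hold (N x) val x Gs"
proof -
  have "hold (N x) val x Fs \<longleftrightarrow> (\<forall>j<length (Fs @ Gs). j < length Fs \<longrightarrow> fam_sat (N x) val x ((Fs @ Gs) ! j))"
    by (auto simp: hold_def all_set_conv_all_nth nth_append)
  then show "af.sat1 x \<alpha> \<longleftrightarrow> hold (N x) val x Fs"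
    using clause_hold[where x = x and \<alpha> = \<alpha> and val = val and I = "\<lambda>j. j < length Fs", OF \<alpha>] by (simp add: af.sat1_def second_def not_le)
  have "hold (N x) val x Gs \<longleftrightarrow> (\<forall>j<length (Fs @ Gs). length Fs \<le> j \<longrightarrow> fam_sat (N x) val x ((Fs @ Gs) ! j))"
  proof
    show "\<forall>j<length (Fs @ Gs). length Fs \<le> j \<longrightarrow> fam_sat (N x) val x ((Fs @ Gs) ! j)" if "hold (N x) val x Gs"
      using that by (auto simp: hold_def all_set_conv_all_nth nth_append)
    show "hold (N x) val x Gs" if all: "\<forall>j<length (Fs @ Gs). length Fs \<le> j \<longrightarrow> fam_sat (N x) val x ((Fs @ Gs) ! j)"
      unfolding hold_def all_set_conv_all_nth
    proof (intro allI impI)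
      fix j assume "j < length Gs"
      then show "fam_sat (N x) val x (Gs ! j)" using all[rule_format, of "length Fs + j"] by simp
    qed
  qed
  then show "af.sat2 x \<alpha> \<longleftrightarrow> hold (N x) val x Gs"
    using clause_hold[where x = x and \<alpha> = \<alpha> and val = val and I = "\<lambda>j. length Fs \<le> j", OF \<alpha>] by (simp add: af.sat2_def second_def)
qed

definition assignment :: "bool list \<Rightarrow> valuation \<Rightarrow> nat \<Rightarrow> bool" where
  "assignment x val v = val (inv code (v div N x ^ 4)) (v div N x ^ 3 mod N x) (v div N x ^ 2 mod N x) (v div N x mod N x)"

definition valuation :: "bool list \<Rightarrow> (nat \<Rightarrow> bool) \<Rightarrow> valuation" where
  "valuation x \<alpha> = (\<lambda>\<kappa> a b c. \<alpha> (var x \<kappa> a b c))"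

lemma assignment_var: "a < N x \<Longrightarrow> b < N x \<Longrightarrow> c < N x \<Longrightarrow> assignment x val (var x \<kappa> a b c) = val \<kappa> a b c"
  by (simp add: assignment_def var_div inv_f_f code_def)

lemma sat1_iff: "(\<exists>\<alpha>. af.sat1 x \<alpha>) \<longleftrightarrow> (\<exists>val. hold (N x) val x Fs)"
proof
  assume "\<exists>\<alpha>. af.sat1 x \<alpha>"
  then obtain \<alpha> where "af.sat1 x \<alpha>" ..
  then have "hold (N x) (valuation x \<alpha>) x Fs" using sat_hold(1)[of x \<alpha> "valuation x \<alpha>"] by (simp add: valuation_def)
  then show "\<exists>val. hold (N x) val x Fs" by (rule exI[of _ "valuation x \<alpha>"])
next
  assume "\<exists>val. hold (N x) val x Fs"
  then obtain val where "hold (N x) val x Fs" ..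
  then have "af.sat1 x (assignment x val)" using sat_hold(1)[of x "assignment x val" val] by (simp add: assignment_var)
  then show "\<exists>\<alpha>. af.sat1 x \<alpha>" by (rule exI[of _ "assignment x val"])
qed

lemma sat_iff:
  "(\<exists>\<alpha>. af.sat1 x \<alpha> \<and> (\<forall>\<beta>. (\<forall>v<size x. \<not> univ x v \<longrightarrow> \<beta> v = \<alpha> v) \<longrightarrow> \<not> af.sat2 x \<beta>)) \<longleftrightarrow>
   (\<exists>val. hold (N x) val x Fs \<and>
     (\<forall>val'. (\<forall>\<kappa>. \<not> universal \<kappa> \<longrightarrow> val' \<kappa> = val \<kappa>) \<longrightarrow> \<not> hold (N x) val' x Gs))"
proof
  assume "\<exists>\<alpha>. af.sat1 x \<alpha> \<and> (\<forall>\<beta>. (\<forall>v<size x. \<not> univ x v \<longrightarrow> \<beta> v = \<alpha> v) \<longrightarrow> \<not> af.sat2 x \<beta>)"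
  then obtain \<alpha> where \<alpha>: "af.sat1 x \<alpha>" "\<And>\<beta>. (\<And>v. v < size x \<Longrightarrow> \<not> univ x v \<Longrightarrow> \<beta> v = \<alpha> v) \<Longrightarrow> \<not> af.sat2 x \<beta>"
    by blast
  have "hold (N x) (valuation x \<alpha>) x Fs" using \<alpha>(1) sat_hold(1)[of x \<alpha> "valuation x \<alpha>"] by (simp add: valuation_def)
  moreover have "\<not> hold (N x) val' x Gs" if agree: "\<forall>\<kappa>. \<not> universal \<kappa> \<longrightarrow> val' \<kappa> = valuation x \<alpha> \<kappa>" for val'
  proof -
    \<comment> \<open>All numbers that are not universal keep the value under
      \<open>\<alpha>\<close>, also those that represent no variable.\<close>
    define \<beta> where "\<beta> v = (if univ x v then assignment x val' v else \<alpha> v)" for v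
    have "\<beta> (var x \<kappa> a b c) = val' \<kappa> a b c" if "\<kappa> \<in> kinds" "a < N x" "b < N x" "c < N x" for \<kappa> a b c
      using that agree by (simp add: \<beta>_def univ_var assignment_var valuation_def)
    from sat_hold(2)[of x \<beta> val', OF this] show ?thesis using \<alpha>(2)[of \<beta>] by (simp add: \<beta>_def)
  qed
  ultimately show "\<exists>val. hold (N x) val x Fs \<and>
     (\<forall>val'. (\<forall>\<kappa>. \<not> universal \<kappa> \<longrightarrow> val' \<kappa> = val \<kappa>) \<longrightarrow> \<not> hold (N x) val' x Gs)" by blast
next
  assume "\<exists>val. hold (N x) val x Fs \<and>
     (\<forall>val'. (\<forall>\<kappa>. \<not> universal \<kappa> \<longrightarrow> val' \<kappa> = val \<kappa>) \<longrightarrow> \<not> hold (N x) val' x Gs)"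
  then obtain val where val: "hold (N x) val x Fs"
    "\<And>val'. (\<And>\<kappa>. \<not> universal \<kappa> \<Longrightarrow> val' \<kappa> = val \<kappa>) \<Longrightarrow> \<not> hold (N x) val' x Gs" by blast
  have "af.sat1 x (assignment x val)" using val(1) sat_hold(1)[of x "assignment x val" val] by (simp add: assignment_var)
  moreover have "\<not> af.sat2 x \<beta>" if agree: "\<forall>v<size x. \<not> univ x v \<longrightarrow> \<beta> v = assignment x val v" for \<beta>
  proof -
    define val' where "val' \<kappa> = (if universal \<kappa> then valuation x \<beta> \<kappa> else val \<kappa>)" for \<kappa>
    have "\<beta> (var x \<kappa> a b c) = val' \<kappa> a b c" if \<kappa>: "\<kappa> \<in> kinds" "a < N x" "b < N x" "c < N x" for \<kappa> a b c
      using agree[rule_format, OF var_less[OF \<kappa>(2-4,1)]] \<kappa> by (simp add: val'_def univ_var assignment_var valuation_def)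
    from sat_hold(2)[of x \<beta> val', OF this] show ?thesis using val(2)[of val'] by (simp add: val'_def)
  qed
  ultimately show "\<exists>\<alpha>. af.sat1 x \<alpha> \<and> (\<forall>\<beta>. (\<forall>v<size x. \<not> univ x v \<longrightarrow> \<beta> v = \<alpha> v) \<longrightarrow> \<not> af.sat2 x \<beta>)" by blast
qed

end

section \<open>Numbering the arguments and computing the reduction\<close>

lemma PF_power: "length ws \<le> 2 \<Longrightarrow> PF ws vs f \<Longrightarrow> PF ws vs (\<lambda>s. f s ^ k)"
  by (induction k) (auto intro!: PF_mult PF_const simp: PF_const[of _ _ "Suc 0"])

text \<open>Four single arguments with numbers below 4 are followed by five blocks of
  \<open>n\<close> arguments each. In particular \<open>G\<close> has number 2.\<close>

definition mk :: "nat \<Rightarrow> nat \<Rightarrow> arg" where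
  "mk t v = (if t = 0 then E else if t = 1 then Est else if t = 2 then G else if t = 3 then S else
     if t = 4 then Lit True v else if t = 5 then Lit False v else if t = 6 then Star True v else
     if t = 7 then Star False v else Cl v)"

definition tag :: "nat \<Rightarrow> nat \<Rightarrow> nat" where "tag n i = (if i < 4 then i else 4 + (i - 4) div n)"
definition idx :: "nat \<Rightarrow> nat \<Rightarrow> nat" where "idx n i = (i - 4) mod n"

definition arg_list :: "nat \<Rightarrow> arg list" where
  "arg_list n = map (\<lambda>i. mk (tag n i) (idx n i)) [0..<4 + 5 * n]"

lemma tag_less: "i < 4 + 5 * n \<Longrightarrow> tag n i < 9"
  using less_mult_imp_div_less[of "i - 4" 5 n] by (auto simp: tag_def)

lemma mk_eq: "t < 9 \<Longrightarrow> t' < 9 \<Longrightarrow> mk t v = mk t' v' \<longleftrightarrow> t = t' \<and> (4 \<le> t \<longrightarrow> v = v')"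
proof -
  assume "t < 9" "t' < 9"
  then have "t \<in> {0, 1, 2, 3, 4, 5, 6, 7, 8}" "t' \<in> {0, 1, 2, 3, 4, 5, 6, 7, 8}" by auto
  then show ?thesis by (auto simp: mk_def)
qed

lemma distinct_arg_list: "distinct (arg_list n)"
proof -
  have "i = j" if ij: "i < 4 + 5 * n" "j < 4 + 5 * n" "mk (tag n i) (idx n i) = mk (tag n j) (idx n j)" for i j
  proof -
    have t: "tag n i = tag n j" and v: "4 \<le> tag n i \<longrightarrow> idx n i = idx n j"
      using ij by (simp_all add: mk_eq tag_less)
    show ?thesis
    proof (cases "i < 4 \<or> j < 4")
      case True
      then show ?thesis using t by (auto simp: tag_def split: if_splits)
    next
      case False
      then have "(i - 4) div n = (j - 4) div n" "(i - 4) mod n = (j - 4) mod n"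
        using t v by (auto simp: tag_def idx_def)
      then have "i - 4 = j - 4" by (metis div_mult_mod_eq)
      then show ?thesis using False by auto
    qed
  qed
  then show ?thesis by (auto simp: arg_list_def distinct_map inj_on_def)
qed

lemma set_arg_list: "set (arg_list n) = args n"
proof
  show "set (arg_list n) \<subseteq> args n"
  proof
    fix a assume "a \<in> set (arg_list n)"
    then obtain i where i: "i < 4 + 5 * n" "a = mk (tag n i) (idx n i)" by (auto simp: arg_list_def)
    have "idx n i < n \<or> tag n i < 4" using i(1) by (cases "i < 4") (auto simp: idx_def tag_def)
    then show "a \<in> args n" using i(2) by (auto simp: mk_def)
  qed
  show "args n \<subseteq> set (arg_list n)"
  proof
    fix a assume a: "a \<in> args n"
    have nth: "mk t v \<in> set (arg_list n)" if "t < 9" "v < n \<or> t < 4" for t v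
    proof -
      define i where "i = (if t < 4 then t else 4 + ((t - 4) * n + v))"
      have "tag n i = t" "t < 4 \<or> idx n i = v" using that by (auto simp: tag_def idx_def i_def)
      then have "mk t v = mk (tag n i) (idx n i)" using that(1) by (auto simp: mk_eq)
      moreover have "i < 4 + 5 * n"
      proof (cases "t < 4")
        case False
        then have "(t - 4) * n + v < Suc (t - 4) * n" using that by simp
        also have "\<dots> \<le> 5 * n" using that by (intro mult_le_mono1) simp
        finally show ?thesis using False by (simp add: i_def)
      qed (simp add: i_def)
      ultimately show ?thesis unfolding arg_list_def by simp
    qed
    show "a \<in> set (arg_list n)"
      using a nth[of 0 0] nth[of 1 0] nth[of 2 0] nth[of 3 0] nth[of 4 v for v] nth[of 5 v for v]
        nth[of 6 v for v] nth[of 7 v for v] nth[of 8 v for v]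
      by (cases a; auto simp: mk_def) (metis (full_types))+
  qed
qed

lemma length_arg_list: "length (arg_list n) = 4 + 5 * n"
  by (simp add: arg_list_def)

text \<open>Turns the nested lists of \<open>encode\<close> into one segment whose bits are computed
  from quotient and remainder of the position.\<close>

lemma concat_map_map:
  "concat (map (\<lambda>a. map (P a) [0..<m]) [0..<k]) = map (\<lambda>i. P (i div m) (i mod m)) [0..<k * m]"
proof (induction k)
  case (Suc k)
  have "[0..<Suc k * m] = [0..<k * m] @ map (\<lambda>b. b + k * m) [0..<m]"
    using upt_add_eq_append[OF le0, of "k * m" m] by (simp only: map_add_upt mult_Suc add.commute[of m])
  moreover have "P ((b + k * m) div m) ((b + k * m) mod m) = P k b" if "b < m" for b
    using that by simp
  ultimately show ?case using Suc by simp
qed simp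

context clause_families
begin

lemma PF_N: "PFx (\<lambda>s. N (fst s))" "PFx (\<lambda>s. N (fst s) ^ k)" "PFx (\<lambda>s. size (fst s))"
  unfolding size_def by (intro N(3) PF_power PF_mult PF_const; simp)+

lemma PF_digits:
  assumes "PFx C"
  shows "PFx (\<lambda>s. C s div N (fst s) ^ k)" "PFx (\<lambda>s. C s div N (fst s) ^ k mod N (fst s))"
    "PFx (\<lambda>s. C s div N (fst s) mod N (fst s))" "PFx (\<lambda>s. C s mod N (fst s))"
  by (intro PF_div PF_mod PF_N assms; simp)+

lemma PB_univ: "PFx V \<Longrightarrow> PBx (\<lambda>s. univ (fst s) (V s))"
  unfolding univ_def by (intro PB_bex_list PB_eq PF_digits PF_const) simp_all

lemma PB_second: "PFx C \<Longrightarrow> PBx (\<lambda>s. second (fst s) (C s))"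
  unfolding second_def by (intro PB_le PF_digits PF_const) simp_all

lemma PF_variable: "PFx A \<Longrightarrow> PFx B \<Longrightarrow> PFx C \<Longrightarrow> PFx (\<lambda>s. var (fst s) \<kappa> (A s) (B s) (C s))"
  unfolding var_def by (intro PF_add PF_mult PF_N PF_const) simp_all

lemma PB_applies:
  assumes "J \<in> set (List.enumerate 0 (Fs @ Gs))" and C: "PFx C"
  shows "PBx (\<lambda>s. applies (fst s) (C s) J)"
proof -
  have "snd J \<in> set (Fs @ Gs)" using assms(1) unfolding enumerate_iff using nth_mem by metis
  then have "fam_ok (snd J)" using fams by blast
  then have "fn_ok (\<lambda>x a b c d. of_bool (fst (snd J) x a b c d))" unfolding fam_ok_def by (rule conjunct1)
  note this[unfolded fn_ok_def, rule_format, OF PF_digits(2)[OF C] PF_digits(2)[OF C] PF_digits(3)[OF C] PF_digits(4)[OF C]]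
  then show ?thesis
    unfolding applies_def by (intro PB_conj PB_eq PF_digits PF_const C) simp_all
qed

lemma PB_member:
  assumes "J \<in> set (List.enumerate 0 (Fs @ Gs))" "l \<in> set (snd (snd J))" and C: "PFx C" "PFx V"
  shows "PBx (\<lambda>s. member (fst s) (C s) b (V s) l)"
proof -
  have "snd J \<in> set (Fs @ Gs)" using assms(1) unfolding enumerate_iff using nth_mem by metis
  then have "fam_ok (snd J)" using fams by blast
  moreover obtain sg \<kappa> f g h where lit: "l = (sg, \<kappa>, f, g, h)" by (metis prod.exhaust)
  ultimately have "fn_ok f \<and> fn_ok g \<and> fn_ok h" using assms(2) unfolding fam_ok_def by auto
  then have "PFx (\<lambda>s. \<phi> (fst s) (C s div N (fst s) ^ 3 mod N (fst s)) (C s div N (fst s) ^ 2 mod N (fst s))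
      (C s div N (fst s) mod N (fst s)) (C s mod N (fst s)))" if "\<phi> \<in> {f, g, h}" for \<phi>
    using that PF_digits(2)[OF C(1)] PF_digits(3,4)[OF C(1)] unfolding fn_ok_def by auto
  then show ?thesis
    unfolding member_def lit prod.case by (intro PB_conj PB_eq PB_const PF_variable C) simp_all
qed

lemma PB_has: "PFx C \<Longrightarrow> PFx V \<Longrightarrow> PBx (\<lambda>s. has (fst s) (C s) b (V s))"
  unfolding has_def
  by (intro PB_disj PB_conj PB_not PB_bex_list PB_applies PB_member PB_eq PF_variable PF_const) simp_all

text \<open>Attacks are defined by pattern matching on constructors, so computability is stated for
  constant tags; \<open>PB_att\<close> reaches computed tags by a case distinction over the nine
  values.\<close>

definition att_ok :: "(bool list \<Rightarrow> arg \<Rightarrow> arg \<Rightarrow> bool) \<Rightarrow> bool" where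
  "att_ok P \<longleftrightarrow> (\<forall>t<9. \<forall>u<9. \<forall>V W. PFx V \<longrightarrow> PFx W \<longrightarrow> PBx (\<lambda>s. P (fst s) (mk t (V s)) (mk u (W s))))"

lemma PB_att:
  assumes "att_ok P" "PFx U" "PFx V" "PFx U'" "PFx V'"
    and less: "\<And>s. Q s \<Longrightarrow> U s < 9 \<and> U' s < 9" and Q: "PBx Q"
  shows "PBx (\<lambda>s. Q s \<and> P (fst s) (mk (U s) (V s)) (mk (U' s) (V' s)))"
proof -
  have "PBx (\<lambda>s. Q s \<and> (\<exists>t\<in>set [0..<9]. \<exists>u\<in>set [0..<9]. U s = t \<and> U' s = u \<and> P (fst s) (mk t (V s)) (mk u (V' s))))"
    by (intro PB_conj PB_bex_list PB_eq PF_const assms(2,4) Q assms(1)[unfolded att_ok_def, rule_format, OF _ _ assms(3,5)])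
      simp_all
  moreover have "Q s \<and> (\<exists>t\<in>set [0..<9]. \<exists>u\<in>set [0..<9]. U s = t \<and> U' s = u \<and> P (fst s) (mk t (V s)) (mk u (V' s)))
      \<longleftrightarrow> Q s \<and> P (fst s) (mk (U s) (V s)) (mk (U' s) (V' s))" for s
    using less[of s] by auto
  ultimately show ?thesis by simp
qed

lemma PF_tag: "PFx I \<Longrightarrow> PFx (\<lambda>s. tag (size (fst s)) (I s))" "PFx I \<Longrightarrow> PFx (\<lambda>s. idx (size (fst s)) (I s))"
  unfolding tag_def idx_def by (intro PF_if PB_less PF_add PF_div PF_mod PF_diff PF_const PF_N; simp)+

lemma reduction_computable:
  assumes att: "att_ok att" and lab: "att_ok (\<lambda>x a b. is_in x a)" "att_ok (\<lambda>x a b. is_out x a)"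
    and L: "\<And>x a. a \<in> args (size x) \<Longrightarrow> (L x a = In \<longleftrightarrow> is_in x a) \<and> (L x a = Out \<longleftrightarrow> is_out x a)"
  shows "poly_time_computable (\<lambda>x. encode (arg_list (size x))
    {(a, b). a \<in> args (size x) \<and> b \<in> args (size x) \<and> att x a b} G 1 (L x))"
proof -
  define m where "m x = 4 + 5 * size x" for x
  let ?nth = "\<lambda>x i. mk (tag (size x) i) (idx (size x) i)"
  have nth: "arg_list (size x) = map (?nth x) [0..<m x]" for x by (simp add: arg_list_def m_def)
  have args: "?nth x i \<in> args (size x)" if "i < m x" for x i
    using that unfolding set_arg_list[symmetric] nth by simp
  have G: "?nth x i = G \<longleftrightarrow> i = 2" for x i
    by (auto simp: mk_def tag_def)
  \<comment> \<open>The bits must be computable at every position, also behind the end of the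
    segment. The guards restrict them to positions where the tags are below 9. The last segment is
    the binary code of the distance 1.\<close>
  define gs :: "segment list" where "gs = [(m, \<lambda>s. True), (\<lambda>x. 1, \<lambda>s. False),
    (\<lambda>x. m x * m x, \<lambda>s. snd s < m (fst s) * m (fst s) \<and>
       att (fst s) (?nth (fst s) (snd s div m (fst s))) (?nth (fst s) (snd s mod m (fst s)))),
    (m, \<lambda>s. snd s = 2),
    (\<lambda>x. m x * 2, \<lambda>s. (snd s < m (fst s) * 2 \<and> is_in (fst s) (?nth (fst s) (snd s div 2)) \<and> snd s mod 2 = 0) \<or>
       (snd s < m (fst s) * 2 \<and> is_out (fst s) (?nth (fst s) (snd s div 2)) \<and> snd s mod 2 = 1)),
    (\<lambda>x. 1, \<lambda>s. True)]"
  have pm: "PFx (\<lambda>s. m (fst s))" unfolding m_def by (intro PF_add PF_mult PF_N PF_const; simp)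
  have pm': "PF [\<lambda>x. x] [] m" unfolding m_def[abs_def] size_def by (intro PF_add PF_mult PF_power N PF_const; simp)
  have ps: "PFx snd" by (rule PF_var) simp
  have less: "s < k * m \<Longrightarrow> s div m < k \<and> s mod m < m" for s k m :: nat
    by (cases "m = 0") (auto simp: less_mult_imp_div_less)
  have tag9: "i < m x \<Longrightarrow> tag (size x) i < 9" for x i by (simp add: m_def tag_less)
  have p1: "PBx (\<lambda>s. snd s < m (fst s) * m (fst s) \<and>
       att (fst s) (?nth (fst s) (snd s div m (fst s))) (?nth (fst s) (snd s mod m (fst s))))"
    by (intro PB_att[OF att] PF_tag PF_div PF_mod PB_less PF_mult pm ps)
      (auto dest!: less simp: tag9)
  have p2: "PBx (\<lambda>s. snd s < m (fst s) * 2 \<and> P (fst s) (?nth (fst s) (snd s div 2)))" if "att_ok (\<lambda>x a b. P x a)" for P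
    by (rule PB_att[where P = "\<lambda>x a b. P x a" and U' = "\<lambda>s. 0" and V' = "\<lambda>s. 0", OF that])
      (auto intro!: PF_tag PF_div PF_mod PB_less PF_mult pm ps PF_const dest!: less simp: tag9)
  have p3: "PBx (\<lambda>s. snd s < m (fst s) * 2 \<and> P (fst s) (?nth (fst s) (snd s div 2)) \<and> snd s mod 2 = k)"
    if "att_ok (\<lambda>x a b. P x a)" for P k
  proof -
    have "PBx (\<lambda>s. (snd s < m (fst s) * 2 \<and> P (fst s) (?nth (fst s) (snd s div 2))) \<and> snd s mod 2 = k)"
      by (intro PB_conj p2[OF that] PB_eq PF_mod ps PF_const) simp_all
    then show ?thesis by (simp add: conj_assoc)
  qed
  have "poly_time_computable (\<lambda>x. concat (map (\<lambda>g. emit g x) gs))"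
  proof (rule poly_time_computableI)
    have "\<forall>g\<in>set gs. PF [\<lambda>x. x] [] (fst g) \<and> PBx (snd g)"
      unfolding gs_def list.set ball_simps fst_conv snd_conv
      by (intro conjI TrueI PF_mult pm' PF_const PB_const p1 PB_disj p3 lab PB_eq ps) simp_all
    then show "PF [\<lambda>x. x] [] (fst g) \<and> PBx (snd g)" if "g \<in> set gs" for g using that by (rule bspec)
  qed
  moreover have "concat (map (\<lambda>g. emit g x) gs) = encode (arg_list (size x))
    {(a, b). a \<in> args (size x) \<and> b \<in> args (size x) \<and> att x a b} G 1 (L x)" for x
  proof -
    let ?R = "{(a, b). a \<in> args (size x) \<and> b \<in> args (size x) \<and> att x a b}"
    have 1: "emit (m, \<lambda>s. True) x = replicate (length (arg_list (size x))) True"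
      by (simp add: emit_def length_arg_list m_def map_replicate_const)
    have "concat (map (\<lambda>a. map (\<lambda>b. (a, b) \<in> ?R) (arg_list (size x))) (arg_list (size x))) =
        concat (map (\<lambda>i. map (\<lambda>j. (?nth x i, ?nth x j) \<in> ?R) [0..<m x]) [0..<m x])"
      by (simp add: nth comp_def)
    also have "\<dots> = map (\<lambda>i. (?nth x (i div m x), ?nth x (i mod m x)) \<in> ?R) [0..<m x * m x]"
      by (rule concat_map_map)
    finally have 2: "emit (\<lambda>x. m x * m x, \<lambda>s. snd s < m (fst s) * m (fst s) \<and>
       att (fst s) (?nth (fst s) (snd s div m (fst s))) (?nth (fst s) (snd s mod m (fst s)))) x =
      concat (map (\<lambda>a. map (\<lambda>b. (a, b) \<in> ?R) (arg_list (size x))) (arg_list (size x)))"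
      by (auto simp: emit_def args dest!: less)
    have 3: "emit (m, \<lambda>s. snd s = 2) x = map (\<lambda>a. a = G) (arg_list (size x))"
      by (simp add: emit_def nth G)
    have "concat (map (\<lambda>a. [L x a = In, L x a = Out]) (arg_list (size x))) =
        concat (map (\<lambda>i. map (\<lambda>j. L x (?nth x i) = (if j = 0 then In else Out)) [0..<2]) [0..<m x])"
      by (simp add: nth comp_def upt_conv_Cons)
    also have "\<dots> = map (\<lambda>i. L x (?nth x (i div 2)) = (if i mod 2 = 0 then In else Out)) [0..<m x * 2]"
      by (rule concat_map_map)
    also have "\<dots> = emit (\<lambda>x. m x * 2, \<lambda>s. (snd s < m (fst s) * 2 \<and> is_in (fst s) (?nth (fst s) (snd s div 2)) \<and> snd s mod 2 = 0) \<or>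
       (snd s < m (fst s) * 2 \<and> is_out (fst s) (?nth (fst s) (snd s div 2)) \<and> snd s mod 2 = 1)) x"
      unfolding emit_def fst_conv snd_conv
    proof (rule map_cong[OF refl])
      fix i assume "i \<in> set [0..<m x * 2]"
      then have i: "i < m x * 2" "i div 2 < m x" by auto
      show "(L x (?nth x (i div 2)) = (if i mod 2 = 0 then In else Out)) =
        ((i < m x * 2 \<and> is_in x (?nth x (i div 2)) \<and> i mod 2 = 0) \<or>
        (i < m x * 2 \<and> is_out x (?nth x (i div 2)) \<and> i mod 2 = 1))"
        using i(1) L[OF args[OF i(2)]] by (cases "i mod 2 = 0") simp_all
    qed
    finally have 4: "emit (\<lambda>x. m x * 2, \<lambda>s. (snd s < m (fst s) * 2 \<and> is_in (fst s) (?nth (fst s) (snd s div 2)) \<and> snd s mod 2 = 0) \<or>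
       (snd s < m (fst s) * 2 \<and> is_out (fst s) (?nth (fst s) (snd s div 2)) \<and> snd s mod 2 = 1)) x =
      concat (map (\<lambda>a. [L x a = In, L x a = Out]) (arg_list (size x)))" by (rule sym)
    have 5: "emit (\<lambda>x. 1, \<lambda>s. b) x = [b]" for b by (simp add: emit_def)
    have 6: "binary 1 = [True]" by simp
    show ?thesis unfolding gs_def encode_def 6 by (simp only: list.map concat.simps 1 2 3 4 5 append_Nil2 append_assoc)
  qed
  ultimately show ?thesis by simp
qed

lemma all_less_9: "(\<forall>t<9. P t) \<longleftrightarrow> P 0 \<and> P 1 \<and> P 2 \<and> P 3 \<and> P 4 \<and> P 5 \<and> P 6 \<and> P 7 \<and> P (8 :: nat)"
proof
  assume P: "P 0 \<and> P 1 \<and> P 2 \<and> P 3 \<and> P 4 \<and> P 5 \<and> P 6 \<and> P 7 \<and> P 8"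
  show "\<forall>t<9. P t"
  proof (intro allI impI)
    fix t :: nat assume "t < 9"
    then have "t \<in> {0, 1, 2, 3, 4, 5, 6, 7, 8}" by auto
    then show "P t" using P by auto
  qed
qed auto

lemma att_ok_att1: "att_ok (af.att1)"
  unfolding att_ok_def all_less_9
  by (intro conjI allI impI) (simp_all add: mk_def PF_const PB_const PB_eq PB_has PB_not PB_second del: of_bool_not_iff of_bool_conj of_bool_eq_iff)

lemma att_ok_att2: "att_ok (af.att2)"
  unfolding att_ok_def all_less_9
  by (intro conjI allI impI) (simp_all add: mk_def PF_const PB_const PB_eq PB_conj PB_has PB_not PB_second PB_univ del: of_bool_not_iff of_bool_conj of_bool_eq_iff)

abbreviation auxiliary :: "arg \<Rightarrow> bool" where
  "auxiliary a \<equiv> case a of Lit b v \<Rightarrow> False | Cl c \<Rightarrow> False | _ \<Rightarrow> True"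

lemma att_ok_labels:
  "att_ok (\<lambda>x a b. auxiliary a)" "att_ok (\<lambda>x a b. \<not> auxiliary a)" "att_ok (\<lambda>x a b. a = E)" "att_ok (\<lambda>x a b. af.att2 x E a)"
  unfolding att_ok_def all_less_9
  by (intro conjI allI impI; simp add: mk_def PF_const)+

text \<open>An extension is recovered from its labelling as the set of \<open>In\<close> arguments,
  so positive distance means a different extension.\<close>

lemma question_iff:
  assumes g: "g \<in> A" and fin: "finite A" and L: "extension \<sigma> (A, R) T"
  shows "sf_ex_question \<sigma> (A, R) g 1 (labelling_of (A, R) T) \<longleftrightarrow>
    (\<exists>U. extension \<sigma> (A, R) U \<and> labelling_of (A, R) T g = labelling_of (A, R) U g \<and> U \<noteq> T)"
proof -
  have "1 \<le> distance (A, R) (labelling_of (A, R) T) (labelling_of (A, R) U) \<longleftrightarrow> U \<noteq> T" if U: "extension \<sigma> (A, R) U" for U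
  proof -
    note sub = extension_subset[OF U, unfolded fst_conv] extension_subset[OF L, unfolded fst_conv]
    have "1 \<le> distance (A, R) (labelling_of (A, R) T) (labelling_of (A, R) U) \<longleftrightarrow>
        (\<exists>a\<in>A. labelling_of (A, R) T a \<noteq> labelling_of (A, R) U a)"
      using fin by (auto simp: distance_def Suc_le_eq card_gt_0_iff)
    also have "\<dots> \<longleftrightarrow> U \<noteq> T"
    proof
      assume ne: "U \<noteq> T"
      then obtain a where a: "a \<in> U \<and> a \<notin> T \<or> a \<in> T \<and> a \<notin> U" by blast
      then have "a \<in> A" using sub by blast
      then show "\<exists>a\<in>A. labelling_of (A, R) T a \<noteq> labelling_of (A, R) U a"
        using a labelling_of_In[of a "(A, R)" U] labelling_of_In[of a "(A, R)" T] sub by (intro bexI[of _ a]) auto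
    qed auto
    finally show ?thesis .
  qed
  then show ?thesis unfolding sf_ex_question_def labellings_def by auto
qed

text \<open>One framework serves both semantics: the witness is stable and hence complete, while the
  converse uses only completeness.\<close>

theorem NP_hard:
  assumes \<sigma>: "\<sigma> \<in> {CO, ST}" and X: "\<And>x. x \<in> X \<longleftrightarrow> (\<exists>val. hold (N x) val x Fs)"
  shows "poly_reducible X (SF_EX \<sigma>)"
proof -
  define L where "L x = labelling_of (args (size x), af.R1 x) (af.L1 x)" for x
  have ext: "extension \<sigma> (args (size x), af.R1 x) (af.L1 x)" for x
    using \<sigma> af.L1_stable[of x] by (auto simp: stable_ext_def preferred_ext_def)
  have L1: "a \<in> af.L1 x \<longleftrightarrow> auxiliary a" if "a \<in> args (size x)" for a x
    using that by (cases a) (auto simp: af.L1_def)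
  have lab: "(L x a = In \<longleftrightarrow> auxiliary a) \<and> (L x a = Out \<longleftrightarrow> \<not> auxiliary a)" if a: "a \<in> args (size x)" for x a
  proof -
    have "a \<in> af.L1 x \<or> a \<in> Def (args (size x), af.R1 x) (af.L1 x)"
      using af.L1_stable[of x] a by (auto simp: stable_ext_def)
    then show ?thesis using a by (auto simp: L_def labelling_of_def L1[OF a])
  qed
  have "x \<in> X \<longleftrightarrow> encode (arg_list (size x)) (af.R1 x) G 1 (L x) \<in> SF_EX \<sigma>" for x
  proof -
    have "encode (arg_list (size x)) (af.R1 x) G 1 (L x) \<in> SF_EX \<sigma> \<longleftrightarrow>
      sf_ex_instance \<sigma> (set (arg_list (size x)), af.R1 x) G 1 (L x) \<and>
      sf_ex_question \<sigma> (set (arg_list (size x)), af.R1 x) G 1 (L x)"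
      using af.framework(1)[of x]
      by (intro encode_SF_EX distinct_arg_list) (auto simp: set_arg_list framework_def L_def labelling_of_def)
    also have "\<dots> \<longleftrightarrow> sf_ex_question \<sigma> (args (size x), af.R1 x) G 1 (L x)"
      using ext af.framework(1)[of x] by (auto simp: set_arg_list sf_ex_instance_def L_def labellings_def)
    also have "\<dots> \<longleftrightarrow> (\<exists>T. extension \<sigma> (args (size x), af.R1 x) T \<and> L x G = labelling_of (args (size x), af.R1 x) T G \<and> T \<noteq> af.L1 x)"
      unfolding L_def by (rule question_iff[OF _ finite_args ext]) simp
    also have "\<dots> \<longleftrightarrow> (\<exists>\<alpha>. af.sat1 x \<alpha>)"
    proof
      assume "\<exists>T. extension \<sigma> (args (size x), af.R1 x) T \<and> L x G = labelling_of (args (size x), af.R1 x) T G \<and> T \<noteq> af.L1 x"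
      then obtain T where T: "extension \<sigma> (args (size x), af.R1 x) T" "L x G = labelling_of (args (size x), af.R1 x) T G" "T \<noteq> af.L1 x"
        by blast
      have "L x G = In" using lab[of G x] by simp
      then have "G \<in> T" using T(2) labelling_of_In[of G "(args (size x), af.R1 x)" T] extension_subset[OF T(1)] by simp
      then show "\<exists>\<alpha>. af.sat1 x \<alpha>" using af.complete_sat1[OF extension_complete[OF T(1)]] T(3) by blast
    next
      assume "\<exists>\<alpha>. af.sat1 x \<alpha>"
      then obtain \<alpha> where \<alpha>: "af.sat1 x \<alpha>" ..
      have "0 < size x" using af.exist[of x] by auto
      then obtain T where T: "stable_ext (args (size x), af.R1 x) T" "G \<in> T" "E \<notin> T" using af.sat1_stable[OF \<alpha>] by blast
      have "extension \<sigma> (args (size x), af.R1 x) T" using \<sigma> T(1) by (auto simp: stable_ext_def preferred_ext_def)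
      moreover have "L x G = labelling_of (args (size x), af.R1 x) T G"
        using lab[of G x] T(2) by (simp add: labelling_of_def)
      moreover have "T \<noteq> af.L1 x" using T(3) by (auto simp: af.L1_def)
      ultimately show "\<exists>T. extension \<sigma> (args (size x), af.R1 x) T \<and> L x G = labelling_of (args (size x), af.R1 x) T G \<and> T \<noteq> af.L1 x" by blast
    qed
    also have "\<dots> \<longleftrightarrow> x \<in> X" unfolding X sat1_iff ..
    finally show ?thesis by simp
  qed
  moreover have "poly_time_computable (\<lambda>x. encode (arg_list (size x)) (af.R1 x) G 1 (L x))"
    unfolding af.R1_def by (rule reduction_computable[OF att_ok_att1 att_ok_labels(1,2) lab])
  ultimately show ?thesis unfolding poly_reducible_def by (intro exI conjI allI) assumption+
qed

text \<open>The witness is semi-stable and hence preferred, while the converse uses only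
  preferredness. In the given labelling \<open>G\<close> is undecided; it attacks itself, so
  agreement on \<open>G\<close> means that it is not attacked by the extension.\<close>

theorem Sigma2p_hard:
  assumes \<sigma>: "\<sigma> \<in> {PR, SST}" and X: "\<And>x. x \<in> X \<longleftrightarrow> (\<exists>val. hold (N x) val x Fs \<and>
     (\<forall>val'. (\<forall>\<kappa>. \<not> universal \<kappa> \<longrightarrow> val' \<kappa> = val \<kappa>) \<longrightarrow> \<not> hold (N x) val' x Gs))"
  shows "poly_reducible X (SF_EX \<sigma>)"
proof -
  let ?\<Lambda> = "\<lambda>x. (args (size x), af.R2 x)"
  define L where "L x = labelling_of (?\<Lambda> x) {E}" for x
  have ext: "extension \<sigma> (?\<Lambda> x) {E}" for x
    using \<sigma> af.E_semi_stable[of x] by (auto simp: semi_stable_ext_def)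
  have DE: "a \<in> Def (?\<Lambda> x) {E} \<longleftrightarrow> af.att2 x E a" if "a \<in> args (size x)" for x a
    using that by (simp add: in_Def af.R2_simps)
  have lab: "(L x a = In \<longleftrightarrow> a = E) \<and> (L x a = Out \<longleftrightarrow> af.att2 x E a)" if a: "a \<in> args (size x)" for x a
    using a by (auto simp: L_def labelling_of_def DE)
  have "x \<in> X \<longleftrightarrow> encode (arg_list (size x)) (af.R2 x) G 1 (L x) \<in> SF_EX \<sigma>" for x
  proof -
    have "encode (arg_list (size x)) (af.R2 x) G 1 (L x) \<in> SF_EX \<sigma> \<longleftrightarrow>
      sf_ex_instance \<sigma> (set (arg_list (size x)), af.R2 x) G 1 (L x) \<and>
      sf_ex_question \<sigma> (set (arg_list (size x)), af.R2 x) G 1 (L x)"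
      using af.framework(2)[of x]
      by (intro encode_SF_EX distinct_arg_list) (auto simp: set_arg_list framework_def L_def labelling_of_def)
    also have "\<dots> \<longleftrightarrow> sf_ex_question \<sigma> (?\<Lambda> x) G 1 (L x)"
      using ext af.framework(2)[of x] by (auto simp: set_arg_list sf_ex_instance_def L_def labellings_def)
    also have "\<dots> \<longleftrightarrow> (\<exists>T. extension \<sigma> (?\<Lambda> x) T \<and> L x G = labelling_of (?\<Lambda> x) T G \<and> T \<noteq> {E})"
      unfolding L_def by (rule question_iff[OF _ finite_args ext]) simp
    also have "\<dots> \<longleftrightarrow> (\<exists>\<alpha>. af.sat1 x \<alpha> \<and> (\<forall>\<beta>. (\<forall>v<size x. \<not> univ x v \<longrightarrow> \<beta> v = \<alpha> v) \<longrightarrow> \<not> af.sat2 x \<beta>))"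
    proof
      assume "\<exists>T. extension \<sigma> (?\<Lambda> x) T \<and> L x G = labelling_of (?\<Lambda> x) T G \<and> T \<noteq> {E}"
      then obtain T where T: "extension \<sigma> (?\<Lambda> x) T" "L x G = labelling_of (?\<Lambda> x) T G" "T \<noteq> {E}" by blast
      have pr: "preferred_ext (?\<Lambda> x) T" using \<sigma> T(1) by (auto simp: semi_stable_ext_def)
      have "preferred_ext (?\<Lambda> x) {E}" using af.E_semi_stable[of x] by (simp add: semi_stable_ext_def)
      then have "E \<notin> T" using pr T(3) unfolding preferred_ext_def by blast
      moreover have "G \<notin> Def (?\<Lambda> x) T"
        using T(2) lab[of G x] by (auto simp: labelling_of_def split: if_splits)
      ultimately show "\<exists>\<alpha>. af.sat1 x \<alpha> \<and> (\<forall>\<beta>. (\<forall>v<size x. \<not> univ x v \<longrightarrow> \<beta> v = \<alpha> v) \<longrightarrow> \<not> af.sat2 x \<beta>)"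
        using af.preferred_sat[OF pr] by blast
    next
      assume "\<exists>\<alpha>. af.sat1 x \<alpha> \<and> (\<forall>\<beta>. (\<forall>v<size x. \<not> univ x v \<longrightarrow> \<beta> v = \<alpha> v) \<longrightarrow> \<not> af.sat2 x \<beta>)"
      then obtain \<alpha> where \<alpha>: "af.sat1 x \<alpha>" "\<And>\<beta>. (\<And>v. v < size x \<Longrightarrow> \<not> univ x v \<Longrightarrow> \<beta> v = \<alpha> v) \<Longrightarrow> \<not> af.sat2 x \<beta>" by blast
      obtain T where T: "semi_stable_ext (?\<Lambda> x) T" "G \<notin> Def (?\<Lambda> x) T" "E \<notin> T" using af.sat_semi_stable[OF \<alpha>] by blast
      have e: "extension \<sigma> (?\<Lambda> x) T" using \<sigma> T(1) by (auto simp: semi_stable_ext_def)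
      moreover have "G \<notin> T" using af.no_self[OF extension_complete[OF e]] by blast
      then have "L x G = labelling_of (?\<Lambda> x) T G"
        using T(2) DE[of G x] by (simp add: labelling_of_def L_def)
      moreover have "T \<noteq> {E}" using T(3) by auto
      ultimately show "\<exists>T. extension \<sigma> (?\<Lambda> x) T \<and> L x G = labelling_of (?\<Lambda> x) T G \<and> T \<noteq> {E}" by blast
    qed
    also have "\<dots> \<longleftrightarrow> x \<in> X" unfolding X sat_iff ..
    finally show ?thesis by simp
  qed
  moreover have "poly_time_computable (\<lambda>x. encode (arg_list (size x)) (af.R2 x) G 1 (L x))"
    unfolding af.R2_def by (rule reduction_computable[OF att_ok_att2 att_ok_labels(3,4) lab])
  ultimately show ?thesis unfolding poly_reducible_def by (intro exI conjI allI) assumption+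
qed

end

section \<open>Computability, bounds and existential kinds of the tableau families\<close>

lemma fam_okI:
  assumes "\<And>A B C D. PFx A \<Longrightarrow> PFx B \<Longrightarrow> PFx C \<Longrightarrow> PFx D \<Longrightarrow> PBx (\<lambda>s. P (fst s) (A s) (B s) (C s) (D s))"
    and "\<And>sg \<kappa> f g h. (sg, \<kappa>, f, g, h) \<in> set ls \<Longrightarrow> fn_ok f \<and> fn_ok g \<and> fn_ok h"
  shows "fam_ok (P, ls)"
  using assms unfolding fam_ok_def fn_ok_def by auto

lemma mv_less: "p \<le> 2 * n \<Longrightarrow> mv m p < 2 * n + 3"
  by (cases m) auto

context
  fixes T :: "bool list \<Rightarrow> nat"
  assumes T: "PFx (\<lambda>s. T (fst s))"
begin

lemma fn_ok_simps: "fn_ok v0" "fn_ok vA" "fn_ok vB" "fn_ok vSB" "fn_ok vC" "fn_ok vSC" "fn_ok vD"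
  "fn_ok (\<lambda>x a b c d. Suc a)" "fn_ok (\<lambda>x a b c d. T x)" "fn_ok (\<lambda>x a b c d. T x + c)" "fn_ok (\<lambda>x a b c d. mv m c)"
proof -
  have "PFx C \<Longrightarrow> PFx (\<lambda>s. mv m (C s))" for C
    by (cases m) (simp_all add: PF_diff PF_const PF_Suc del: One_nat_def)
  then show "fn_ok (\<lambda>x a b c d. mv m c)" by (simp add: fn_ok_def)
qed (simp_all add: fn_ok_def PF_const PF_Suc PF_add T)

lemma T2: "PFx (\<lambda>s. 2 * T (fst s))" by (intro PF_mult PF_const T) simp

lemma tab_ok: "F \<in> set (tab g \<Delta> k Q A T) \<Longrightarrow> fam_ok F"
  unfolding tab_def tab1_def tab2_def tab3_def tab4_def tab5_def tab6_def tab7_def tab8_def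
  by (auto intro!: fam_okI PB_conj PB_less PB_le PB_not PB_eq PF_const T T2 simp: fn_ok_simps simp del: of_bool_not_iff of_bool_conj)

lemma start_ok: "F \<in> set (start_fams g k q T) \<Longrightarrow> fam_ok F"
  unfolding start_fams_def
  by (auto intro!: fam_okI PB_conj PB_less PB_le PF_const T T2 simp: fn_ok_simps simp del: of_bool_conj)

lemma main_ok: "F \<in> set (main_fams A yes T) \<Longrightarrow> fam_ok F"
  unfolding main_fams_def
  by (auto intro!: fam_okI PB_conj PB_less PB_le PB_not PB_eq PB_bit[where w = fst] PF_len[where w = fst] PF_diff PF_const T T2
    simp: fn_ok_simps simp del: of_bool_conj of_bool_not_iff de_Morgan_conj not_le not_less)

lemma link_ok: "F \<in> set (link_fams g A T) \<Longrightarrow> fam_ok F"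
  unfolding link_fams_def
  by (auto intro!: fam_okI PB_conj PB_less PB_le PF_const T simp: fn_ok_simps simp del: of_bool_conj)

lemma chain_ok: "F \<in> set (chain_fams no T) \<Longrightarrow> fam_ok F"
  unfolding chain_fams_def
  by (auto intro!: fam_okI PB_conj PB_less PB_le PF_const T simp: fn_ok_simps simp del: of_bool_conj)

lemma tab_bounded: "F \<in> set (tab g \<Delta> k Q A T) \<Longrightarrow> fam_bounded (\<lambda>x. 2 * T x + 3) F"
  unfolding tab_def tab1_def tab2_def tab3_def tab4_def tab5_def tab6_def tab7_def tab8_def
  by (auto simp: fam_bounded_def mv_less)

lemma start_bounded: "F \<in> set (start_fams g k q T) \<Longrightarrow> fam_bounded (\<lambda>x. 2 * T x + 3) F"
  unfolding start_fams_def by (auto simp: fam_bounded_def)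

lemma main_bounded: "F \<in> set (main_fams A yes T) \<Longrightarrow> fam_bounded (\<lambda>x. 2 * T x + 3) F"
  unfolding main_fams_def by (auto simp: fam_bounded_def)

lemma link_bounded: "F \<in> set (link_fams g A T) \<Longrightarrow> fam_bounded (\<lambda>x. 2 * T x + 3) F"
  unfolding link_fams_def by (auto simp: fam_bounded_def)

lemma chain_bounded: "F \<in> set (chain_fams no T) \<Longrightarrow> fam_bounded (\<lambda>x. 2 * T x + 3) F"
  unfolding chain_fams_def by (auto simp: fam_bounded_def)

lemma tab_existential: "F \<in> set (tab g \<Delta> k Q A T) \<Longrightarrow> g < 2 \<Longrightarrow> existential F"
  unfolding tab_def tab1_def tab2_def tab3_def tab4_def tab5_def tab6_def tab7_def tab8_def
  by (auto simp: existential_def)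

lemma start_existential: "F \<in> set (start_fams g k q T) \<Longrightarrow> g < 2 \<Longrightarrow> existential F"
  unfolding start_fams_def by (auto simp: existential_def)

lemma main_existential: "F \<in> set (main_fams A yes T) \<Longrightarrow> existential F"
  unfolding main_fams_def by (auto simp: existential_def)

lemma link_existential: "F \<in> set (link_fams g A T) \<Longrightarrow> g < 2 \<Longrightarrow> existential F"
  unfolding link_fams_def by (auto simp: existential_def)

end

context oracle_tableau
begin

lemma PF_T: "PFx (\<lambda>s. T (fst s))" "PF [\<lambda>x. x] [] T"
  unfolding T_def[abs_def] by (intro PF_poly PF_len; simp)+

lemma N_eq: "N = (\<lambda>x. 2 * T x + 3)"
  by (simp add: N_def fun_eq_iff)

sublocale families: clause_families fams1 fams2 N
proof
  show "fam_ok F \<and> fam_bounded N F" if "F \<in> set (fams1 @ fams2)" for F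
    using that unfolding fams1_def fams2_def N_eq set_append Un_iff
    by (elim disjE) ((rule conjI,
      (rule tab_ok[OF PF_T(1)] start_ok[OF PF_T(1)] main_ok[OF PF_T(1)] link_ok[OF PF_T(1)] chain_ok[OF PF_T(1)],
        assumption),
      (rule tab_bounded[OF PF_T(1)] start_bounded[OF PF_T(1)] main_bounded[OF PF_T(1)] link_bounded[OF PF_T(1)]
        chain_bounded[OF PF_T(1)], assumption))+)
  show "existential F" if "F \<in> set fams1" for F
    using that unfolding fams1_def set_append Un_iff
    by (elim disjE)
      ((rule tab_existential[OF PF_T(1)] start_existential[OF PF_T(1)] main_existential[OF PF_T(1)]
        link_existential[OF PF_T(1)], assumption, simp?)+)
  show "0 < N x" for x by (simp add: N_def)
  show "PF [\<lambda>x. x] [] N" "PFx (\<lambda>s. N (fst s))"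
    unfolding N_eq by (intro PF_add PF_mult PF_const PF_T; simp)+
qed

lemma oracle_reducible: "\<sigma> \<in> {PR, SST} \<Longrightarrow> poly_reducible X (SF_EX \<sigma>)"
  by (rule families.Sigma2p_hard) (use accepts_sat sat_accepts in blast)+

lemma empty_oracle_reducible: "B = {} \<Longrightarrow> \<sigma> \<in> {CO, ST} \<Longrightarrow> poly_reducible X (SF_EX \<sigma>)"
  by (rule families.NP_hard) (use accepts_sat sat_accepts in blast)+

end

section \<open>From machines to hardness\<close>

lemma initial_eq: "initial M x = ini (tape_count M) (start M) x"
  by (simp add: initial_def ini_def)

lemma empty_NP: "{} \<in> NP"
  using NP_I[OF PB_const[of _ _ False]] by simp

lemma NP_oracle_reducible:
  assumes "X \<in> NP_oracle B" "B \<in> NP" "\<sigma> \<in> {PR, SST}"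
  shows "poly_reducible X (SF_EX \<sigma>)"
proof -
  obtain M p where M: "wf_tm M"
    and time: "\<And>x n c. (oracle_step M B ^^ n) (initial M x) c \<Longrightarrow> n \<le> poly p (length x)"
    and dec: "\<And>x. x \<in> X \<longleftrightarrow> (\<exists>c. (oracle_step M B)\<^sup>*\<^sup>* (initial M x) c \<and> halted (oracle_step M B) c \<and> fst c = accept M)"
    using assms(1) unfolding NP_oracle_def decides_in_poly_time_def by blast
  obtain M' :: tm and p' where M': "wf_tm M'"
    and time': "\<And>x n c. (tm_step M' ^^ n) (initial M' x) c \<Longrightarrow> n \<le> poly p' (length x)"
    and dec': "\<And>x. x \<in> B \<longleftrightarrow> (\<exists>c. (tm_step M')\<^sup>*\<^sup>* (initial M' x) c \<and> halted (tm_step M') c \<and> fst c = accept M')"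
    using assms(2) unfolding NP_def decides_in_poly_time_def by blast
  obtain \<Delta> Q A where sim: "simulates \<Delta> (tape_count M) Q A (answered B) (oracle_step M B) (accept M)"
    "\<forall>r\<in>set \<Delta>. flag r \<le> 2" "{0, 1, 2} \<subseteq> set A" "start M \<in> set Q"
    using oracle_tm_simulates[OF M, of B] by blast
  obtain \<Delta>' Q' A' where sim': "simulates \<Delta>' (tape_count M') Q' A' (\<lambda>_ _. True) (tm_step M') (accept M')"
    "{0, 1, 2} \<subseteq> set A'" "start M' \<in> set Q'"
    using tm_simulates[OF M'] by blast
  interpret oracle_tableau X B \<Delta> "tape_count M" Q A "oracle_step M B" "accept M" "start M" p
    \<Delta>' "tape_count M'" Q' A' "tm_step M'" "accept M'" "start M'" p'
    by unfold_locales
      (use M M' sim sim' time dec time' dec' in \<open>simp_all add: initial_eq wf_tm_def\<close>)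
  show ?thesis using assms(3) by (rule oracle_reducible)
qed

text \<open>An ordinary machine is treated as one with the empty oracle: all its rules have flag 0,
  so \<open>answered\<close> holds trivially. The machine for the oracle is one that decides the
  empty language.\<close>

lemma NP_reducible:
  assumes "X \<in> NP" "\<sigma> \<in> {CO, ST}"
  shows "poly_reducible X (SF_EX \<sigma>)"
proof -
  obtain M :: tm and p where M: "wf_tm M"
    and time: "\<And>x n c. (tm_step M ^^ n) (initial M x) c \<Longrightarrow> n \<le> poly p (length x)"
    and dec: "\<And>x. x \<in> X \<longleftrightarrow> (\<exists>c. (tm_step M)\<^sup>*\<^sup>* (initial M x) c \<and> halted (tm_step M) c \<and> fst c = accept M)"
    using assms(1) unfolding NP_def decides_in_poly_time_def by blast
  obtain M' :: tm and p' where M': "wf_tm M'"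
    and time': "\<And>x n c. (tm_step M' ^^ n) (initial M' x) c \<Longrightarrow> n \<le> poly p' (length x)"
    and dec': "\<And>x. x \<in> {} \<longleftrightarrow> (\<exists>c. (tm_step M')\<^sup>*\<^sup>* (initial M' x) c \<and> halted (tm_step M') c \<and> fst c = accept M')"
    using empty_NP unfolding NP_def decides_in_poly_time_def by blast
  obtain \<Delta> Q A where sim0: "simulates \<Delta> (tape_count M) Q A (\<lambda>_ _. True) (tm_step M) (accept M)"
    "\<forall>r\<in>set \<Delta>. flag r = 0" "{0, 1, 2} \<subseteq> set A" "start M \<in> set Q"
    using tm_simulates[OF M] by blast
  have "answered {} r c" if "r \<in> set \<Delta>" for r c using sim0(2) that by (simp add: answered_def)
  then have sim: "simulates \<Delta> (tape_count M) Q A (answered {}) (tm_step M) (accept M)"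
    using sim0(1) unfolding simulates_def by blast
  obtain \<Delta>' Q' A' where sim': "simulates \<Delta>' (tape_count M') Q' A' (\<lambda>_ _. True) (tm_step M') (accept M')"
    "{0, 1, 2} \<subseteq> set A'" "start M' \<in> set Q'"
    using tm_simulates[OF M'] by blast
  interpret oracle_tableau X "{}" \<Delta> "tape_count M" Q A "tm_step M" "accept M" "start M" p
    \<Delta>' "tape_count M'" Q' A' "tm_step M'" "accept M'" "start M'" p'
    by unfold_locales
      (use M M' sim sim0 sim' time dec time' dec' in \<open>simp_all add: initial_eq wf_tm_def\<close>)
  show ?thesis using assms(2) by (rule empty_oracle_reducible[OF refl])
qed

section \<open>Membership\<close>

lemma binary_nth:
  "(\<forall>i<length (binary k). binary k ! i \<longleftrightarrow> k div 2 ^ i mod 2 = 1) \<and> k div 2 ^ length (binary k) = 0 \<and>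
   (binary k = [] \<or> binary k ! (length (binary k) - 1))"
proof (induction k rule: binary.induct)
  case (2 k)
  let ?m = "Suc k div 2"
  have d: "Suc k div 2 ^ Suc i = ?m div 2 ^ i" for i by (simp add: div_mult2_eq)
  have bin: "binary (Suc k) = odd (Suc k) # binary ?m" by simp
  have 1: "binary (Suc k) ! i \<longleftrightarrow> Suc k div 2 ^ i mod 2 = 1" if "i < length (binary (Suc k))" for i
  proof (cases i)
    case 0
    then show ?thesis unfolding bin by (simp del: binary.simps) presburger
  next
    case (Suc j)
    then show ?thesis using 2 that unfolding bin d Suc by (simp del: binary.simps power_Suc)
  qed
  have 2: "Suc k div 2 ^ length (binary (Suc k)) = 0"
    using 2 unfolding bin by (simp only: list.size add_0_right add_Suc_right d)
  have 3: "binary (Suc k) ! (length (binary (Suc k)) - 1)"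
  proof (cases "binary ?m = []")
    case True
    then have "?m = 0" by (cases ?m) (auto simp del: div2_Suc_Suc)
    then have "k = 0" by auto
    then show ?thesis by simp
  next
    case False
    then obtain l where l: "length (binary ?m) = Suc l" by (cases "length (binary ?m)") auto
    then have "binary ?m ! l" using "2.IH" False by simp
    then show ?thesis unfolding bin using l by (simp del: binary.simps)
  qed
  show ?case using 1 2 3 by blast
qed simp

text \<open>The digits start with the least significant one, so the last condition excludes leading
  zeros and with them other codes of the same number.\<close>

lemma binary_unique:
  assumes "\<And>i. i < length bs \<Longrightarrow> bs ! i \<longleftrightarrow> k div 2 ^ i mod 2 = 1" "k div 2 ^ length bs = 0"
    "bs = [] \<or> bs ! (length bs - 1)"
  shows "binary k = bs"
  using assms
proof (induction bs arbitrary: k)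
  case (Cons b bs)
  have d: "k div 2 ^ Suc i = k div 2 div 2 ^ i" for i by (simp add: div_mult2_eq)
  have "k \<noteq> 0"
  proof
    assume "k = 0"
    then show False using Cons.prems(1)[of "length bs"] Cons.prems(3) by simp
  qed
  then obtain m where m: "k = Suc m" by (cases k) auto
  have "binary (k div 2) = bs"
  proof (rule Cons.IH)
    show "bs ! i \<longleftrightarrow> k div 2 div 2 ^ i mod 2 = 1" if "i < length bs" for i
      using Cons.prems(1)[of "Suc i"] that unfolding d by simp
    show "k div 2 div 2 ^ length bs = 0" using Cons.prems(2) by (simp only: list.size add_0_right add_Suc_right d)
    show "bs = [] \<or> bs ! (length bs - 1)" using Cons.prems(3) by (cases bs) auto
  qed
  moreover have "b = odd k" using Cons.prems(1)[of 0] by (simp add: odd_iff_mod_2_eq_one)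
  ultimately show ?case unfolding m binary.simps(2) by simp
qed simp

lemma encode_flat:
  "encode [0..<n] R g k L = replicate n True @ [False] @ map (\<lambda>i. (i div n, i mod n) \<in> R) [0..<n * n] @
     map (\<lambda>i. i = g) [0..<n] @ map (\<lambda>i. L (i div 2) = (if i mod 2 = 0 then In else Out)) [0..<n * 2] @ binary k"
proof -
  have "concat (map (\<lambda>a. [L a = In, L a = Out]) [0..<n]) =
      concat (map (\<lambda>i. map (\<lambda>j. L i = (if j = 0 then In else Out)) [0..<2]) [0..<n])"
    by (simp add: upt_conv_Cons)
  also have "\<dots> = map (\<lambda>i. L (i div 2) = (if i mod 2 = 0 then In else Out)) [0..<n * 2]"
    by (rule concat_map_map)
  finally show ?thesis
    unfolding encode_def concat_map_map[of "\<lambda>a b. (a, b) \<in> R"] by simp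
qed

text \<open>The input is given by its bits \<open>inp\<close> and its length because it is the second half of the word that
  the oracle receives.\<close>

definition attack :: "(nat \<Rightarrow> bool) \<Rightarrow> nat \<Rightarrow> nat \<Rightarrow> nat \<Rightarrow> bool" where
  "attack inp n i j \<longleftrightarrow> inp (n + 1 + (i * n + j))"

definition is_in :: "(nat \<Rightarrow> bool) \<Rightarrow> nat \<Rightarrow> nat \<Rightarrow> bool" where
  "is_in inp n i \<longleftrightarrow> inp (n + 1 + n * n + n + i * 2)"

definition is_out :: "(nat \<Rightarrow> bool) \<Rightarrow> nat \<Rightarrow> nat \<Rightarrow> bool" where
  "is_out inp n i \<longleftrightarrow> inp (n + 1 + n * n + n + i * 2 + 1)"

text \<open>Follows the layout of \<open>encode\<close>: \<open>n\<close> ones and a zero, the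
  matrix, the goal vector, two bits per argument, and \<open>k\<close> in binary, whose last digit
  must be one if there is any. The parameters \<open>n\<close>, \<open>g\<close> and
  \<open>k\<close> are searched for instead of being parsed.\<close>

definition code_ok :: "nat \<Rightarrow> (nat \<Rightarrow> bool) \<Rightarrow> nat \<Rightarrow> nat \<Rightarrow> nat \<Rightarrow> bool" where
  "code_ok len inp n g k \<longleftrightarrow> (\<forall>i<n. inp i) \<and> \<not> inp n \<and>
     (\<forall>i<n. inp (n + 1 + n * n + i) \<longleftrightarrow> i = g) \<and> (\<forall>i<n. \<not> (is_in inp n i \<and> is_out inp n i)) \<and>
     n + 1 + n * n + n + n * 2 \<le> len \<and>
     (\<forall>i<len - (n + 1 + n * n + n + n * 2). inp (n + 1 + n * n + n + n * 2 + i) \<longleftrightarrow> k div 2 ^ i mod 2 = 1) \<and>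
     k div 2 ^ (len - (n + 1 + n * n + n + n * 2)) = 0 \<and>
     (len = n + 1 + n * n + n + n * 2 \<or> inp (len - 1))"

definition attacks :: "(nat \<Rightarrow> bool) \<Rightarrow> nat \<Rightarrow> (nat \<times> nat) set" where
  "attacks inp n = {(i, j). i < n \<and> j < n \<and> attack inp n i j}"

definition label :: "(nat \<Rightarrow> bool) \<Rightarrow> nat \<Rightarrow> nat \<Rightarrow> label" where
  "label inp n = (\<lambda>i\<in>{0..<n}. if is_in inp n i then In else if is_out inp n i then Out else Und)"

lemma code_ok_encode:
  assumes "code_ok (length x) (bit x) n g k"
  shows "x = encode [0..<n] (attacks (bit x) n) g k (label (bit x) n)"
proof -
  note ok = assms[unfolded code_ok_def]
  define P where "P = n + 1 + n * n + n + n * 2"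
  have len: "P \<le> length x" using ok by (simp add: P_def)
  have bit: "bit x i \<longleftrightarrow> x ! i" if "i < length x" for i using that by (simp add: bit_def)
  have "binary k = drop P x"
  proof (rule binary_unique)
    show "drop P x ! i \<longleftrightarrow> k div 2 ^ i mod 2 = 1" if "i < length (drop P x)" for i
      using ok that bit[of "P + i"] len unfolding P_def[symmetric] by simp
    show "k div 2 ^ length (drop P x) = 0" using ok unfolding P_def[symmetric] by simp
    show "drop P x = [] \<or> drop P x ! (length (drop P x) - 1)"
      using ok bit[of "length x - 1"] len unfolding P_def[symmetric]
      by (cases "length x = P") (auto simp: bit_def)
  qed
  moreover have "take P x = replicate n True @ [False] @ map (\<lambda>i. (i div n, i mod n) \<in> attacks (bit x) n) [0..<n * n] @
     map (\<lambda>i. i = g) [0..<n] @ map (\<lambda>i. label (bit x) n (i div 2) = (if i mod 2 = 0 then In else Out)) [0..<n * 2]"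
    (is "_ = ?r")
  proof (rule nth_equalityI)
    show "length (take P x) = length ?r" using len by (simp add: P_def)
    fix i assume i: "i < length (take P x)"
    then have nth: "take P x ! i = bit x i" by (simp add: bit_def)
    consider "i < n" | "i = n" | m where "i = n + 1 + m" "m < n * n" | m where "i = n + 1 + n * n + m" "m < n"
      | m where "i = n + 1 + n * n + n + m" "m < n * 2"
    proof -
      assume c: "i < n \<Longrightarrow> thesis" "i = n \<Longrightarrow> thesis" "\<And>m. i = n + 1 + m \<Longrightarrow> m < n * n \<Longrightarrow> thesis"
        "\<And>m. i = n + 1 + n * n + m \<Longrightarrow> m < n \<Longrightarrow> thesis" "\<And>m. i = n + 1 + n * n + n + m \<Longrightarrow> m < n * 2 \<Longrightarrow> thesis"
      have "i < P" using i by simp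
      then show thesis
        using c(1,2) c(3)[of "i - (n + 1)"] c(4)[of "i - (n + 1 + n * n)"] c(5)[of "i - (n + 1 + n * n + n)"]
        unfolding P_def by linarith
    qed
    then show "take P x ! i = ?r ! i"
    proof cases
      case 1
      then show ?thesis using ok nth by (simp add: nth_append)
    next
      case 2
      then show ?thesis using ok nth by (simp add: nth_append)
    next
      case (3 m)
      have "m div n < n" "m mod n < n" using 3(2) by (auto simp: less_mult_imp_div_less) (metis mod_less_divisor mult_is_0 not_gr_zero not_less_zero)
      then show ?thesis using 3 nth by (simp add: nth_append attacks_def attack_def)
    next
      case (4 m)
      then show ?thesis using ok nth by (simp add: nth_append)
    next
      case (5 m)
      have m: "m div 2 < n" using 5(2) by auto
      then have no: "\<not> (is_in (bit x) n (m div 2) \<and> is_out (bit x) n (m div 2))" using ok by blast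
      have eq: "m = m div 2 * 2 + m mod 2" by simp
      show ?thesis
      proof (cases "m mod 2 = 0")
        case True
        then have "is_in (bit x) n (m div 2) = bit x i" using eq 5(1) by (simp add: is_in_def)
        then show ?thesis using 5 nth True m by (simp add: nth_append label_def)
      next
        case False
        then have "n + 1 + n * n + n + m div 2 * 2 + 1 = i" using eq 5(1) by linarith
        then have "is_out (bit x) n (m div 2) = bit x i" unfolding is_out_def by simp
        then show ?thesis using 5 nth False no m by (auto simp add: nth_append label_def)
      qed
    qed
  qed
  ultimately show ?thesis unfolding encode_flat using append_take_drop_id[of P x] by simp
qed

lemma encode_code_ok:
  assumes "x = encode [0..<n] R g k L"
  shows "code_ok (length x) (bit x) n g k"
proof -
  define P where "P = n + 1 + n * n + n + n * 2"
  note x = assms[unfolded encode_flat]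
  have len: "length x = P + length (binary k)" unfolding x P_def by simp
  have bit: "bit x i \<longleftrightarrow> x ! i" if "i < P" for i using that len by (simp add: bit_def)
  have 1: "bit x i" if "i < n" for i using that bit[of i] by (simp add: P_def x nth_append)
  have 2: "\<not> bit x n" using bit[of n] by (simp add: P_def x nth_append)
  have 3: "bit x (n + 1 + n * n + i) \<longleftrightarrow> i = g" if "i < n" for i
    using bit[of "n + 1 + n * n + i"] that by (simp add: P_def x nth_append)
  have 4: "bit x (n + 1 + n * n + n + i) \<longleftrightarrow> L (i div 2) = (if i mod 2 = 0 then In else Out)" if "i < n * 2" for i
    using bit[of "n + 1 + n * n + n + i"] that by (simp add: P_def x nth_append)
  have 5: "bit x (P + i) \<longleftrightarrow> binary k ! i" if "i < length (binary k)" for i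
  proof -
    have "x ! (P + i) = binary k ! i" by (simp add: P_def x nth_append)
    then show ?thesis using that len by (simp add: bit_def)
  qed
  have 6: "\<not> (is_in (bit x) n i \<and> is_out (bit x) n i)" if "i < n" for i
  proof -
    have "(i * 2 + 1) mod 2 = 1" "(i * 2 + 1) div 2 = i" "n + 1 + n * n + n + (i * 2 + 1) = n + 1 + n * n + n + i * 2 + 1"
      by presburger+
    then show ?thesis
      using 4[of "i * 2"] 4[of "i * 2 + 1"] that unfolding is_in_def is_out_def by auto
  qed
  have 7: "length x = P \<or> bit x (length x - 1)"
  proof (cases "binary k = []")
    case False
    then have "length x - 1 = P + (length (binary k) - 1)" "length (binary k) - 1 < length (binary k)"
      unfolding len by (simp_all add: Suc_le_eq)
    then show ?thesis using 5 binary_nth[of k] False by metis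
  qed (simp add: len)
  show ?thesis
    unfolding code_ok_def P_def[symmetric]
  proof (intro conjI allI impI)
    fix i assume i: "i < length x - P"
    then have "i < length (binary k)" using len by simp
    then show "bit x (P + i) \<longleftrightarrow> k div 2 ^ i mod 2 = 1" using 5 binary_nth[of k] by blast
  next
    show "k div 2 ^ (length x - P) = 0" using binary_nth[of k] len by simp
  qed (use 1 2 3 6 7 len in simp_all)
qed

definition AF :: "(nat \<Rightarrow> bool) \<Rightarrow> nat \<Rightarrow> nat framework" where
  "AF inp n = ({0..<n}, attacks inp n)"

lemma SF_EX_code:
  "x \<in> SF_EX \<sigma> \<longleftrightarrow> (\<exists>n g k. code_ok (length x) (bit x) n g k \<and> sf_ex_instance \<sigma> (AF (bit x) n) g k (label (bit x) n)
     \<and> sf_ex_question \<sigma> (AF (bit x) n) g k (label (bit x) n))"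
proof
  assume "x \<in> SF_EX \<sigma>"
  then obtain n R g k L where x: "x = encode [0..<n] R g k L"
    and inst: "sf_ex_instance \<sigma> ({0..<n}, R) g k L" "sf_ex_question \<sigma> ({0..<n}, R) g k L"
    unfolding SF_EX_upt by metis
  have ok: "code_ok (length x) (bit x) n g k" using encode_code_ok[OF x] .
  note enc = encode_inject[OF trans[OF x[symmetric] code_ok_encode[OF ok]]]
  have R: "R \<subseteq> {0..<n} \<times> {0..<n}" and L: "L \<in> labellings \<sigma> ({0..<n}, R)"
    using inst(1) by (simp_all add: sf_ex_instance_def framework_def)
  have "(i, j) \<in> R \<longleftrightarrow> (i, j) \<in> attacks (bit x) n" if "i < n" "j < n" for i j using enc(2)[of i j] that by simp
  then have "R = attacks (bit x) n" using R by (auto simp: attacks_def)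
  moreover have "L = label (bit x) n"
  proof (rule extensionalityI)
    show "L \<in> extensional {0..<n}" using L by (auto simp: labellings_def labelling_of_def)
    show "label (bit x) n \<in> extensional {0..<n}" by (simp add: label_def)
    show "L i = label (bit x) n i" if "i \<in> {0..<n}" for i using enc(4)[of i] that by simp
  qed
  ultimately show "\<exists>n g k. code_ok (length x) (bit x) n g k \<and> sf_ex_instance \<sigma> (AF (bit x) n) g k (label (bit x) n)
     \<and> sf_ex_question \<sigma> (AF (bit x) n) g k (label (bit x) n)"
    using ok inst unfolding AF_def by blast
next
  assume "\<exists>n g k. code_ok (length x) (bit x) n g k \<and> sf_ex_instance \<sigma> (AF (bit x) n) g k (label (bit x) n)
     \<and> sf_ex_question \<sigma> (AF (bit x) n) g k (label (bit x) n)"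
  then show "x \<in> SF_EX \<sigma>" unfolding SF_EX_upt AF_def using code_ok_encode by metis
qed

text \<open>The goal must be below the number of arguments because otherwise its vector is empty of
  ones and does not determine it.\<close>

lemma code_ok_unique:
  assumes "code_ok (length x) (bit x) n g k" "g < n" "code_ok (length x) (bit x) m h l" "h < m"
  shows "m = n \<and> h = g \<and> l = k"
proof -
  note enc = encode_inject[OF trans[OF code_ok_encode[OF assms(3), symmetric] code_ok_encode[OF assms(1)]]]
  have "m = n" using enc(1) by simp
  moreover have "h = g" using enc(3)[of h] assms calculation by simp
  ultimately show ?thesis using enc(5) by simp
qed

subsection \<open>Extensions as predicates\<close>

definition attacked :: "(nat \<Rightarrow> bool) \<Rightarrow> nat \<Rightarrow> (nat \<Rightarrow> bool) \<Rightarrow> nat \<Rightarrow> bool" where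
  "attacked inp n C i \<longleftrightarrow> (\<exists>j<n. C j \<and> attack inp n j i)"

definition is_complete :: "(nat \<Rightarrow> bool) \<Rightarrow> nat \<Rightarrow> (nat \<Rightarrow> bool) \<Rightarrow> bool" where
  "is_complete inp n C \<longleftrightarrow> (\<forall>i<n. (C i \<longrightarrow> \<not> attacked inp n C i) \<and>
     (C i \<longleftrightarrow> (\<forall>j<n. attack inp n j i \<longrightarrow> attacked inp n C j)))"

definition ext :: "nat \<Rightarrow> (nat \<Rightarrow> bool) \<Rightarrow> nat set" where
  "ext n C = {i. i < n \<and> C i}"

lemma in_ext: "i \<in> ext n C \<longleftrightarrow> i < n \<and> C i"
  by (simp add: ext_def)

lemma fst_AF [simp]: "fst (AF inp n) = {0..<n}"
  by (simp add: AF_def)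

lemma framework_AF: "framework (AF inp n)"
  by (auto simp: AF_def framework_def attacks_def)

lemma Def_ext: "Def (AF inp n) (ext n C) = ext n (attacked inp n C)"
  by (auto simp: AF_def in_Def ext_def attacked_def attacks_def)

lemma complete_ext_iff: "complete_ext (AF inp n) (ext n C) \<longleftrightarrow> is_complete inp n C"
proof -
  let ?K = "\<lambda>i. \<forall>j<n. attack inp n j i \<longrightarrow> attacked inp n C j"
  have "a \<in> Acc (AF inp n) X \<longleftrightarrow> a < n \<and> (\<forall>b<n. attack inp n b a \<longrightarrow> b \<in> Def (AF inp n) X)" for a X
    unfolding AF_def in_Acc by (auto simp: attacks_def)
  then have Acc: "Acc (AF inp n) (ext n C) = ext n ?K"
    by (auto simp: Def_ext in_ext)
  have 1: "ext n C \<subseteq> {0..<n}" by (auto simp: ext_def)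
  have 2: "ext n C \<inter> ext n X = {} \<longleftrightarrow> (\<forall>i<n. C i \<longrightarrow> \<not> X i)" for X by (auto simp: ext_def)
  have 3: "ext n C = ext n X \<longleftrightarrow> (\<forall>i<n. C i \<longleftrightarrow> X i)" for X by (auto simp: ext_def)
  have 4: "(p \<and> q \<and> X \<subseteq> Y) \<and> X = Y \<longleftrightarrow> q \<and> X = Y" if p for p q and X Y :: "nat set"
    using that by blast
  have 5: "(\<forall>i<n. P i \<and> Q i) \<longleftrightarrow> (\<forall>i<n. P i) \<and> (\<forall>i<n. Q i)" for P Q by blast
  have "is_complete inp n C \<longleftrightarrow> (\<forall>i<n. C i \<longrightarrow> \<not> attacked inp n C i) \<and> ext n C = ext n ?K"
    unfolding is_complete_def 3 5 ..
  then show ?thesis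
    unfolding complete_ext_def admissible_def conflict_free_def Acc Def_ext fst_AF 2 by (simp only: 4[OF 1])
qed

lemma ext_bits: "T \<subseteq> {0..<n} \<Longrightarrow> n \<le> m \<Longrightarrow> \<exists>y. length y = m \<and> ext n (bit y) = T"
  by (intro exI[of _ "map (\<lambda>i. i \<in> T) [0..<m]"]) (auto simp: ext_def bit_def)

definition agree :: "(nat \<Rightarrow> bool) \<Rightarrow> nat \<Rightarrow> (nat \<Rightarrow> bool) \<Rightarrow> nat \<Rightarrow> bool" where
  "agree inp n C i \<longleftrightarrow> (is_in inp n i \<longleftrightarrow> C i) \<and> (is_out inp n i \<longleftrightarrow> attacked inp n C i)"

text \<open>All that can be tested in polynomial time for every semantics: the code, completeness of
  both extensions, the given labelling, the goal and the distance. Only totality or maximality is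
  left.\<close>

definition base :: "nat \<Rightarrow> (nat \<Rightarrow> bool) \<Rightarrow> nat \<Rightarrow> nat \<Rightarrow> nat \<Rightarrow> (nat \<Rightarrow> bool) \<Rightarrow> bool" where
  "base len inp n g k C \<longleftrightarrow> code_ok len inp n g k \<and> is_complete inp n (is_in inp n) \<and>
     (\<forall>i<n. is_out inp n i \<longleftrightarrow> attacked inp n (is_in inp n) i) \<and> is_complete inp n C \<and> agree inp n C g \<and>
     k \<le> (\<Sum>i<n. of_bool (\<not> agree inp n C i))"

lemma label_agree:
  assumes "\<And>i. i < n \<Longrightarrow> \<not> (is_in inp n i \<and> is_out inp n i)" "is_complete inp n C" "i < n"
  shows "label inp n i = labelling_of (AF inp n) (ext n C) i \<longleftrightarrow> agree inp n C i"
proof -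
  have 1: "i \<in> Def (AF inp n) (ext n C) \<longleftrightarrow> attacked inp n C i" unfolding Def_ext using assms(3) by (simp add: ext_def)
  have 2: "i \<in> ext n C \<longleftrightarrow> C i" using assms(3) by (simp add: ext_def)
  have 3: "C i \<longrightarrow> \<not> attacked inp n C i" using assms(2,3) by (simp add: is_complete_def)
  show ?thesis
    using assms(1)[OF assms(3)] assms(3) 3 by (auto simp: label_def labelling_of_def 1 2 agree_def)
qed

lemma distance_agree:
  assumes "\<And>i. i < n \<Longrightarrow> \<not> (is_in inp n i \<and> is_out inp n i)" "is_complete inp n C"
  shows "distance (AF inp n) (label inp n) (labelling_of (AF inp n) (ext n C)) = (\<Sum>i<n. of_bool (\<not> agree inp n C i))"
proof -
  have "{i \<in> {0..<n}. label inp n i \<noteq> labelling_of (AF inp n) (ext n C) i} = {i \<in> {..<n}. \<not> agree inp n C i}"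
    using label_agree[OF assms] by auto
  moreover have "(\<Sum>i<n. of_bool (\<not> agree inp n C i)) = card {i \<in> {..<n}. \<not> agree inp n C i}"
    by (simp add: sum.If_cases of_bool_def if_distrib Int_def cong: if_cong)
  ultimately show ?thesis by (simp add: distance_def)
qed

text \<open>The certificate is read through \<open>F\<close> because the oracle will see it as a
  prefix of \<open>y @ x\<close>. The search is polynomial although \<open>k\<close> is written in
  binary: no distance exceeds \<open>n\<close>, so a larger \<open>k\<close> makes the answer
  negative.\<close>

lemma SF_EX_base:
  assumes F: "\<And>n y. n \<le> length x \<Longrightarrow> length y = length x \<Longrightarrow> ext n (F y) = ext n (bit y)"
  shows "x \<in> SF_EX \<sigma> \<longleftrightarrow> (\<exists>y. length y = length x \<and> (\<exists>n<Suc (length x). \<exists>g<n. \<exists>k<Suc n.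
     base (length x) (bit x) n g k (F y) \<and> extension \<sigma> (AF (bit x) n) (ext n (is_in (bit x) n)) \<and>
     extension \<sigma> (AF (bit x) n) (ext n (F y))))" (is "_ \<longleftrightarrow> ?R")
proof
  assume "x \<in> SF_EX \<sigma>"
  then obtain n g k where ok: "code_ok (length x) (bit x) n g k" and inst: "sf_ex_instance \<sigma> (AF (bit x) n) g k (label (bit x) n)"
    and quest: "sf_ex_question \<sigma> (AF (bit x) n) g k (label (bit x) n)"
    unfolding SF_EX_code by blast
  have no: "\<not> (is_in (bit x) n i \<and> is_out (bit x) n i)" if "i < n" for i using ok that by (simp add: code_ok_def)
  have n: "n \<le> length x" using ok by (simp add: code_ok_def)
  obtain T where T: "extension \<sigma> (AF (bit x) n) T" "label (bit x) n = labelling_of (AF (bit x) n) T"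
    using inst by (auto simp: sf_ex_instance_def labellings_def)
  obtain U where U: "extension \<sigma> (AF (bit x) n) U" "label (bit x) n g = labelling_of (AF (bit x) n) U g"
    "k \<le> distance (AF (bit x) n) (label (bit x) n) (labelling_of (AF (bit x) n) U)"
    using quest by (auto simp: sf_ex_question_def labellings_def)
  have g: "g < n" using inst by (simp add: sf_ex_instance_def)
  have "i \<in> T \<longleftrightarrow> is_in (bit x) n i" if "i < n" for i
    using that labelling_of_In[of i "AF (bit x) n" T] extension_subset[OF T(1)] unfolding T(2)[symmetric]
    by (auto simp: label_def split: if_splits)
  then have T_eq: "T = ext n (is_in (bit x) n)"
    using extension_subset[OF T(1)] by (auto simp: ext_def)
  have cT: "is_complete (bit x) n (is_in (bit x) n)"
    using extension_complete[OF T(1)] by (simp add: T_eq complete_ext_iff)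
  obtain y where y: "length y = length x" "ext n (bit y) = U"
    using ext_bits[of U n "length x"] extension_subset[OF U(1)] n by auto
  have "ext n (F y) = U" using F[OF n y(1)] y(2) by simp
  note U = U[folded this]
  have cU: "is_complete (bit x) n (F y)"
    using extension_complete[OF U(1)] by (simp add: complete_ext_iff)
  have "agree (bit x) n (is_in (bit x) n) i" if "i < n" for i
    using label_agree[OF no cT that] T(2) T_eq by simp
  moreover have "agree (bit x) n (F y) g"
    using label_agree[OF no cU g] U(2) by simp
  moreover have "k \<le> (\<Sum>i<n. of_bool (\<not> agree (bit x) n (F y) i))"
    using distance_agree[OF no cU] U(3) by simp
  ultimately have b: "base (length x) (bit x) n g k (F y)"
    using ok cT cU by (simp add: base_def agree_def[of _ _ "is_in (bit x) n"])
  have "(\<Sum>i<n. of_bool (\<not> agree (bit x) n (F y) i)) \<le> (\<Sum>i<n. 1 :: nat)" by (intro sum_mono) simp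
  then have "k < Suc n" using \<open>k \<le> (\<Sum>i<n. _)\<close> by simp
  then show ?R using y(1) n g b T(1) U(1) unfolding T_eq by (metis le_imp_less_Suc)
next
  assume ?R
  then obtain y n g k where b: "base (length x) (bit x) n g k (F y)" and g: "g < n"
    and T: "extension \<sigma> (AF (bit x) n) (ext n (is_in (bit x) n))" and U: "extension \<sigma> (AF (bit x) n) (ext n (F y))"
    by blast
  have ok: "code_ok (length x) (bit x) n g k" using b by (simp add: base_def)
  then have no: "\<not> (is_in (bit x) n i \<and> is_out (bit x) n i)" if "i < n" for i using that by (simp add: code_ok_def)
  have cT: "is_complete (bit x) n (is_in (bit x) n)" and cU: "is_complete (bit x) n (F y)" using b by (simp_all add: base_def)
  have "label (bit x) n = labelling_of (AF (bit x) n) (ext n (is_in (bit x) n))"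
  proof (rule extensionalityI)
    show "label (bit x) n \<in> extensional {0..<n}" by (simp add: label_def)
    show "labelling_of (AF (bit x) n) (ext n (is_in (bit x) n)) \<in> extensional {0..<n}" by (simp add: labelling_of_def)
    show "label (bit x) n i = labelling_of (AF (bit x) n) (ext n (is_in (bit x) n)) i" if "i \<in> {0..<n}" for i
      using label_agree[OF no cT, of i] that b by (simp add: base_def agree_def)
  qed
  then have "sf_ex_instance \<sigma> (AF (bit x) n) g k (label (bit x) n)"
    using framework_AF g T by (auto simp: sf_ex_instance_def labellings_def)
  moreover have "sf_ex_question \<sigma> (AF (bit x) n) g k (label (bit x) n)"
    unfolding sf_ex_question_def
  proof (intro bexI conjI)
    show "labelling_of (AF (bit x) n) (ext n (F y)) \<in> labellings \<sigma> (AF (bit x) n)"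
      using U by (auto simp: labellings_def)
    show "label (bit x) n g = labelling_of (AF (bit x) n) (ext n (F y)) g"
      using label_agree[OF no cU g] b by (simp add: base_def)
    show "k \<le> distance (AF (bit x) n) (label (bit x) n) (labelling_of (AF (bit x) n) (ext n (F y)))"
      using distance_agree[OF no cU] b by (simp add: base_def)
  qed
  ultimately show "x \<in> SF_EX \<sigma>" unfolding SF_EX_code using ok by blast
qed

lemma range_ext: "ext n C \<union> Def (AF inp n) (ext n C) = ext n (\<lambda>i. C i \<or> attacked inp n C i)"
  unfolding Def_ext by (rule set_eqI) (simp add: in_ext conj_disj_distribL)

definition total :: "(nat \<Rightarrow> bool) \<Rightarrow> nat \<Rightarrow> (nat \<Rightarrow> bool) \<Rightarrow> bool" where
  "total inp n C \<longleftrightarrow> (\<forall>i<n. C i \<or> attacked inp n C i)"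

lemma stable_total: "stable_ext (AF inp n) (ext n C) \<longleftrightarrow> is_complete inp n C \<and> total inp n C"
proof -
  have "ext n X = {0..<n} \<longleftrightarrow> (\<forall>i<n. X i)" for X
    unfolding set_eq_iff in_ext by auto
  then have *: "ext n C \<union> Def (AF inp n) (ext n C) = fst (AF inp n) \<longleftrightarrow> total inp n C"
    unfolding range_ext fst_AF total_def .
  have "stable_ext \<Lambda> T \<longleftrightarrow> complete_ext \<Lambda> T \<and> T \<union> Def \<Lambda> T = fst \<Lambda>" for \<Lambda> :: "nat framework" and T
    using stableI[of \<Lambda> T] by (auto simp: stable_ext_def preferred_ext_def)
  then show ?thesis by (simp only: * complete_ext_iff)
qed

text \<open>A complete extension is included in a preferred one, whose range is no smaller.
  Conversely, if a larger complete set had no larger range, each of its new members would be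
  attacked by \<open>C\<close> and hence by the set itself.\<close>

lemma semi_stable_iff:
  assumes "framework \<Lambda>"
  shows "semi_stable_ext \<Lambda> C \<longleftrightarrow> complete_ext \<Lambda> C \<and> \<not> (\<exists>T. complete_ext \<Lambda> T \<and> C \<union> Def \<Lambda> C \<subset> T \<union> Def \<Lambda> T)"
proof
  assume C: "semi_stable_ext \<Lambda> C"
  have "\<not> C \<union> Def \<Lambda> C \<subset> T \<union> Def \<Lambda> T" if T: "complete_ext \<Lambda> T" for T
  proof
    assume less: "C \<union> Def \<Lambda> C \<subset> T \<union> Def \<Lambda> T"
    obtain U where "preferred_ext \<Lambda> U" "T \<subseteq> U"
      using admissible_preferred[OF assms, of T] T by (auto simp: complete_ext_def)
    then show False using C less range_subset[of T U \<Lambda>] unfolding semi_stable_ext_def by blast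
  qed
  then show "complete_ext \<Lambda> C \<and> \<not> (\<exists>T. complete_ext \<Lambda> T \<and> C \<union> Def \<Lambda> C \<subset> T \<union> Def \<Lambda> T)"
    using C by (auto simp: semi_stable_ext_def preferred_ext_def)
next
  assume C: "complete_ext \<Lambda> C \<and> \<not> (\<exists>T. complete_ext \<Lambda> T \<and> C \<union> Def \<Lambda> C \<subset> T \<union> Def \<Lambda> T)"
  have "\<not> C \<subset> T" if T: "complete_ext \<Lambda> T" for T
  proof
    assume "C \<subset> T"
    then obtain a where a: "a \<in> T" "a \<notin> C" by blast
    have "T \<union> Def \<Lambda> T \<subseteq> C \<union> Def \<Lambda> C" using C T range_subset[of C T \<Lambda>] \<open>C \<subset> T\<close> by blast
    then have "a \<in> Def \<Lambda> T" using a Def_mono[of C T \<Lambda>] \<open>C \<subset> T\<close> by blast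
    then show False using a T by (auto simp: complete_ext_def admissible_def conflict_free_def)
  qed
  then show "semi_stable_ext \<Lambda> C"
    using C unfolding semi_stable_ext_def preferred_ext_def by blast
qed

text \<open>Says that \<open>Z\<close> refutes the maximality of \<open>C\<close>, as a set for
  \<open>PR\<close> and in terms of the range otherwise.\<close>

definition above :: "sem \<Rightarrow> (nat \<Rightarrow> bool) \<Rightarrow> nat \<Rightarrow> (nat \<Rightarrow> bool) \<Rightarrow> (nat \<Rightarrow> bool) \<Rightarrow> bool" where
  "above \<sigma> inp n C Z \<longleftrightarrow> (if \<sigma> = PR then (\<forall>i<n. C i \<longrightarrow> Z i) \<and> (\<exists>i<n. Z i \<and> \<not> C i)
     else (\<forall>i<n. C i \<or> attacked inp n C i \<longrightarrow> Z i \<or> attacked inp n Z i) \<and>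
       (\<exists>i<n. (Z i \<or> attacked inp n Z i) \<and> \<not> (C i \<or> attacked inp n C i)))"

lemma maximal_above:
  assumes "\<sigma> \<in> {PR, SST}" "n \<le> m"
  shows "extension \<sigma> (AF inp n) (ext n C) \<longleftrightarrow>
    is_complete inp n C \<and> \<not> (\<exists>z. length z = m \<and> is_complete inp n (bit z) \<and> above \<sigma> inp n C (bit z))"
proof -
  have sub: "ext n C \<subset> ext n Z \<longleftrightarrow> (\<forall>i<n. C i \<longrightarrow> Z i) \<and> (\<exists>i<n. Z i \<and> \<not> C i)" for C Z
    by (auto simp: ext_def)
  have *: "(\<exists>T. complete_ext (AF inp n) T \<and> P T) \<longleftrightarrow> (\<exists>z. length z = m \<and> is_complete inp n (bit z) \<and> P (ext n (bit z)))" for P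
  proof
    assume "\<exists>T. complete_ext (AF inp n) T \<and> P T"
    then obtain T where T: "complete_ext (AF inp n) T" "P T" by blast
    then have "T \<subseteq> {0..<n}" by (auto simp: complete_ext_def admissible_def)
    then obtain z where "length z = m" "ext n (bit z) = T" using ext_bits assms(2) by blast
    then show "\<exists>z. length z = m \<and> is_complete inp n (bit z) \<and> P (ext n (bit z))"
      using T complete_ext_iff by metis
  qed (metis complete_ext_iff)
  show ?thesis
  proof (cases "\<sigma> = PR")
    case True
    then show ?thesis by (simp add: preferred_ext_def complete_ext_iff * sub above_def)
  next
    case False
    then have "\<sigma> = SST" using assms(1) by simp
    then show ?thesis by (simp add: semi_stable_iff[OF framework_AF] complete_ext_iff * range_ext sub above_def)
  qed
qed

section \<open>Programs for the membership tests\<close>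

lemma PF_snd: "PF (lift ws) (bind vs) snd"
  by (rule PF_var) (simp add: bind_def)

lemma lift_mem: "w \<in> set ws \<Longrightarrow> (\<lambda>p. w (fst p)) \<in> set (lift ws)"
  by (auto simp: lift_def)

text \<open>Repeated halving never exceeds \<open>f s\<close>, whereas the value
  \<open>2 ^ g s\<close> itself would be exponential.\<close>

lemma PF_div_pow:
  assumes "length ws \<le> 2" "PF ws vs f" "PF ws vs g"
  shows "PF ws vs (\<lambda>s. f s div 2 ^ g s)"
proof -
  have eq: "rec_nat m (\<lambda>_ acc. acc div 2) i = m div 2 ^ i" for m i :: nat
    by (induction i) (simp_all add: div_mult2_eq[symmetric] mult.commute)
  have "PF ws vs (\<lambda>s. rec_nat (f s) (\<lambda>_ acc. acc div 2) (g s))"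
    by (rule PF_rec[OF assms, where h = f])
      (auto intro!: PF_div PF_snd PF_const PF_pb[OF assms(2)] simp: assms(1) eq)
  then show ?thesis unfolding eq .
qed

context
  fixes ws :: "('s \<Rightarrow> bool list) list" and vs :: "('s \<Rightarrow> nat) list" and w w' :: "'s \<Rightarrow> bool list"
  assumes ws: "length ws \<le> 2" "w \<in> set ws" "w' \<in> set ws"
begin

text \<open>The offset \<open>b\<close> covers an input that is the second half of a longer word.
  The progression \<open>a + j * c\<close> covers certificates, with step 1, and the
  \<open>In\<close> bits of the given labelling, with step 2.\<close>

lemma PB_attacked:
  assumes "PF ws vs b" "PF ws vs n" "PF ws vs a" "PF ws vs c" "PF ws vs i"
  shows "PB ws vs (\<lambda>s. attacked (\<lambda>j. bit (w s) (b s + j)) (n s) (\<lambda>j. bit (w' s) (a s + j * c s)) (i s))"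
  unfolding attacked_def attack_def
  by (intro PB_ex PB_conj PB_bit PF_add PF_mult PF_const PF_snd lift_mem PF_weaken assms ws)
    (simp_all add: ws)

end

text \<open>The contexts are closed in between because the lemmas are needed for the states inside binders.\<close>

context
  fixes ws :: "('s \<Rightarrow> bool list) list" and vs :: "('s \<Rightarrow> nat) list" and w w' :: "'s \<Rightarrow> bool list"
  assumes ws: "length ws \<le> 2" "w \<in> set ws" "w' \<in> set ws"
begin

lemma PB_is_complete:
  assumes "PF ws vs b" "PF ws vs n" "PF ws vs a" "PF ws vs c"
  shows "PB ws vs (\<lambda>s. is_complete (\<lambda>j. bit (w s) (b s + j)) (n s) (\<lambda>j. bit (w' s) (a s + j * c s)))"
  unfolding is_complete_def attack_def
  by (intro PB_all PB_conj PB_imp PB_not PB_iff PB_attacked PB_bit PF_add PF_mult PF_const PF_snd lift_mem PF_weaken assms ws)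
    (simp_all add: ws)

lemma PB_total:
  assumes "PF ws vs b" "PF ws vs n" "PF ws vs a" "PF ws vs c"
  shows "PB ws vs (\<lambda>s. total (\<lambda>j. bit (w s) (b s + j)) (n s) (\<lambda>j. bit (w' s) (a s + j * c s)))"
  unfolding total_def
  by (intro PB_all PB_disj PB_attacked PB_bit PF_add PF_mult PF_snd lift_mem PF_weaken assms ws)
    (simp_all add: ws)

lemma PB_above:
  assumes w'': "w'' \<in> set ws" and "PF ws vs b" "PF ws vs n" "PF ws vs a" "PF ws vs c" "PF ws vs a'" "PF ws vs c'"
  shows "PB ws vs (\<lambda>s. above \<sigma> (\<lambda>j. bit (w s) (b s + j)) (n s) (\<lambda>j. bit (w' s) (a s + j * c s)) (\<lambda>j. bit (w'' s) (a' s + j * c' s)))"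
proof (cases "\<sigma> = PR")
  case True
  show ?thesis
    unfolding above_def if_P[OF True]
    by (intro PB_all PB_ex PB_conj PB_imp PB_not PB_bit PF_add PF_mult PF_snd lift_mem PF_weaken assms ws)
      (simp_all add: ws)
next
  case False
  show ?thesis
    unfolding above_def if_not_P[OF False]
    by (intro PB_all PB_ex PB_conj PB_disj PB_imp PB_not PB_attacked PB_bit PF_add PF_mult PF_snd lift_mem PF_weaken assms ws)
      (simp_all add: ws)
qed

lemma PB_agree:
  assumes "PF ws vs b" "PF ws vs n" "PF ws vs a" "PF ws vs c" "PF ws vs i"
  shows "PB ws vs (\<lambda>s. agree (\<lambda>j. bit (w s) (b s + j)) (n s) (\<lambda>j. bit (w' s) (a s + j * c s)) (i s))"
  unfolding agree_def is_in_def is_out_def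
  by (intro PB_conj PB_iff PB_attacked PB_bit PF_add PF_mult PF_const assms ws)

end

lemma PB_code_ok:
  assumes ws: "length ws \<le> 2" "w \<in> set ws"
    and "PF ws vs b" "PF ws vs n" "PF ws vs g" "PF ws vs k" "PF ws vs len"
  shows "PB ws vs (\<lambda>s. code_ok (len s) (\<lambda>j. bit (w s) (b s + j)) (n s) (g s) (k s))"
  unfolding code_ok_def is_in_def is_out_def
  by (intro PB_all PB_disj PB_conj PB_not PB_iff PB_le PB_eq PB_bit PF_diff PF_div_pow PF_mod PF_add PF_mult PF_const
      PF_snd lift_mem PF_weaken assms ws)
    (simp_all add: ws)

lemma is_in_bit: "is_in (\<lambda>j. bit x (b + j)) n = (\<lambda>i. bit x (b + (n + 1 + n * n + n) + i * 2))"
  by (simp add: is_in_def fun_eq_iff add.assoc)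

context
  fixes ws :: "('s \<Rightarrow> bool list) list" and vs :: "('s \<Rightarrow> nat) list" and w w' :: "'s \<Rightarrow> bool list"
  assumes ws: "length ws \<le> 2" "w \<in> set ws" "w' \<in> set ws"
begin

lemma PB_base:
  assumes "PF ws vs b" "PF ws vs n" "PF ws vs g" "PF ws vs k" "PF ws vs len" "PF ws vs a" "PF ws vs c"
  shows "PB ws vs (\<lambda>s. base (len s) (\<lambda>j. bit (w s) (b s + j)) (n s) (g s) (k s) (\<lambda>j. bit (w' s) (a s + j * c s)))"
  unfolding base_def is_in_bit is_out_def
  by (intro PB_all PB_conj PB_not PB_iff PB_le PB_code_ok PB_is_complete PB_attacked PB_agree PB_bit PF_sum PF_add PF_mult PF_const
      PF_snd lift_mem PF_weaken assms ws)
    (simp_all add: ws)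

end

theorem SF_EX_NP:
  assumes "\<sigma> \<in> {CO, ST}"
  shows "SF_EX \<sigma> \<in> NP"
proof -
  \<comment> \<open>Terms such as \<open>0 + j * 1\<close> only give the predicates the form of the
    computability lemmas.\<close>
  define V where "V p \<longleftrightarrow> (\<exists>n<Suc (length (fst p)). \<exists>g<n. \<exists>k<Suc n.
    base (length (fst p)) (\<lambda>j. bit (fst p) (0 + j)) n g k (\<lambda>j. bit (snd p) (0 + j * 1)) \<and>
    (\<sigma> = ST \<longrightarrow> total (\<lambda>j. bit (fst p) (0 + j)) n (\<lambda>i. bit (fst p) (0 + (n + 1 + n * n + n) + i * 2)) \<and>
       total (\<lambda>j. bit (fst p) (0 + j)) n (\<lambda>j. bit (snd p) (0 + j * 1))))" for p :: "bool list \<times> bool list"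
  have "PB [fst, snd] [] V"
    unfolding V_def
    by (intro PB_ex PB_conj PB_imp PB_const PB_base PB_total PF_Suc PF_len PF_snd PF_add PF_mult PF_const lift_mem PF_weaken)
      simp_all
  then have "{x. \<exists>y. length y = length x \<and> V (x, y)} \<in> NP" by (rule NP_I)
  moreover have "SF_EX \<sigma> = {x. \<exists>y. length y = length x \<and> V (x, y)}"
  proof (rule set_eqI)
    fix x
    have "base (length x) (bit x) n g k (bit y) \<and> extension \<sigma> (AF (bit x) n) (ext n (is_in (bit x) n)) \<and>
         extension \<sigma> (AF (bit x) n) (ext n (bit y)) \<longleftrightarrow>
      base (length x) (bit x) n g k (bit y) \<and>
         (\<sigma> = ST \<longrightarrow> total (bit x) n (is_in (bit x) n) \<and> total (bit x) n (bit y))" for y n g k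
      using assms by (auto simp: base_def complete_ext_iff stable_total)
    then show "x \<in> SF_EX \<sigma> \<longleftrightarrow> x \<in> {x. \<exists>y. length y = length x \<and> V (x, y)}"
      using SF_EX_base[of x bit \<sigma>] is_in_bit[of x 0]
      by (simp add: V_def)
  qed
  ultimately show ?thesis by simp
qed

theorem SF_EX_Sigma2p:
  assumes "\<sigma> \<in> {PR, SST}"
  shows "SF_EX \<sigma> \<in> Sigma2p"
proof -
  \<comment> \<open>The word \<open>fst p\<close> is \<open>y @ x\<close> with halves of equal
    length, so \<open>x\<close> starts at half the length. The word \<open>snd p\<close> refutes the
    maximality of the given or of the guessed extension, hence one query checks both. If
    \<open>base\<close> fails for all \<open>n\<close>, \<open>g\<close> and \<open>k\<close>, then
    \<open>V\<close> holds vacuously and the guess \<open>y\<close> is rejected.\<close>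
  define V where "V p \<longleftrightarrow> (\<forall>n<Suc (length (fst p) - length (fst p) div 2). \<forall>g<n. \<forall>k<Suc n.
    base (length (fst p) - length (fst p) div 2) (\<lambda>j. bit (fst p) (length (fst p) div 2 + j)) n g k
      (\<lambda>j. bit (fst p) (0 + j * 1)) \<longrightarrow>
    is_complete (\<lambda>j. bit (fst p) (length (fst p) div 2 + j)) n (\<lambda>j. bit (snd p) (0 + j * 1)) \<and>
    (above \<sigma> (\<lambda>j. bit (fst p) (length (fst p) div 2 + j)) n
       (\<lambda>i. bit (fst p) (length (fst p) div 2 + (n + 1 + n * n + n) + i * 2)) (\<lambda>j. bit (snd p) (0 + j * 1)) \<or>
     above \<sigma> (\<lambda>j. bit (fst p) (length (fst p) div 2 + j)) n
       (\<lambda>j. bit (fst p) (0 + j * 1)) (\<lambda>j. bit (snd p) (0 + j * 1))))" for p :: "bool list \<times> bool list"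
  have "PB [fst, snd] [] V"
    unfolding V_def
    by (intro PB_all PB_conj PB_disj PB_imp PB_const PB_base PB_is_complete PB_above PF_Suc PF_len PF_snd PF_diff PF_div PF_add PF_mult
        PF_const lift_mem PF_weaken)
      simp_all
  then have B: "{w. \<exists>z. length z = length w \<and> V (w, z)} \<in> NP" (is "?B \<in> _") by (rule NP_I)
  have "SF_EX \<sigma> = {x. \<exists>y. length y = length x \<and> y @ x \<notin> ?B}"
  proof (rule set_eqI)
    fix x
    have bits: "ext n (bit (y @ x)) = ext n (bit y)" if "n \<le> length x" "length y = length x" for n y
      using that by (auto simp: ext_def bit_def nth_append)
    have "(\<exists>n<Suc (length x). \<exists>g<n. \<exists>k<Suc n.
       base (length x) (bit x) n g k (bit (y @ x)) \<and> extension \<sigma> (AF (bit x) n) (ext n (is_in (bit x) n)) \<and>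
       extension \<sigma> (AF (bit x) n) (ext n (bit (y @ x)))) \<longleftrightarrow> y @ x \<notin> ?B" (is "?L \<longleftrightarrow> _")
      if y: "length y = length x" for y
    proof -
      let ?A = "\<lambda>n z. is_complete (bit x) n (bit z) \<and>
        (above \<sigma> (bit x) n (is_in (bit x) n) (bit z) \<or> above \<sigma> (bit x) n (bit (y @ x)) (bit z))"
      have m: "length (y @ x) div 2 = length x" "length (y @ x) - length x = length x" using y by simp_all
      have inp: "(\<lambda>j. bit (y @ x) (length x + j)) = bit x" using y by (auto simp: bit_def nth_append fun_eq_iff)
      have V: "V (y @ x, z) \<longleftrightarrow> (\<forall>n<Suc (length x). \<forall>g<n. \<forall>k<Suc n. base (length x) (bit x) n g k (bit (y @ x)) \<longrightarrow> ?A n z)" for z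
        unfolding V_def fst_conv snd_conv m inp is_in_bit[of "y @ x" "length x", symmetric, unfolded inp] by simp
      have "?L \<longleftrightarrow> (\<exists>n<Suc (length x). \<exists>g<n. \<exists>k<Suc n. base (length x) (bit x) n g k (bit (y @ x)) \<and>
          \<not> (\<exists>z. length z = length (y @ x) \<and> ?A n z))"
      proof (intro ex_cong1 conj_cong refl)
        fix n g k assume n: "n < Suc (length x)" and b: "base (length x) (bit x) n g k (bit (y @ x))"
        have "n \<le> length (y @ x)" using n by simp
        note mx = maximal_above[OF assms this, of "bit x"]
        show "extension \<sigma> (AF (bit x) n) (ext n (is_in (bit x) n)) \<and> extension \<sigma> (AF (bit x) n) (ext n (bit (y @ x))) \<longleftrightarrow>
          \<not> (\<exists>z. length z = length (y @ x) \<and> ?A n z)"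
          unfolding mx using b unfolding base_def by blast
      qed
      also have "\<dots> \<longleftrightarrow> \<not> (\<exists>z. length z = length (y @ x) \<and> V (y @ x, z))"
      proof (cases "\<exists>n<Suc (length x). \<exists>g<n. \<exists>k<Suc n. base (length x) (bit x) n g k (bit (y @ x))")
        case False
        have "length (y @ x) = length (y @ x) \<and> V (y @ x, y @ x)" using False unfolding V by blast
        then show ?thesis using False by blast
      next
        case True
        then obtain n g k where ngk: "n < Suc (length x)" "g < n" "k < Suc n" "base (length x) (bit x) n g k (bit (y @ x))" by blast
        \<comment> \<open>The code determines \<open>n\<close>, \<open>g\<close> and
          \<open>k\<close>, so the universal quantifiers in \<open>V\<close> and the existential
          ones in the criterion concern the same instance.\<close>
        have uniq: "n' = n \<and> g' = g \<and> k' = k" if "g' < n'" "base (length x) (bit x) n' g' k' (bit (y @ x))" for n' g' k'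
          using code_ok_unique[of x n g k n' g' k'] ngk that by (simp add: base_def)
        have "V (y @ x, z) \<longleftrightarrow> ?A n z" for z unfolding V using ngk uniq by blast
        moreover have "(\<exists>n<Suc (length x). \<exists>g<n. \<exists>k<Suc n. base (length x) (bit x) n g k (bit (y @ x)) \<and> Q n) \<longleftrightarrow> Q n" for Q
          using ngk uniq by blast
        ultimately show ?thesis by simp
      qed
      finally show ?thesis by simp
    qed
    note eq = this
    have "x \<in> SF_EX \<sigma> \<longleftrightarrow> (\<exists>y. length y = length x \<and> (\<exists>n<Suc (length x). \<exists>g<n. \<exists>k<Suc n.
       base (length x) (bit x) n g k (bit (y @ x)) \<and> extension \<sigma> (AF (bit x) n) (ext n (is_in (bit x) n)) \<and>
       extension \<sigma> (AF (bit x) n) (ext n (bit (y @ x)))))"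
      by (rule SF_EX_base) (rule bits)
    also have "\<dots> \<longleftrightarrow> (\<exists>y. length y = length x \<and> y @ x \<notin> ?B)"
      by (intro ex_cong1 conj_cong refl eq)
    finally show "x \<in> SF_EX \<sigma> \<longleftrightarrow> x \<in> {x. \<exists>y. length y = length x \<and> y @ x \<notin> ?B}" by simp
  qed
  then show ?thesis using Sigma2p_I[OF B] by simp
qed

theorem theorem5:
  "(\<forall>\<sigma>\<in>{CO, ST}. complete_for NP (SF_EX \<sigma>)) \<and>
   (\<forall>\<sigma>\<in>{PR, SST}. complete_for Sigma2p (SF_EX \<sigma>))"
proof (intro conjI ballI)
  fix \<sigma> assume \<sigma>: "\<sigma> \<in> {CO, ST}"
  show "complete_for NP (SF_EX \<sigma>)"
    unfolding complete_for_def by (intro conjI ballI SF_EX_NP NP_reducible \<sigma>)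
next
  fix \<sigma> assume \<sigma>: "\<sigma> \<in> {PR, SST}"
  have "poly_reducible X (SF_EX \<sigma>)" if X: "X \<in> Sigma2p" for X
  proof -
    obtain B where "B \<in> NP" "X \<in> NP_oracle B" using X unfolding Sigma2p_def by (rule UN_E)
    then show ?thesis using NP_oracle_reducible \<sigma> by metis
  qed
  then show "complete_for Sigma2p (SF_EX \<sigma>)"
    unfolding complete_for_def using SF_EX_Sigma2p[OF \<sigma>] by (intro conjI ballI)
qed

end
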